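(* Let $m>2$ be an integer and, in formal coordinates $(\theta,x_1,\dots,x_{2n})$ on $(\mathbb{C}^{2n+1},O)$, let $\alpha=d(\theta^m-x_1\theta)+\gamma$, where $\gamma=\sum_{i=1}^{2n}g_i(x)\,dx_i$ has coefficients independent of $\theta$, $\gamma(O)=0$, $d\gamma$ is a symplectic form in the variables $x_1,\dots,x_{2n}$, and $(g_1,\dots,g_{2n})$ is a local diffeomorphism of $(\mathbb{C}^{2n},O)$. Let $X$ be a formal vector field vanishing at $O$ with $\mathcal{L}_X\alpha=0$. Then there is a formal coordinate system $(\theta,x'_1,\dots,x'_{2n})$ (with $\theta$ unchanged) and a formal function $f(x')$ with $f(O)=0$, $df(O)\neq0$, such that $\alpha=d(\theta^m-f\theta)+\gamma'$ with $\gamma'$ in primitive normal form (P) in the coordinates $x'$, $X$ is in Poincaré–Dulac normal form, $X(\theta)=X(f)=0$, and the functions $Q=\sum_sQ_s$ and $R$ of (P) are first integrals of the semisimple part $X^s$ of the linear part of $X$. In particular this applies to the generically tangent case $m=3$.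
   Context: Primitive normal form (P): in coordinates $(x_1,\dots,x_{2n})$, a 1-form $\gamma=\sum_ig_i(x)dx_i$ is in primitive normal form if $d\gamma=\sum_{i=1}^ndx_i\wedge dx_{i+n}$ and there are integers $1=n_1<n_2<\cdots<n_k<n_{k+1}=n+1$ and complex numbers $\lambda_1,\dots,\lambda_{2n}$ (the eigenvalues of the vector field $Z$ defined by $Z\lrcorner d\gamma=\gamma$) with $\lambda_i+\lambda_{n+i}=1$ for all $i\le n$ and $\lambda_i=\lambda_j$ whenever $n_s\le i<j<n_{s+1}$, such that $\gamma=\sum_{s=1}^k(\gamma_s+dQ_s)+dR$, where (i) $\gamma_s=\sum_{j=n_s}^{n_{s+1}-1}\big(\lambda_{n_s}x_jdx_{n+j}+(\lambda_{n_s}-1)x_{n+j}dx_j\big)$; (ii) if $\lambda_{n_s}\neq\frac12$ then $Q_s=0$ or $Q_s=\sum_{j=n_s}^{n_{s+1}-2}x_{j+1}x_{n+j}$; if $\lambda_{n_s}=\frac12$ then $Q_s$ is one of: $0$; $x_{n_s+n}^2$ (only when $n_{s+1}=n_s+1$); $2\sum_{j=n_s}^{n_{s+1}-2}x_jx_{n+j+1}+(-1)^{n_{s+1}-n_s}x_{n_{s+1}-1}^2$; $2\sum_{j=n_s}^{n_{s+1}-2}x_jx_{n+j+1}$ (only when $n_{s+1}-n_s\ge3$ is odd); (iii) $R$ is a formal function of $x_1,\dots,x_{2n}$ containing only monomials $\prod x_i^{a_i}$ with $\sum_ia_i\lambda_i=1$ and $\sum_ia_i\ge3$. For a formal vector field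 $X$ vanishing at $O$, let $X^{(1)}=X^s+X^n$ be the Jordan decomposition of its linear part; $X$ is in Poincaré–Dulac normal form if $[X^s,X]=0$. *)

theory Defs
  imports Complex_Main "Jordan_Normal_Form.Matrix" "Jordan_Normal_Form.Determinant"
begin

text \<open>A formal power series is represented by its coefficient function on exponent
vectors (nat => nat). A series "in k variables" (variables indexed 0..k-1) has zero
coefficients at exponent vectors that use a variable with index >= k.\<close>

type_synonym mps = "(nat \<Rightarrow> nat) \<Rightarrow> complex"

definition mps_wf :: "nat \<Rightarrow> mps \<Rightarrow> bool" where
  "mps_wf k F \<longleftrightarrow> (\<forall>a. (\<exists>i\<ge>k. a i \<noteq> 0) \<longrightarrow> F a = 0)"

definition zexp :: "nat \<Rightarrow> nat" where "zexp = (\<lambda>_. 0)"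

definition unitv :: "nat \<Rightarrow> nat \<Rightarrow> nat" where
  "unitv i = (\<lambda>j. if j = i then 1 else 0)"

definition indep0 :: "mps \<Rightarrow> bool" where
  "indep0 F \<longleftrightarrow> (\<forall>a. a 0 \<noteq> 0 \<longrightarrow> F a = 0)"

definition mps_zero :: mps where "mps_zero = (\<lambda>_. 0)"

definition mps_const :: "complex \<Rightarrow> mps" where
  "mps_const c = (\<lambda>a. if a = zexp then c else 0)"

definition mps_var :: "nat \<Rightarrow> mps" where
  "mps_var i = (\<lambda>a. if a = unitv i then 1 else 0)"

definition mps_add :: "mps \<Rightarrow> mps \<Rightarrow> mps" where
  "mps_add F G = (\<lambda>a. F a + G a)"

definition mps_scale :: "complex \<Rightarrow> mps \<Rightarrow> mps" where
  "mps_scale c F = (\<lambda>a. c * F a)"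

definition mps_mul :: "mps \<Rightarrow> mps \<Rightarrow> mps" where
  "mps_mul F G = (\<lambda>a. \<Sum>b\<in>{b. \<forall>i. b i \<le> a i}. F b * G (\<lambda>i. a i - b i))"

primrec mps_pow :: "mps \<Rightarrow> nat \<Rightarrow> mps" where
  "mps_pow F 0 = mps_const 1"
| "mps_pow F (Suc p) = mps_mul (mps_pow F p) F"

definition mps_sum :: "nat set \<Rightarrow> (nat \<Rightarrow> mps) \<Rightarrow> mps" where
  "mps_sum A f = (\<lambda>a. \<Sum>i\<in>A. f i a)"

definition mps_pd :: "nat \<Rightarrow> mps \<Rightarrow> mps" where
  "mps_pd i F = (\<lambda>a. of_nat (a i + 1) * F (a(i := a i + 1)))"

definition mps_deg :: "nat \<Rightarrow> (nat \<Rightarrow> nat) \<Rightarrow> nat" where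
  "mps_deg k a = (\<Sum>i<k. a i)"

primrec mps_monprod :: "(nat \<Rightarrow> mps) \<Rightarrow> (nat \<Rightarrow> nat) \<Rightarrow> nat \<Rightarrow> mps" where
  "mps_monprod Phi b 0 = mps_const 1"
| "mps_monprod Phi b (Suc j) = mps_mul (mps_monprod Phi b j) (mps_pow (Phi j) (b j))"

text \<open>substitution F(Phi_0,...,Phi_(k-1)) of series Phi_j without constant term
(well defined as a formal series exactly in that case)\<close>
definition mps_comp :: "nat \<Rightarrow> mps \<Rightarrow> (nat \<Rightarrow> mps) \<Rightarrow> mps" where
  "mps_comp k F Phi = (\<lambda>a. \<Sum>b\<in>{b. (\<forall>i\<ge>k. b i = 0) \<and> mps_deg k b \<le> mps_deg k a}.
       F b * mps_monprod Phi b k a)"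

text \<open>A vector field X = sum_i X i d/dx_i and a 1-form alpha = sum_j alpha j dx_j are
given by their component series (components with index < k).\<close>

definition vf_apply :: "nat \<Rightarrow> (nat \<Rightarrow> mps) \<Rightarrow> mps \<Rightarrow> mps" where
  "vf_apply k V h = mps_sum {..<k} (\<lambda>i. mps_mul (V i) (mps_pd i h))"

definition form_d :: "mps \<Rightarrow> nat \<Rightarrow> mps" where
  "form_d h = (\<lambda>j. mps_pd j h)"

definition lie_form :: "nat \<Rightarrow> (nat \<Rightarrow> mps) \<Rightarrow> (nat \<Rightarrow> mps) \<Rightarrow> nat \<Rightarrow> mps" where
  "lie_form k X alpha = (\<lambda>j. mps_sum {..<k}
      (\<lambda>i. mps_add (mps_mul (X i) (mps_pd i (alpha j))) (mps_mul (alpha i) (mps_pd j (X i)))))"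

definition vf_bracket :: "nat \<Rightarrow> (nat \<Rightarrow> mps) \<Rightarrow> (nat \<Rightarrow> mps) \<Rightarrow> nat \<Rightarrow> mps" where
  "vf_bracket k V W = (\<lambda>j a. vf_apply k V (W j) a - vf_apply k W (V j) a)"

definition lin_part :: "nat \<Rightarrow> (nat \<Rightarrow> mps) \<Rightarrow> complex mat" where
  "lin_part k X = mat k k (\<lambda>(j, i). X j (unitv i))"

definition lin_vf :: "nat \<Rightarrow> complex mat \<Rightarrow> nat \<Rightarrow> mps" where
  "lin_vf k S = (\<lambda>j. mps_sum {..<k} (\<lambda>i. mps_scale (S $$ (j, i)) (mps_var i)))"

definition diagonalizable_mat :: "complex mat \<Rightarrow> bool" where
  "diagonalizable_mat S \<longleftrightarrow> (\<exists>D. similar_mat S D \<and> diagonal_mat D)"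

definition nilpotent_mat :: "nat \<Rightarrow> complex mat \<Rightarrow> bool" where
  "nilpotent_mat k N \<longleftrightarrow> (\<exists>p. N ^\<^sub>m p = 0\<^sub>m k k)"

definition jordan_decomp :: "nat \<Rightarrow> complex mat \<Rightarrow> complex mat \<Rightarrow> complex mat \<Rightarrow> bool" where
  "jordan_decomp k A S N \<longleftrightarrow> S \<in> carrier_mat k k \<and> N \<in> carrier_mat k k \<and>
     A = S + N \<and> diagonalizable_mat S \<and> nilpotent_mat k N \<and> S * N = N * S"

text \<open>Coordinates: index 0 is theta, indices 1..2n are x_1..x_2n.\<close>

text \<open>the 1-form gamma_s of block [p,q) with eigenvalue l\<close>
definition gamma_blk :: "nat \<Rightarrow> nat \<Rightarrow> nat \<Rightarrow> complex \<Rightarrow> nat \<Rightarrow> mps" where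
  "gamma_blk n p q l j =
     (if p \<le> j \<and> j < q then mps_scale (l - 1) (mps_var (n + j))
      else if n < j \<and> p \<le> j - n \<and> j - n < q then mps_scale l (mps_var (j - n))
      else mps_zero)"

definition Qs_ok :: "nat \<Rightarrow> nat \<Rightarrow> nat \<Rightarrow> complex \<Rightarrow> mps \<Rightarrow> bool" where
  "Qs_ok n p q l Q \<longleftrightarrow>
    (l \<noteq> 1/2 \<and>
       (Q = mps_zero \<or>
        Q = mps_sum {p..<q - 1} (\<lambda>j. mps_mul (mps_var (j + 1)) (mps_var (n + j)))))
  \<or> (l = 1/2 \<and>
       (Q = mps_zero \<or>
        (q = p + 1 \<and> Q = mps_pow (mps_var (p + n)) 2) \<or>
        Q = mps_add (mps_scale 2 (mps_sum {p..<q - 1} (\<lambda>j. mps_mul (mps_var j) (mps_var (n + j + 1)))))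
                    (mps_scale ((-1) ^ (q - p)) (mps_pow (mps_var (q - 1)) 2)) \<or>
        (q - p \<ge> 3 \<and> odd (q - p) \<and>
         Q = mps_scale 2 (mps_sum {p..<q - 1} (\<lambda>j. mps_mul (mps_var j) (mps_var (n + j + 1)))))))"

text \<open>gamma (components 0..2n, component 0 = d theta) is in primitive normal form (P)
in the variables x_1..x_2n, with Q = sum_s Q_s and R the functions of (P)\<close>
definition prim_nf :: "nat \<Rightarrow> (nat \<Rightarrow> mps) \<Rightarrow> mps \<Rightarrow> mps \<Rightarrow> bool" where
  "prim_nf n gam Q R \<longleftrightarrow>
    (\<forall>i\<in>{1..2*n}. \<forall>j\<in>{1..2*n}.
        (\<lambda>a. mps_pd i (gam j) a - mps_pd j (gam i) a) =
        mps_const (if j = i + n then 1 else if i = j + n then -1 else 0)) \<and>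
    (\<exists>(k::nat) (ns::nat \<Rightarrow> nat) (lam::nat \<Rightarrow> complex) (Qs::nat \<Rightarrow> mps).
       ns 1 = 1 \<and> ns (k + 1) = n + 1 \<and> (\<forall>s\<in>{1..k}. ns s < ns (s + 1)) \<and>
       (\<forall>i\<in>{1..n}. lam i + lam (n + i) = 1) \<and>
       (\<forall>s\<in>{1..k}. \<forall>i j. ns s \<le> i \<and> i < j \<and> j < ns (s + 1) \<longrightarrow> lam i = lam j) \<and>
       (\<forall>s\<in>{1..k}. Qs_ok n (ns s) (ns (s + 1)) (lam (ns s)) (Qs s)) \<and>
       Q = mps_sum {1..k} Qs \<and>
       mps_wf (2*n+1) R \<and> indep0 R \<and>
       (\<forall>a. R a \<noteq> 0 \<longrightarrow> (\<Sum>i\<in>{1..2*n}. of_nat (a i) * lam i) = 1 \<and> (\<Sum>i\<in>{1..2*n}. a i) \<ge> 3) \<and>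
       (\<forall>j\<in>{0..2*n}. gam j =
          mps_add (mps_sum {1..k} (\<lambda>s. mps_add (gamma_blk n (ns s) (ns (s + 1)) (lam (ns s)) j)
                                                 (mps_pd j (Qs s))))
                  (mps_pd j R)))"

definition alpha_form :: "nat \<Rightarrow> nat \<Rightarrow> (nat \<Rightarrow> mps) \<Rightarrow> nat \<Rightarrow> mps" where
  "alpha_form m n g = (\<lambda>j. mps_add
      (form_d (mps_add (mps_pow (mps_var 0) m)
                       (mps_scale (-1) (mps_mul (mps_var 1) (mps_var 0)))) j)
      (if 1 \<le> j \<and> j \<le> 2*n then g j else mps_zero))"

definition jac0 :: "nat \<Rightarrow> (nat \<Rightarrow> mps) \<Rightarrow> complex mat" where
  "jac0 k Phi = mat k k (\<lambda>(j, i). Phi j (unitv i))"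

end

theory Submission
  imports Defs "HOL-Library.Function_Algebras" "HOL-Computational_Algebra.Fundamental_Theorem_Algebra"
begin

text \<open>Comparing coefficients of \<open>\<theta>\<close> in \<open>L\<^sub>X \<alpha> = 0\<close> shows that \<open>X(\<theta>) = X(x\<^sub>1) = 0\<close>, that \<open>X\<close> does not
  depend on \<open>\<theta>\<close>, and that \<open>L\<^sub>X \<gamma> = 0\<close>. The field \<open>Z\<close> with \<open>Z \<rightharpoonup> d\<gamma> = \<gamma>\<close> satisfies \<open>L\<^sub>Z \<gamma> = \<gamma>\<close> and
  commutes with \<open>X\<close>. A joint generalized eigenbasis of the linear parts of \<open>Z\<close> and \<open>X\<close> lifts to formal
  coordinates on which \<open>Z - \<lambda>\<^sub>i\<close> and \<open>X - \<mu>\<^sub>i\<close> are topologically nilpotent; in such coordinates a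
  generalized eigenfunction contains only monomials of its own weight. A weight-preserving Darboux
  argument then reduces \<open>\<gamma>\<close> to its quadratic part up to an exact form \<open>dR\<close> with \<open>R\<close> of weight \<open>(1, 0)\<close>.

  The operator \<open>T\<close> induced by \<open>Z\<close> on linear functions satisfies \<open>B(Tu, v) + B(u, Tv) = B(u, v)\<close> for the
  Poisson pairing \<open>B\<close>, and splitting off Jordan chains puts the quadratic part into the form (P) by a
  linear change \<open>c\<close>. The semisimple part \<open>S\<close> of the linear part of \<open>X\<close> is \<open>c diag(\<mu>) c\<^sup>-\<^sup>1\<close>. It kills \<open>R\<close>
  and normalizes \<open>X\<close> because of the weights. It preserves the quadratic part of \<open>\<gamma>\<close> and commutes with
  \<open>diag(\<lambda>)\<close>, hence it preserves \<open>\<Sum>\<gamma>\<^sub>s\<close>, so it also kills \<open>Q\<close>.\<close>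

text \<open>The form and the field ask for different linear coordinates. The blocks of (P) are
  Jordan chains of \<open>Z\<close>, chosen without regard to \<open>X\<close>, whereas weights for
  \<open>X\<close> are visible only in a joint generalized eigenbasis. Two bases are therefore kept.
  The matrix \<open>c\<close> between them mixes only coordinates with equal \<lambda>, so weights
  for \<open>Z\<close> survive the passage to the blocks and weights for \<open>X\<close> do not:
  the semisimple part is diagonal only up to conjugation by \<open>c\<close>. Derivations of power
  series are not locally finite, so generalized eigenspaces are defined order by order, and
  eigencomponents are limits of polynomials in the operator. Such limits stay in every closed
  invariant subspace, in particular in the generalized eigenspaces of a commuting field; this makes
  joint eigenfunctions possible. The old \<open>x_1\<close> need not be one of the new coordinates:
  \<open>f\<close> is \<open>x_1\<close> written in them, so that X(f) = 0 is the equation X(x_1) =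
  0. The eigenvalue 1/2 is exceptional in (P) because \<lambda> is paired with 1 - \<lambda>; there
  \<open>T - 1/2\<close> is nilpotent and infinitesimally symplectic.\<close>

definition supp :: "(nat \<Rightarrow> nat) \<Rightarrow> nat set" where
  "supp a = {i. a i \<noteq> 0}"

definition deg :: "(nat \<Rightarrow> nat) \<Rightarrow> nat" where
  "deg a = (\<Sum>i\<in>supp a. a i)"

lemma supp_zero [simp]: "supp 0 = {}"
  by (simp add: supp_def)

lemma supp_unitv [simp]: "supp (unitv i) = {i}"
  by (auto simp: supp_def unitv_def)

lemma supp_plus [simp]: "supp (a + b) = supp a \<union> supp b"
  by (auto simp: supp_def)

lemma supp_mono: "b \<le> a \<Longrightarrow> supp b \<subseteq> supp a"
  by (auto simp: supp_def le_fun_def) (meson less_le_trans)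

lemma supp_minus: "supp (a - b) \<subseteq> supp (a :: nat \<Rightarrow> nat)"
  by (auto simp: supp_def fun_diff_def)

lemma deg_eq_sum: "finite A \<Longrightarrow> supp a \<subseteq> A \<Longrightarrow> deg a = (\<Sum>i\<in>A. a i)"
  unfolding deg_def by (rule sum.mono_neutral_left) (auto simp: supp_def)

lemma deg_zero [simp]: "deg 0 = 0"
  by (simp add: deg_def)

lemma deg_unitv [simp]: "deg (unitv i) = 1"
  by (simp add: deg_def) (simp add: unitv_def)

lemma deg_plus [simp]:
  assumes "finite (supp a)" "finite (supp b)"
  shows "deg (a + b) = deg a + deg b"
proof -
  have "deg a = sum a (supp a \<union> supp b)" "deg b = sum b (supp a \<union> supp b)"
    using assms by (auto intro!: deg_eq_sum)
  then show ?thesis by (simp add: deg_def sum.distrib)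
qed

lemma deg_eq_0: "finite (supp a) \<Longrightarrow> deg a = 0 \<longleftrightarrow> a = 0"
  by (auto simp: deg_def supp_def zero_fun_def)

lemma minus_plus_exp: "b \<le> a \<Longrightarrow> b + (a - b) = (a :: nat \<Rightarrow> nat)"
  by (auto simp: le_fun_def fun_eq_iff fun_diff_def)

lemma plus_minus_exp [simp]: "(b + a) - b = (a :: nat \<Rightarrow> nat)"
  by (auto simp: fun_eq_iff fun_diff_def)

lemma fun_le_plus [simp]: "(a :: nat \<Rightarrow> nat) \<le> a + b" "(a :: nat \<Rightarrow> nat) \<le> b + a"
  by (auto simp: le_fun_def)

lemma exp_cases:
  assumes "finite (supp a)" "a \<noteq> 0"
  obtains b i where "a = b + unitv i" "i \<in> supp a" "finite (supp b)" "supp b \<subseteq> supp a"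
proof -
  obtain i where i: "a i \<noteq> 0" using assms(2) by (auto simp: fun_eq_iff)
  have "unitv i \<le> a" using i by (auto simp: le_fun_def unitv_def)
  then have "a = (a - unitv i) + unitv i" by (metis minus_plus_exp add.commute)
  moreover have "supp (a - unitv i) \<subseteq> supp a" by (rule supp_minus)
  ultimately show ?thesis using that i assms(1) finite_subset unfolding supp_def by blast
qed

lemma exp_induct [consumes 1, case_names zero plus]:
  assumes "finite (supp a)" "P 0"
    and "\<And>b i. finite (supp b) \<Longrightarrow> P b \<Longrightarrow> P (b + unitv i)"
  shows "P a"
  using assms(1)
proof (induction "deg a" arbitrary: a)
  case 0
  then show ?case using deg_eq_0 assms(2) by metis
next
  case (Suc d)
  have "a \<noteq> 0" using Suc(2) by auto
  then obtain b i where b: "a = b + unitv i" "finite (supp b)" using exp_cases Suc(3) by metis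
  then have "deg b = d" using Suc(2) by simp
  then show ?case using b Suc(1) assms(3) by simp
qed

lemma finite_exps: "finite I \<Longrightarrow> finite {a. supp a \<subseteq> I \<and> deg a \<le> d}"
proof -
  assume I: "finite I"
  have "{a. supp a \<subseteq> I \<and> deg a \<le> d} \<subseteq> {f. \<forall>x. (x \<in> I \<longrightarrow> f x \<in> {..d}) \<and> (x \<notin> I \<longrightarrow> f x = 0)}"
  proof (intro subsetI CollectI allI conjI impI)
    fix a :: "nat \<Rightarrow> nat" and x assume "a \<in> {a. supp a \<subseteq> I \<and> deg a \<le> d}" and x: "x \<in> I"
    then have a: "supp a \<subseteq> I" "deg a \<le> d" "x \<in> I" by auto
    have "a x \<le> (\<Sum>i\<in>I. a i)" using I a(3) by (simp add: member_le_sum)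
    then show "a x \<in> {..d}" using a I deg_eq_sum by (metis atMost_iff order_trans)
  qed (auto simp: supp_def)
  moreover have "finite {f. \<forall>x. (x \<in> I \<longrightarrow> f x \<in> {..d}) \<and> (x \<notin> I \<longrightarrow> f x = (0::nat))}"
    using I by (intro finite_set_of_finite_funs) auto
  ultimately show ?thesis by (rule finite_subset)
qed

lemma deg_mono: "finite (supp a) \<Longrightarrow> b \<le> a \<Longrightarrow> deg b \<le> deg a"
  using deg_plus[of b "a - b"] by (metis finite_subset le_add1 minus_plus_exp supp_minus supp_mono)

lemma finite_atMost_exp [simp]: "finite (supp a) \<Longrightarrow> finite {..a}"
  by (rule finite_subset[OF _ finite_exps[of "supp a" "deg a"]])
    (auto dest: supp_mono deg_mono)

section \<open>The ring of formal power series\<close>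

lemma infinite_supp_split:
  assumes "infinite (supp a)" "b \<le> a"
  shows "infinite (supp b) \<or> infinite (supp (a - b))"
  using assms by (metis finite_UnI minus_plus_exp supp_plus)

text \<open>Coefficients at exponents of infinite support are forced to vanish because the product
  there would be a sum over an infinite set. The number of variables stays out of the type, so that
  one ring serves the base space and its tangent bundle.\<close>

typedef ser = "{F :: mps. \<forall>a. infinite (supp a) \<longrightarrow> F a = 0}" morphisms coef Ser
  by (rule exI[of _ "\<lambda>_. 0"]) simp

setup_lifting type_definition_ser

lemma coef_inf [simp]: "infinite (supp a) \<Longrightarrow> coef F a = 0"
  using coef by blast

lemma ser_eqI: "(\<And>a. finite (supp a) \<Longrightarrow> coef F a = coef G a) \<Longrightarrow> F = G"
  by (metis coef_inject coef_inf ext)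

lemma mps_mul_atMost: "mps_mul F G a = (\<Sum>b\<in>{..a}. F b * G (a - b))"
  by (simp add: mps_mul_def atMost_def le_fun_def fun_diff_def)

instantiation ser :: comm_ring_1
begin

lift_definition zero_ser :: ser is "\<lambda>_. 0" by simp
lift_definition one_ser :: ser is "\<lambda>a. if a = 0 then 1 else 0" by auto
lift_definition plus_ser :: "ser \<Rightarrow> ser \<Rightarrow> ser" is "\<lambda>F G a. F a + G a" by simp
lift_definition minus_ser :: "ser \<Rightarrow> ser \<Rightarrow> ser" is "\<lambda>F G a. F a - G a" by simp
lift_definition uminus_ser :: "ser \<Rightarrow> ser" is "\<lambda>F a. - F a" by simp
lift_definition times_ser :: "ser \<Rightarrow> ser \<Rightarrow> ser" is "\<lambda>F G a. \<Sum>b\<in>{..a}. F b * G (a - b)"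
  using infinite_supp_split by (intro sum.neutral ballI) (metis atMost_iff mult_zero_left mult_zero_right)

instance
proof
  fix F G H :: ser
  have comm: "coef (F * G) a = coef (G * F) a" if "finite (supp a)" for a and F G :: ser
    by (simp add: times_ser.rep_eq,
        rule sum.reindex_bij_witness[of _ "\<lambda>b. a - b" "\<lambda>b. a - b"])
      (auto simp: le_fun_def fun_diff_def mult.commute)
  show "F * G = G * F" by (rule ser_eqI) (rule comm)
  show "F * G * H = F * (G * H)"
  proof (rule ser_eqI)
    fix a :: "nat \<Rightarrow> nat" assume a: "finite (supp a)"
    have f1: "finite {..b}" if "b \<in> {..a}" for b
      using that a finite_subset supp_mono by (metis atMost_iff finite_atMost_exp)
    have f2: "finite {..a - c}" if "c \<in> {..a}" for c
      using a finite_subset supp_minus by (metis finite_atMost_exp)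
    have "coef (F * G * H) a
        = (\<Sum>b\<in>{..a}. \<Sum>c\<in>{..b}. coef F c * coef G (b - c) * coef H (a - b))"
      by (simp add: times_ser.rep_eq sum_distrib_right)
    also have "\<dots> = (\<Sum>(b, c)\<in>Sigma {..a} (\<lambda>b. {..b}). coef F c * coef G (b - c) * coef H (a - b))"
      using a f1 by (subst sum.Sigma) auto
    \<comment> \<open>The usual regrouping of the splittings of \<open>a\<close> into three
      exponents, (b, c) -> (c, b - c).\<close>
    also have "\<dots> = (\<Sum>(c, e)\<in>Sigma {..a} (\<lambda>c. {..a - c}). coef F c * (coef G e * coef H (a - c - e)))"
    proof (rule sum.reindex_bij_witness[of _ "\<lambda>(c, e). (c + e, c)" "\<lambda>(b, c). (c, b - c)"], goal_cases)
      case (1 p)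
      then show ?case by (auto simp: minus_plus_exp)
    next
      case (2 p)
      obtain b c where p: "p = (b, c)" by (cases p)
      with 2 have bc: "b \<le> a" "c \<le> b" by auto
      have "b x - c x \<le> a x - c x" for x
        using le_funD[OF bc(1), of x] by simp
      then show ?case using p order_trans[OF bc(2,1)] by (simp add: le_fun_def fun_diff_def)
    next
      case (3 p)
      then show ?case by auto
    next
      case (4 p)
      obtain c e where p: "p = (c, e)" by (cases p)
      with 4 have "c \<le> a" "e \<le> a - c" by auto
      then have "c x + e x \<le> a x" for x
        using le_funD[of c a x] le_funD[of e "a - c" x] by (simp add: fun_diff_def)
      then show ?case using p by (simp add: le_fun_def)
    next
      case (5 p)
      obtain b c where p: "p = (b, c)" by (cases p)
      with 5 have "c \<le> b" by auto
      then have "a x - c x - (b x - c x) = a x - b x" for x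
        using le_funD[of c b x] by simp
      then have "a - c - (b - c) = a - b" by (simp add: fun_eq_iff fun_diff_def)
      then show ?case using p by (simp add: mult.assoc)
    qed
    also have "\<dots> = (\<Sum>c\<in>{..a}. \<Sum>e\<in>{..a - c}. coef F c * (coef G e * coef H (a - c - e)))"
      using a f2 by (subst sum.Sigma) auto
    also have "\<dots> = coef (F * (G * H)) a"
      by (simp add: times_ser.rep_eq sum_distrib_left)
    finally show "coef (F * G * H) a = coef (F * (G * H)) a" .
  qed
  show "1 * F = F"
  proof (rule ser_eqI)
    fix a :: "nat \<Rightarrow> nat" assume a: "finite (supp a)"
    have "coef (1 * F) a = (\<Sum>b\<in>{..a}. if b = 0 then coef F a else 0)"
      by (simp add: times_ser.rep_eq one_ser.rep_eq) (rule sum.cong, auto simp: fun_diff_def)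
    also have "\<dots> = coef F a" using a by (simp add: le_fun_def)
    finally show "coef (1 * F) a = coef F a" .
  qed
  show "(F + G) * H = F * H + G * H"
    by (rule ser_eqI) (simp add: times_ser.rep_eq plus_ser.rep_eq algebra_simps sum.distrib)
  show "F + G + H = F + (G + H)" "F + G = G + F" "0 + F = F" "- F + F = 0" "F - G = F + - G"
    by (rule ser_eqI; simp add: plus_ser.rep_eq zero_ser.rep_eq uminus_ser.rep_eq minus_ser.rep_eq)+
  have "coef 0 0 \<noteq> coef 1 0" by (simp add: zero_ser.rep_eq one_ser.rep_eq)
  then show "(0 :: ser) \<noteq> 1" by metis
qed

end

lemma coef_simps [simp]:
  "coef 0 a = 0" "coef (F + G) a = coef F a + coef G a" "coef (F - G) a = coef F a - coef G a"
  "coef (- F) a = - coef F a" "coef 1 a = (if a = 0 then 1 else 0)"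
  by (simp_all add: plus_ser.rep_eq zero_ser.rep_eq uminus_ser.rep_eq minus_ser.rep_eq one_ser.rep_eq)

lemma coef_sum [simp]: "coef (sum f A) a = (\<Sum>i\<in>A. coef (f i) a)"
  by (induction A rule: infinite_finite_induct) auto

lemma coef_mult: "coef (F * G) a = (\<Sum>b\<in>{..a}. coef F b * coef G (a - b))"
  by (simp add: times_ser.rep_eq)

lift_definition xmon :: "(nat \<Rightarrow> nat) \<Rightarrow> ser" is "\<lambda>b a. if finite (supp b) \<and> a = b then 1 else 0"
  by auto

lemma coef_xmon: "coef (xmon b) a = (if finite (supp b) \<and> a = b then 1 else 0)"
  by (simp add: xmon.rep_eq)

definition var :: "nat \<Rightarrow> ser" where "var i = xmon (unitv i)"

lift_definition C :: "complex \<Rightarrow> ser" is "\<lambda>c a. if a = 0 then c else 0" by auto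

lemma coef_C: "coef (C c) a = (if a = 0 then c else 0)"
  by (simp add: C.rep_eq)

lemma coef_var: "coef (var i) a = (if a = unitv i then 1 else 0)"
  by (simp add: var_def coef_xmon)

lemma coef_C_mult [simp]: "coef (C c * F) a = c * coef F a"
proof (cases "finite (supp a)")
  case True
  have "coef (C c * F) a = (\<Sum>b\<in>{..a}. if b = 0 then c * coef F a else 0)"
    by (simp add: times_ser.rep_eq C.rep_eq) (rule sum.cong, auto simp: fun_diff_def)
  also have "\<dots> = c * coef F a" using True by (simp add: le_fun_def)
  finally show ?thesis .
qed simp

lemma C_simps [simp]: "C 0 = 0" "C 1 = 1" "C (a + b) = C a + C b" "C (a - b) = C a - C b"
  "C (- a) = - C a" "C (a * b) = C a * C b"
  by (rule ser_eqI; simp add: coef_C)+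

lemma C_sum: "C (sum f A) = (\<Sum>i\<in>A. C (f i))"
  by (induction A rule: infinite_finite_induct) auto

lemma C_of_nat: "C (of_nat k) = of_nat k"
  by (induction k) auto

lemma coef_xmon_mult:
  assumes "finite (supp b)"
  shows "coef (xmon b * F) a = (if b \<le> a then coef F (a - b) else 0)"
proof (cases "finite (supp a)")
  case True
  have "coef (xmon b * F) a = (\<Sum>c\<in>{..a}. if c = b then coef F (a - b) else 0)"
    using assms by (simp add: coef_mult coef_xmon) (rule sum.cong, auto)
  then show ?thesis using True by simp
next
  case False
  then have "infinite (supp (a - b))" if "b \<le> a"
    using infinite_supp_split that assms by blast
  then show ?thesis using False by simp
qed

lemma coef_xmon_mult_plus [simp]: "finite (supp b) \<Longrightarrow> coef (xmon b * F) (b + a) = coef F a"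
  by (simp add: coef_xmon_mult)

lemma xmon_mult: "finite (supp a) \<Longrightarrow> finite (supp b) \<Longrightarrow> xmon (a + b) = xmon a * xmon b"
  by (rule ser_eqI) (auto simp: coef_xmon_mult coef_xmon minus_plus_exp)

lemma xmon_zero [simp]: "xmon 0 = 1"
  by (rule ser_eqI) (simp add: coef_xmon)

lemma xmon_plus_var: "finite (supp a) \<Longrightarrow> xmon (a + unitv i) = xmon a * var i"
  by (simp add: var_def xmon_mult)

lemma xmon_mult_cancel: "finite (supp b) \<Longrightarrow> xmon b * F = xmon b * G \<Longrightarrow> F = G"
  by (rule ser_eqI) (metis coef_xmon_mult_plus)

lemma var_mult_cancel: "var i * F = var i * G \<Longrightarrow> F = G"
  by (rule xmon_mult_cancel[of "unitv i"]) (auto simp: var_def)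

section \<open>Order of vanishing at the origin, which gives the topology of all limits
  below\<close>

definition om :: "nat \<Rightarrow> ser \<Rightarrow> bool" where
  "om d F \<longleftrightarrow> (\<forall>a. deg a < d \<longrightarrow> finite (supp a) \<longrightarrow> coef F a = 0)"

lemma om_0 [simp]: "om 0 F" by (simp add: om_def)
lemma om_zero [simp]: "om d 0" by (simp add: om_def)
lemma om_add: "om d F \<Longrightarrow> om d G \<Longrightarrow> om d (F + G)" by (simp add: om_def)
lemma om_diff: "om d F \<Longrightarrow> om d G \<Longrightarrow> om d (F - G)" by (simp add: om_def)
lemma om_uminus: "om d F \<Longrightarrow> om d (- F)" by (simp add: om_def)
lemma om_sum: "(\<And>i. i \<in> A \<Longrightarrow> om d (f i)) \<Longrightarrow> om d (sum f A)" by (simp add: om_def)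
lemma om_mono: "om d F \<Longrightarrow> e \<le> d \<Longrightarrow> om e F" by (simp add: om_def)

lemma om_mult: assumes "om d F" "om e G" shows "om (d + e) (F * G)"
  unfolding om_def
proof safe
  fix a assume a: "deg a < d + e" "finite (supp a)"
  have "coef F b * coef G (a - b) = 0" if "b \<le> a" for b
  proof -
    have "finite (supp b)" "finite (supp (a - b))"
      using finite_subset[OF supp_mono[OF that] a(2)] finite_subset[OF supp_minus a(2)] by auto
    moreover from this have "deg b + deg (a - b) < d + e"
      using a(1) deg_plus[of b "a - b"] minus_plus_exp[OF that] by simp
    then have "deg b < d \<or> deg (a - b) < e" by linarith
    ultimately show ?thesis using assms unfolding om_def by auto
  qed
  then show "coef (F * G) a = 0" unfolding coef_mult by (intro sum.neutral) (simp add: Ball_def)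
qed

lemma om_mult_left: "om d G \<Longrightarrow> om d (F * G)"
  using om_mult[of 0 F d G] by simp
lemma om_mult_right: "om d F \<Longrightarrow> om d (F * G)"
  using om_mult[of d F 0 G] by simp

lemma om_all_zero: "(\<And>d. om d F) \<Longrightarrow> F = 0"
  by (rule ser_eqI) (metis coef_simps(1) lessI om_def)

lemma om_eqI: "(\<And>d. om d (F - G)) \<Longrightarrow> F = G"
  using om_all_zero[of "F - G"] by simp

lemma om_power: "om d F \<Longrightarrow> om (d * k) (F ^ k)"
  by (induction k) (auto dest: om_mult)

lemma om_xmon: "om (deg b) (xmon b)"
  by (auto simp: om_def coef_xmon)

lemma om_var [simp]: "om 1 (var i)"
  using om_xmon[of "unitv i"] by (simp add: var_def)

lemma om_Suc_var [simp]: "om (Suc 0) (var i)"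
  using om_var[of i] by simp

lemma om_prod: "finite A \<Longrightarrow> (\<And>i. i \<in> A \<Longrightarrow> om (e i) (f i)) \<Longrightarrow> om (sum e A) (prod f A)"
  by (induction A rule: finite_induct) (auto intro: om_mult)

lemma om1_iff: "om 1 F \<longleftrightarrow> coef F 0 = 0"
  by (auto simp: om_def deg_eq_0)

text \<open>Since the type does not bound the number of variables, this predicate records which ones
  occur: those of the base, those without \<theta>, or those of the tangent bundle.\<close>

definition on :: "nat set \<Rightarrow> ser \<Rightarrow> bool" where
  "on I F \<longleftrightarrow> (\<forall>a. coef F a \<noteq> 0 \<longrightarrow> supp a \<subseteq> I)"

lemma on_zero [simp]: "on I 0" by (simp add: on_def)
lemma on_C [simp]: "on I (C c)" by (simp add: on_def coef_C)
lemma on_one [simp]: "on I 1" by (simp add: on_def)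
lemma on_add: "on I F \<Longrightarrow> on I G \<Longrightarrow> on I (F + G)" unfolding on_def by (metis add.left_neutral coef_simps(2))
lemma on_uminus: "on I F \<Longrightarrow> on I (- F)" by (simp add: on_def)
lemma on_diff: "on I F \<Longrightarrow> on I G \<Longrightarrow> on I (F - G)" using on_add[of I F "- G"] on_uminus by simp
lemma on_sum: "(\<And>i. i \<in> A \<Longrightarrow> on I (f i)) \<Longrightarrow> on I (sum f A)"
  by (induction A rule: infinite_finite_induct) (auto intro: on_add)
lemma on_mult: assumes "on I F" "on I G" shows "on I (F * G)"
  unfolding on_def
proof (intro allI impI)
  fix a assume "coef (F * G) a \<noteq> 0"
  then obtain b where "b \<le> a" "coef F b \<noteq> 0" "coef G (a - b) \<noteq> 0"
    unfolding coef_mult by (metis (no_types, lifting) atMost_iff mult_zero_left mult_zero_right sum.neutral)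
  then show "supp a \<subseteq> I" using assms unfolding on_def by (metis Un_least minus_plus_exp supp_plus)
qed
lemma on_power: "on I F \<Longrightarrow> on I (F ^ k)"
  by (induction k) (auto intro: on_mult)
lemma on_prod: "(\<And>i. i \<in> A \<Longrightarrow> on I (f i)) \<Longrightarrow> on I (prod f A)"
  by (induction A rule: infinite_finite_induct) (auto intro: on_mult)
lemma on_mono: "on I F \<Longrightarrow> I \<subseteq> J \<Longrightarrow> on J F" unfolding on_def by blast
lemma on_var [simp]: "i \<in> I \<Longrightarrow> on I (var i)" by (auto simp: on_def coef_var)
lemma on_limit: assumes "\<And>d. \<exists>G. on I G \<and> om d (F - G)" shows "on I F"
  unfolding on_def
proof (intro allI impI)
  fix a assume a: "coef F a \<noteq> 0"
  obtain G where "on I G" "om (Suc (deg a)) (F - G)" using assms by blast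
  moreover have "finite (supp a)" using a coef_inf by blast
  ultimately show "supp a \<subseteq> I" using a unfolding on_def om_def by auto
qed

section \<open>Partial derivatives\<close>

lift_definition pd :: "nat \<Rightarrow> ser \<Rightarrow> ser" is "\<lambda>i F a. of_nat (a i + 1) * F (a + unitv i)"
  by simp

lemma coef_pd: "coef (pd i F) a = of_nat (a i + 1) * coef F (a + unitv i)"
  by (simp add: pd.rep_eq)

lemma mps_pd_alt: "mps_pd i F a = of_nat (a i + 1) * F (a + unitv i)"
proof -
  have "a(i := a i + 1) = a + unitv i" by (auto simp: fun_eq_iff unitv_def)
  then show ?thesis by (simp add: mps_pd_def)
qed

text \<open>The Euler operator is diagonal on monomials. The Leibniz rule is proved for it first,
  where it is just additivity of exponents, and the factor \<open>var i\<close> is cancelled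
  afterwards.\<close>

lemma coef_var_pd: "coef (var i * pd i F) a = of_nat (a i) * coef F a"
proof (cases "a i = 0")
  case True
  then have "\<not> unitv i \<le> a" by (auto simp: le_fun_def unitv_def)
  then show ?thesis using True by (simp add: var_def coef_xmon_mult)
next
  case False
  then have "unitv i \<le> a" by (auto simp: le_fun_def unitv_def)
  moreover from this have "a - unitv i + unitv i = a" by (metis minus_plus_exp add.commute)
  moreover have "(a - unitv i) i = a i - 1" by (simp add: fun_diff_def unitv_def)
  ultimately show ?thesis using False by (simp add: var_def coef_xmon_mult coef_pd)
qed

lemma pd_add [simp]: "pd i (F + G) = pd i F + pd i G"
  by (rule ser_eqI) (simp add: coef_pd algebra_simps)
lemma pd_diff [simp]: "pd i (F - G) = pd i F - pd i G"
  by (rule ser_eqI) (simp add: coef_pd algebra_simps)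
lemma pd_uminus [simp]: "pd i (- F) = - pd i F"
  by (rule ser_eqI) (simp add: coef_pd)
lemma pd_zero [simp]: "pd i 0 = 0"
  by (rule ser_eqI) (simp add: coef_pd)
lemma pd_C [simp]: "pd i (C c) = 0"
proof (rule ser_eqI)
  fix a have "(a + unitv i) i \<noteq> 0" by (simp add: unitv_def)
  then have nz: "a + unitv i \<noteq> 0" by (metis zero_fun_apply)
  then show "coef (pd i (C c)) a = coef 0 a" using nz by (simp only: coef_pd coef_C coef_simps if_False mult_zero_right)
qed
lemma pd_one [simp]: "pd i 1 = 0" using pd_C[of i 1] by (simp del: pd_C)
lemma pd_sum [simp]: "pd i (sum f A) = (\<Sum>j\<in>A. pd i (f j))"
  by (induction A rule: infinite_finite_induct) auto

lemma pd_mult [simp]: "pd i (F * G) = pd i F * G + F * pd i G"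
proof (rule var_mult_cancel[of i], rule ser_eqI)
  fix a :: "nat \<Rightarrow> nat" assume "finite (supp a)"
  have "coef (var i * pd i (F * G)) a
      = (\<Sum>b\<in>{..a}. coef (var i * pd i F) b * coef G (a - b) + coef F b * coef (var i * pd i G) (a - b))"
    unfolding coef_var_pd unfolding coef_mult sum_distrib_left
  proof (rule sum.cong)
    fix b assume "b \<in> {..a}"
    then have "a i = b i + (a - b) i" by (metis atMost_iff minus_plus_exp plus_fun_apply)
    then show "of_nat (a i) * (coef F b * coef G (a - b)) = of_nat (b i) * coef F b * coef G (a - b)
        + coef F b * (of_nat ((a - b) i) * coef G (a - b))"
      by (simp add: algebra_simps)
  qed simp
  also have "\<dots> = coef (var i * pd i F * G + F * (var i * pd i G)) a"
    by (simp add: coef_mult sum.distrib)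
  also have "var i * pd i F * G + F * (var i * pd i G) = var i * (pd i F * G + F * pd i G)"
    by (simp add: algebra_simps)
  finally show "coef (var i * pd i (F * G)) a = coef (var i * (pd i F * G + F * pd i G)) a" .
qed

lemma pd_var: "pd i (var j) = (if i = j then 1 else 0)"
proof (rule ser_eqI)
  fix a :: "nat \<Rightarrow> nat"
  have "a + unitv i = unitv j \<longleftrightarrow> i = j \<and> a = 0"
  proof safe
    assume h: "a + unitv i = unitv j"
    have x: "a x + unitv i x = unitv j x" for x using h by (metis plus_fun_apply)
    show ij: "i = j" using x[of i] by (simp add: unitv_def split: if_splits)
    show "a = 0" using x unfolding ij by (auto simp: fun_eq_iff)
  qed auto
  then show "coef (pd i (var j)) a = coef (if i = j then 1 else 0) a"
    by (auto simp: coef_pd coef_var)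
qed

lemma pd_commute: "pd i (pd j F) = pd j (pd i F)"
proof (rule ser_eqI)
  fix a :: "nat \<Rightarrow> nat"
  have "a + unitv i + unitv j = a + unitv j + unitv i" by (simp add: add_ac)
  then show "coef (pd i (pd j F)) a = coef (pd j (pd i F)) a"
    by (cases "i = j") (simp_all add: coef_pd unitv_def del: add_ac)
qed

lemma pd_power: "pd i (F ^ k) = of_nat k * F ^ (k - 1) * pd i F"
proof (induction k)
  case (Suc k)
  then show ?case by (cases k) (auto simp: algebra_simps)
qed simp

lemma om_pd: "om d F \<Longrightarrow> om (d - 1) (pd i F)"
  by (auto simp: om_def coef_pd)
lemma om_pd_Suc: "om (Suc d) F \<Longrightarrow> om d (pd i F)"
  using om_pd[of "Suc d" F] by simp

lemma on_pd: "on I F \<Longrightarrow> on I (pd i F)"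
  unfolding on_def coef_pd by (metis Un_subset_iff mult_eq_0_iff supp_plus)
lemma on_pd_zero: "on I F \<Longrightarrow> i \<notin> I \<Longrightarrow> pd i F = 0"
  by (rule ser_eqI) (auto simp: coef_pd on_def)

section \<open>Limits and contractions in the order topology\<close>

lemma ser_limit:
  assumes "\<And>d. om d (u (Suc d) - u d)"
  obtains L where "\<And>d. om d (L - u d)"
proof -
  \<comment> \<open>From the index \<open>Suc (deg a)\<close> on, the coefficient of
    \<open>a\<close> no longer changes.\<close>
  define L where "L = Ser (\<lambda>a. coef (u (Suc (deg a))) a)"
  have L: "coef L a = coef (u (Suc (deg a))) a" for a
    unfolding L_def by (subst Ser_inverse) auto
  have step: "om d (u (d + e) - u d)" for d e
  proof (induction e)
    case (Suc e)
    have "om d (u (Suc (d + e)) - u (d + e))" using assms om_mono by (metis le_add1)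
    from om_add[OF this Suc] show ?case by simp
  qed simp
  have "om d (L - u d)" for d
    unfolding om_def
  proof safe
    fix a assume a: "deg a < d" "finite (supp a)"
    then obtain e where "d = Suc (deg a) + e" using less_iff_Suc_add by auto
    then show "coef (L - u d) a = 0" using step[of "Suc (deg a)" e] a unfolding om_def by (auto simp: L)
  qed
  then show ?thesis using that by blast
qed

text \<open>Banach's fixed point theorem for the order topology, for maps that gain one order. The
  predicate \<open>P\<close> carries a closed invariant through the iteration; it will record the
  variables, a bound on the order, and the weights. The inverse function theorem, the Liouville
  field and the Darboux coordinates are its three uses.\<close>

lemma contraction_fixpoint:
  fixes T :: "('i \<Rightarrow> ser) \<Rightarrow> ('i \<Rightarrow> ser)"
  assumes z: "P h0" and T: "\<And>h. P h \<Longrightarrow> P (T h)"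
    and closed: "\<And>h. (\<And>d. \<exists>u. P u \<and> (\<forall>i. om d (h i - u i))) \<Longrightarrow> P h"
    and contr: "\<And>h u d. P h \<Longrightarrow> P u \<Longrightarrow> (\<And>i. om d (h i - u i)) \<Longrightarrow> (\<And>i. om (Suc d) (T h i - T u i))"
  obtains h where "P h" "T h = h"
proof -
  define u where "u k = (T ^^ k) h0" for k
  have P: "P (u k)" for k by (induction k) (auto simp: u_def z T)
  have "om d (u (Suc d) i - u d i)" for d i
  proof (induction d arbitrary: i)
    case (Suc d)
    from contr[OF P P this] show ?case by (simp add: u_def)
  qed simp
  then have "\<exists>L. \<forall>d. om d (L - u d i)" for i using ser_limit[of "\<lambda>d. u d i"] by metis
  then obtain h where h: "om d (h i - u d i)" for i d by metis
  have Ph: "P h" by (rule closed) (use P h in blast)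
  have "om d (T h i - h i)" for d i
  proof -
    have "om (Suc d) (T h i - u (Suc d) i)" using contr[OF Ph P h] by (simp add: u_def)
    from om_diff[OF this h[of "Suc d" i]] have "om (Suc d) (T h i - h i)" by simp
    then show ?thesis by (rule om_mono) simp
  qed
  then have "T h = h" using om_eqI by blast
  with Ph show ?thesis using that by blast
qed

section \<open>Substitution of power series and the chain rule\<close>

definition powv :: "nat \<Rightarrow> (nat \<Rightarrow> ser) \<Rightarrow> (nat \<Rightarrow> nat) \<Rightarrow> ser" where
  "powv k \<Phi> b = (\<Prod>i<k. \<Phi> i ^ b i)"

definition small :: "nat \<Rightarrow> (nat \<Rightarrow> ser) \<Rightarrow> bool" where
  "small k \<Phi> \<longleftrightarrow> (\<forall>i<k. om 1 (\<Phi> i))"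

lemma powv_zero [simp]: "powv k \<Phi> 0 = 1"
  by (simp add: powv_def)

lemma powv_plus: "powv k \<Phi> (a + b) = powv k \<Phi> a * powv k \<Phi> b"
  by (simp add: powv_def power_add prod.distrib)

lemma powv_unitv: "i < k \<Longrightarrow> powv k \<Phi> (unitv i) = \<Phi> i"
proof -
  assume "i < k"
  have "powv k \<Phi> (unitv i) = (\<Prod>j<k. if j = i then \<Phi> i else 1)"
    unfolding powv_def unitv_def by (rule prod.cong) auto
  then show ?thesis using \<open>i < k\<close> by simp
qed

lemma om_powv:
  assumes "small k \<Phi>" "supp b \<subseteq> {..<k}"
  shows "om (deg b) (powv k \<Phi> b)"
proof -
  have "om (\<Sum>i<k. 1 * b i) (powv k \<Phi> b)"
    unfolding powv_def using assms(1) by (intro om_prod om_power) (auto simp: small_def)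
  then show ?thesis using deg_eq_sum[of "{..<k}" b] assms(2) by simp
qed

abbreviation exps :: "nat \<Rightarrow> nat \<Rightarrow> (nat \<Rightarrow> nat) set" where
  "exps k d \<equiv> {b. supp b \<subseteq> {..<k} \<and> deg b \<le> d}"

text \<open>If the substituted series have no constant term, then \<open>powv k \<Phi> b\<close>
  vanishes to order \<open>deg b\<close>, so the exponents with \<open>deg b \<le> deg a\<close> are
  the only ones that reach the coefficient of \<open>a\<close>. Truncating there keeps every sum
  finite, whence linearity in \<open>F\<close> holds without any condition on
  \<open>\<Phi>\<close>.\<close>

definition cmp :: "nat \<Rightarrow> ser \<Rightarrow> (nat \<Rightarrow> ser) \<Rightarrow> ser" where
  "cmp k F \<Phi> = Ser (\<lambda>a. \<Sum>b\<in>exps k (deg a). coef F b * coef (powv k \<Phi> b) a)"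

lemma coef_cmp: "coef (cmp k F \<Phi>) a = (\<Sum>b\<in>exps k (deg a). coef F b * coef (powv k \<Phi> b) a)"
  unfolding cmp_def by (subst Ser_inverse) auto

lemma cmp_add [simp]: "cmp k (F + G) \<Phi> = cmp k F \<Phi> + cmp k G \<Phi>"
  by (rule ser_eqI) (simp add: coef_cmp algebra_simps sum.distrib)
lemma cmp_diff [simp]: "cmp k (F - G) \<Phi> = cmp k F \<Phi> - cmp k G \<Phi>"
  by (rule ser_eqI) (simp add: coef_cmp algebra_simps sum_subtractf)
lemma cmp_uminus [simp]: "cmp k (- F) \<Phi> = - cmp k F \<Phi>"
  by (rule ser_eqI) (simp add: coef_cmp sum_negf)
lemma cmp_zero [simp]: "cmp k 0 \<Phi> = 0"
  by (rule ser_eqI) (simp add: coef_cmp)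
lemma cmp_sum [simp]: "cmp k (sum f A) \<Phi> = (\<Sum>i\<in>A. cmp k (f i) \<Phi>)"
  by (induction A rule: infinite_finite_induct) auto
lemma cmp_C_mult: "cmp k (C c * F) \<Phi> = C c * cmp k F \<Phi>"
  by (rule ser_eqI) (simp add: coef_cmp sum_distrib_left mult.assoc)

lemma om_cmp:
  assumes "om d F" shows "om d (cmp k F \<Phi>)"
  unfolding om_def
proof safe
  fix a assume a: "deg a < d"
  have "coef F b = 0" if "b \<in> exps k (deg a)" for b
    using that assms a finite_subset[of "supp b" "{..<k}"] unfolding om_def by auto
  then show "coef (cmp k F \<Phi>) a = 0" unfolding coef_cmp by (intro sum.neutral) simp
qed

lemma cmp_xmon:
  assumes "small k \<Phi>" "supp b \<subseteq> {..<k}"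
  shows "cmp k (xmon b) \<Phi> = powv k \<Phi> b"
proof (rule ser_eqI)
  fix a :: "nat \<Rightarrow> nat" assume a: "finite (supp a)"
  have fb: "finite (supp b)" using assms(2) finite_subset by blast
  have "coef (cmp k (xmon b) \<Phi>) a = (\<Sum>c\<in>exps k (deg a). if c = b then coef (powv k \<Phi> b) a else 0)"
    unfolding coef_cmp by (rule sum.cong) (auto simp: coef_xmon fb)
  also have "\<dots> = (if b \<in> exps k (deg a) then coef (powv k \<Phi> b) a else 0)"
    by (rule sum.delta) (simp add: finite_exps)
  also have "\<dots> = coef (powv k \<Phi> b) a"
    using om_powv[OF assms] a assms(2) by (auto simp: om_def)
  finally show "coef (cmp k (xmon b) \<Phi>) a = coef (powv k \<Phi> b) a" .
qed

lemma cmp_one [simp]: "small k \<Phi> \<Longrightarrow> cmp k 1 \<Phi> = 1"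
  using cmp_xmon[of k \<Phi> 0] by simp
lemma cmp_C [simp]: "small k \<Phi> \<Longrightarrow> cmp k (C c) \<Phi> = C c"
  using cmp_C_mult[of k c 1 \<Phi>] by simp
lemma cmp_var [simp]: "small k \<Phi> \<Longrightarrow> i < k \<Longrightarrow> cmp k (var i) \<Phi> = \<Phi> i"
  using cmp_xmon[of k \<Phi> "unitv i"] by (simp add: var_def powv_unitv)

lemma trunc_sum:
  assumes I: "finite I" and F: "on I F"
  shows "om (Suc d) (F - (\<Sum>b\<in>{b. supp b \<subseteq> I \<and> deg b \<le> d}. C (coef F b) * xmon b))"
  unfolding om_def
proof safe
  fix a assume a: "deg a < Suc d" "finite (supp a)"
  have "(\<Sum>b\<in>{b. supp b \<subseteq> I \<and> deg b \<le> d}. coef F b * coef (xmon b) a)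
      = (\<Sum>b\<in>{b. supp b \<subseteq> I \<and> deg b \<le> d}. if b = a then coef F a else 0)"
    by (rule sum.cong) (auto simp: coef_xmon a(2))
  also have "\<dots> = (if supp a \<subseteq> I \<and> deg a \<le> d then coef F a else 0)"
    using finite_exps[OF I, of d] by simp
  also have "\<dots> = coef F a" using F a unfolding on_def by auto
  finally show "coef (F - (\<Sum>b\<in>{b. supp b \<subseteq> I \<and> deg b \<le> d}. C (coef F b) * xmon b)) a = 0"
    by simp
qed

text \<open>Polynomials are dense, so a continuous linear operator is determined by its values on
  monomials. The permitted loss \<open>e\<close> of order admits operators that contain a
  derivative, as in the chain rule.\<close>

lemma continuous_linear_zero:
  fixes L :: "ser \<Rightarrow> ser"
  assumes I: "finite I" and F: "on I F"
    and add: "\<And>F G. L (F + G) = L F + L G" and scal: "\<And>c F. L (C c * F) = C c * L F"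
    and cont: "\<And>d F. om d F \<Longrightarrow> om (d - e) (L F)"
    and mono: "\<And>b. supp b \<subseteq> I \<Longrightarrow> L (xmon b) = 0"
  shows "L F = 0"
proof (rule om_all_zero)
  fix d
  define S where "S = (\<Sum>b\<in>{b. supp b \<subseteq> I \<and> deg b \<le> d + e}. C (coef F b) * xmon b)"
  have L0: "L 0 = 0" using scal[of 0 0] by simp
  have "L S = (\<Sum>b\<in>{b. supp b \<subseteq> I \<and> deg b \<le> d + e}. L (C (coef F b) * xmon b))"
    unfolding S_def using finite_exps[OF I, of "d + e"]
    by (induction rule: finite_induct) (auto simp: L0 add)
  also have "\<dots> = 0" by (intro sum.neutral) (simp add: scal mono)
  finally have "L F = L (F - S)" using add[of "F - S" S] by simp
  then show "om d (L F)" using cont[OF trunc_sum[OF I F, of "d + e"]] om_mono unfolding S_def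
    by (metis Suc_diff_le add_diff_cancel_right' le_SucI le_add2 order_refl)
qed

text \<open>Setting the variables outside \<open>I\<close> to zero is a ring homomorphism that
  \<open>cmp\<close> does not notice. With it the laws of substitution, proved by density for series
  in the first \<open>k\<close> variables, extend to all series.\<close>

lift_definition restr :: "nat set \<Rightarrow> ser \<Rightarrow> ser" is "\<lambda>I F a. if supp a \<subseteq> I then F a else 0"
  by simp

lemma coef_restr: "coef (restr I F) a = (if supp a \<subseteq> I then coef F a else 0)"
  by (simp add: restr.rep_eq)

lemma on_restr [simp]: "on I (restr I F)"
  by (simp add: on_def coef_restr)

lemma cmp_restr: "cmp k (restr {..<k} F) \<Phi> = cmp k F \<Phi>"
  by (rule ser_eqI) (simp add: coef_cmp coef_restr)

lemma restr_mult: "restr I (F * G) = restr I F * restr I G"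
proof (rule ser_eqI)
  fix a :: "nat \<Rightarrow> nat"
  show "coef (restr I (F * G)) a = coef (restr I F * restr I G) a"
  proof (cases "supp a \<subseteq> I")
    case True
    then have "supp b \<subseteq> I \<and> supp (a - b) \<subseteq> I" if "b \<le> a" for b
      using supp_mono[OF that] supp_minus[of a b] by blast
    then show ?thesis using True by (simp add: coef_restr coef_mult)
  next
    case False
    then show ?thesis using on_mult[OF on_restr on_restr, of I F G] by (auto simp: coef_restr on_def)
  qed
qed

lemma restr_pd: "i \<in> I \<Longrightarrow> restr I (pd i F) = pd i (restr I F)"
  by (rule ser_eqI) (simp add: coef_restr coef_pd)

text \<open>Density is used in one factor at a time: first against a monomial, then in general. On
  two monomials the claim is additivity of exponents.\<close>

lemma cmp_mult [simp]:
  assumes s: "small k \<Phi>"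
  shows "cmp k (F * G) \<Phi> = cmp k F \<Phi> * cmp k G \<Phi>"
proof -
  let ?I = "{..<k}"
  have 1: "cmp k (F * xmon c) \<Phi> - cmp k F \<Phi> * cmp k (xmon c) \<Phi> = 0"
    if c: "supp c \<subseteq> ?I" and F: "on ?I F" for F c
  proof (rule continuous_linear_zero[where e = 0 and I = ?I and L = "\<lambda>F. cmp k (F * xmon c) \<Phi> - cmp k F \<Phi> * cmp k (xmon c) \<Phi>", OF _ F])
    fix b assume b: "supp b \<subseteq> ?I"
    have "finite (supp b)" "finite (supp c)" using b c finite_subset by blast+
    then have "xmon b * xmon c = xmon (b + c)" by (simp add: xmon_mult)
    moreover have "cmp k (xmon (b + c)) \<Phi> = powv k \<Phi> (b + c)"
      using b c by (intro cmp_xmon[OF s]) simp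
    ultimately show "cmp k (xmon b * xmon c) \<Phi> - cmp k (xmon b) \<Phi> * cmp k (xmon c) \<Phi> = 0"
      by (simp add: cmp_xmon[OF s] b c powv_plus)
  next
    show "cmp k ((F + G) * xmon c) \<Phi> - cmp k (F + G) \<Phi> * cmp k (xmon c) \<Phi>
        = cmp k (F * xmon c) \<Phi> - cmp k F \<Phi> * cmp k (xmon c) \<Phi>
          + (cmp k (G * xmon c) \<Phi> - cmp k G \<Phi> * cmp k (xmon c) \<Phi>)" for F G
      by (simp add: algebra_simps)
    show "cmp k (C r * F * xmon c) \<Phi> - cmp k (C r * F) \<Phi> * cmp k (xmon c) \<Phi>
        = C r * (cmp k (F * xmon c) \<Phi> - cmp k F \<Phi> * cmp k (xmon c) \<Phi>)" for r F
      by (simp add: cmp_C_mult mult.assoc right_diff_distrib)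
    show "om (d - 0) (cmp k (F * xmon c) \<Phi> - cmp k F \<Phi> * cmp k (xmon c) \<Phi>)" if "om d F" for d F
      using that by (simp add: om_diff om_cmp om_mult_right)
  qed simp
  have 2: "cmp k (F * G) \<Phi> - cmp k F \<Phi> * cmp k G \<Phi> = 0" if F: "on ?I F" and G: "on ?I G" for F G
  proof (rule continuous_linear_zero[where e = 0 and I = ?I and L = "\<lambda>G. cmp k (F * G) \<Phi> - cmp k F \<Phi> * cmp k G \<Phi>", OF _ G])
    show "cmp k (F * (A + B)) \<Phi> - cmp k F \<Phi> * cmp k (A + B) \<Phi>
        = cmp k (F * A) \<Phi> - cmp k F \<Phi> * cmp k A \<Phi> + (cmp k (F * B) \<Phi> - cmp k F \<Phi> * cmp k B \<Phi>)" for A B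
      by (simp add: algebra_simps)
    show "cmp k (F * (C r * A)) \<Phi> - cmp k F \<Phi> * cmp k (C r * A) \<Phi>
        = C r * (cmp k (F * A) \<Phi> - cmp k F \<Phi> * cmp k A \<Phi>)" for r A
      by (simp add: cmp_C_mult mult.left_commute[of _ "C r"] right_diff_distrib)
    show "om (d - 0) (cmp k (F * A) \<Phi> - cmp k F \<Phi> * cmp k A \<Phi>)" if "om d A" for d A
      using that by (simp add: om_diff om_cmp om_mult_left)
  qed (use 1 F in simp_all)
  show ?thesis using 2[of "restr ?I F" "restr ?I G"]
    by (simp add: cmp_restr flip: restr_mult)
qed

lemma cmp_power [simp]: "small k \<Phi> \<Longrightarrow> cmp k (F ^ p) \<Phi> = cmp k F \<Phi> ^ p"
  by (induction p) auto

lemma cmp_prod [simp]: "small k \<Phi> \<Longrightarrow> cmp k (prod f A) \<Phi> = (\<Prod>i\<in>A. cmp k (f i) \<Phi>)"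
  by (induction A rule: infinite_finite_induct) auto

lemma chain_rule:
  assumes s: "small k \<Phi>"
  shows "pd p (cmp k F \<Phi>) = (\<Sum>i<k. cmp k (pd i F) \<Phi> * pd p (\<Phi> i))"
proof -
  let ?I = "{..<k}"
  have 1: "pd p (cmp k F \<Phi>) - (\<Sum>i<k. cmp k (pd i F) \<Phi> * pd p (\<Phi> i)) = 0" if F: "on ?I F" for F
  proof (rule continuous_linear_zero[where e = 1 and I = ?I, OF _ F])
    fix b :: "nat \<Rightarrow> nat" assume b: "supp b \<subseteq> ?I"
    have "finite (supp b)" using b finite_subset by blast
    then show "pd p (cmp k (xmon b) \<Phi>) - (\<Sum>i<k. cmp k (pd i (xmon b)) \<Phi> * pd p (\<Phi> i)) = 0"
      using b
    proof (induction b rule: exp_induct)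
      case (plus b j)
      have bj: "supp b \<union> {j} \<subseteq> {..<k}" using plus.prems by (simp only: supp_plus supp_unitv)
      then have j: "j < k" and IH: "pd p (cmp k (xmon b) \<Phi>) = (\<Sum>i<k. cmp k (pd i (xmon b)) \<Phi> * pd p (\<Phi> i))"
        using plus.IH by auto
      have "(\<Sum>i<k. cmp k (pd i (xmon b * var j)) \<Phi> * pd p (\<Phi> i))
          = (\<Sum>i<k. cmp k (pd i (xmon b)) \<Phi> * pd p (\<Phi> i) * \<Phi> j
              + (if i = j then cmp k (xmon b) \<Phi> * pd p (\<Phi> j) else 0))"
        by (rule sum.cong) (auto simp: s j pd_var algebra_simps)
      also have "\<dots> = (\<Sum>i<k. cmp k (pd i (xmon b)) \<Phi> * pd p (\<Phi> i)) * \<Phi> j + cmp k (xmon b) \<Phi> * pd p (\<Phi> j)"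
        using j by (simp add: sum.distrib sum_distrib_right)
      also have "\<dots> = pd p (cmp k (xmon b * var j) \<Phi>)"
        using j by (simp add: s flip: IH)
      finally show "pd p (cmp k (xmon (b + unitv j)) \<Phi>) - (\<Sum>i<k. cmp k (pd i (xmon (b + unitv j))) \<Phi> * pd p (\<Phi> i)) = 0"
        by (simp add: xmon_plus_var plus(1) del: pd_mult)
    qed (simp add: s)
  next
    fix d F assume "om d F"
    then show "om (d - 1) (pd p (cmp k F \<Phi>) - (\<Sum>i<k. cmp k (pd i F) \<Phi> * pd p (\<Phi> i)))"
      by (intro om_diff om_sum om_mult_right om_pd om_cmp)
  next
    fix c F
    show "pd p (cmp k (C c * F) \<Phi>) - (\<Sum>i<k. cmp k (pd i (C c * F)) \<Phi> * pd p (\<Phi> i))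
        = C c * (pd p (cmp k F \<Phi>) - (\<Sum>i<k. cmp k (pd i F) \<Phi> * pd p (\<Phi> i)))"
      by (simp add: cmp_C_mult s sum_distrib_left right_diff_distrib mult.assoc)
  qed (auto simp: algebra_simps sum.distrib)
  show ?thesis using 1[of "restr ?I F"]
    by (simp add: cmp_restr flip: restr_pd)
qed

lemma small_cmp: "small k \<Phi> \<Longrightarrow> small k (\<lambda>i. cmp k (\<Phi> i) \<Psi>)"
  unfolding small_def by (auto intro: om_cmp)

lemma cmp_assoc:
  assumes s: "small k \<Phi>" "small k \<Psi>"
  shows "cmp k (cmp k F \<Phi>) \<Psi> = cmp k F (\<lambda>i. cmp k (\<Phi> i) \<Psi>)"
proof -
  have s2: "small k (\<lambda>i. cmp k (\<Phi> i) \<Psi>)" by (rule small_cmp) fact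
  have 1: "cmp k (cmp k F \<Phi>) \<Psi> - cmp k F (\<lambda>i. cmp k (\<Phi> i) \<Psi>) = 0" if F: "on {..<k} F" for F
    by (rule continuous_linear_zero[where e = 0 and I = "{..<k}", OF _ F])
      (auto simp: cmp_C_mult s s2 cmp_xmon algebra_simps intro!: om_diff om_cmp,
       simp add: powv_def s)
  show ?thesis using 1[of "restr {..<k} F"] by (simp add: cmp_restr)
qed

lemma powv_var: "supp b \<subseteq> {..<k} \<Longrightarrow> powv k var b = xmon b"
proof -
  assume b: "supp b \<subseteq> {..<k}"
  then have "finite (supp b)" using finite_subset by blast
  then have "supp b \<subseteq> {..<k} \<longrightarrow> powv k var b = xmon b"
    by (rule exp_induct[where P = "\<lambda>b. supp b \<subseteq> {..<k} \<longrightarrow> powv k var b = xmon b"])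
      (auto simp: powv_plus powv_unitv xmon_plus_var)
  with b show ?thesis by blast
qed

lemma small_var [simp]: "small k var"
  by (simp add: small_def)

lemma cmp_ident: assumes "on {..<k} F" shows "cmp k F var = F"
proof -
  have "cmp k F var - F = 0"
    by (rule continuous_linear_zero[where e = 0 and I = "{..<k}", OF _ assms])
      (auto simp: cmp_C_mult cmp_xmon powv_var algebra_simps intro!: om_diff om_cmp)
  then show ?thesis by simp
qed

lemma powv_cong: "(\<And>i. i \<in> supp b \<Longrightarrow> \<Phi> i = \<Psi> i) \<Longrightarrow> powv k \<Phi> b = powv k \<Psi> b"
  unfolding powv_def
proof (rule prod.cong)
  fix i assume "\<And>i. i \<in> supp b \<Longrightarrow> \<Phi> i = \<Psi> i"
  then show "\<Phi> i ^ b i = \<Psi> i ^ b i" by (cases "b i = 0") (auto simp: supp_def)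
qed simp

lemma cmp_cong: "on I F \<Longrightarrow> (\<And>i. i \<in> I \<Longrightarrow> i < k \<Longrightarrow> \<Phi> i = \<Psi> i) \<Longrightarrow> cmp k F \<Phi> = cmp k F \<Psi>"
proof (rule ser_eqI)
  fix a :: "nat \<Rightarrow> nat"
  assume F: "on I F" and eq: "\<And>i. i \<in> I \<Longrightarrow> i < k \<Longrightarrow> \<Phi> i = \<Psi> i"
  show "coef (cmp k F \<Phi>) a = coef (cmp k F \<Psi>) a"
    unfolding coef_cmp
  proof (rule sum.cong)
    fix b assume b: "b \<in> exps k (deg a)"
    show "coef F b * coef (powv k \<Phi> b) a = coef F b * coef (powv k \<Psi> b) a"
    proof (cases "coef F b = 0")
      case False
      then have "supp b \<subseteq> I" using F by (auto simp: on_def)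
      then have "powv k \<Phi> b = powv k \<Psi> b" using b eq by (intro powv_cong) auto
      then show ?thesis by simp
    qed simp
  qed simp
qed

lemma on_powv: "(\<And>i. i \<in> supp b \<Longrightarrow> on J (\<Phi> i)) \<Longrightarrow> on J (powv k \<Phi> b)"
  unfolding powv_def
proof (rule on_prod)
  fix i assume "\<And>i. i \<in> supp b \<Longrightarrow> on J (\<Phi> i)"
  then show "on J (\<Phi> i ^ b i)" by (cases "b i = 0") (auto simp: supp_def intro: on_power)
qed

lemma on_cmp:
  assumes "on I F" "\<And>i. i \<in> I \<Longrightarrow> i < k \<Longrightarrow> on J (\<Phi> i)"
  shows "on J (cmp k F \<Phi>)"
  unfolding on_def
proof (intro allI impI)
  fix a assume "coef (cmp k F \<Phi>) a \<noteq> 0"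
  then obtain b where b: "b \<in> exps k (deg a)" "coef F b \<noteq> 0" "coef (powv k \<Phi> b) a \<noteq> 0"
    unfolding coef_cmp by (metis (no_types, lifting) mult_eq_0_iff sum.neutral)
  then have "supp b \<subseteq> I" using assms(1) by (auto simp: on_def)
  then have "on J (powv k \<Phi> b)" using assms(2) b(1) by (intro on_powv) auto
  then show "supp a \<subseteq> J" using b(3) by (auto simp: on_def)
qed

text \<open>Exchanging one factor at a time, the exchanged factor contributes order \<open>d\<close>
  and each of the other \<open>deg b - 1\<close> factors at least one. For \<open>b = 0\<close> the
  difference is zero, so the truncated subtraction does no harm.\<close>

lemma om_powv_diff:
  assumes s: "small k \<Phi>" "small k \<Psi>" and d: "\<And>i. i < k \<Longrightarrow> om d (\<Phi> i - \<Psi> i)"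
    and b: "supp b \<subseteq> {..<k}"
  shows "om (d + deg b - 1) (powv k \<Phi> b - powv k \<Psi> b)"
proof -
  have "finite (supp b)" using b finite_subset by blast
  then show ?thesis using b
  proof (induction b rule: exp_induct)
    case (plus c i)
    have ci: "supp c \<union> {i} \<subseteq> {..<k}" using plus.prems by (simp only: supp_plus supp_unitv)
    then have c: "supp c \<subseteq> {..<k}" and i: "i < k" by auto
    have "om (deg c + d) (powv k \<Phi> c * (\<Phi> i - \<Psi> i))"
      by (intro om_mult om_powv s d i c)
    moreover have "om (d + deg c) ((powv k \<Phi> c - powv k \<Psi> c) * \<Psi> i)"
    proof (cases "deg c = 0")
      case True
      then have "c = 0" using plus(1) deg_eq_0 by blast
      then show ?thesis by simp
    next
      case False
      have "om (d + deg c - 1 + 1) ((powv k \<Phi> c - powv k \<Psi> c) * \<Psi> i)"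
        using plus c i s by (intro om_mult) (auto simp: small_def)
      then show ?thesis using False by simp
    qed
    ultimately have "om (d + deg c) (powv k \<Phi> c * (\<Phi> i - \<Psi> i) + (powv k \<Phi> c - powv k \<Psi> c) * \<Psi> i)"
      by (intro om_add) (simp_all add: add.commute)
    moreover have "powv k \<Phi> c * (\<Phi> i - \<Psi> i) + (powv k \<Phi> c - powv k \<Psi> c) * \<Psi> i
        = powv k \<Phi> (c + unitv i) - powv k \<Psi> (c + unitv i)"
      by (simp add: powv_plus powv_unitv i algebra_simps)
    ultimately show "om (d + deg (c + unitv i) - 1) (powv k \<Phi> (c + unitv i) - powv k \<Psi> (c + unitv i))"
      using plus(1) by simp
  qed simp
qed

text \<open>With \<open>e = 2\<close> this gains one order: substitution into a series without
  constant and linear terms is a contraction.\<close>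

lemma om_cmp_diff:
  assumes s: "small k \<Phi>" "small k \<Psi>" and d: "\<And>i. i < k \<Longrightarrow> om d (\<Phi> i - \<Psi> i)"
    and F: "om e F"
  shows "om (d + e - 1) (cmp k F \<Phi> - cmp k F \<Psi>)"
  unfolding om_def
proof safe
  fix a assume a: "deg a < d + e - 1" "finite (supp a)"
  have "coef F b * coef (powv k \<Phi> b - powv k \<Psi> b) a = 0" if b: "b \<in> exps k (deg a)" for b
  proof (cases "deg b < e")
    case True
    have "finite (supp b)" using b finite_subset by blast
    then show ?thesis using F True by (simp add: om_def)
  next
    case False
    have "om (d + deg b - 1) (powv k \<Phi> b - powv k \<Psi> b)" using om_powv_diff[OF s d] b by blast
    then show ?thesis using a False by (simp add: om_def)
  qed
  then have "(\<Sum>b\<in>exps k (deg a). coef F b * coef (powv k \<Phi> b - powv k \<Psi> b) a) = 0"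
    by (intro sum.neutral) blast
  then show "coef (cmp k F \<Phi> - cmp k F \<Psi>) a = 0"
    by (simp add: coef_cmp right_diff_distrib sum_subtractf)
qed

subsection \<open>Formal coordinate systems\<close>

definition jac :: "(nat \<Rightarrow> ser) \<Rightarrow> nat \<Rightarrow> nat \<Rightarrow> complex" where
  "jac \<Phi> i j = coef (\<Phi> i) (unitv j)"

text \<open>Matrices are plain functions on an index set, since the indices that occur are those of
  the variables, starting at 1. The shift to matrices indexed from 0 is confined to the final
  translation.\<close>

definition inv_pair :: "nat set \<Rightarrow> (nat \<Rightarrow> nat \<Rightarrow> complex) \<Rightarrow> (nat \<Rightarrow> nat \<Rightarrow> complex) \<Rightarrow> bool" where
  "inv_pair I P J \<longleftrightarrow> (\<forall>i\<in>I. \<forall>l\<in>I. (\<Sum>j\<in>I. P i j * J j l) = (if i = l then 1 else 0) \<and>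
      (\<Sum>j\<in>I. J i j * P j l) = (if i = l then 1 else 0))"

lemma inv_pair_sym: "inv_pair I P J \<Longrightarrow> inv_pair I J P"
  by (simp add: inv_pair_def)

lemma inv_pair_cong:
  assumes "\<And>i j. i \<in> I \<Longrightarrow> j \<in> I \<Longrightarrow> P i j = P' i j" "\<And>i j. i \<in> I \<Longrightarrow> j \<in> I \<Longrightarrow> J i j = J' i j"
  shows "inv_pair I P J \<longleftrightarrow> inv_pair I P' J'"
  unfolding inv_pair_def using assms by (intro ball_cong refl) (simp cong: sum.cong)

definition coords :: "nat \<Rightarrow> (nat \<Rightarrow> ser) \<Rightarrow> bool" where
  "coords k \<Phi> \<longleftrightarrow> small k \<Phi> \<and> (\<forall>i<k. on {..<k} (\<Phi> i)) \<and> (\<exists>P. inv_pair {..<k} P (jac \<Phi>))"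

lemma unitv_inj [simp]: "unitv i = unitv j \<longleftrightarrow> i = j"
  by (metis singleton_inject supp_unitv)

lemma unitv_nz [simp]: "unitv i \<noteq> 0" "0 \<noteq> unitv i"
  by (metis deg_unitv deg_zero one_neq_zero)+

lemma deg_1: "finite (supp a) \<Longrightarrow> deg a = 1 \<Longrightarrow> \<exists>i. a = unitv i"
proof -
  assume a: "finite (supp a)" "deg a = 1"
  then have "a \<noteq> 0" by auto
  then obtain b i where b: "a = b + unitv i" "finite (supp b)" using exp_cases a(1) by metis
  then have "b = 0" using a deg_eq_0[of b] by simp
  then show ?thesis using b by auto
qed

lemma om2I:
  assumes "coef F 0 = 0" "\<And>i. coef F (unitv i) = 0"
  shows "om 2 F"
  unfolding om_def
proof safe
  fix a assume a: "deg a < 2" "finite (supp a)"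
  then have "deg a = 0 \<or> deg a = 1" by linarith
  then show "coef F a = 0" using deg_eq_0[OF a(2)] deg_1[OF a(2)] assms by auto
qed

lemma om2_iff: "om 2 F \<longleftrightarrow> coef F 0 = 0 \<and> (\<forall>i. coef F (unitv i) = 0)"
proof
  assume h: "om 2 F"
  show "coef F 0 = 0 \<and> (\<forall>i. coef F (unitv i) = 0)"
    using h[unfolded om_def, rule_format, of 0] h[unfolded om_def, rule_format, of "unitv _"] by simp
qed (use om2I in blast)

lemma om2_linear:
  assumes "finite I" "on I F" "om 1 F"
  shows "om 2 (F - (\<Sum>j\<in>I. C (coef F (unitv j)) * var j))"
proof (rule om2I)
  have "coef F 0 = 0" using assms(3) om1_iff by blast
  then show "coef (F - (\<Sum>j\<in>I. C (coef F (unitv j)) * var j)) 0 = 0"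
    by (simp add: coef_var)
next
  fix i
  have "coef F (unitv i) = 0" if "i \<notin> I" using assms(2) that by (auto simp: on_def)
  then show "coef (F - (\<Sum>j\<in>I. C (coef F (unitv j)) * var j)) (unitv i) = 0"
    using assms(1) by (auto simp: coef_var if_distrib cong: if_cong)
qed

lemma inv_pair_solve:
  assumes IP: "inv_pair I P J" and I: "finite I" and i: "i \<in> I"
  shows "(\<Sum>j\<in>I. C (J i j) * (\<Sum>l\<in>I. C (P j l) * u l)) = u i"
proof -
  have "(\<Sum>j\<in>I. C (J i j) * (\<Sum>l\<in>I. C (P j l) * u l)) = (\<Sum>l\<in>I. C (\<Sum>j\<in>I. J i j * P j l) * u l)"
    by (simp add: sum_distrib_left sum_distrib_right C_sum mult.assoc) (rule sum.swap)
  also have "\<dots> = (\<Sum>l\<in>I. if l = i then u i else 0)"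
    using IP i by (intro sum.cong) (auto simp: inv_pair_def)
  finally show ?thesis using I i by simp
qed

text \<open>The formal inverse function theorem. Writing \<Phi> as its linear part plus
  \<open>H\<close> and denoting by \<open>P\<close> the inverse of the linear part, the equation
  becomes \<Psi> = P (x - H(\<Psi>)), a contraction because \<open>H\<close> has order 2.\<close>

lemma coords_right_inverse:
  assumes c: "coords k \<Phi>"
  obtains \<Psi> where "coords k \<Psi>" "\<And>i. i < k \<Longrightarrow> cmp k (\<Phi> i) \<Psi> = var i"
proof -
  have s: "small k \<Phi>" and on: "\<And>i. i < k \<Longrightarrow> on {..<k} (\<Phi> i)" using c by (auto simp: coords_def)
  obtain P where IP: "inv_pair {..<k} P (jac \<Phi>)" using c coords_def by blast
  define H where "H i = \<Phi> i - (\<Sum>j<k. C (jac \<Phi> i j) * var j)" for i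
  have H2: "om 2 (H i)" if "i < k" for i
    unfolding H_def jac_def using s on that by (intro om2_linear) (auto simp: small_def)
  have Hon: "on {..<k} (H i)" if "i < k" for i
    unfolding H_def using on[OF that] by (intro on_diff on_sum on_mult) auto
  define T where "T \<Psi> i = (if i < k then \<Sum>j<k. C (P i j) * (var j - cmp k (H j) \<Psi>) else 0)" for \<Psi> i
  define good where "good \<Psi> \<longleftrightarrow> (\<forall>i. om 1 (\<Psi> i) \<and> on {..<k} (\<Psi> i))" for \<Psi> :: "nat \<Rightarrow> ser"
  have gs: "small k \<Psi>" if "good \<Psi>" for \<Psi> using that by (auto simp: good_def small_def)
  have om1: "om 1 (H j)" if "j < k" for j using H2[OF that] om_mono by fastforce
  obtain \<Psi> where g: "good \<Psi>" and fp: "T \<Psi> = \<Psi>"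
  proof (rule contraction_fixpoint[of good "\<lambda>_. 0" T])
    show "good (\<lambda>_. 0)" by (simp add: good_def)
    show "good (T h)" if "good h" for h
      unfolding good_def T_def
      using that om1 Hon
      by (auto intro!: om_sum om_mult_left om_diff om_cmp on_sum on_mult on_diff on_cmp[of "{..<k}"] simp: good_def)
    show "good h" if h: "\<And>d. \<exists>u. good u \<and> (\<forall>i. om d (h i - u i))" for h
      unfolding good_def
    proof (intro allI conjI)
      fix i
      obtain u where "good u" "\<forall>i. om 1 (h i - u i)" using h by blast
      then show "om 1 (h i)" using om_add[of 1 "h i - u i" "u i"] by (simp add: good_def)
      show "on {..<k} (h i)" by (rule on_limit) (use h good_def in blast)
    qed
    show "om (Suc d) (T h i - T u i)" if "good h" "good u" "\<And>i. om d (h i - u i)" for h u d i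
    proof (cases "i < k")
      case True
      have "om (Suc d) (cmp k (H j) h - cmp k (H j) u)" if "j < k" for j
        using om_cmp_diff[OF gs gs _ H2[OF that], of h u d] \<open>good h\<close> \<open>good u\<close> \<open>\<And>i. om d (h i - u i)\<close>
        by simp
      then have "om (Suc d) (\<Sum>j<k. C (P i j) * (- (cmp k (H j) h - cmp k (H j) u)))"
        by (intro om_sum om_mult_left om_uminus) auto
      moreover have "T h i - T u i = (\<Sum>j<k. C (P i j) * (- (cmp k (H j) h - cmp k (H j) u)))"
        using True by (simp add: T_def algebra_simps flip: sum_subtractf)
      ultimately show ?thesis by simp
    qed (simp add: T_def)
  qed
  have s\<Psi>: "small k \<Psi>" by (rule gs) fact
  have \<Psi>: "\<Psi> i = (\<Sum>j<k. C (P i j) * (var j - cmp k (H j) \<Psi>))" if "i < k" for i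
    using fp that by (metis T_def)
  have inv: "cmp k (\<Phi> i) \<Psi> = var i" if i: "i < k" for i
  proof -
    have "\<Phi> i = (\<Sum>j<k. C (jac \<Phi> i j) * var j) + H i" by (simp add: H_def)
    then have "cmp k (\<Phi> i) \<Psi> = (\<Sum>j<k. C (jac \<Phi> i j) * \<Psi> j) + cmp k (H i) \<Psi>"
      using s\<Psi> by simp
    also have "(\<Sum>j<k. C (jac \<Phi> i j) * \<Psi> j)
        = (\<Sum>j<k. C (jac \<Phi> i j) * (\<Sum>l<k. C (P j l) * (var l - cmp k (H l) \<Psi>)))"
      using \<Psi> by simp
    also have "\<dots> = var i - cmp k (H i) \<Psi>" using i by (intro inv_pair_solve[OF IP]) auto
    finally show ?thesis by simp
  qed
  have j\<Psi>: "jac \<Psi> i j = P i j" if "i < k" "j < k" for i j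
  proof -
    have "coef (cmp k (H l) \<Psi>) (unitv j) = 0" if "l < k" for l
      using om_cmp[OF H2[OF that]] om2_iff by blast
    then have "jac \<Psi> i j = (\<Sum>l<k. if j = l then P i l else 0)"
      unfolding jac_def \<Psi>[OF that(1)] coef_sum by (intro sum.cong) (auto simp: coef_var)
    then show ?thesis using that by simp
  qed
  have "inv_pair {..<k} (jac \<Phi>) (jac \<Psi>)"
    using inv_pair_sym[OF IP] inv_pair_cong[of "{..<k}" "jac \<Phi>" "jac \<Phi>" "jac \<Psi>" P] by (simp add: j\<Psi>)
  then have "coords k \<Psi>" using g s\<Psi> by (auto simp: coords_def good_def)
  with inv show ?thesis using that by blast
qed

text \<open>The right inverse \<Psi> has a right inverse \<Xi> of its own, and associativity of
  substitution identifies \<Xi> with \<Phi>.\<close>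

lemma coords_inverse:
  assumes c: "coords k \<Phi>"
  shows "\<exists>\<Psi>. coords k \<Psi> \<and> (\<forall>i<k. cmp k (\<Phi> i) \<Psi> = var i) \<and> (\<forall>i<k. cmp k (\<Psi> i) \<Phi> = var i)"
proof -
  obtain \<Psi> where \<Psi>: "coords k \<Psi>" "\<And>i. i < k \<Longrightarrow> cmp k (\<Phi> i) \<Psi> = var i"
    using coords_right_inverse[OF c] by blast
  obtain \<Xi> where \<Xi>: "coords k \<Xi>" "\<And>i. i < k \<Longrightarrow> cmp k (\<Psi> i) \<Xi> = var i"
    using coords_right_inverse[OF \<Psi>(1)] by blast
  have s: "small k \<Phi>" "small k \<Psi>" "small k \<Xi>" using c \<Psi> \<Xi> by (auto simp: coords_def)
  have "\<Xi> i = \<Phi> i" if "i < k" for i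
  proof -
    have "\<Xi> i = cmp k (cmp k (\<Phi> i) \<Psi>) \<Xi>" using \<Psi>(2) that s by simp
    also have "\<dots> = cmp k (\<Phi> i) (\<lambda>j. cmp k (\<Psi> j) \<Xi>)" by (rule cmp_assoc) fact+
    also have "\<dots> = cmp k (\<Phi> i) var"
      using \<Xi>(2) c that by (intro cmp_cong[of "{..<k}"]) (auto simp: coords_def)
    also have "\<dots> = \<Phi> i" using c that by (intro cmp_ident) (auto simp: coords_def)
    finally show ?thesis .
  qed
  then have "cmp k (\<Psi> i) \<Phi> = var i" if "i < k" for i
    using \<Xi>(2)[OF that] \<Psi>(1) that cmp_cong[of "{..<k}" "\<Psi> i" k \<Xi> \<Phi>] by (auto simp: coords_def)
  then show ?thesis using \<Psi> by blast
qed

lemma cmp_inj: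
  assumes c: "coords k \<Phi>" and on: "on {..<k} F" "on {..<k} G" and eq: "cmp k F \<Phi> = cmp k G \<Phi>"
  shows "F = G"
proof -
  obtain \<Psi> where \<Psi>: "coords k \<Psi>" "\<And>i. i < k \<Longrightarrow> cmp k (\<Phi> i) \<Psi> = var i"
    using coords_right_inverse[OF c] by blast
  have *: "cmp k (cmp k F \<Phi>) \<Psi> = F" if "on {..<k} F" for F
  proof -
    have "cmp k (cmp k F \<Phi>) \<Psi> = cmp k F (\<lambda>j. cmp k (\<Phi> j) \<Psi>)"
      using c \<Psi>(1) by (intro cmp_assoc) (auto simp: coords_def)
    also have "\<dots> = cmp k F var" using \<Psi>(2) that by (intro cmp_cong[of "{..<k}"]) auto
    finally show ?thesis using cmp_ident[OF that] by simp
  qed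
  show ?thesis using *[OF on(1)] *[OF on(2)] unfolding eq by (rule box_equals[OF refl])
qed

lemma cmp_surj:
  assumes c: "coords k \<Phi>" and on: "on {..<k} F"
  obtains G where "on {..<k} G" "cmp k G \<Phi> = F"
proof -
  obtain \<Psi> where \<Psi>: "coords k \<Psi>" and "\<And>i. i < k \<Longrightarrow> cmp k (\<Phi> i) \<Psi> = var i"
    and \<Psi>2: "\<And>i. i < k \<Longrightarrow> cmp k (\<Psi> i) \<Phi> = var i"
    using coords_inverse[OF c] by blast
  have "cmp k (cmp k F \<Psi>) \<Phi> = cmp k F (\<lambda>j. cmp k (\<Psi> j) \<Phi>)"
    using c \<Psi> by (intro cmp_assoc) (auto simp: coords_def)
  also have "\<dots> = cmp k F var" using \<Psi>2 on by (intro cmp_cong[of "{..<k}"]) auto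
  also have "\<dots> = F" by (rule cmp_ident) fact
  finally have "cmp k (cmp k F \<Psi>) \<Phi> = F" .
  moreover have "on {..<k} (cmp k F \<Psi>)" using \<Psi> on by (intro on_cmp[of "{..<k}"]) (auto simp: coords_def)
  ultimately show ?thesis using that by blast
qed

subsection \<open>Vector fields\<close>

definition vf :: "nat \<Rightarrow> (nat \<Rightarrow> ser) \<Rightarrow> ser \<Rightarrow> ser" where
  "vf k V F = (\<Sum>i<k. V i * pd i F)"

lemma vf_add [simp]: "vf k V (F + G) = vf k V F + vf k V G"
  by (simp add: vf_def algebra_simps sum.distrib)
lemma vf_diff [simp]: "vf k V (F - G) = vf k V F - vf k V G"
  by (simp add: vf_def algebra_simps sum_subtractf)
lemma vf_uminus [simp]: "vf k V (- F) = - vf k V F"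
  by (simp add: vf_def sum_negf)
lemma vf_C [simp]: "vf k V (C c) = 0"
  by (simp add: vf_def)
lemma vf_zero [simp]: "vf k V 0 = 0"
  by (simp add: vf_def)
lemma vf_sum [simp]: "vf k V (sum f A) = (\<Sum>i\<in>A. vf k V (f i))"
  by (induction A rule: infinite_finite_induct) auto
lemma vf_mult [simp]: "vf k V (F * G) = vf k V F * G + F * vf k V G"
  by (simp add: vf_def algebra_simps sum.distrib sum_distrib_left)
lemma vf_var [simp]: "i < k \<Longrightarrow> vf k V (var i) = V i"
  by (simp add: vf_def pd_var if_distrib cong: if_cong)

lemma om_vf: assumes "small k V" "om d F" shows "om d (vf k V F)"
proof (cases d)
  case (Suc e)
  have "om (1 + e) (V i * pd i F)" if "i < k" for i
    using assms that Suc by (intro om_mult om_pd_Suc) (auto simp: small_def)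
  then show ?thesis unfolding vf_def Suc by (intro om_sum) auto
qed simp

text \<open>The terms with second derivatives are symmetric in the two fields and cancel, so the
  commutator is again a vector field.\<close>

lemma vf_bracket:
  "vf k V (vf k W F) - vf k W (vf k V F) = vf k (\<lambda>j. vf k V (W j) - vf k W (V j)) F"
proof -
  have "vf k V (vf k W F) = vf k (\<lambda>j. vf k V (W j)) F + (\<Sum>i<k. \<Sum>j<k. V i * W j * pd i (pd j F))"
    for V W
    by (simp add: vf_def sum.distrib sum_distrib_left sum_distrib_right algebra_simps) (rule sum.swap)
  moreover have "(\<Sum>i<k. \<Sum>j<k. V i * W j * pd i (pd j F)) = (\<Sum>i<k. \<Sum>j<k. W i * V j * pd i (pd j F))"
    by (subst sum.swap) (simp add: pd_commute mult.commute)
  ultimately show ?thesis by (simp add: vf_def left_diff_distrib sum_subtractf)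
qed

lemma vf_chain: "small k \<Phi> \<Longrightarrow> vf l V (cmp k F \<Phi>) = (\<Sum>i<k. cmp k (pd i F) \<Phi> * vf l V (\<Phi> i))"
  unfolding vf_def
  by (simp add: chain_rule sum_distrib_left) (subst sum.swap, simp add: algebra_simps)

section \<open>Underdetermined linear systems and one-sided inverses\<close>

lemma homogeneous_system:
  fixes c :: "'i \<Rightarrow> 's \<Rightarrow> complex"
  assumes "finite S" "finite I" "card S < card I"
  shows "\<exists>r. (\<exists>i\<in>I. r i \<noteq> 0) \<and> (\<forall>s\<in>S. (\<Sum>i\<in>I. r i * c i s) = 0)"
  using assms
proof (induction S arbitrary: I c rule: finite_induct)
  case empty
  then obtain i where "i \<in> I" by fastforce
  then show ?case by (intro exI[of _ "\<lambda>_. 1"]) auto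
next
  case (insert s S)
  show ?case
  proof (cases "\<forall>i\<in>I. c i s = 0")
    case True
    have "card S < card I" using insert by simp
    then obtain r where "\<exists>i\<in>I. r i \<noteq> 0" "\<forall>s\<in>S. (\<Sum>i\<in>I. r i * c i s) = 0"
      using insert.IH[OF insert.prems(1), of c] by blast
    then show ?thesis using True by (intro exI[of _ r]) auto
  next
    case False
    then obtain i0 where i0: "i0 \<in> I" "c i0 s \<noteq> 0" by auto
    define I' where "I' = I - {i0}"
    have I': "finite I'" "card S < card I'" using insert i0 by (auto simp: I'_def)
    \<comment> \<open>Elimination: from every vector the multiple of the one with index
      \<open>i0\<close> is subtracted that cancels its coordinate \<open>s\<close>. The coefficient
      \<open>r0\<close> below collects the subtracted multiples.\<close>
    define c' where "c' i t = c i t - c i s / c i0 s * c i0 t" for i t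
    obtain r where r: "\<exists>i\<in>I'. r i \<noteq> 0" "\<forall>t\<in>S. (\<Sum>i\<in>I'. r i * c' i t) = 0"
      using insert.IH[OF I', of c'] by auto
    define r0 where "r0 = - (\<Sum>i\<in>I'. r i * c i s) / c i0 s"
    define q where "q i = (if i = i0 then r0 else r i)" for i
    have sum: "(\<Sum>i\<in>I. q i * c i t) = r0 * c i0 t + (\<Sum>i\<in>I'. r i * c i t)" for t
    proof -
      have "(\<Sum>i\<in>I. q i * c i t) = q i0 * c i0 t + (\<Sum>i\<in>I'. q i * c i t)"
        unfolding I'_def using i0 insert by (intro sum.remove) auto
      also have "(\<Sum>i\<in>I'. q i * c i t) = (\<Sum>i\<in>I'. r i * c i t)"
        by (rule sum.cong) (auto simp: q_def I'_def)
      finally show ?thesis by (simp add: q_def)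
    qed
    have "(\<Sum>i\<in>I. q i * c i t) = 0" if "t \<in> S" for t
    proof -
      have "0 = (\<Sum>i\<in>I'. r i * c' i t)" using r that by simp
      also have "\<dots> = (\<Sum>i\<in>I'. r i * c i t) - (\<Sum>i\<in>I'. r i * c i s) / c i0 s * c i0 t"
        by (simp add: c'_def right_diff_distrib sum_subtractf sum_distrib_right sum_divide_distrib mult.assoc)
      finally show ?thesis unfolding sum r0_def by simp
    qed
    moreover have "(\<Sum>i\<in>I. q i * c i s) = 0" unfolding sum r0_def using i0 by simp
    moreover have "\<exists>i\<in>I. q i \<noteq> 0" using r(1) by (auto simp: q_def I'_def)
    ultimately show ?thesis by (intro exI[of _ q]) auto
  qed
qed

text \<open>A vector \<open>u\<close> in the kernel of \<open>P\<close> together with the columns of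
  \<open>J\<close> makes one vector more than there are coordinates. Applying \<open>P\<close> to a
  linear relation among them drops \<open>u\<close> and isolates the coefficients of the columns, so
  \<open>u\<close> must vanish. The columns of \<open>J P - 1\<close> lie in that kernel.\<close>

lemma left_inverse_inv_pair:
  assumes I: "finite I" and left: "\<And>i l. i \<in> I \<Longrightarrow> l \<in> I \<Longrightarrow> (\<Sum>j\<in>I. P i j * J j l) = (if i = l then 1 else 0)"
  shows "inv_pair I P J"
proof -
  have ker: "u l = 0" if Pu: "\<And>i. i \<in> I \<Longrightarrow> (\<Sum>j\<in>I. P i j * u j) = 0" and l: "l \<in> I" for u l
  proof (rule ccontr)
    assume ul: "u l \<noteq> 0"
    define c where "c o' i = (case o' of None \<Rightarrow> u i | Some j \<Rightarrow> J i j)" for o' i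
    have cd: "card I < card (insert None (Some ` I))" using I by (simp add: card_image)
    obtain r where r: "\<exists>i\<in>insert None (Some ` I). r i \<noteq> 0"
      "\<forall>s\<in>I. (\<Sum>i\<in>insert None (Some ` I). r i * c i s) = 0"
      using homogeneous_system[OF I _ cd, of c] I by auto
    have eq: "r None * u s + (\<Sum>j\<in>I. r (Some j) * J s j) = 0" if "s \<in> I" for s
      using r(2) that I by (simp add: c_def sum.reindex)
    have rS: "r (Some i) = 0" if i: "i \<in> I" for i
    proof -
      have "0 = (\<Sum>s\<in>I. P i s * (r None * u s + (\<Sum>j\<in>I. r (Some j) * J s j)))"
        using eq by simp
      also have "\<dots> = r None * (\<Sum>s\<in>I. P i s * u s) + (\<Sum>s\<in>I. \<Sum>j\<in>I. r (Some j) * (P i s * J s j))"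
        by (simp add: algebra_simps sum.distrib sum_distrib_left)
      also have "(\<Sum>s\<in>I. \<Sum>j\<in>I. r (Some j) * (P i s * J s j)) = (\<Sum>j\<in>I. r (Some j) * (\<Sum>s\<in>I. P i s * J s j))"
        by (subst sum.swap) (simp add: sum_distrib_left)
      also have "\<dots> = (\<Sum>j\<in>I. if i = j then r (Some j) else 0)"
        using i by (intro sum.cong) (auto simp: left)
      finally show ?thesis using Pu[OF i] I i by simp
    qed
    then have "r None * u l = 0" using eq[OF l] by simp
    then have "r None = 0" using ul by simp
    then show False using r(1) rS by auto
  qed
  have "(\<Sum>j\<in>I. J i j * P j l) - (if i = l then 1 else 0) = 0" if il: "i \<in> I" "l \<in> I" for i l
  proof (rule ker[where u = "\<lambda>i. (\<Sum>j\<in>I. J i j * P j l) - (if i = l then 1 else 0)", OF _ il(1)])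
    fix a assume a: "a \<in> I"
    have "(\<Sum>i\<in>I. P a i * ((\<Sum>j\<in>I. J i j * P j l) - (if i = l then 1 else 0)))
        = (\<Sum>i\<in>I. \<Sum>j\<in>I. P a i * J i j * P j l) - (\<Sum>i\<in>I. if i = l then P a i else 0)"
      unfolding right_diff_distrib sum_subtractf sum_distrib_left mult.assoc
      by (intro arg_cong2[of _ _ _ _ minus] refl sum.cong) auto
    also have "(\<Sum>i\<in>I. \<Sum>j\<in>I. P a i * J i j * P j l) = (\<Sum>j\<in>I. (\<Sum>i\<in>I. P a i * J i j) * P j l)"
      by (subst sum.swap) (simp add: sum_distrib_right)
    also have "\<dots> = (\<Sum>j\<in>I. if a = j then P j l else 0)"
      using a by (intro sum.cong) (auto simp: left)
    finally show "(\<Sum>i\<in>I. P a i * ((\<Sum>j\<in>I. J i j * P j l) - (if i = l then 1 else 0))) = 0"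
      using I a il by simp
  qed
  then show ?thesis using left unfolding inv_pair_def by auto
qed

subsection \<open>Polynomials in a linear operator\<close>

definition linop :: "(ser \<Rightarrow> ser) \<Rightarrow> bool" where
  "linop D \<longleftrightarrow> (\<forall>F G. D (F + G) = D F + D G) \<and> (\<forall>c F. D (C c * F) = C c * D F)"

text \<open>Subspaces serve as moduli: with \<open>{0}\<close> a statement is exact, with the series
  of order at least \<open>d\<close> it holds up to that order. The polynomial arguments below are
  written once for both.\<close>

definition linsub :: "ser set \<Rightarrow> bool" where
  "linsub U \<longleftrightarrow> 0 \<in> U \<and> (\<forall>F\<in>U. \<forall>G\<in>U. F + G \<in> U) \<and> (\<forall>c. \<forall>F\<in>U. C c * F \<in> U)"

lemma linop_zero: "linop D \<Longrightarrow> D 0 = 0"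
  unfolding linop_def by (metis C_simps(1) mult_zero_left)
lemma linop_uminus: "linop D \<Longrightarrow> D (- F) = - D F"
  unfolding linop_def by (metis C_simps(2) C_simps(5) mult_1 mult_minus_left)
lemma linop_diff: "linop D \<Longrightarrow> D (F - G) = D F - D G"
  using linop_uminus[of D G] unfolding linop_def by (metis diff_conv_add_uminus)
lemma linop_sum: "linop D \<Longrightarrow> D (sum f A) = (\<Sum>i\<in>A. D (f i))"
  by (induction A rule: infinite_finite_induct) (auto simp: linop_zero, auto simp: linop_def)
lemma linop_funpow: "linop D \<Longrightarrow> linop (D ^^ i)"
  by (induction i) (auto simp: linop_def)

lemma linsub_zero: "linsub U \<Longrightarrow> 0 \<in> U" by (simp add: linsub_def)
lemma linsub_add: "linsub U \<Longrightarrow> F \<in> U \<Longrightarrow> G \<in> U \<Longrightarrow> F + G \<in> U" by (simp add: linsub_def)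
lemma linsub_scale: "linsub U \<Longrightarrow> F \<in> U \<Longrightarrow> C c * F \<in> U" by (simp add: linsub_def)
lemma linsub_uminus: "linsub U \<Longrightarrow> F \<in> U \<Longrightarrow> - F \<in> U"
  using linsub_scale[of U F "-1"] by simp
lemma linsub_diff: "linsub U \<Longrightarrow> F \<in> U \<Longrightarrow> G \<in> U \<Longrightarrow> F - G \<in> U"
  using linsub_add[of U F "- G"] linsub_uminus by simp
lemma linsub_sum: "linsub U \<Longrightarrow> (\<And>i. i \<in> A \<Longrightarrow> f i \<in> U) \<Longrightarrow> sum f A \<in> U"
  by (induction A rule: infinite_finite_induct) (auto simp: linsub_zero linsub_add)

lemma linsub_om [simp]: "linsub {F. om d F}"
  by (auto simp: linsub_def intro: om_add om_mult_left)
lemma linsub_on: "linsub {F. on I F}"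
  by (auto simp: linsub_def intro: on_add on_mult)
lemma linsub_0: "linsub {0}"
  by (auto simp: linsub_def)

definition papp :: "(ser \<Rightarrow> ser) \<Rightarrow> complex poly \<Rightarrow> ser \<Rightarrow> ser" where
  "papp D p F = (\<Sum>i\<le>degree p. C (coeff p i) * (D ^^ i) F)"

lemma papp_ge: "degree p \<le> N \<Longrightarrow> papp D p F = (\<Sum>i\<le>N. C (coeff p i) * (D ^^ i) F)"
  unfolding papp_def by (rule sum.mono_neutral_left) (auto simp: coeff_eq_0)

lemma papp_add: "papp D (p + q) F = papp D p F + papp D q F"
  using papp_ge[of p "max (degree p) (degree q)"] papp_ge[of q "max (degree p) (degree q)"]
    papp_ge[of "p + q" "max (degree p) (degree q)"] degree_add_le_max[of p q]
  by (simp add: algebra_simps sum.distrib)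

lemma papp_smult: "papp D (smult a p) F = C a * papp D p F"
  using papp_ge[of "smult a p" "degree p" D F] degree_smult_le[of a p]
  by (simp add: papp_def sum_distrib_left mult.assoc)

lemma papp_0 [simp]: "papp D 0 F = 0" by (simp add: papp_def)
lemma papp_1 [simp]: "papp D 1 F = F" by (simp add: papp_def)

lemma linop_papp: "linop D \<Longrightarrow> linop (papp D p)"
  unfolding linop_def papp_def
proof (intro conjI allI)
  fix F G c assume "(\<forall>F G. D (F + G) = D F + D G) \<and> (\<forall>c F. D (C c * F) = C c * D F)"
  then have "linop (D ^^ i)" for i by (intro linop_funpow) (simp add: linop_def)
  then have D: "(D ^^ i) (F + G) = (D ^^ i) F + (D ^^ i) G" "(D ^^ i) (C c * F) = C c * (D ^^ i) F" for i F G c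
    by (simp_all add: linop_def)
  show "(\<Sum>i\<le>degree p. C (coeff p i) * (D ^^ i) (F + G)) = (\<Sum>i\<le>degree p. C (coeff p i) * (D ^^ i) F) + (\<Sum>i\<le>degree p. C (coeff p i) * (D ^^ i) G)"
    by (simp add: D algebra_simps sum.distrib)
  show "(\<Sum>i\<le>degree p. C (coeff p i) * (D ^^ i) (C c * F)) = C c * (\<Sum>i\<le>degree p. C (coeff p i) * (D ^^ i) F)"
    by (simp add: D sum_distrib_left mult.left_commute)
qed

lemma papp_pCons:
  assumes D: "linop D"
  shows "papp D (pCons a p) F = C a * F + D (papp D p F)"
proof -
  have "papp D (pCons a p) F = (\<Sum>i\<le>Suc (degree p). C (coeff (pCons a p) i) * (D ^^ i) F)"
    by (rule papp_ge) (simp add: degree_pCons_le)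
  also have "\<dots> = C a * F + (\<Sum>i\<le>degree p. C (coeff p i) * D ((D ^^ i) F))"
    by (subst sum.atMost_Suc_shift) simp
  also have "(\<Sum>i\<le>degree p. C (coeff p i) * D ((D ^^ i) F)) = D (papp D p F)"
    using D by (simp add: papp_def linop_sum) (simp add: linop_def)
  finally show ?thesis .
qed

lemma papp_mult:
  assumes D: "linop D"
  shows "papp D (p * q) F = papp D p (papp D q F)"
proof (induction p)
  case (pCons a p)
  then show ?case using D by (simp add: papp_add papp_smult papp_pCons)
qed simp

definition sh :: "(ser \<Rightarrow> ser) \<Rightarrow> complex \<Rightarrow> ser \<Rightarrow> ser" where
  "sh D \<kappa> F = D F - C \<kappa> * F"

lemma linop_sh: "linop D \<Longrightarrow> linop (sh D \<kappa>)"
  by (auto simp: linop_def sh_def algebra_simps)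

lemma papp_linear: "linop D \<Longrightarrow> papp D [:- \<kappa>, 1:] F = sh D \<kappa> F"
  by (simp add: papp_pCons sh_def linop_zero)

lemma papp_linear_power:
  assumes "linop D"
  shows "papp D ([:- \<kappa>, 1:] ^ p) F = (sh D \<kappa> ^^ p) F"
  by (induction p) (simp_all add: papp_mult[OF assms] papp_linear[OF assms] del: mult_pCons_left)

lemma papp_in: "linsub U \<Longrightarrow> (\<And>F. F \<in> U \<Longrightarrow> D F \<in> U) \<Longrightarrow> F \<in> U \<Longrightarrow> papp D p F \<in> U"
proof -
  assume U: "linsub U" "\<And>F. F \<in> U \<Longrightarrow> D F \<in> U" "F \<in> U"
  have "(D ^^ i) F \<in> U" for i by (induction i) (use U in auto)
  then show ?thesis unfolding papp_def by (intro linsub_sum linsub_scale U(1)) auto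
qed

lemma sh_in: "linsub U \<Longrightarrow> (\<And>F. F \<in> U \<Longrightarrow> D F \<in> U) \<Longrightarrow> F \<in> U \<Longrightarrow> sh D \<kappa> F \<in> U"
  unfolding sh_def by (intro linsub_diff linsub_scale) auto

lemma sh_pow_in: "linsub U \<Longrightarrow> (\<And>F. F \<in> U \<Longrightarrow> D F \<in> U) \<Longrightarrow> F \<in> U \<Longrightarrow> (sh D \<kappa> ^^ p) F \<in> U"
  by (induction p) (auto intro: sh_in)

lemma sh_pow_mono:
  "linsub U \<Longrightarrow> (\<And>F. F \<in> U \<Longrightarrow> D F \<in> U) \<Longrightarrow> (sh D \<kappa> ^^ p) F \<in> U \<Longrightarrow> p \<le> q \<Longrightarrow> (sh D \<kappa> ^^ q) F \<in> U"
  using sh_pow_in[of U D "(sh D \<kappa> ^^ p) F" "q - p" \<kappa>]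
  by (metis comp_apply funpow_add le_add_diff_inverse2)

text \<open>Modulo the linear polynomial, \<open>q\<close> is the nonzero constant
  \<open>poly q \<chi>\<close>, which gives a relation for the first power. Multiplying it with the
  relation for the power \<open>k\<close> raises the exponent by one.\<close>

lemma bezout_linear_power:
  fixes q :: "complex poly"
  assumes "poly q \<chi> \<noteq> 0"
  shows "\<exists>a b. a * [:- \<chi>, 1:] ^ k + b * q = 1"
proof (induction k)
  case 0
  show ?case by (intro exI[of _ 1] exI[of _ 0]) simp
next
  case (Suc k)
  then obtain a b where ab: "a * [:- \<chi>, 1:] ^ k + b * q = 1" by blast
  have "poly (q - [:poly q \<chi>:]) \<chi> = 0" by simp
  then obtain s where s: "q - [:poly q \<chi>:] = [:- \<chi>, 1:] * s" using poly_eq_0_iff_dvd by blast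
  define t where "t = [:1 / poly q \<chi>:]"
  have t: "t * [:poly q \<chi>:] = 1" using assms by (simp add: t_def one_pCons)
  have "t * q - t * [:- \<chi>, 1:] * s = t * (q - [:- \<chi>, 1:] * s)" by (simp add: algebra_simps)
  also have "q - [:- \<chi>, 1:] * s = [:poly q \<chi>:]" using s by (metis diff_diff_eq2 diff_add_cancel add_diff_cancel_left')
  finally have 1: "t * q - t * [:- \<chi>, 1:] * s = 1" using t by simp
  define X where "X = [:- \<chi>, 1:]"
  have "1 = (a * X ^ k + b * q) * (t * q - t * X * s)" using ab 1 by (simp add: X_def)
  also have "\<dots> = (- a * t * s) * X ^ Suc k + (a * X ^ k * t + b * (t * q - t * X * s)) * q"
    by (simp add: algebra_simps)
  finally show ?case unfolding X_def by metis
qed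

text \<open>The product \<open>q\<close> of the annihilators of the \<open>w \<kappa>\<close> sends
  \<open>v\<close> into \<open>U\<close>. As \<chi> is not among its roots, it is coprime to the
  annihilating power for \<chi>, and a Bezout relation puts \<open>v\<close> itself into
  \<open>U\<close>.\<close>

lemma gen_eigen_unique:
  assumes D: "linop D" and U: "linsub U" "\<And>F. F \<in> U \<Longrightarrow> D F \<in> U"
    and K: "finite K" "\<chi> \<notin> K"
    and w: "\<And>\<kappa>. \<kappa> \<in> K \<Longrightarrow> \<exists>p. (sh D \<kappa> ^^ p) (w \<kappa>) \<in> U"
    and v: "(sh D \<chi> ^^ p) v \<in> U" and eq: "v - (\<Sum>\<kappa>\<in>K. w \<kappa>) \<in> U"
  shows "v \<in> U"
proof -
  obtain e where e: "\<And>\<kappa>. \<kappa> \<in> K \<Longrightarrow> (sh D \<kappa> ^^ e \<kappa>) (w \<kappa>) \<in> U" using w by metis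
  define q where "q = (\<Prod>\<kappa>\<in>K. [:- \<kappa>, 1:] ^ e \<kappa>)"
  have "poly q \<chi> \<noteq> 0" using K by (auto simp: q_def poly_prod)
  then obtain a b where ab: "a * [:- \<chi>, 1:] ^ p + b * q = 1" using bezout_linear_power by blast
  have "papp D q (w \<kappa>) \<in> U" if "\<kappa> \<in> K" for \<kappa>
  proof -
    have "q = (\<Prod>\<kappa>\<in>K - {\<kappa>}. [:- \<kappa>, 1:] ^ e \<kappa>) * [:- \<kappa>, 1:] ^ e \<kappa>"
      unfolding q_def using K that by (subst prod.remove[of K \<kappa>]) (auto simp: mult.commute)
    then show ?thesis using e[OF that] D U by (simp add: papp_mult papp_linear_power papp_in)
  qed
  then have "papp D q (\<Sum>\<kappa>\<in>K. w \<kappa>) \<in> U"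
    using U D by (simp add: linop_sum linop_papp linsub_sum)
  moreover have "papp D q (v - (\<Sum>\<kappa>\<in>K. w \<kappa>)) \<in> U" using eq U by (intro papp_in)
  ultimately have "papp D q (v - (\<Sum>\<kappa>\<in>K. w \<kappa>)) + papp D q (\<Sum>\<kappa>\<in>K. w \<kappa>) \<in> U"
    using U linsub_add by blast
  then have qv: "papp D q v \<in> U" using linop_papp[OF D] by (simp add: linop_diff)
  have "v = papp D (a * [:- \<chi>, 1:] ^ p + b * q) v" unfolding ab by simp
  also have "\<dots> = papp D a ((sh D \<chi> ^^ p) v) + papp D b (papp D q v)"
    by (simp add: papp_add papp_mult[OF D] papp_linear_power[OF D])
  finally have e: "v = papp D a ((sh D \<chi> ^^ p) v) + papp D b (papp D q v)" .
  show ?thesis by (subst e) (rule linsub_add[OF U(1) papp_in[OF U v] papp_in[OF U qv]])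
qed

text \<open>Modulo \<open>U\<close> the iterates of \<open>F\<close> lie in a space spanned by
  \<open>S\<close>, so \<open>card S + 1\<close> of them are linearly dependent.\<close>

lemma annihilator:
  assumes D: "linop D" and U: "linsub U" and S: "finite S"
    and W: "\<And>i. \<exists>c. (D ^^ i) F - (\<Sum>s\<in>S. C (c s) * s) \<in> U"
  shows "\<exists>p. p \<noteq> 0 \<and> papp D p F \<in> U"
proof -
  obtain c where c: "\<And>i. (D ^^ i) F - (\<Sum>s\<in>S. C (c i s) * s) \<in> U" using W by metis
  obtain r where r: "\<exists>i\<in>{..card S}. r i \<noteq> 0" "\<forall>s\<in>S. (\<Sum>i\<in>{..card S}. r i * c i s) = 0"
    using homogeneous_system[OF S, of "{..card S}" c] by auto
  define p where "p = (\<Sum>i\<le>card S. monom (r i) i)"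
  have cp: "coeff p i = (if i \<le> card S then r i else 0)" for i
    by (simp add: p_def coeff_sum if_distrib cong: if_cong)
  have nz: "p \<noteq> 0" using r(1) cp by (metis atMost_iff coeff_0)
  have "degree p \<le> card S" by (rule degree_le) (simp add: cp)
  have "papp D p F = (\<Sum>i\<le>card S. C (r i) * (D ^^ i) F)"
    unfolding papp_ge[OF \<open>degree p \<le> card S\<close>] by (intro sum.cong) (auto simp: cp)
  also have "\<dots> = (\<Sum>i\<le>card S. C (r i) * ((D ^^ i) F - (\<Sum>s\<in>S. C (c i s) * s)))
      + (\<Sum>s\<in>S. C (\<Sum>i\<le>card S. r i * c i s) * s)"
    by (simp add: algebra_simps sum.distrib sum_subtractf sum_distrib_left sum_distrib_right C_sum)
      (rule sum.swap)
  also have "(\<Sum>s\<in>S. C (\<Sum>i\<le>card S. r i * c i s) * s) = 0" using r(2) by simp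
  finally have "papp D p F \<in> U" using c U by (auto intro!: linsub_sum linsub_scale)
  then show ?thesis using nz by blast
qed

lemma annihilator_root:
  fixes p :: "complex poly"
  assumes "p \<noteq> 0"
  shows "\<exists>a r. p = [:- \<chi>, 1:] ^ a * r \<and> poly r \<chi> \<noteq> 0"
  using order_decomp[OF assms, of \<chi>] by (auto simp: poly_eq_0_iff_dvd)

text \<open>A root \<chi> of \<open>p\<close> is split off with its full multiplicity by a Bezout
  relation, and the complementary component is killed by a polynomial of smaller degree. Each
  component is a polynomial in \<open>D\<close> applied to \<open>F\<close>; hence it stays in every
  \<open>D\<close>-stable subspace containing \<open>F\<close> and is respected by operators
  commuting with \<open>D\<close>.\<close>

lemma gen_eigen_decomp:
  assumes D: "linop D" and "p \<noteq> 0" "papp D p F = 0"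
  shows "\<exists>K u. finite K \<and> F = (\<Sum>\<kappa>\<in>K. papp D (u \<kappa>) F) \<and>
    (\<forall>\<kappa>\<in>K. \<exists>e. (sh D \<kappa> ^^ e) (papp D (u \<kappa>) F) = 0)"
  using assms(2,3)
proof (induction "degree p" arbitrary: p F rule: less_induct)
  case less
  show ?case
  proof (cases "degree p = 0")
    case True
    then obtain c where c: "p = [:c:]" by (metis degree_eq_zeroE)
    then have "C c * F = 0" "c \<noteq> 0" using less by (auto simp: papp_def)
    then have "C (1 / c) * (C c * F) = 0" by simp
    then have "F = 0" using \<open>c \<noteq> 0\<close> by (simp flip: mult.assoc C_simps(6))
    then show ?thesis by (intro exI[of _ "{}"]) simp
  next
    case False
    then obtain \<chi> where \<chi>: "poly p \<chi> = 0"
      using fundamental_theorem_of_algebra constant_degree by metis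
    obtain a r where ar: "p = [:- \<chi>, 1:] ^ a * r" "poly r \<chi> \<noteq> 0"
      using annihilator_root[OF less(2), of \<chi>] by blast
    have r0: "r \<noteq> 0" using ar by auto
    have a0: "a \<noteq> 0" using ar \<chi> by (intro notI) simp
    have "degree p = degree ([:- \<chi>, 1:] ^ a) + degree r"
      unfolding ar(1) using r0 by (intro degree_mult_eq) auto
    then have deg: "degree r < degree p" using a0 by (simp add: degree_power_eq)
    obtain x y where xy: "x * [:- \<chi>, 1:] ^ a + y * r = 1" using bezout_linear_power[OF ar(2)] by blast
    define G where "G = papp D (x * [:- \<chi>, 1:] ^ a) F"
    have FG: "F = G + papp D (y * r) F"
      unfolding G_def by (simp flip: papp_add add: xy)
    have "papp D r G = papp D x (papp D p F)"
      unfolding G_def ar(1) by (simp flip: papp_mult[OF D] add: mult_ac)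
    then have "papp D r G = 0" using less(3) linop_zero[OF linop_papp[OF D]] by simp
    from less(1)[OF deg r0 this] obtain K u where Ku: "finite K" "G = (\<Sum>\<kappa>\<in>K. papp D (u \<kappa>) G)"
      "\<forall>\<kappa>\<in>K. \<exists>e. (sh D \<kappa> ^^ e) (papp D (u \<kappa>) G) = 0" by blast
    have last: "(sh D \<chi> ^^ a) (papp D (y * r) F) = 0"
    proof -
      have "(sh D \<chi> ^^ a) (papp D (y * r) F) = papp D ([:- \<chi>, 1:] ^ a * (y * r)) F"
        by (simp only: papp_mult[OF D] papp_linear_power[OF D])
      also have "[:- \<chi>, 1:] ^ a * (y * r) = y * p" unfolding ar(1) by (simp only: mult_ac)
      finally show ?thesis using less(3) linop_zero[OF linop_papp[OF D]] by (simp add: papp_mult[OF D])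
    qed
    \<comment> \<open>The induction hypothesis does not exclude that \<open>K\<close> already
      contains \<chi>; in that case both contributions are added.\<close>
    define v where "v \<kappa> = (if \<kappa> \<in> K then u \<kappa> * (x * [:- \<chi>, 1:] ^ a) else 0) + (if \<kappa> = \<chi> then y * r else 0)" for \<kappa>
    have v: "papp D (v \<kappa>) F = (if \<kappa> \<in> K then papp D (u \<kappa>) G else 0) + (if \<kappa> = \<chi> then papp D (y * r) F else 0)" for \<kappa>
      unfolding v_def papp_add by (simp add: papp_mult[OF D] G_def)
    have "(\<Sum>\<kappa>\<in>insert \<chi> K. papp D (v \<kappa>) F) = G + papp D (y * r) F"
    proof -
      have "(\<Sum>\<kappa>\<in>insert \<chi> K. if \<kappa> \<in> K then papp D (u \<kappa>) G else 0) = (\<Sum>\<kappa>\<in>K. papp D (u \<kappa>) G)"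
        using Ku(1) by (intro sum.mono_neutral_cong_right) auto
      then show ?thesis using Ku(1,2) by (simp add: v sum.distrib del: sum.insert)
    qed
    moreover have "\<exists>e. (sh D \<kappa> ^^ e) (papp D (v \<kappa>) F) = 0" if \<kappa>: "\<kappa> \<in> insert \<chi> K" for \<kappa>
    proof -
      have "\<exists>e. (sh D \<kappa> ^^ e) (if \<kappa> \<in> K then papp D (u \<kappa>) G else 0) = 0"
        using Ku(3) by (auto intro: exI[of _ 0])
      then obtain e where e: "(sh D \<kappa> ^^ e) (if \<kappa> \<in> K then papp D (u \<kappa>) G else 0) \<in> {0}" by auto
      have "\<exists>e. (sh D \<kappa> ^^ e) (if \<kappa> = \<chi> then papp D (y * r) F else 0) = 0"
        using last by (auto intro: exI[of _ 0])
      then obtain e' where e': "(sh D \<kappa> ^^ e') (if \<kappa> = \<chi> then papp D (y * r) F else 0) \<in> {0}" by auto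
      note mono = sh_pow_mono[OF linsub_0, of D]
      have "(sh D \<kappa> ^^ max e e') (papp D (v \<kappa>) F) = 0"
        unfolding v using mono[OF _ e, of "max e e'"] mono[OF _ e', of "max e e'"] linop_zero[OF D]
          linop_funpow[OF linop_sh[OF D]] by (simp add: linop_def)
      then show ?thesis by blast
    qed
    ultimately show ?thesis using FG Ku(1) by (intro exI[of _ "insert \<chi> K"] exI[of _ v]) auto
  qed
qed

subsection \<open>Generalized eigenspaces of a derivation\<close>

text \<open>Topological generalized eigenspaces: the powers of \<open>D - \<chi>\<close> applied to
  \<open>F\<close> tend to zero, with an exponent that depends on the order and need not be
  bounded.\<close>

definition geig :: "(ser \<Rightarrow> ser) \<Rightarrow> complex \<Rightarrow> ser set" where
  "geig D \<chi> = {F. \<forall>d. \<exists>p. om d ((sh D \<chi> ^^ p) F)}"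

definition filtered :: "(ser \<Rightarrow> ser) \<Rightarrow> bool" where
  "filtered D \<longleftrightarrow> linop D \<and> (\<forall>d F. om d F \<longrightarrow> om d (D F))"

lemma filtered_linop: "filtered D \<Longrightarrow> linop D" by (simp add: filtered_def)
lemma filtered_om: "filtered D \<Longrightarrow> om d F \<Longrightarrow> om d (D F)" by (simp add: filtered_def)

lemma filtered_sh_pow: "filtered D \<Longrightarrow> om d F \<Longrightarrow> om d ((sh D \<chi> ^^ p) F)"
  using sh_pow_in[of "{F. om d F}" D F p \<chi>] by (auto simp: filtered_om)

lemma filtered_papp: "filtered D \<Longrightarrow> om d F \<Longrightarrow> om d (papp D p F)"
  using papp_in[of "{F. om d F}" D F p] by (auto simp: filtered_om)

lemma filtered_sh_mono: "filtered D \<Longrightarrow> om d ((sh D \<chi> ^^ p) F) \<Longrightarrow> p \<le> q \<Longrightarrow> om d ((sh D \<chi> ^^ q) F)"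
  using sh_pow_mono[of "{F. om d F}" D p \<chi> F q] by (auto simp: filtered_om)

lemma sh_pow_lin: "linop D \<Longrightarrow> (sh D \<chi> ^^ p) (F + G) = (sh D \<chi> ^^ p) F + (sh D \<chi> ^^ p) G"
  "linop D \<Longrightarrow> (sh D \<chi> ^^ p) (F - G) = (sh D \<chi> ^^ p) F - (sh D \<chi> ^^ p) G"
  "linop D \<Longrightarrow> (sh D \<chi> ^^ p) (C c * F) = C c * (sh D \<chi> ^^ p) F"
  using linop_funpow[OF linop_sh, of D p \<chi>] by (auto simp: linop_diff linop_def)

lemma linsub_geig:
  assumes D: "filtered D" shows "linsub (geig D \<chi>)"
  unfolding linsub_def
proof (intro conjI ballI allI)
  note lin = sh_pow_lin[OF filtered_linop[OF D]]
  show "0 \<in> geig D \<chi>" by (auto simp: geig_def intro: exI[of _ 0])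
  fix F assume F: "F \<in> geig D \<chi>"
  show "C c * F \<in> geig D \<chi>" for c
    using F unfolding geig_def lin mem_Collect_eq by (meson om_mult_left)
  fix G assume G: "G \<in> geig D \<chi>"
  show "F + G \<in> geig D \<chi>"
    unfolding geig_def mem_Collect_eq
  proof
    fix d
    obtain p q where "om d ((sh D \<chi> ^^ p) F)" "om d ((sh D \<chi> ^^ q) G)" using F G geig_def by blast
    then have "om d ((sh D \<chi> ^^ max p q) F)" "om d ((sh D \<chi> ^^ max p q) G)"
      using filtered_sh_mono[OF D] by (meson max.cobounded1 max.cobounded2)+
    then show "\<exists>p. om d ((sh D \<chi> ^^ p) (F + G))" unfolding lin using om_add by blast
  qed
qed

lemma geig_closed:
  assumes D: "filtered D" and F: "\<And>d. \<exists>G\<in>geig D \<chi>. om d (F - G)"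
  shows "F \<in> geig D \<chi>"
  unfolding geig_def mem_Collect_eq
proof
  fix d
  obtain G where G: "G \<in> geig D \<chi>" "om d (F - G)" using F by blast
  then obtain p where p: "om d ((sh D \<chi> ^^ p) G)" using geig_def by blast
  have "om d ((sh D \<chi> ^^ p) (F - G) + (sh D \<chi> ^^ p) G)"
    using filtered_sh_pow[OF D G(2)] p om_add by blast
  then show "\<exists>p. om d ((sh D \<chi> ^^ p) F)"
    using sh_pow_lin(2)[OF filtered_linop[OF D], of p \<chi> F G] by (intro exI[of _ p]) simp
qed

definition deriv_op :: "(ser \<Rightarrow> ser) \<Rightarrow> bool" where
  "deriv_op D \<longleftrightarrow> filtered D \<and> (\<forall>F G. D (F * G) = D F * G + F * D G)"

lemma deriv_op_vf: "small k V \<Longrightarrow> deriv_op (vf k V)"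
  by (auto simp: deriv_op_def filtered_def linop_def om_vf)

lemma deriv_op_filtered: "deriv_op D \<Longrightarrow> filtered D" by (simp add: deriv_op_def)

lemma geig_one: assumes "deriv_op D" shows "1 \<in> geig D 0"
proof -
  have "D (1 * 1) = D 1 * 1 + 1 * D 1" using assms deriv_op_def by blast
  then have "D 1 = 0" by simp
  then have "sh D 0 1 = 0" by (simp add: sh_def)
  then have "om d ((sh D 0 ^^ 1) 1)" for d by simp
  then show ?thesis unfolding geig_def by blast
qed

text \<open>By the Leibniz rule \<open>D - (\<chi> + \<psi>)\<close> acts on the product as
  \<open>D - \<chi>\<close> on one factor plus \<open>D - \<psi>\<close> on the other; each summand
  lowers one of the two exponents.\<close>

lemma geig_mult:
  assumes D: "deriv_op D" and F: "F \<in> geig D \<chi>" and G: "G \<in> geig D \<psi>"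
  shows "F * G \<in> geig D (\<chi> + \<psi>)"
  unfolding geig_def mem_Collect_eq
proof
  fix d
  note fD = deriv_op_filtered[OF D]
  obtain p q where "om d ((sh D \<chi> ^^ p) F)" "om d ((sh D \<psi> ^^ q) G)" using F G geig_def by blast
  then show "\<exists>r. om d ((sh D (\<chi> + \<psi>) ^^ r) (F * G))"
  proof (induction "p + q" arbitrary: p q F G)
    case 0
    then show ?case by (intro exI[of _ 0]) (auto intro: om_mult_right)
  next
    case (Suc n)
    show ?case
    proof (cases "p = 0 \<or> q = 0")
      case True
      then have "om d (F * G)" using Suc.prems by (auto intro: om_mult_right om_mult_left)
      then show ?thesis by (intro exI[of _ 0]) simp
    next
      case False
      then obtain p' q' where pq: "p = Suc p'" "q = Suc q'" by (metis not0_implies_Suc)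
      have "om d ((sh D \<chi> ^^ p') (sh D \<chi> F))" "om d ((sh D \<psi> ^^ q') (sh D \<psi> G))"
        using Suc.prems pq by (simp_all add: funpow_swap1)
      with Suc.hyps(1)[of p' q] Suc.hyps(1)[of p q'] Suc.prems Suc.hyps(2) pq
      obtain r1 r2 where r: "om d ((sh D (\<chi> + \<psi>) ^^ r1) (sh D \<chi> F * G))"
        "om d ((sh D (\<chi> + \<psi>) ^^ r2) (F * sh D \<psi> G))"
        by (metis add_Suc add_Suc_right nat.inject)
      have e: "sh D (\<chi> + \<psi>) (F * G) = sh D \<chi> F * G + F * sh D \<psi> G"
        using D by (simp add: sh_def deriv_op_def algebra_simps)
      have "om d ((sh D (\<chi> + \<psi>) ^^ max r1 r2) (sh D (\<chi> + \<psi>) (F * G)))"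
        unfolding e sh_pow_lin(1)[OF filtered_linop[OF fD]]
        using r filtered_sh_mono[OF fD] by (intro om_add) (meson max.cobounded1 max.cobounded2)+
      then have "om d ((sh D (\<chi> + \<psi>) ^^ Suc (max r1 r2)) (F * G))" by (simp only: funpow_Suc_right o_apply)
      then show ?thesis by blast
    qed
  qed
qed

lemma geig_power: "deriv_op D \<Longrightarrow> F \<in> geig D \<chi> \<Longrightarrow> F ^ p \<in> geig D (of_nat p * \<chi>)"
proof (induction p)
  case (Suc p)
  then show ?case using geig_mult[of D F \<chi> "F ^ p" "of_nat p * \<chi>"] by (simp add: algebra_simps)
qed (simp add: geig_one)

lemma geig_prod: "deriv_op D \<Longrightarrow> (\<And>i. i \<in> A \<Longrightarrow> f i \<in> geig D (\<chi> i)) \<Longrightarrow> finite A \<Longrightarrow> prod f A \<in> geig D (sum \<chi> A)"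
  by (rotate_tac 2, induction A rule: finite_induct) (auto simp: geig_one geig_mult)

lemma geig_commute:
  assumes D: "filtered D" and E: "filtered E" and comm: "\<And>F. D (E F) = E (D F)" and F: "F \<in> geig D \<chi>"
  shows "E F \<in> geig D \<chi>"
proof -
  have "sh D \<chi> (E F) = E (sh D \<chi> F)" for F
    using comm E by (simp add: sh_def linop_diff filtered_linop) (simp add: filtered_def linop_def)
  then have "(sh D \<chi> ^^ p) (E F) = E ((sh D \<chi> ^^ p) F)" for p F
    by (induction p) auto
  then show ?thesis using F filtered_om[OF E] unfolding geig_def by (simp, meson)
qed

section \<open>Weights of monomials and generalized eigencoordinates\<close>

definition wt :: "nat \<Rightarrow> (nat \<Rightarrow> complex) \<Rightarrow> (nat \<Rightarrow> nat) \<Rightarrow> complex" where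
  "wt k \<mu> b = (\<Sum>i<k. of_nat (b i) * \<mu> i)"

definition wtd :: "nat \<Rightarrow> (nat \<Rightarrow> complex) \<Rightarrow> complex \<Rightarrow> ser \<Rightarrow> bool" where
  "wtd k \<mu> \<chi> F \<longleftrightarrow> (\<forall>b. coef F b \<noteq> 0 \<longrightarrow> wt k \<mu> b = \<chi>)"

lemma geig_powv: "deriv_op D \<Longrightarrow> (\<And>i. i < k \<Longrightarrow> \<Phi> i \<in> geig D (\<mu> i)) \<Longrightarrow> powv k \<Phi> b \<in> geig D (wt k \<mu> b)"
  unfolding powv_def wt_def by (intro geig_prod geig_power) auto

lemma geig_cmp:
  assumes D: "deriv_op D" and s: "small k \<Phi>" and \<Phi>: "\<And>i. i < k \<Longrightarrow> \<Phi> i \<in> geig D (\<mu> i)"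
    and F: "on {..<k} F" "wtd k \<mu> \<chi> F"
  shows "cmp k F \<Phi> \<in> geig D \<chi>"
proof (rule geig_closed[OF deriv_op_filtered[OF D]])
  fix d
  define T where "T = (\<Sum>b\<in>exps k d. C (coef F b) * xmon b)"
  have "om (Suc d) (cmp k (F - T) \<Phi>)"
    unfolding T_def by (intro om_cmp trunc_sum F) auto
  then have "om d (cmp k F \<Phi> - cmp k T \<Phi>)" using om_mono by (metis cmp_diff le_SucI order_refl)
  moreover have "C (coef F b) * powv k \<Phi> b \<in> geig D \<chi>" for b
  proof (cases "coef F b = 0")
    case True
    then show ?thesis using linsub_zero[OF linsub_geig[OF deriv_op_filtered[OF D]]] by simp
  next
    case False
    then have "wt k \<mu> b = \<chi>" using F by (simp add: wtd_def)
    then show ?thesis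
      using geig_powv[OF D, of k \<Phi> \<mu> b] \<Phi> linsub_scale[OF linsub_geig[OF deriv_op_filtered[OF D]]] by auto
  qed
  then have "cmp k T \<Phi> \<in> geig D \<chi>"
    unfolding T_def cmp_sum using s
    by (intro linsub_sum linsub_geig deriv_op_filtered D) (simp add: cmp_C_mult cmp_xmon)
  ultimately show "\<exists>G\<in>geig D \<chi>. om d (cmp k F \<Phi> - G)" by blast
qed

lift_definition filt :: "((nat \<Rightarrow> nat) \<Rightarrow> bool) \<Rightarrow> ser \<Rightarrow> ser" is "\<lambda>Q F a. if Q a then F a else 0"
  by simp

lemma coef_filt: "coef (filt Q F) a = (if Q a then coef F a else 0)"
  by (simp add: filt.rep_eq)

lemma on_filt: "on I F \<Longrightarrow> on I (filt Q F)"
  by (auto simp: on_def coef_filt)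

text \<open>The part \<open>F2\<close> of \<open>F\<close> with the wrong weights pulls back to a
  generalized eigenfunction for \<chi>, being a difference of two. Up to any order it is also a
  finite sum of generalized eigenfunctions for other eigenvalues. Uniqueness makes it vanish to
  every order, and substitution of coordinates is injective.\<close>

lemma geig_cmp_weights:
  assumes D: "deriv_op D" and c: "coords k \<Phi>" and \<Phi>: "\<And>i. i < k \<Longrightarrow> \<Phi> i \<in> geig D (\<mu> i)"
    and F: "on {..<k} F" and G: "cmp k F \<Phi> \<in> geig D \<chi>"
  shows "wtd k \<mu> \<chi> F"
proof -
  note fD = deriv_op_filtered[OF D]
  note lD = filtered_linop[OF fD]
  have s: "small k \<Phi>" using c by (simp add: coords_def)
  define F2 where "F2 = filt (\<lambda>b. wt k \<mu> b \<noteq> \<chi>) F"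
  have on2: "on {..<k} F2" unfolding F2_def by (rule on_filt) fact
  have "cmp k (F - F2) \<Phi> \<in> geig D \<chi>"
    by (rule geig_cmp[OF D s \<Phi>]) (auto simp: F F2_def wtd_def coef_filt on_diff on_filt)
  from linsub_diff[OF linsub_geig[OF fD] G this] have v: "cmp k F2 \<Phi> \<in> geig D \<chi>" by simp
  have "om d (cmp k F2 \<Phi>)" for d
  proof -
    let ?U = "{F. om d F}"
    define B where "B = {b \<in> exps k d. wt k \<mu> b \<noteq> \<chi>}"
    have finB: "finite B" unfolding B_def by (rule finite_subset[OF _ finite_exps[of "{..<k}" d]]) auto
    define T where "T = (\<Sum>b\<in>exps k d. C (coef F2 b) * xmon b)"
    define w where "w \<kappa> = (\<Sum>b\<in>{b\<in>B. wt k \<mu> b = \<kappa>}. C (coef F2 b) * powv k \<Phi> b)" for \<kappa>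
    have "cmp k T \<Phi> = (\<Sum>b\<in>exps k d. C (coef F2 b) * powv k \<Phi> b)"
      unfolding T_def cmp_sum by (rule sum.cong) (auto simp: cmp_C_mult cmp_xmon s)
    also have "\<dots> = (\<Sum>b\<in>B. C (coef F2 b) * powv k \<Phi> b)"
      by (rule sum.mono_neutral_right) (auto simp: B_def F2_def coef_filt finite_exps)
    also have "\<dots> = (\<Sum>\<kappa>\<in>wt k \<mu> ` B. w \<kappa>)"
      unfolding w_def by (rule sum.image_gen) fact
    finally have T: "cmp k T \<Phi> = (\<Sum>\<kappa>\<in>wt k \<mu> ` B. w \<kappa>)" .
    obtain p where p: "om d ((sh D \<chi> ^^ p) (cmp k F2 \<Phi>))" using v geig_def by blast
    have "cmp k F2 \<Phi> \<in> ?U"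
    proof (rule gen_eigen_unique[OF lD linsub_om, where K = "wt k \<mu> ` B" and w = w])
      show "\<exists>p. (sh D \<kappa> ^^ p) (w \<kappa>) \<in> ?U" for \<kappa>
      proof -
        have "w \<kappa> \<in> geig D \<kappa>"
          unfolding w_def using geig_powv[OF D, of k \<Phi> \<mu>] \<Phi>
          by (intro linsub_sum linsub_scale linsub_geig fD) auto
        then show ?thesis by (auto simp: geig_def)
      qed
      have "om (Suc d) (cmp k (F2 - T) \<Phi>)"
        unfolding T_def by (intro om_cmp trunc_sum on2) auto
      then have "om d (cmp k F2 \<Phi> - cmp k T \<Phi>)" using om_mono by (metis cmp_diff le_SucI order_refl)
      then show "cmp k F2 \<Phi> - (\<Sum>\<kappa>\<in>wt k \<mu> ` B. w \<kappa>) \<in> ?U" by (simp add: T)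
    qed (use p finB filtered_om[OF fD] in \<open>auto simp: B_def\<close>)
    then show ?thesis by simp
  qed
  then have "cmp k F2 \<Phi> = cmp k 0 \<Phi>" using om_all_zero by simp
  then have "F2 = 0" using cmp_inj[OF c on2] by simp
  then have "coef F2 b = 0" for b by simp
  then show ?thesis unfolding F2_def coef_filt wtd_def by metis
qed

text \<open>Up to order \<open>e + d + 1\<close> the series in finitely many variables form a
  finite-dimensional space, so a polynomial in \<open>D\<close> projects the current approximation
  onto its \<chi>-component there. The change is a polynomial in \<open>D\<close> applied to a power
  of \<open>D - \<chi>\<close> on the approximation, hence of order \<open>e + d\<close>, and the
  sequence converges. The last conclusion, approximation by polynomials in \<open>D\<close>, later
  transfers invariants of \<open>F\<close> to the limit.\<close>

lemma geig_lift:
  assumes D: "filtered D" and I: "finite I" and Don: "\<And>F. on I F \<Longrightarrow> on I (D F)"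
    and F: "on I F" and p: "om e ((sh D \<chi> ^^ p) F)"
  shows "\<exists>G. om e (G - F) \<and> G \<in> geig D \<chi> \<and> (\<forall>d. \<exists>u. om d (G - papp D u F))"
proof -
  note lD = filtered_linop[OF D]
  define P where "P d G \<longleftrightarrow> (\<exists>u. G = papp D u F) \<and> (\<exists>q. om (e + d) ((sh D \<chi> ^^ q) G))" for d G
  have "F = papp D 1 F" by simp
  then have start: "P 0 F" unfolding P_def using p by (metis add_0_right)
  have step: "\<exists>G'. P (Suc d) G' \<and> om (e + d) (G' - G)" if G: "P d G" for d G
  proof -
    obtain u q where u: "G = papp D u F" and q: "om (e + d) ((sh D \<chi> ^^ q) G)" using G P_def by blast
    have onG: "on I ((D ^^ i) G)" for i
    proof (induction i)
      case 0
      then show ?case using papp_in[OF linsub_on[of I], of D F u] Don F by (simp add: u)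
    qed (simp add: Don)
    define B where "B = {b. supp b \<subseteq> I \<and> deg b \<le> e + d}"
    have "\<exists>p. p \<noteq> 0 \<and> papp D p G \<in> {F. om (Suc (e + d)) F}"
    proof (rule annihilator[OF lD linsub_om, of "xmon ` B"])
      have inj: "inj_on xmon B"
      proof (rule inj_onI)
        fix a b assume ab: "a \<in> B" "b \<in> B" "xmon a = xmon b"
        then have "finite (supp a)" using I finite_subset B_def by blast
        then show "a = b" using ab(3) by (metis coef_xmon zero_neq_one)
      qed
      show "finite (xmon ` B)" using finite_exps[OF I] by (simp add: B_def)
      fix i
      have e: "(\<Sum>s\<in>xmon ` B. C (coef ((D ^^ i) G) (the_inv_into B xmon s)) * s)
          = (\<Sum>b\<in>B. C (coef ((D ^^ i) G) b) * xmon b)"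
        by (subst sum.reindex[OF inj]) (auto intro!: sum.cong simp: the_inv_into_f_f[OF inj])
      have "om (Suc (e + d)) ((D ^^ i) G - (\<Sum>b\<in>B. C (coef ((D ^^ i) G) b) * xmon b))"
        using trunc_sum[OF I onG, of "e + d" i] unfolding B_def .
      then show "\<exists>c. (D ^^ i) G - (\<Sum>s\<in>xmon ` B. C (c s) * s) \<in> {F. om (Suc (e + d)) F}"
        unfolding mem_Collect_eq e[symmetric] by (intro exI)
    qed
    then obtain pp where pp: "pp \<noteq> 0" "om (Suc (e + d)) (papp D pp G)" by blast
    obtain a r where ar: "pp = [:- \<chi>, 1:] ^ a * r" "poly r \<chi> \<noteq> 0" using annihilator_root[OF pp(1), of \<chi>] by blast
    obtain x y where xy: "x * [:- \<chi>, 1:] ^ q + y * r = 1" using bezout_linear_power[OF ar(2)] by blast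
    define G' where "G' = papp D (y * r) G"
    have "G = papp D (x * [:- \<chi>, 1:] ^ q) G + G'" unfolding G'_def by (simp flip: papp_add add: xy)
    moreover have "B - A = - E" if "A = E + B" for A B E :: ser using that by simp
    ultimately have "G' - G = - papp D x ((sh D \<chi> ^^ q) G)"
      unfolding papp_mult[OF lD] papp_linear_power[OF lD] by blast
    then have 1: "om (e + d) (G' - G)" using filtered_papp[OF D q] om_uminus by simp
    have "(sh D \<chi> ^^ a) G' = papp D ([:- \<chi>, 1:] ^ a * (y * r)) G"
      unfolding G'_def by (simp only: papp_mult[OF lD] papp_linear_power[OF lD])
    also have "[:- \<chi>, 1:] ^ a * (y * r) = y * pp" unfolding ar(1) by (simp only: mult_ac)
    finally have "om (e + Suc d) ((sh D \<chi> ^^ a) G')"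
      using filtered_papp[OF D pp(2)] by (simp add: papp_mult[OF lD])
    moreover have "G' = papp D (y * r * u) F" unfolding G'_def u by (simp add: papp_mult[OF lD])
    ultimately show ?thesis using 1 unfolding P_def by blast
  qed
  obtain f where f: "\<And>d. P d (f d) \<and> (d = 0 \<longrightarrow> f d = F)" and f2: "\<And>d. om (e + d) (f (Suc d) - f d)"
    using dependent_nat_choice[of "\<lambda>d G. P d G \<and> (d = 0 \<longrightarrow> G = F)" "\<lambda>d G G'. om (e + d) (G' - G)"]
      start step by (metis nat.distinct(1))
  have "om d (f (Suc d) - f d)" for d using f2 om_mono le_add2 by blast
  then obtain L where L: "\<And>d. om d (L - f d)" by (rule ser_limit) blast
  have f0: "om e (f d - f 0)" for d
  proof (induction d)
    case (Suc d)
    have "om e (f (Suc d) - f d)" using f2 om_mono le_add1 by blast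
    from om_add[OF this Suc] show ?case by simp
  qed simp
  have "om e (L - F)" using om_add[OF L f0, of e] f[of 0] by simp
  moreover have "L \<in> geig D \<chi>"
    unfolding geig_def mem_Collect_eq
  proof
    fix d
    obtain q where "om (e + d) ((sh D \<chi> ^^ q) (f d))" using f[of d] P_def by blast
    then have q: "om d ((sh D \<chi> ^^ q) (f d))" using om_mono le_add2 by blast
    from om_add[OF filtered_sh_pow[OF D L, where p = q and \<chi> = \<chi>] q] show "\<exists>q. om d ((sh D \<chi> ^^ q) L)"
      by (intro exI[of _ q]) (simp add: sh_pow_lin(2)[OF lD])
  qed
  moreover have "\<exists>u. om d (L - papp D u F)" for d
    using L[of d] f[of d] P_def by metis
  ultimately show ?thesis by blast
qed

subsection \<open>Symplectic normal form of an infinitesimal similitude\<close>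

lemma strict_ns_mono:
  fixes ns :: "nat \<Rightarrow> nat"
  assumes "\<forall>s\<in>{1..k}. ns s < (ns (s + 1) :: nat)" "1 \<le> s" "s \<le> t" "t \<le> k + 1"
  shows "ns s \<le> ns t"
  using assms(3,4)
proof (induction t rule: dec_induct)
  case (step t)
  then have "ns t < ns (t + 1)" using assms(1,2) by auto
  then show ?case using step by simp
qed simp

lemma block_index:
  fixes ns :: "nat \<Rightarrow> nat"
  assumes "ns 1 = 1" "ns (k + 1) = N + 1" "\<forall>s\<in>{1..k}. ns s < (ns (s + 1) :: nat)" "i \<in> {1..N}"
  shows "\<exists>s\<in>{1..k}. ns s \<le> i \<and> i < ns (s + 1)"
proof -
  define s where "s = (GREATEST s. s \<le> k + 1 \<and> 1 \<le> s \<and> ns s \<le> i)"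
  let ?P = "\<lambda>s. s \<le> k + 1 \<and> 1 \<le> s \<and> ns s \<le> i"
  have "?P 1" using assms by auto
  then have s: "?P s" unfolding s_def by (rule GreatestI_nat[of ?P _ "k + 1"]) auto
  have "s \<noteq> k + 1" using s assms by auto
  then have sk: "s \<in> {1..k}" using s by auto
  moreover have "i < ns (s + 1)"
  proof (rule ccontr)
    assume "\<not> i < ns (s + 1)"
    then have "?P (s + 1)" using sk by auto
    then have "s + 1 \<le> s" unfolding s_def by (rule Greatest_le_nat[of ?P _ "k + 1"]) auto
    then show False by simp
  qed
  ultimately show ?thesis using s by blast
qed

text \<open>The relation \<open>rel\<close> says that \<open>T - 1/2\<close> is infinitesimally
  symplectic; it makes \<open>T - (1 - \<kappa>)\<close> minus the adjoint of
  \<open>T - \<kappa>\<close>, so \<kappa> is paired with 1 - \<kappa>. The set \<open>S\<close>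
  serves to bound the dimension of \<open>V\<close>.\<close>

locale symp =
  fixes T :: "ser \<Rightarrow> ser" and B :: "ser \<Rightarrow> ser \<Rightarrow> complex" and V S :: "ser set"
  assumes T: "linop T"
    and B_add: "B (F + G) H = B F H + B G H"
    and B_scale: "B (C c * F) H = c * B F H"
    and B_skew: "B F G = - B G F"
    and V: "linsub V" and TV: "v \<in> V \<Longrightarrow> T v \<in> V"
    and rel: "u \<in> V \<Longrightarrow> v \<in> V \<Longrightarrow> B (T u) v + B u (T v) = B u v"
    and fin: "finite S" and span: "v \<in> V \<Longrightarrow> \<exists>c. v = (\<Sum>s\<in>S. C (c s) * s)"
begin

lemma B_add2: "B H (F + G) = B H F + B H G"
  using B_skew[of H] B_add[of F G H] by simp
lemma B_scale2: "B H (C c * F) = c * B H F"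
  using B_skew[of H] B_scale[of c F H] by simp
lemma B_zero [simp]: "B 0 H = 0" "B H 0 = 0"
  using B_scale[of 0 0 H] B_scale2[of H 0 0] by simp_all
lemma B_uminus: "B (- F) H = - B F H" "B H (- F) = - B H F"
  using B_scale[of "-1" F H] B_scale2[of H "-1" F] by simp_all
lemma B_diff: "B (F - G) H = B F H - B G H" "B H (F - G) = B H F - B H G"
  using B_add[of F "- G" H] B_add2[of H F "- G"] by (simp_all add: B_uminus)
lemma B_sum: "B (sum f A) H = (\<Sum>i\<in>A. B (f i) H)" "B H (sum f A) = (\<Sum>i\<in>A. B H (f i))"
  by (induction A rule: infinite_finite_induct) (auto simp: B_add B_add2)
lemma B_self [simp]: "B F F = 0"
  using B_skew[of F F] by simp

lemmas B_lin = B_add B_add2 B_scale B_scale2 B_uminus B_diff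

lemma N_in: "linsub U \<Longrightarrow> (\<And>u. u \<in> U \<Longrightarrow> T u \<in> U) \<Longrightarrow> v \<in> U \<Longrightarrow> (sh T \<kappa> ^^ i) v \<in> U"
  by (rule sh_pow_in)

lemma NV: "v \<in> V \<Longrightarrow> (sh T \<kappa> ^^ i) v \<in> V"
  by (rule sh_pow_in) (auto simp: V TV)

lemma B_sh: "u \<in> V \<Longrightarrow> v \<in> V \<Longrightarrow> B (sh T \<kappa> u) v = - B u (sh T (1 - \<kappa>) v)"
  using rel[of u v] by (simp add: sh_def B_lin left_diff_distrib) (simp add: algebra_simps)

lemma B_sh_pow: "u \<in> V \<Longrightarrow> v \<in> V \<Longrightarrow> B ((sh T \<kappa> ^^ i) u) v = (-1) ^ i * B u ((sh T (1 - \<kappa>) ^^ i) v)"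
proof (induction i arbitrary: u v)
  case (Suc i)
  have "B ((sh T \<kappa> ^^ Suc i) u) v = - B ((sh T \<kappa> ^^ i) u) (sh T (1 - \<kappa>) v)"
    using B_sh[of "(sh T \<kappa> ^^ i) u" v \<kappa>] NV Suc.prems by simp
  also have "\<dots> = - ((-1) ^ i * B u ((sh T (1 - \<kappa>) ^^ i) (sh T (1 - \<kappa>) v)))"
    using Suc.IH[of u "sh T (1 - \<kappa>) v"] NV[of v 1 "1 - \<kappa>"] Suc.prems by simp
  finally show ?case by (simp add: funpow_swap1)
qed simp

text \<open>Since 1 - \<kappa> differs from \<kappa>', the power of
  \<open>T - (1 - \<kappa>)\<close> is invertible on the generalized eigenvector \<open>v\<close>.
  Written as the image of that power and moved across the pairing, it annihilates
  \<open>u\<close>.\<close>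

lemma B_orth:
  assumes "u \<in> V" "v \<in> V" "(sh T \<kappa> ^^ p) u = 0" "(sh T \<kappa>' ^^ q) v = 0" "\<kappa> + \<kappa>' \<noteq> 1"
  shows "B u v = 0"
proof -
  have "poly ([:- \<kappa>', 1:] ^ q) (1 - \<kappa>) \<noteq> 0" using assms(5) by (auto simp: algebra_simps)
  then obtain a b where ab: "a * [:- (1 - \<kappa>), 1:] ^ p + b * [:- \<kappa>', 1:] ^ q = 1"
    using bezout_linear_power by blast
  have "v = papp T ([:- (1 - \<kappa>), 1:] ^ p * a + b * [:- \<kappa>', 1:] ^ q) v"
    using ab by (simp only: mult.commute[of _ a] papp_1)
  also have "\<dots> = (sh T (1 - \<kappa>) ^^ p) (papp T a v)"
    by (simp only: papp_add papp_mult[OF T] papp_linear_power[OF T] assms linop_zero[OF linop_papp[OF T]] add_0_right)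
  finally have v: "v = (sh T (1 - \<kappa>) ^^ p) (papp T a v)" .
  have "papp T a v \<in> V" using papp_in V TV assms(2) by blast
  then have "(-1) ^ p * B u ((sh T (1 - \<kappa>) ^^ p) (papp T a v)) = 0"
    using B_sh_pow[OF assms(1), of "papp T a v" p \<kappa>] assms(3) by simp
  then show ?thesis using v by simp
qed

definition good :: "ser set \<Rightarrow> bool" where
  "good U \<longleftrightarrow> linsub U \<and> U \<subseteq> V \<and> (\<forall>u\<in>U. T u \<in> U) \<and> (\<forall>u\<in>U. (\<forall>v\<in>U. B u v = 0) \<longrightarrow> u = 0)"

lemma decomp:
  assumes U: "linsub U" "\<And>u. u \<in> U \<Longrightarrow> T u \<in> U" "U \<subseteq> V" and v: "v \<in> U"
  shows "\<exists>K w. finite K \<and> v = sum w K \<and> (\<forall>\<kappa>\<in>K. w \<kappa> \<in> U \<and> (\<exists>e. (sh T \<kappa> ^^ e) (w \<kappa>) = 0))"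
proof -
  have "\<exists>c. (T ^^ i) v - (\<Sum>s\<in>S. C (c s) * s) \<in> {0}" for i
  proof -
    have "(T ^^ i) v \<in> U" by (induction i) (use U v in auto)
    then show ?thesis using span U(3) by force
  qed
  then obtain p where "p \<noteq> 0" "papp T p v \<in> {0}" using annihilator[OF T linsub_0 fin] by blast
  then obtain K u where K: "finite K" "v = (\<Sum>\<kappa>\<in>K. papp T (u \<kappa>) v)" "\<forall>\<kappa>\<in>K. \<exists>e. (sh T \<kappa> ^^ e) (papp T (u \<kappa>) v) = 0"
    using gen_eigen_decomp[OF T, of p v] by auto
  have "papp T (u \<kappa>) v \<in> U" for \<kappa> using U v by (intro papp_in)
  then show ?thesis using K by (intro exI[of _ K] exI[of _ "\<lambda>\<kappa>. papp T (u \<kappa>) v"]) auto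
qed

text \<open>The nonzero iterates of a nilpotent operator are independent: if \<open>m\<close> is the
  exact exponent and \<open>j\<close> the lowest index in a relation, applying the power
  \<open>m - 1 - j\<close> leaves only that term. So there are at most \<open>card S\<close> of
  them.\<close>

lemma nilpotency_bound:
  assumes "v \<in> V" "(sh T \<kappa> ^^ p) v = 0"
  shows "(sh T \<kappa> ^^ card S) v = 0"
proof (rule ccontr)
  assume nz: "(sh T \<kappa> ^^ card S) v \<noteq> 0"
  define m where "m = (LEAST m. (sh T \<kappa> ^^ m) v = 0)"
  have m0: "(sh T \<kappa> ^^ m) v = 0" unfolding m_def using assms(2) by (rule LeastI)
  have z: "(sh T \<kappa> ^^ (a + m)) v = 0" for a
    using m0 linop_zero[OF linop_funpow[OF linop_sh[OF T]]] by (simp add: funpow_add)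
  have cm: "card S < m"
  proof (rule ccontr)
    assume "\<not> card S < m"
    then show False using z[of "card S - m"] nz by simp
  qed
  have "\<forall>i. \<exists>c. (sh T \<kappa> ^^ i) v = (\<Sum>s\<in>S. C (c s) * s)"
    using span[OF NV[OF assms(1)]] by (intro allI)
  from choice[OF this] obtain c where c: "\<And>i. (sh T \<kappa> ^^ i) v = (\<Sum>s\<in>S. C (c i s) * s)"
    by blast
  obtain r where r: "\<exists>i\<in>{..<m}. r i \<noteq> 0" "\<forall>s\<in>S. (\<Sum>i\<in>{..<m}. r i * c i s) = 0"
    using homogeneous_system[OF fin, of "{..<m}" c] cm by auto
  have "(\<Sum>i<m. C (r i) * (sh T \<kappa> ^^ i) v) = (\<Sum>s\<in>S. C (\<Sum>i<m. r i * c i s) * s)"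
    by (simp add: c sum_distrib_left sum_distrib_right C_sum mult.assoc) (rule sum.swap)
  then have rel0: "(\<Sum>i<m. C (r i) * (sh T \<kappa> ^^ i) v) = 0" using r(2) by simp
  define j where "j = (LEAST j. j < m \<and> r j \<noteq> 0)"
  have "\<exists>j. j < m \<and> r j \<noteq> 0" using r(1) by auto
  then have j: "j < m \<and> r j \<noteq> 0" unfolding j_def by (rule LeastI_ex)
  have jl: "r i = 0" if "i < j" for i
    using not_less_Least[of i "\<lambda>j. j < m \<and> r j \<noteq> 0"] that j unfolding j_def by auto
  let ?M = "sh T \<kappa> ^^ (m - 1 - j)"
  have lM: "linop ?M" by (intro linop_funpow linop_sh T)
  have "0 = ?M (\<Sum>i<m. C (r i) * (sh T \<kappa> ^^ i) v)" using rel0 linop_zero[OF lM] by simp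
  also have "\<dots> = (\<Sum>i<m. C (r i) * (sh T \<kappa> ^^ (m - 1 - j + i)) v)"
    using lM by (simp add: linop_sum) (simp add: linop_def funpow_add)
  also have "\<dots> = (\<Sum>i<m. if i = j then C (r j) * (sh T \<kappa> ^^ (m - 1)) v else 0)"
  proof (rule sum.cong)
    fix i assume i: "i \<in> {..<m}"
    show "C (r i) * (sh T \<kappa> ^^ (m - 1 - j + i)) v = (if i = j then C (r j) * (sh T \<kappa> ^^ (m - 1)) v else 0)"
    proof (cases "i < j \<or> i = j")
      case True
      then show ?thesis using jl j by auto
    next
      case False
      then have "m - 1 - j + i = (i - j - 1) + m" using j by auto
      then have "(sh T \<kappa> ^^ (m - 1 - j + i)) v = 0" using z by (simp only:)
      then show ?thesis using False by simp
    qed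
  qed simp
  finally have "C (r j) * (sh T \<kappa> ^^ (m - 1)) v = 0" using j by simp
  then have "C (1 / r j) * (C (r j) * (sh T \<kappa> ^^ (m - 1)) v) = 0" by simp
  then have "(sh T \<kappa> ^^ (m - 1)) v = 0" using j by (simp flip: mult.assoc C_simps(6))
  moreover have "m - 1 < m" using cm by simp
  ultimately show False using not_less_Least[of "m - 1" "\<lambda>m. (sh T \<kappa> ^^ m) v = 0"] unfolding m_def by blast
qed

lemma pow_zero: "(sh T \<kappa> ^^ r) v = 0 \<Longrightarrow> r \<le> i \<Longrightarrow> (sh T \<kappa> ^^ i) v = 0"
  using sh_pow_mono[OF linsub_0, of T r \<kappa> v i] linop_zero[OF T] by auto

lemma papp_sh_commute: "(sh T \<kappa> ^^ r) (papp T p v) = papp T p ((sh T \<kappa> ^^ r) v)"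
  by (simp only: papp_linear_power[OF T, symmetric] papp_mult[OF T, symmetric] mult.commute)

text \<open>The exponent \<open>r\<close> is the exact nilpotency index of
  \<open>T - \<kappa>\<close> on its generalized eigenspace \<open>E\<close> in \<open>U\<close>,
  and \<open>v\<close> attains it. Nondegeneracy gives a partner for the end of the chain of
  \<open>v\<close>, of which only the component for 1 - \<kappa> matters. Its chain has length at
  most \<open>r\<close>, because the next iterate is orthogonal to \<open>E\<close> by adjointness
  and to the other eigenspaces by \<open>B_orth\<close>.\<close>

lemma cyclic_pair:
  assumes U: "good U" "U \<noteq> {0}"
  shows "\<exists>\<kappa> r v w. r \<ge> 1 \<and> v \<in> U \<and> w \<in> U \<and> (sh T \<kappa> ^^ r) v = 0 \<and> (sh T (1 - \<kappa>) ^^ r) w = 0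
    \<and> B ((sh T \<kappa> ^^ (r - 1)) v) w \<noteq> 0"
proof -
  have lU: "linsub U" and UV: "U \<subseteq> V" and TU: "\<And>u. u \<in> U \<Longrightarrow> T u \<in> U"
    and nd: "\<And>u. u \<in> U \<Longrightarrow> (\<And>v. v \<in> U \<Longrightarrow> B u v = 0) \<Longrightarrow> u = 0"
    using U(1) by (auto simp: good_def)
  obtain x where x: "x \<in> U" "x \<noteq> 0" using U lU linsub_zero by blast
  obtain K y where K: "finite K" "x = sum y K" "\<forall>\<kappa>\<in>K. y \<kappa> \<in> U \<and> (\<exists>e. (sh T \<kappa> ^^ e) (y \<kappa>) = 0)"
    using decomp[OF lU TU UV x(1)] by blast
  then obtain \<kappa> where k: "\<kappa> \<in> K" "y \<kappa> \<noteq> 0" using x(2) by (metis sum.neutral)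
  define E where "E = {u \<in> U. \<exists>e. (sh T \<kappa> ^^ e) u = 0}"
  have yE: "y \<kappa> \<in> E" using K k by (auto simp: E_def)
  define r where "r = (LEAST r. \<forall>u\<in>E. (sh T \<kappa> ^^ r) u = 0)"
  have ex: "\<forall>u\<in>E. (sh T \<kappa> ^^ card S) u = 0" using nilpotency_bound UV by (auto simp: E_def)
  have r: "\<forall>u\<in>E. (sh T \<kappa> ^^ r) u = 0"
    unfolding r_def by (rule LeastI[of "\<lambda>r. \<forall>u\<in>E. (sh T \<kappa> ^^ r) u = 0"]) (rule ex)
  have r1: "r \<ge> 1"
  proof (rule ccontr)
    assume "\<not> r \<ge> 1"
    then have "r = 0" by simp
    then show False using r yE k(2) by force
  qed
  then have "\<not> (\<forall>u\<in>E. (sh T \<kappa> ^^ (r - 1)) u = 0)"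
    using not_less_Least[of "r - 1" "\<lambda>r. \<forall>u\<in>E. (sh T \<kappa> ^^ r) u = 0"] unfolding r_def[symmetric] by simp
  then obtain v where v: "v \<in> E" "(sh T \<kappa> ^^ (r - 1)) v \<noteq> 0" by blast
  have vU: "v \<in> U" and vr: "(sh T \<kappa> ^^ r) v = 0" using v r by (auto simp: E_def)
  define v' where "v' = (sh T \<kappa> ^^ (r - 1)) v"
  have v'U: "v' \<in> U" unfolding v'_def using N_in[OF lU TU vU] .
  have v'1: "(sh T \<kappa> ^^ 1) v' = 0" unfolding v'_def using vr r1
    by (cases r) auto
  have "v' \<noteq> 0" using v(2) by (simp add: v'_def)
  then obtain w0 where w0: "w0 \<in> U" "B v' w0 \<noteq> 0" using nd[OF v'U] by blast
  obtain K2 z where K2: "finite K2" "w0 = sum z K2" "\<forall>\<kappa>\<in>K2. z \<kappa> \<in> U \<and> (\<exists>e. (sh T \<kappa> ^^ e) (z \<kappa>) = 0)"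
    using decomp[OF lU TU UV w0(1)] by blast
  then have "B v' w0 = (\<Sum>\<kappa>\<in>K2. B v' (z \<kappa>))" by (simp add: B_sum)
  then obtain \<kappa>' where k': "\<kappa>' \<in> K2" "B v' (z \<kappa>') \<noteq> 0" using w0(2) by (metis sum.neutral)
  define w where "w = z \<kappa>'"
  obtain q where q: "(sh T \<kappa>' ^^ q) w = 0" and wU: "w \<in> U" using K2(3) k' by (auto simp: w_def)
  have "\<kappa>' = 1 - \<kappa>"
  proof (rule ccontr)
    assume "\<kappa>' \<noteq> 1 - \<kappa>"
    then have "\<kappa> + \<kappa>' \<noteq> 1" by (metis add_diff_cancel_left')
    then show False using B_orth[of v' w 1 \<kappa> q \<kappa>'] v'U wU UV v'1 q k' by (auto simp: w_def)
  qed
  note q = q[unfolded this]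
  define w' where "w' = (sh T (1 - \<kappa>) ^^ r) w"
  have w'U: "w' \<in> U" unfolding w'_def using N_in[OF lU TU wU] .
  have w'q: "(sh T (1 - \<kappa>) ^^ q) w' = 0"
    unfolding w'_def using pow_zero[OF q, of "q + r"] by (simp add: funpow_add)
  have "w' = 0"
  proof (rule nd[OF w'U])
    fix x assume xU: "x \<in> U"
    obtain K3 z3 where K3: "finite K3" "x = sum z3 K3" "\<forall>\<kappa>\<in>K3. z3 \<kappa> \<in> U \<and> (\<exists>e. (sh T \<kappa> ^^ e) (z3 \<kappa>) = 0)"
      using decomp[OF lU TU UV xU] by blast
    have "B w' (z3 \<kappa>3) = 0" if k3: "\<kappa>3 \<in> K3" for \<kappa>3
    proof (cases "\<kappa>3 = \<kappa>")
      case True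
      then have "z3 \<kappa>3 \<in> E" using K3(3) k3 by (auto simp: E_def)
      then have "(sh T \<kappa> ^^ r) (z3 \<kappa>3) = 0" using r by blast
      then show ?thesis
        using B_sh_pow[of w "z3 \<kappa>3" r "1 - \<kappa>"] wU UV K3(3) k3 by (auto simp: w'_def)
    next
      case False
      then have "1 - \<kappa> + \<kappa>3 \<noteq> 1" by simp
      then show ?thesis using B_orth[of w' "z3 \<kappa>3" q "1 - \<kappa>" _ \<kappa>3] w'U w'q UV K3(3) k3 by blast
    qed
    then show "B w' x = 0" using K3 by (simp add: B_sum)
  qed
  then show ?thesis using r1 vU wU vr k'(2) unfolding v'_def w'_def w_def
    by (intro exI[of _ \<kappa>] exI[of _ r] exI[of _ v] exI[of _ "z \<kappa>'"]) auto
qed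

text \<open>The pairings are corrected from the top index downwards. Adding a multiple of the power
  \<open>e\<close> of \<open>T - (1 - \<kappa>)\<close> applied to \<open>w\<close> leaves all
  indices above \<open>r - 1 - e\<close> alone. Staying within polynomials in \<open>T\<close> keeps
  \<open>w\<close> in its invariant subspaces.\<close>

lemma normalize_pairing:
  assumes vV: "v \<in> V" and wV: "w \<in> V" and v: "(sh T \<kappa> ^^ r) v = 0"
    and s: "B ((sh T \<kappa> ^^ (r - 1)) v) w \<noteq> 0" and r: "r \<ge> 1"
  shows "\<exists>p. \<forall>i<r. B ((sh T \<kappa> ^^ i) v) (papp T p w) = (if i = r - 1 then c else 0)"
proof -
  have "\<exists>p. \<forall>i<r. r - 1 - m \<le> i \<longrightarrow> B ((sh T \<kappa> ^^ i) v) (papp T p w) = (if i = r - 1 then 1 else 0)" for m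
  proof (induction m)
    case 0
    have "papp T [:1 / B ((sh T \<kappa> ^^ (r - 1)) v) w:] w = C (1 / B ((sh T \<kappa> ^^ (r - 1)) v) w) * w"
      by (simp add: papp_def)
    then have "B ((sh T \<kappa> ^^ (r - 1)) v) (papp T [:1 / B ((sh T \<kappa> ^^ (r - 1)) v) w:] w) = 1"
      using s by (simp only: B_scale2) simp
    moreover have "i = r - 1" if "i < r" "r - 1 \<le> i" for i using that by simp
    ultimately show ?case by (intro exI[of _ "[:1 / B ((sh T \<kappa> ^^ (r - 1)) v) w:]"]) auto
  next
    case (Suc m)
    then obtain p where p: "\<And>i. i < r \<Longrightarrow> r - 1 - m \<le> i \<Longrightarrow> B ((sh T \<kappa> ^^ i) v) (papp T p w) = (if i = r - 1 then 1 else 0)"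
      by blast
    define w1 where "w1 = papp T p w"
    have w1V: "w1 \<in> V" unfolding w1_def using papp_in V TV wV by blast
    show ?case
    proof (cases "m < r - 1")
      case False
      then have "r - 1 - m = r - 1 - Suc m" by simp
      then show ?thesis using p by (intro exI[of _ p]) auto
    next
      case True
      define j where "j = r - 1 - Suc m"
      define e where "e = Suc m"
      have je: "j + e = r - 1" using True by (simp add: j_def e_def)
      \<comment> \<open>Moving the power \<open>e\<close> across the pairing turns the index
        \<open>j\<close> into \<open>r - 1\<close>, where the pairing is already 1; indices above
        \<open>j\<close> are pushed beyond the end of the chain of \<open>v\<close>.\<close>
      define a where "a = (-1) ^ e * B ((sh T \<kappa> ^^ j) v) w1"
      define p' where "p' = p - smult a ([:- (1 - \<kappa>), 1:] ^ e * p)"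
      have "papp T p' w = papp T (p + smult (- a) ([:- (1 - \<kappa>), 1:] ^ e * p)) w"
        unfolding p'_def by (simp only: diff_conv_add_uminus smult_minus_left)
      then have p'w: "papp T p' w = w1 + C (- a) * (sh T (1 - \<kappa>) ^^ e) w1"
        by (simp only: papp_add papp_smult papp_mult[OF T] papp_linear_power[OF T] w1_def)
      have shift: "B ((sh T \<kappa> ^^ i) v) ((sh T (1 - \<kappa>) ^^ e) w1) = (-1) ^ e * B ((sh T \<kappa> ^^ (e + i)) v) w1" for i
        using B_sh_pow[OF NV[OF vV, of i \<kappa>] w1V, of e \<kappa>]
        by (simp add: funpow_add)
      have "B ((sh T \<kappa> ^^ i) v) (papp T p' w) = (if i = r - 1 then 1 else 0)"
        if i: "i < r" "r - 1 - Suc m \<le> i" for i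
      proof (cases "i = j")
        case True
        have "B ((sh T \<kappa> ^^ (e + j)) v) w1 = 1"
          using p[of "r - 1"] je r by (simp add: w1_def add.commute)
        then have "B ((sh T \<kappa> ^^ j) v) (papp T p' w) = B ((sh T \<kappa> ^^ j) v) w1 - a * (-1) ^ e"
          unfolding p'w B_lin shift by simp
        also have "\<dots> = 0" by (simp add: a_def flip: power_mult_distrib)
        finally show ?thesis using True je by (simp add: e_def)
      next
        case False
        then have "r \<le> e + i" using i je by (simp add: j_def)
        then have "(sh T \<kappa> ^^ (e + i)) v = 0" using pow_zero[OF v] by blast
        then have "B ((sh T \<kappa> ^^ i) v) (papp T p' w) = B ((sh T \<kappa> ^^ i) v) w1"
          unfolding p'w B_lin shift by simp
        then show ?thesis using p[OF i(1)] i False by (simp add: w1_def j_def)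
      qed
      then show ?thesis by blast
    qed
  qed
  from this[of r] obtain p where p: "\<forall>i<r. B ((sh T \<kappa> ^^ i) v) (papp T p w) = (if i = r - 1 then 1 else 0)"
    by auto
  show ?thesis
    by (rule exI[of _ "smult c p"]) (use p in \<open>simp add: papp_smult B_lin\<close>)
qed

text \<open>Adding multiples of \<open>N^e u\<close> to \<open>v\<close> kills the pairings \<open>B (N^i v) v\<close>.\<close>

lemma isotropize:
  fixes v u :: ser
  defines "N \<equiv> sh T (1/2)"
  assumes vV: "v \<in> V" and uV: "u \<in> V" and v: "(N ^^ r) v = 0" and u: "(N ^^ r) u = 0"
    and s: "B ((N ^^ (r - 1)) v) u \<noteq> 0"
  shows "\<exists>p. let v' = v + papp T p (N u) in \<forall>i<r - 1. B ((N ^^ i) v') v' = 0"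
proof -
  have half: "1 - 1/2 = (1/2 :: complex)" by simp
  have lN: "linop (N ^^ i)" for i unfolding N_def by (intro linop_funpow linop_sh T)
  have Nadd: "(N ^^ i) (x + y) = (N ^^ i) x + (N ^^ i) y" "(N ^^ i) (C c * x) = C c * (N ^^ i) x" for i x y c
    using lN unfolding linop_def by auto
  have NVV: "x \<in> V \<Longrightarrow> (N ^^ i) x \<in> V" for i x unfolding N_def by (rule NV)
  have move: "B ((N ^^ i) x) y = (-1) ^ i * B x ((N ^^ i) y)" if "x \<in> V" "y \<in> V" for i x y
    using B_sh_pow[OF that, of i "1/2"] unfolding half N_def .
  have Nz: "(N ^^ r) x = 0 \<Longrightarrow> r \<le> i \<Longrightarrow> (N ^^ i) x = 0" for i x unfolding N_def by (rule pow_zero)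
  have NuV: "N u \<in> V" using NVV[OF uV, of 1] by simp
  have Nr: "(N ^^ (r - 1)) (papp T p (N u)) = 0 \<and> (N ^^ r) (papp T p (N u)) = 0" for p
  proof -
    have "(N ^^ i) (papp T p (N u)) = papp T p ((N ^^ Suc i) u)" for i
      unfolding N_def papp_sh_commute by (simp only: funpow_Suc_right o_apply)
    moreover have "(N ^^ Suc (r - 1)) u = 0" "(N ^^ Suc r) u = 0" by (rule Nz[OF u], simp)+
    ultimately show ?thesis using linop_zero[OF linop_papp[OF T]] by simp
  qed
  define s0 where "s0 = B ((N ^^ (r - 1)) v) u"
  have "\<exists>p. let v' = v + papp T p (N u) in \<forall>i<r - 1. r - 1 - m \<le> i \<longrightarrow> B ((N ^^ i) v') v' = 0" for m
  proof (induction m)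
    case 0
    show ?case by (intro exI[of _ 0]) (auto simp: Let_def)
  next
    case (Suc m)
    then obtain p where p: "\<And>i. i < r - 1 \<Longrightarrow> r - 1 - m \<le> i \<Longrightarrow>
        B ((N ^^ i) (v + papp T p (N u))) (v + papp T p (N u)) = 0"
      by (auto simp: Let_def)
    define v1 where "v1 = v + papp T p (N u)"
    have v1V: "v1 \<in> V" unfolding v1_def using V TV vV NuV by (intro linsub_add papp_in)
    have v1r: "(N ^^ r) v1 = 0" unfolding v1_def Nadd using v Nr by simp
    have v1s: "(N ^^ (r - 1)) v1 = (N ^^ (r - 1)) v" unfolding v1_def Nadd using Nr by simp
    define j where "j = r - 1 - Suc m"
    show ?case
    proof (cases "m < r - 1 \<and> odd j")
      case False
      \<comment> \<open>An even power of \<open>N\<close> crosses the pairing without a sign, so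
        skew-symmetry alone makes these values vanish. Only odd \<open>j\<close> need a
        correction.\<close>
      have "B ((N ^^ i) v1) v1 = 0" if i: "i < r - 1" "r - 1 - Suc m \<le> i" for i
      proof (cases "r - 1 - m \<le> i")
        case True
        then show ?thesis using p i by (simp add: v1_def)
      next
        case F: False
        then have "i = j" "m < r - 1" using i by (auto simp: j_def)
        then have "even i" using False by blast
        then have "B ((N ^^ i) v1) v1 = B v1 ((N ^^ i) v1)" using move[OF v1V v1V, of i] by simp
        then show ?thesis using B_skew[of v1 "(N ^^ i) v1"] by simp
      qed
      then show ?thesis unfolding v1_def by (intro exI[of _ p]) (auto simp: Let_def)
    next
      case True
      define e where "e = Suc m"
      have je: "j + e = r - 1" using True by (auto simp: j_def e_def)
      have par: "(-1) ^ e = ((-1) ^ r :: complex)"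
      proof -
        have "even (e + r)" using je True by presburger
        then show ?thesis by (simp add: minus_one_power_iff)
      qed
      \<comment> \<open>The correction changes the pairing at \<open>j\<close> by
        \<open>2 * (-1) ^ r * s0 * c\<close>: for odd \<open>j\<close> the two cross terms agree,
        and the term quadratic in \<open>u\<close> runs past the end of the chain.\<close>
      define c where "c = - B ((N ^^ j) v1) v1 / (2 * (-1) ^ r * s0)"
      define v2 where "v2 = v1 + C c * (N ^^ e) u"
      have cross1: "B ((N ^^ i) v1) ((N ^^ e) u) = (-1) ^ e * B ((N ^^ (e + i)) v1) u" for i
        using move[OF NVV[OF v1V, of i] uV, of e]
        by (simp add: funpow_add)
      have cross2: "B ((N ^^ i) ((N ^^ e) u)) v1 = B ((N ^^ (e + i)) u) v1" for i
        by (simp add: add.commute[of e i] funpow_add)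
      have cross3: "B ((N ^^ i) ((N ^^ e) u)) ((N ^^ e) u) = 0" if "j \<le> i" for i
      proof -
        have "B ((N ^^ i) ((N ^^ e) u)) ((N ^^ e) u) = B ((N ^^ (i + e)) u) ((N ^^ e) u)"
          by (simp add: funpow_add)
        also have "\<dots> = (-1) ^ (i + e) * B u ((N ^^ (i + e)) ((N ^^ e) u))"
          using uV NVV by (intro move)
        also have "(N ^^ (i + e)) ((N ^^ e) u) = (N ^^ (i + e + e)) u" by (simp add: funpow_add)
        also have "\<dots> = 0" using je that by (intro Nz[OF u]) (simp add: e_def)
        finally show ?thesis by simp
      qed
      have expand: "B ((N ^^ i) v2) v2 = B ((N ^^ i) v1) v1 + c * ((-1) ^ e * B ((N ^^ (e + i)) v1) u + B ((N ^^ (e + i)) u) v1)"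
        if "j \<le> i" for i
        unfolding v2_def Nadd B_lin cross1 cross2 cross3[OF that] by (simp add: algebra_simps)
      have "B ((N ^^ i) v2) v2 = 0" if i: "i < r - 1" "r - 1 - Suc m \<le> i" for i
      proof (cases "i = j")
        case False
        then have "r \<le> e + i" using i je by (simp add: j_def)
        then have "(N ^^ (e + i)) v1 = 0" "(N ^^ (e + i)) u = 0" using Nz v1r u by blast+
        then show ?thesis using expand[of i] p[of i] i False by (simp add: j_def v1_def)
      next
        case ij: True
        have ej: "e + j = r - 1" using je by simp
        have 1: "B ((N ^^ (r - 1)) v1) u = s0" unfolding v1s s0_def by simp
        have "B ((N ^^ (r - 1)) u) v1 = (-1) ^ (r - 1) * B u ((N ^^ (r - 1)) v1)" using uV v1V by (rule move)
        also have "\<dots> = (-1) ^ r * s0" using 1 B_skew[of u] je by (cases r) (auto simp: e_def)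
        finally have 2: "B ((N ^^ (r - 1)) u) v1 = (-1) ^ r * s0" .
        have "B ((N ^^ j) v2) v2 = B ((N ^^ j) v1) v1 + c * (2 * (-1) ^ r * s0)"
          unfolding expand[OF order_refl] ej 1 2 par by simp
        also have "\<dots> = 0" using s by (simp add: c_def s0_def)
        finally show ?thesis using ij by simp
      qed
      moreover have "v2 = v + papp T (p + smult c ([:- (1/2), 1:] ^ m)) (N u)"
      proof -
        have "(N ^^ e) u = (N ^^ m) (N u)" unfolding e_def by (simp only: funpow_Suc_right o_apply)
        then show ?thesis
          unfolding v2_def v1_def papp_add papp_smult papp_linear_power[OF T] N_def[symmetric] by (simp add: add.assoc)
      qed
      ultimately show ?thesis by (intro exI[of _ "p + smult c ([:- (1/2), 1:] ^ m)"]) (simp add: Let_def)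
    qed
  qed
  from this[of r] show ?thesis by simp
qed

text \<open>The shapes of a block of size \<open>r\<close>: the values \<open>0\<close>, \<open>1\<close>, \<open>2\<close> of \<open>\<tau>\<close> correspond to
  \<open>Q = \<Sum>x\<^sub>j\<^sub>+\<^sub>1 x\<^sub>n\<^sub>+\<^sub>j\<close>, to the single Jordan chain of length \<open>2r\<close>, and to the two chains of odd length \<open>r\<close>.\<close>

definition block :: "nat \<Rightarrow> complex \<Rightarrow> nat \<Rightarrow> (nat \<Rightarrow> ser) \<Rightarrow> (nat \<Rightarrow> ser) \<Rightarrow> bool" where
  "block \<tau> \<kappa> r e f \<longleftrightarrow> r \<ge> 1 \<and>
    (\<tau> = 0 \<and> (\<kappa> \<noteq> 1/2 \<or> r = 1) \<and>
      (\<forall>i<r. T (e i) = C \<kappa> * e i + (if i + 1 < r then e (i + 1) else 0)) \<and>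
      (\<forall>i<r. T (f i) = C (1 - \<kappa>) * f i - (if i > 0 then f (i - 1) else 0)) \<or>
     \<tau> = 1 \<and> \<kappa> = 1/2 \<and>
      (\<forall>i<r. T (e i) = C \<kappa> * e i + (if i > 0 then C 2 * e (i - 1) else 0)) \<and>
      (\<forall>i<r. T (f i) = C (1 - \<kappa>) * f i - (if i + 1 < r then C 2 * f (i + 1) else C (2 * (-1) ^ r) * e (r - 1))) \<or>
     \<tau> = 2 \<and> \<kappa> = 1/2 \<and> odd r \<and> r \<ge> 3 \<and>
      (\<forall>i<r. T (e i) = C \<kappa> * e i + (if i > 0 then C 2 * e (i - 1) else 0)) \<and>
      (\<forall>i<r. T (f i) = C (1 - \<kappa>) * f i - (if i + 1 < r then C 2 * f (i + 1) else 0)))"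

lemma block_cong:
  assumes b: "block \<tau> \<kappa> r e f"
    and e: "\<And>i. i < r \<Longrightarrow> e i = e' i" and f: "\<And>i. i < r \<Longrightarrow> f i = f' i"
  shows "block \<tau> \<kappa> r e' f'"
proof -
  have r: "r \<ge> 1" using b by (simp add: block_def)
  have s: "(if i + 1 < r then g (i + 1) else x) = (if i + 1 < r then g' (i + 1) else x)"
    "i < r \<Longrightarrow> (if i > 0 then g (i - 1) else y) = (if i > 0 then g' (i - 1) else y)"
    if "\<And>i. i < r \<Longrightarrow> g i = g' i" for i and g g' :: "nat \<Rightarrow> ser" and x y :: ser
    using that by auto
  note e1 = s(1)[of e e', OF e] s(2)[of e e', OF e] s(1)[of f f', OF f] s(2)[of f f', OF f]
    s(2)[of "\<lambda>i. C 2 * e i" "\<lambda>i. C 2 * e' i"] s(1)[of "\<lambda>i. C 2 * f i" "\<lambda>i. C 2 * f' i"]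
  have er: "e (r - 1) = e' (r - 1)" using r e by simp
  consider "\<tau> = 0" | "\<tau> = 1" | "\<tau> = 2" using b unfolding block_def by blast
  then show ?thesis
  proof cases
    case 1
    then show ?thesis using b unfolding block_def by (simp add: e1 e f)
  next
    case 2
    then show ?thesis using b er unfolding block_def by (simp add: e1 e f)
  next
    case 3
    then show ?thesis using b unfolding block_def by (simp add: e1 e f)
  qed
qed

definition nilp :: "complex \<Rightarrow> ser \<Rightarrow> bool" where
  "nilp \<kappa> v \<longleftrightarrow> (\<exists>p. (sh T \<kappa> ^^ p) v = 0)"

definition dual_family :: "nat \<Rightarrow> (nat \<Rightarrow> ser) \<Rightarrow> (nat \<Rightarrow> ser) \<Rightarrow> bool" where
  "dual_family r e f \<longleftrightarrow> (\<forall>i<r. \<forall>j<r. B (e i) (f j) = (if i = j then 1 else 0) \<and> B (e i) (e j) = 0 \<and> B (f i) (f j) = 0)"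

definition blk_in :: "ser set \<Rightarrow> nat \<Rightarrow> complex \<Rightarrow> nat \<Rightarrow> (nat \<Rightarrow> ser) \<Rightarrow> (nat \<Rightarrow> ser) \<Rightarrow> bool" where
  "blk_in U \<tau> \<kappa> r e f \<longleftrightarrow> block \<tau> \<kappa> r e f \<and> dual_family r e f \<and>
     (\<forall>i<r. e i \<in> U \<and> f i \<in> U \<and> nilp \<kappa> (e i) \<and> nilp (1 - \<kappa>) (f i))"

section \<open>Symplectic bases of the three block shapes from Jordan chains\<close>

lemma T_sh: "T v = C \<kappa> * v + sh T \<kappa> v"
  by (simp add: sh_def)

lemma sh_scale_pow: "sh T \<kappa> (C c * (sh T \<kappa> ^^ i) v) = C c * (sh T \<kappa> ^^ Suc i) v"
  using linop_sh[OF T, of \<kappa>] by (simp add: linop_def)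

lemma nilp_scale_pow: "(sh T \<kappa> ^^ r) v = 0 \<Longrightarrow> nilp \<kappa> (C c * (sh T \<kappa> ^^ i) v)"
proof -
  assume "(sh T \<kappa> ^^ r) v = 0"
  then have "(sh T \<kappa> ^^ (r + i)) v = 0" by (rule pow_zero) simp
  then have "(sh T \<kappa> ^^ r) (C c * (sh T \<kappa> ^^ i) v) = 0"
    using sh_pow_lin(3)[OF T] by (simp add: funpow_add)
  then show ?thesis unfolding nilp_def by blast
qed

lemma B_pow_pow:
  assumes "v \<in> V" "w \<in> V"
  shows "B ((sh T \<kappa> ^^ i) v) ((sh T (1 - \<kappa>) ^^ k) w) = (-1) ^ k * B ((sh T \<kappa> ^^ (i + k)) v) w"
  using B_sh_pow[OF NV[OF assms(1), of i \<kappa>] assms(2), of k \<kappa>]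
  by (simp add: funpow_add add.commute[of i])

text \<open>The basis consists of the chain of \<open>v\<close> and the reversed chain of
  \<open>w\<close>; the signs in \<open>f\<close> cancel those of moving operators across the
  pairing. Both chains are isotropic because generalized eigenspaces with 2 \<kappa> different from
  1 are, and for \<open>r = 1\<close> by skew-symmetry.\<close>

lemma block_pair:
  assumes U: "linsub U" "\<And>u. u \<in> U \<Longrightarrow> T u \<in> U" "U \<subseteq> V"
    and v: "v \<in> U" "(sh T \<kappa> ^^ r) v = 0" and w: "w \<in> U" "(sh T (1 - \<kappa>) ^^ r) w = 0" and r: "r \<ge> 1"
    and vw: "\<And>i. i < r \<Longrightarrow> B ((sh T \<kappa> ^^ i) v) w = (if i = r - 1 then 1 else 0)"
    and k: "\<kappa> \<noteq> 1/2 \<or> r = 1"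
  shows "\<exists>e f. blk_in U 0 \<kappa> r e f"
proof -
  \<comment> \<open>The factor \<open>C 1\<close> gives \<open>e\<close> the shape of
    \<open>sh_scale_pow\<close> and \<open>nilp_scale_pow\<close>.\<close>
  define e where "e i = C 1 * (sh T \<kappa> ^^ i) v" for i
  define f where "f i = C ((-1) ^ (r - 1 - i)) * (sh T (1 - \<kappa>) ^^ (r - 1 - i)) w" for i
  have VV: "v \<in> V" "w \<in> V" using U v w by auto
  have Te: "T (e i) = C \<kappa> * e i + (if i + 1 < r then e (i + 1) else 0)" if "i < r" for i
  proof -
    have "T (e i) = C \<kappa> * e i + C 1 * (sh T \<kappa> ^^ Suc i) v"
      using T_sh[of "e i" \<kappa>] unfolding e_def sh_scale_pow .
    moreover have "(sh T \<kappa> ^^ Suc i) v = 0" if "\<not> i + 1 < r"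
      by (rule pow_zero[OF v(2)]) (use that in simp)
    ultimately show ?thesis by (simp add: e_def del: funpow.simps)
  qed
  have Tf: "T (f i) = C (1 - \<kappa>) * f i - (if i > 0 then f (i - 1) else 0)" if i: "i < r" for i
  proof -
    have "T (f i) = C (1 - \<kappa>) * f i + C ((-1) ^ (r - 1 - i)) * (sh T (1 - \<kappa>) ^^ Suc (r - 1 - i)) w"
      using T_sh[of "f i" "1 - \<kappa>"] unfolding f_def sh_scale_pow .
    moreover have "C ((-1) ^ (r - 1 - i)) * (sh T (1 - \<kappa>) ^^ Suc (r - 1 - i)) w = - (if i > 0 then f (i - 1) else 0)"
    proof (cases "i = 0")
      case True
      then have "Suc (r - 1 - i) = r" using r by simp
      then show ?thesis using w(2) True by (simp del: funpow.simps)
    next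
      case False
      then have sr: "r - 1 - (i - 1) = Suc (r - 1 - i)" using i by simp
      have "f (i - 1) = - (C ((-1) ^ (r - 1 - i)) * (sh T (1 - \<kappa>) ^^ Suc (r - 1 - i)) w)"
        unfolding f_def sr by (simp del: funpow.simps)
      then show ?thesis using False by simp
    qed
    ultimately show ?thesis by simp
  qed
  have nil: "nilp \<kappa> (e i)" "nilp (1 - \<kappa>) (f i)" for i
    unfolding e_def f_def using nilp_scale_pow v w by blast+
  have inU: "e i \<in> U" "f i \<in> U" for i
    unfolding e_def f_def using U v w by (auto intro!: linsub_scale N_in simp del: C_simps)
  have ef: "B (e i) (f j) = (if i = j then 1 else 0)" if "i < r" "j < r" for i j
  proof -
    have "B (e i) (f j) = B ((sh T \<kappa> ^^ (i + (r - 1 - j))) v) w"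
      unfolding e_def f_def B_lin B_pow_pow[OF VV] by (simp flip: mult.assoc power_mult_distrib)
    also have "\<dots> = (if i = j then 1 else 0)"
    proof (cases "i + (r - 1 - j) < r")
      case True
      then show ?thesis using vw that by auto
    next
      case False
      then have "(sh T \<kappa> ^^ (i + (r - 1 - j))) v = 0" by (intro pow_zero[OF v(2)]) simp
      then show ?thesis using False that by auto
    qed
    finally show ?thesis .
  qed
  have iso: "B (e i) (e j) = 0 \<and> B (f i) (f j) = 0" if ij: "i < r" "j < r" for i j
  proof (cases "r = 1")
    case True
    then show ?thesis using ij by simp
  next
    case False
    then have k2: "\<kappa> + \<kappa> \<noteq> 1" "1 - \<kappa> + (1 - \<kappa>) \<noteq> 1" using k by (auto simp: algebra_simps)
    obtain p q p' q' where "(sh T \<kappa> ^^ p) (e i) = 0" "(sh T \<kappa> ^^ q) (e j) = 0"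
      "(sh T (1 - \<kappa>) ^^ p') (f i) = 0" "(sh T (1 - \<kappa>) ^^ q') (f j) = 0"
      using nil unfolding nilp_def by meson
    then show ?thesis using B_orth k2 inU U(3) by (meson subsetD)
  qed
  have "block 0 \<kappa> r e f" unfolding block_def using r k Te Tf by auto
  then have "blk_in U 0 \<kappa> r e f" unfolding blk_in_def dual_family_def using inU nil ef iso by auto
  then show ?thesis by blast
qed

text \<open>One chain of length \<open>2 * r\<close> supplies both halves of a symplectic basis: its
  first half, scaled, is \<open>f\<close>, and its second half, reversed and scaled, is
  \<open>e\<close>. The powers of 2 produce the factor 2 in the cross terms of Q, and the step from
  one half to the other produces its square term.\<close>

lemma block_chain:
  assumes U: "linsub U" "\<And>u. u \<in> U \<Longrightarrow> T u \<in> U" "U \<subseteq> V"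
    and v: "v \<in> U" "(sh T (1/2) ^^ (2 * r)) v = 0" and r: "r \<ge> 1"
    and vv: "\<And>i. i < 2 * r \<Longrightarrow> B ((sh T (1/2) ^^ i) v) v = (if i = 2 * r - 1 then 2 ^ (2 * r - 1) else 0)"
  shows "\<exists>e f. blk_in U 1 (1/2) r e f"
proof -
  let ?N = "sh T (1/2)"
  define e where "e i = C (1 / 2 ^ (2 * r - 1 - i)) * (?N ^^ (2 * r - 1 - i)) v" for i
  define f where "f i = C (1 / (-2) ^ i) * (?N ^^ i) v" for i
  have half: "1 - 1/2 = (1/2 :: complex)" by simp
  have vV: "v \<in> V" using U v by auto
  have pp: "B ((?N ^^ i) v) ((?N ^^ k) v) = (if i + k = 2 * r - 1 then (-1) ^ k * 2 ^ (2 * r - 1) else 0)" for i k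
  proof (cases "i + k < 2 * r")
    case True
    then show ?thesis using B_pow_pow[OF vV vV, of i "1/2" k] vv[OF True] unfolding half by simp
  next
    case False
    then have "(?N ^^ (i + k)) v = 0" by (intro pow_zero[OF v(2)]) simp
    then show ?thesis using B_pow_pow[OF vV vV, of i "1/2" k] False r unfolding half by auto
  qed
  have ef: "B (e i) (f j) = (if i = j then 1 else 0)" if ij: "i < r" "j < r" for i j
  proof (cases "i = j")
    case True
    have "(2::complex) ^ (2 * r - 1) = 2 ^ (2 * r - 1 - j) * 2 ^ j" using ij by (simp flip: power_add)
    moreover have "(-2 :: complex) ^ j = (-1) ^ j * 2 ^ j" by (metis mult_minus1 power_mult_distrib)
    ultimately show ?thesis using True ij unfolding e_def f_def B_lin pp by simp
  next
    case False
    then have "2 * r - 1 - i + j \<noteq> 2 * r - 1" using ij by linarith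
    then show ?thesis using False unfolding e_def f_def B_lin pp by simp
  qed
  have iso: "B (e i) (e j) = 0 \<and> B (f i) (f j) = 0" if ij: "i < r" "j < r" for i j
    using ij unfolding e_def f_def B_lin pp by auto
  have Te: "T (e i) = C (1/2) * e i + (if i > 0 then C 2 * e (i - 1) else 0)" if i: "i < r" for i
  proof -
    have "T (e i) = C (1/2) * e i + C (1 / 2 ^ (2 * r - 1 - i)) * (?N ^^ Suc (2 * r - 1 - i)) v"
      using T_sh[of "e i" "1/2"] unfolding e_def sh_scale_pow .
    moreover have "C (1 / 2 ^ (2 * r - 1 - i)) * (?N ^^ Suc (2 * r - 1 - i)) v = (if i > 0 then C 2 * e (i - 1) else 0)"
    proof (cases "i = 0")
      case True
      then have "Suc (2 * r - 1 - i) = 2 * r" using r by simp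
      then show ?thesis using v(2) True by (simp del: funpow.simps)
    next
      case False
      then have s: "2 * r - 1 - (i - 1) = Suc (2 * r - 1 - i)" using i by simp
      have "C 2 * e (i - 1) = C (2 * (1 / 2 ^ Suc (2 * r - 1 - i))) * (?N ^^ Suc (2 * r - 1 - i)) v"
        unfolding e_def s by (simp only: C_simps mult.assoc)
      also have "2 * (1 / 2 ^ Suc (2 * r - 1 - i)) = (1 / 2 ^ (2 * r - 1 - i) :: complex)" by simp
      finally show ?thesis using False by simp
    qed
    ultimately show ?thesis by simp
  qed
  have Tf: "T (f i) = C (1 - 1/2) * f i - (if i + 1 < r then C 2 * f (i + 1) else C (2 * (-1) ^ r) * e (r - 1))"
    if i: "i < r" for i
  proof -
    have "T (f i) = C (1/2) * f i + C (1 / (-2) ^ i) * (?N ^^ Suc i) v"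
      using T_sh[of "f i" "1/2"] unfolding f_def sh_scale_pow .
    moreover have "C (1 / (-2) ^ i) * (?N ^^ Suc i) v = - (if i + 1 < r then C 2 * f (i + 1) else C (2 * (-1) ^ r) * e (r - 1))"
    proof (cases "i + 1 < r")
      case True
      have "C 2 * f (i + 1) = C (2 * (1 / (-2) ^ Suc i)) * (?N ^^ Suc i) v"
        unfolding f_def by (simp only: C_simps mult.assoc Suc_eq_plus1)
      also have "2 * (1 / (-2) ^ Suc i) = - (1 / (-2) ^ i :: complex)" by simp
      finally show ?thesis using True by (simp del: funpow.simps)
    next
      case False
      then have ir: "Suc i = r" using i by simp
      have s: "2 * r - 1 - (r - 1) = r" using r by simp
      have "C (2 * (-1) ^ r) * e (r - 1) = C (2 * (-1) ^ r * (1 / 2 ^ r)) * (?N ^^ r) v"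
        unfolding e_def s by (simp only: C_simps mult.assoc)
      also have "2 * (-1) ^ r * (1 / 2 ^ r) = - (1 / (-2) ^ i :: complex)"
      proof -
        have "(-2 :: complex) ^ i = (-1) ^ i * 2 ^ i" by (metis mult_minus1 power_mult_distrib)
        then show ?thesis unfolding ir[symmetric] by (cases "even i") (auto simp: field_simps)
      qed
      finally show ?thesis using False unfolding ir by simp
    qed
    ultimately show ?thesis by (simp del: funpow.simps)
  qed
  have nil: "nilp (1/2) (e i)" "nilp (1 - 1/2) (f i)" for i
    unfolding e_def f_def half using nilp_scale_pow v by blast+
  have inU: "e i \<in> U" "f i \<in> U" for i
    unfolding e_def f_def using U v by (auto intro!: linsub_scale N_in)
  have "block 1 (1/2) r e f" unfolding block_def using r Te Tf by auto
  then have "blk_in U 1 (1/2) r e f" unfolding blk_in_def dual_family_def using inU nil ef iso by auto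
  then show ?thesis by blast
qed

text \<open>The scaling is that of the single chain, but \<open>e\<close> and \<open>f\<close> come
  from two chains. Nothing leads from the end of one to the other, so Q has no square term; isotropy
  of each chain has to be assumed.\<close>

lemma block_two_chains:
  assumes U: "linsub U" "\<And>u. u \<in> U \<Longrightarrow> T u \<in> U" "U \<subseteq> V"
    and v: "v \<in> U" "(sh T (1/2) ^^ r) v = 0" and w: "w \<in> U" "(sh T (1/2) ^^ r) w = 0" and r: "r \<ge> 3" "odd r"
    and vw: "\<And>i. i < r \<Longrightarrow> B ((sh T (1/2) ^^ i) v) w = (if i = r - 1 then 2 ^ (r - 1) else 0)"
    and vv: "\<And>i. i < r \<Longrightarrow> B ((sh T (1/2) ^^ i) v) v = 0"
    and ww: "\<And>i. i < r \<Longrightarrow> B ((sh T (1/2) ^^ i) w) w = 0"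
  shows "\<exists>e f. blk_in U 2 (1/2) r e f"
proof -
  let ?N = "sh T (1/2)"
  define e where "e i = C (1 / 2 ^ (r - 1 - i)) * (?N ^^ (r - 1 - i)) v" for i
  define f where "f i = C (1 / (-2) ^ i) * (?N ^^ i) w" for i
  have half: "1 - 1/2 = (1/2 :: complex)" by simp
  have VV: "v \<in> V" "w \<in> V" using U v w by auto
  have pw: "B ((?N ^^ i) v) ((?N ^^ k) w) = (if i + k = r - 1 then (-1) ^ k * 2 ^ (r - 1) else 0)" for i k
  proof (cases "i + k < r")
    case True
    then show ?thesis using B_pow_pow[OF VV, of i "1/2" k] vw[OF True] unfolding half by simp
  next
    case False
    then have "(?N ^^ (i + k)) v = 0" by (intro pow_zero[OF v(2)]) simp
    then show ?thesis using B_pow_pow[OF VV, of i "1/2" k] False r unfolding half by auto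
  qed
  have p0: "B ((?N ^^ i) x) ((?N ^^ k) x) = 0"
    if "x \<in> V" "(?N ^^ r) x = 0" "\<And>i. i < r \<Longrightarrow> B ((?N ^^ i) x) x = 0" for i k x
  proof (cases "i + k < r")
    case True
    then show ?thesis using B_pow_pow[OF that(1,1), of i "1/2" k] that(3)[OF True] unfolding half by simp
  next
    case False
    then have "(?N ^^ (i + k)) x = 0" by (intro pow_zero[OF that(2)]) simp
    then show ?thesis using B_pow_pow[OF that(1,1), of i "1/2" k] False unfolding half by simp
  qed
  have ef: "B (e i) (f j) = (if i = j then 1 else 0)" if ij: "i < r" "j < r" for i j
  proof (cases "i = j")
    case True
    have "(2::complex) ^ (r - 1) = 2 ^ (r - 1 - j) * 2 ^ j" using ij by (simp flip: power_add)
    moreover have "(-2 :: complex) ^ j = (-1) ^ j * 2 ^ j" by (metis mult_minus1 power_mult_distrib)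
    ultimately show ?thesis using True ij unfolding e_def f_def B_lin pw by simp
  next
    case False
    then have "r - 1 - i + j \<noteq> r - 1" using ij by linarith
    then show ?thesis using False unfolding e_def f_def B_lin pw by simp
  qed
  have iso: "B (e i) (e j) = 0 \<and> B (f i) (f j) = 0" for i j
    using p0[OF VV(1) v(2) vv] p0[OF VV(2) w(2) ww] unfolding e_def f_def B_lin by simp
  have Te: "T (e i) = C (1/2) * e i + (if i > 0 then C 2 * e (i - 1) else 0)" if i: "i < r" for i
  proof -
    have "T (e i) = C (1/2) * e i + C (1 / 2 ^ (r - 1 - i)) * (?N ^^ Suc (r - 1 - i)) v"
      using T_sh[of "e i" "1/2"] unfolding e_def sh_scale_pow .
    moreover have "C (1 / 2 ^ (r - 1 - i)) * (?N ^^ Suc (r - 1 - i)) v = (if i > 0 then C 2 * e (i - 1) else 0)"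
    proof (cases "i = 0")
      case True
      then have "Suc (r - 1 - i) = r" using r by simp
      then show ?thesis using v(2) True by (simp del: funpow.simps)
    next
      case False
      then have s: "r - 1 - (i - 1) = Suc (r - 1 - i)" using i by simp
      have "C 2 * e (i - 1) = C (2 * (1 / 2 ^ Suc (r - 1 - i))) * (?N ^^ Suc (r - 1 - i)) v"
        unfolding e_def s by (simp only: C_simps mult.assoc)
      also have "2 * (1 / 2 ^ Suc (r - 1 - i)) = (1 / 2 ^ (r - 1 - i) :: complex)" by simp
      finally show ?thesis using False by simp
    qed
    ultimately show ?thesis by simp
  qed
  have Tf: "T (f i) = C (1 - 1/2) * f i - (if i + 1 < r then C 2 * f (i + 1) else 0)"
    if i: "i < r" for i
  proof -
    have "T (f i) = C (1/2) * f i + C (1 / (-2) ^ i) * (?N ^^ Suc i) w"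
      using T_sh[of "f i" "1/2"] unfolding f_def sh_scale_pow .
    moreover have "C (1 / (-2) ^ i) * (?N ^^ Suc i) w = - (if i + 1 < r then C 2 * f (i + 1) else 0)"
    proof (cases "i + 1 < r")
      case True
      have "C 2 * f (i + 1) = C (2 * (1 / (-2) ^ Suc i)) * (?N ^^ Suc i) w"
        unfolding f_def by (simp only: C_simps mult.assoc Suc_eq_plus1)
      also have "2 * (1 / (-2) ^ Suc i) = - (1 / (-2) ^ i :: complex)" by simp
      finally show ?thesis using True by (simp del: funpow.simps)
    next
      case False
      then have "Suc i = r" using i by simp
      then show ?thesis using w(2) False by (simp del: funpow.simps)
    qed
    ultimately show ?thesis by (simp del: funpow.simps)
  qed
  have nil: "nilp (1/2) (e i)" "nilp (1 - 1/2) (f i)" for i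
    unfolding e_def f_def half using nilp_scale_pow v w by blast+
  have inU: "e i \<in> U" "f i \<in> U" for i
    unfolding e_def f_def using U v w by (auto intro!: linsub_scale N_in)
  have "block 2 (1/2) r e f" unfolding block_def using r Te Tf by auto
  then have "blk_in U 2 (1/2) r e f" unfolding blk_in_def dual_family_def using inU nil ef iso by auto
  then show ?thesis by blast
qed

lemma papp_U: "linsub U \<Longrightarrow> (\<And>u. u \<in> U \<Longrightarrow> T u \<in> U) \<Longrightarrow> v \<in> U \<Longrightarrow> papp T p v \<in> U"
  by (rule papp_in)

lemma papp_nil: "(sh T \<kappa> ^^ r) v = 0 \<Longrightarrow> (sh T \<kappa> ^^ r) (papp T p v) = 0"
  by (simp add: papp_sh_commute linop_zero[OF linop_papp[OF T]])

text \<open>The correction is a polynomial in \<open>T\<close> applied to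
  \<open>(T - 1/2) u\<close>, which the power \<open>r - 1\<close> kills; so the end of the chain of
  \<open>v\<close>, and every pairing with it, is unchanged.\<close>

lemma isotropize_top:
  assumes "v \<in> V" "u \<in> V" "(sh T (1/2) ^^ r) v = 0" "(sh T (1/2) ^^ r) u = 0"
    and s: "B ((sh T (1/2) ^^ (r - 1)) v) u \<noteq> 0" and r: "r \<ge> 1"
  shows "\<exists>v' p. v' = v + papp T p (sh T (1/2) u) \<and> (sh T (1/2) ^^ r) v' = 0
    \<and> (sh T (1/2) ^^ (r - 1)) v' = (sh T (1/2) ^^ (r - 1)) v \<and> (\<forall>i<r - 1. B ((sh T (1/2) ^^ i) v') v' = 0)"
proof -
  obtain p where p: "\<forall>i<r - 1. B ((sh T (1/2) ^^ i) (v + papp T p (sh T (1/2) u))) (v + papp T p (sh T (1/2) u)) = 0"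
    using isotropize[OF assms(1-5)] by (auto simp: Let_def)
  have u1: "(sh T (1/2) ^^ (r - 1)) (sh T (1/2) u) = 0"
    using assms(4) r by (cases r) (auto simp: funpow_swap1)
  have u2: "(sh T (1/2) ^^ r) (sh T (1/2) u) = 0" by (rule pow_zero[OF u1]) simp
  show ?thesis
    using p papp_nil[OF u1, of p] papp_nil[OF u2, of p] assms(3)
    by (intro exI[of _ "v + papp T p (sh T (1/2) u)"] exI[of _ p]) (simp add: sh_pow_lin[OF T])
qed

text \<open>For the eigenvalue 1/2 put N = T - 1/2. On the kernel of N^r the bilinear form taking
  (x, y) to B(N^(r-1) x, y) is symmetric for even \<open>r\<close> and skew for odd
  \<open>r\<close>. In the even case polarization yields a vector pairing nontrivially with the end
  of its own chain, hence one chain of length \<open>r\<close>. In the odd case no such vector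
  exists and two chains are needed.\<close>

lemma exists_block:
  assumes U: "good U" "U \<noteq> {0}"
  shows "\<exists>\<tau> \<kappa> r e f. blk_in U \<tau> \<kappa> r e f"
proof -
  have lU: "linsub U" and UV: "U \<subseteq> V" and TU: "\<And>u. u \<in> U \<Longrightarrow> T u \<in> U"
    using U(1) by (auto simp: good_def)
  obtain \<kappa> r v w where r: "r \<ge> 1" and vU: "v \<in> U" and wU: "w \<in> U"
    and v: "(sh T \<kappa> ^^ r) v = 0" and w: "(sh T (1 - \<kappa>) ^^ r) w = 0"
    and s: "B ((sh T \<kappa> ^^ (r - 1)) v) w \<noteq> 0" using cyclic_pair[OF U] by blast
  have vV: "v \<in> V" and wV: "w \<in> V" using vU wU UV by auto
  show ?thesis
  proof (cases "\<kappa> \<noteq> 1/2 \<or> r = 1")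
    case True
    obtain p where "\<forall>i<r. B ((sh T \<kappa> ^^ i) v) (papp T p w) = (if i = r - 1 then 1 else 0)"
      using normalize_pairing[OF vV wV v s r] by blast
    then show ?thesis
      using block_pair[OF lU TU UV vU v papp_U[OF lU TU wU, of p] papp_nil[OF w, of p] r _ True] by blast
  next
    case False
    then have k: "\<kappa> = 1/2" and r2: "r \<noteq> 1" by auto
    have half: "1 - 1/2 = (1/2 :: complex)" by simp
    let ?N = "sh T (1/2)"
    note v = v[unfolded k] and w = w[unfolded k half] and s = s[unfolded k]
    have move: "B ((?N ^^ i) x) y = (-1) ^ i * B x ((?N ^^ i) y)" if "x \<in> V" "y \<in> V" for i x y
      using B_sh_pow[OF that, of i "1/2"] unfolding half .
    have flip: "B ((?N ^^ i) x) y = - ((-1) ^ i * B ((?N ^^ i) y) x)" if "x \<in> V" "y \<in> V" for i x y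
      using move[OF that, of i] B_skew[of x] by simp
    show ?thesis
    proof (cases "even r")
      case True
      then obtain r' where r': "r = 2 * r'" by blast
      have odd: "odd (r - 1)" using True r by simp
      have "\<exists>v\<in>U. (?N ^^ r) v = 0 \<and> B ((?N ^^ (r - 1)) v) v \<noteq> 0"
      proof (rule ccontr)
        assume "\<not> ?thesis"
        then have none: "B ((?N ^^ (r - 1)) x) x = 0" if "x \<in> U" "(?N ^^ r) x = 0" for x using that by blast
        have "(?N ^^ r) (v + w) = 0" using v w by (simp add: sh_pow_lin[OF T])
        then have "B ((?N ^^ (r - 1)) (v + w)) (v + w) = 0" using none lU vU wU linsub_add by blast
        then have "B ((?N ^^ (r - 1)) v) w + B ((?N ^^ (r - 1)) w) v = 0"
          using none[OF vU v] none[OF wU w] by (simp add: sh_pow_lin[OF T] B_lin add.commute)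
        moreover have "B ((?N ^^ (r - 1)) w) v = B ((?N ^^ (r - 1)) v) w" using flip[OF wV vV, of "r - 1"] odd by simp
        ultimately show False using s by simp
      qed
      then obtain v0 where v0: "v0 \<in> U" "(?N ^^ r) v0 = 0" "B ((?N ^^ (r - 1)) v0) v0 \<noteq> 0" by blast
      have v0V: "v0 \<in> V" using v0 UV by auto
      obtain v1 p where v1: "v1 = v0 + papp T p (?N v0)" "(?N ^^ r) v1 = 0"
        "(?N ^^ (r - 1)) v1 = (?N ^^ (r - 1)) v0" "\<forall>i<r - 1. B ((?N ^^ i) v1) v1 = 0"
        using isotropize_top[OF v0V v0V v0(2) v0(2) v0(3) r] by blast
      have Nv0: "?N v0 \<in> U" using N_in[OF lU TU v0(1), of 1] by simp
      have v1U: "v1 \<in> U" unfolding v1(1) using lU v0(1) papp_U[OF lU TU Nv0] linsub_add by blast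
      then have v1V: "v1 \<in> V" using UV by auto
      define s1 where "s1 = B ((?N ^^ (r - 1)) v1) v1"
      have "s1 = B ((?N ^^ (r - 1)) v0) v1" by (simp only: s1_def v1(3))
      also have "\<dots> = B ((?N ^^ (r - 1)) v1) v0" using flip[OF v0V v1V, of "r - 1"] odd by simp
      also have "\<dots> \<noteq> 0" using v0(3) by (simp only: v1(3) not_False_eq_True)
      finally have s1: "s1 \<noteq> 0" .
      \<comment> \<open>A complex square root normalizes the self-pairing of the chain to the value
        that \<open>block_chain\<close> expects.\<close>
      define t where "t = csqrt (2 ^ (r - 1) / s1)"
      have t: "t * t * s1 = 2 ^ (r - 1)" using s1 by (simp add: t_def flip: power2_eq_square)
      define v2 where "v2 = C t * v1"
      have v2N: "(?N ^^ i) v2 = C t * (?N ^^ i) v1" for i unfolding v2_def by (rule sh_pow_lin(3)[OF T])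
      have "\<exists>e f. blk_in U 1 (1/2) r' e f"
      proof (rule block_chain[OF lU TU UV])
        show "v2 \<in> U" unfolding v2_def using lU v1U linsub_scale by blast
        show "(?N ^^ (2 * r')) v2 = 0" unfolding v2N r'[symmetric] v1(2) by simp
        show "r' \<ge> 1" using r r' by simp
        fix i assume i: "i < 2 * r'"
        have "B ((?N ^^ i) v2) v2 = t * t * B ((?N ^^ i) v1) v1"
          unfolding v2N unfolding v2_def B_lin by simp
        also have "\<dots> = (if i = r - 1 then 2 ^ (r - 1) else 0)"
          using t v1(4) i by (auto simp: s1_def r')
        finally show "B ((?N ^^ i) v2) v2 = (if i = 2 * r' - 1 then 2 ^ (2 * r' - 1) else 0)" by (simp add: r')
      qed
      then show ?thesis by blast
    next
      case False
      then have r3: "r \<ge> 3" using r r2 by presburger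
      have ev: "even (r - 1)" using False r by simp
      have diag: "B ((?N ^^ (r - 1)) x) x = 0" if "x \<in> V" for x
        using flip[OF that that, of "r - 1"] ev by simp
      obtain v1 p where v1: "v1 = v + papp T p (?N w)" "(?N ^^ r) v1 = 0"
        "(?N ^^ (r - 1)) v1 = (?N ^^ (r - 1)) v" "\<forall>i<r - 1. B ((?N ^^ i) v1) v1 = 0"
        using isotropize_top[OF vV wV v w s r] by blast
      have NwU: "?N w \<in> U" using N_in[OF lU TU wU, of 1] by simp
      have v1U: "v1 \<in> U" unfolding v1(1) using lU vU papp_U[OF lU TU NwU] linsub_add by blast
      then have v1V: "v1 \<in> V" using UV by auto
      have v1iso: "B ((?N ^^ i) v1) v1 = 0" for i
      proof (cases "i < r - 1 \<or> i = r - 1")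
        case True
        then show ?thesis using v1(4) diag[OF v1V] by auto
      next
        case False
        then have "(?N ^^ i) v1 = 0" by (intro pow_zero[OF v1(2)]) (use r in arith)
        then show ?thesis by simp
      qed
      have s1: "B ((?N ^^ (r - 1)) v1) w \<noteq> 0" using s by (simp only: v1(3) not_False_eq_True)
      obtain q where q: "\<forall>i<r. B ((?N ^^ i) v1) (papp T q w) = (if i = r - 1 then 2 ^ (r - 1) else 0)"
        using normalize_pairing[OF v1V wV v1(2) s1 r] by blast
      define w1 where "w1 = papp T q w"
      have w1U: "w1 \<in> U" unfolding w1_def by (rule papp_U[OF lU TU wU])
      then have w1V: "w1 \<in> V" using UV by auto
      have w1: "(?N ^^ r) w1 = 0" unfolding w1_def by (rule papp_nil[OF w])
      have "B ((?N ^^ (r - 1)) w1) v1 = - (2 ^ (r - 1))"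
        using flip[OF w1V v1V, of "r - 1"] q r ev by (simp add: w1_def)
      then have s2: "B ((?N ^^ (r - 1)) w1) v1 \<noteq> 0" by simp
      obtain w2 p2 where w2: "w2 = w1 + papp T p2 (?N v1)" "(?N ^^ r) w2 = 0"
        "(?N ^^ (r - 1)) w2 = (?N ^^ (r - 1)) w1" "\<forall>i<r - 1. B ((?N ^^ i) w2) w2 = 0"
        using isotropize_top[OF w1V v1V w1 v1(2) s2 r] by blast
      have Nv1U: "?N v1 \<in> U" using N_in[OF lU TU v1U, of 1] by simp
      have w2U: "w2 \<in> U" unfolding w2(1) using lU w1U papp_U[OF lU TU Nv1U] linsub_add by blast
      then have w2V: "w2 \<in> V" using UV by auto
      \<comment> \<open>\<open>W\<close> is the orthogonal complement of the chain of
        \<open>v1\<close> and is stable under \<open>T\<close>. The vector added to make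
        \<open>w2\<close> isotropic lies in it, so the normalized pairings with \<open>v1\<close>
        are kept.\<close>
      define W where "W = {x \<in> V. \<forall>i. B ((?N ^^ i) v1) x = 0}"
      have lW: "linsub W" using V unfolding W_def linsub_def by (auto simp: B_lin)
      have TW: "T x \<in> W" if "x \<in> W" for x
      proof -
        have xV: "x \<in> V" using that W_def by blast
        have "B ((?N ^^ i) v1) (T x) = 0" for i
        proof -
          have "B ((?N ^^ i) v1) (?N x) = - B ((?N ^^ Suc i) v1) x"
            using B_sh[OF NV[OF v1V, of i "1/2"] xV, of "1/2"] unfolding half by simp
          then have "B ((?N ^^ i) v1) (?N x) = 0" using that by (simp add: W_def del: funpow.simps)
          then show ?thesis using that T_sh[of x "1/2"] by (simp add: B_lin W_def)
        qed
        then show ?thesis using TV[OF xV] by (simp add: W_def)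
      qed
      have Nv1V: "?N v1 \<in> V" using Nv1U UV by auto
      have "B ((?N ^^ i) v1) (?N v1) = 0" for i
      proof -
        have "B ((?N ^^ i) v1) (?N v1) = - B ((?N ^^ Suc i) v1) v1"
          using B_sh[OF NV[OF v1V, of i "1/2"] v1V, of "1/2"] unfolding half by simp
        then show ?thesis using v1iso by (simp del: funpow.simps)
      qed
      then have "?N v1 \<in> W" using Nv1V by (simp add: W_def)
      then have "papp T p2 (?N v1) \<in> W" using lW TW by (intro papp_in)
      then have v1w2: "B ((?N ^^ i) v1) w2 = B ((?N ^^ i) v1) w1" for i
        unfolding w2(1) by (simp add: B_lin W_def)
      have "\<exists>e f. blk_in U 2 (1/2) r e f"
      proof (rule block_two_chains[OF lU TU UV v1U v1(2) w2U w2(2) r3 False _ v1iso])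
        fix i assume i: "i < r"
        show "B ((?N ^^ i) v1) w2 = (if i = r - 1 then 2 ^ (r - 1) else 0)"
          unfolding v1w2 using q i by (simp add: w1_def)
        show "B ((?N ^^ i) w2) w2 = 0"
        proof (cases "i = r - 1")
          case True
          then show ?thesis using diag[OF w2V] by simp
        qed (use w2(4) i in auto)
      qed
      then show ?thesis by blast
    qed
  qed
qed

section \<open>Exhausting the space by blocks\<close>

definition block_system :: "nat \<Rightarrow> nat \<Rightarrow> (nat \<Rightarrow> nat) \<Rightarrow> (nat \<Rightarrow> complex) \<Rightarrow> (nat \<Rightarrow> nat) \<Rightarrow> (nat \<Rightarrow> ser) \<Rightarrow> (nat \<Rightarrow> ser) \<Rightarrow> bool" where
  "block_system N k ns lam \<tau> e f \<longleftrightarrow>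
     ns 1 = 1 \<and> ns (k + 1) = N + 1 \<and> (\<forall>s\<in>{1..k}. ns s < ns (s + 1)) \<and>
     (\<forall>s\<in>{1..k}. \<forall>i. ns s \<le> i \<and> i < ns (s + 1) \<longrightarrow> lam i = lam (ns s)) \<and>
     (\<forall>s\<in>{1..k}. block (\<tau> s) (lam (ns s)) (ns (s + 1) - ns s) (\<lambda>i. e (ns s + i)) (\<lambda>i. f (ns s + i))) \<and>
     (\<forall>i\<in>{1..N}. e i \<in> V \<and> f i \<in> V \<and> nilp (lam i) (e i) \<and> nilp (1 - lam i) (f i)) \<and>
     (\<forall>i\<in>{1..N}. \<forall>j\<in>{1..N}. B (e i) (f j) = (if i = j then 1 else 0) \<and> B (e i) (e j) = 0 \<and> B (f i) (f j) = 0)"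

lemma block_orth:
  assumes b: "block \<tau> \<kappa> r e f" and x: "\<And>j. j < r \<Longrightarrow> B x (e j) = 0" "\<And>j. j < r \<Longrightarrow> B x (f j) = 0" and i: "i < r"
  shows "B x (T (e i)) = 0" "B x (T (f i)) = 0"
proof -
  have "(i > 0 \<longrightarrow> i - 1 < r) \<and> r - 1 < r" using i by auto
  note this x(1)[OF i] x(2)[OF i]
  then show "B x (T (e i)) = 0" using b x i unfolding block_def by (auto simp: B_lin simp del: C_simps)
  show "B x (T (f i)) = 0" using b x i \<open>(i > 0 \<longrightarrow> i - 1 < r) \<and> r - 1 < r\<close>
    unfolding block_def by (auto simp: B_lin simp del: C_simps)
qed

text \<open>Pairing with the dual vectors \<open>f j\<close> shows that the \<open>e i\<close> are
  independent. The bound guarantees that a block system of maximal size exists.\<close>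

lemma block_system_bound:
  assumes b: "block_system N k ns lam \<tau> e f"
  shows "N \<le> card S"
proof (rule ccontr)
  assume "\<not> N \<le> card S"
  then have cd: "card S < card {1..N}" by simp
  have eV: "e i \<in> V" if "i \<in> {1..N}" for i using b that by (auto simp: block_system_def)
  have "\<forall>i. \<exists>c. i \<in> {1..N} \<longrightarrow> e i = (\<Sum>s\<in>S. C (c s) * s)" using span[OF eV] by blast
  from choice[OF this] obtain c where c: "\<And>i. i \<in> {1..N} \<Longrightarrow> e i = (\<Sum>s\<in>S. C (c i s) * s)" by blast
  obtain r where r: "\<exists>i\<in>{1..N}. r i \<noteq> 0" "\<forall>s\<in>S. (\<Sum>i\<in>{1..N}. r i * c i s) = 0"
    using homogeneous_system[OF fin _ cd, of c] by auto
  have "(\<Sum>i\<in>{1..N}. C (r i) * e i) = (\<Sum>i\<in>{1..N}. \<Sum>s\<in>S. C (r i * c i s) * s)"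
    by (rule sum.cong) (simp_all add: c sum_distrib_left mult.assoc)
  also have "\<dots> = (\<Sum>s\<in>S. C (\<Sum>i\<in>{1..N}. r i * c i s) * s)"
    by (subst sum.swap) (simp only: C_sum sum_distrib_right)
  also have "\<dots> = 0" using r(2) by simp
  finally have z: "(\<Sum>i\<in>{1..N}. C (r i) * e i) = 0" .
  have "r j = 0" if j: "j \<in> {1..N}" for j
  proof -
    have "0 = B (\<Sum>i\<in>{1..N}. C (r i) * e i) (f j)" using z by simp
    also have "\<dots> = (\<Sum>i\<in>{1..N}. if i = j then r i else 0)"
      unfolding B_sum B_lin using b j by (intro sum.cong) (auto simp: block_system_def)
    finally show ?thesis using j by simp
  qed
  then show False using r(1) by blast
qed

text \<open>Take a block system of maximal size, with symplectic projection \<open>pr\<close>. The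
  orthogonal complement \<open>U\<close> of its span is stable under \<open>T\<close> and
  nondegenerate; if it were not zero it would contain another block, and appending that block would
  contradict maximality.\<close>

lemma normal_form:
  assumes nd: "\<And>u. u \<in> V \<Longrightarrow> (\<And>v. v \<in> V \<Longrightarrow> B u v = 0) \<Longrightarrow> u = 0"
  shows "\<exists>N k ns lam \<tau> e f. block_system N k ns lam \<tau> e f \<and>
    (\<forall>v\<in>V. v = (\<Sum>i\<in>{1..N}. C (B v (f i)) * e i - C (B v (e i)) * f i))"
proof -
  define P where "P N \<longleftrightarrow> (\<exists>k ns lam \<tau> e f. block_system N k ns lam \<tau> e f)" for N
  have "block_system 0 0 (\<lambda>_. 1) (\<lambda>_. 0) (\<lambda>_. 0) (\<lambda>_. 0) (\<lambda>_. 0)"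
    by (simp add: block_system_def)
  then have P0: "P 0" unfolding P_def by blast
  have Pb: "N \<le> card S" if "P N" for N using that block_system_bound unfolding P_def by blast
  define N where "N = (GREATEST N. P N)"
  have "P N" unfolding N_def by (rule GreatestI_nat[of P 0 "card S", OF P0 Pb])
  then obtain k ns lam \<tau> e f where b: "block_system N k ns lam \<tau> e f" unfolding P_def by blast
  note bd = b[unfolded block_system_def]
  have ef: "B (e i) (f j) = (if i = j then 1 else 0)" "B (e i) (e j) = 0" "B (f i) (f j) = 0"
    if "i \<in> {1..N}" "j \<in> {1..N}" for i j using bd that by blast+
  have fe: "B (f i) (e j) = (if i = j then -1 else 0)" if "i \<in> {1..N}" "j \<in> {1..N}" for i j
    using ef(1)[OF that(2,1)] B_skew[of "f i"] by auto
  have eV: "e i \<in> V" "f i \<in> V" if "i \<in> {1..N}" for i using bd that by blast+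
  define pr where "pr v = (\<Sum>i\<in>{1..N}. C (B v (f i)) * e i - C (B v (e i)) * f i)" for v
  have prV: "pr v \<in> V" for v
    unfolding pr_def using eV V by (intro linsub_sum linsub_diff linsub_scale) auto
  define U where "U = {u \<in> V. \<forall>i\<in>{1..N}. B u (e i) = 0 \<and> B u (f i) = 0}"
  have Bpr: "B (pr v) (e j) = B v (e j) \<and> B (pr v) (f j) = B v (f j)" if j: "j \<in> {1..N}" for v j
  proof -
    have "B (pr v) (e j) = (\<Sum>i\<in>{1..N}. if i = j then B v (e i) else 0)"
      unfolding pr_def B_sum B_lin using j by (intro sum.cong) (auto simp: ef fe)
    moreover have "B (pr v) (f j) = (\<Sum>i\<in>{1..N}. if i = j then B v (f i) else 0)"
      unfolding pr_def B_sum B_lin using j by (intro sum.cong) (auto simp: ef fe)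
    ultimately show ?thesis using j by simp
  qed
  have dU: "v - pr v \<in> U" if "v \<in> V" for v
    using that prV V Bpr by (auto simp: U_def B_lin linsub_diff)
  have TeV: "B u (T (e i)) = 0 \<and> B u (T (f i)) = 0" if u: "u \<in> U" and i: "i \<in> {1..N}" for u i
  proof -
    have ns: "ns 1 = 1" "ns (k + 1) = N + 1" "\<forall>s\<in>{1..k}. ns s < ns (s + 1)" using bd by blast+
    obtain s where s: "s \<in> {1..k}" "ns s \<le> i" "i < ns (s + 1)" using block_index[OF ns i] by blast
    have bl: "block (\<tau> s) (lam (ns s)) (ns (s + 1) - ns s) (\<lambda>i. e (ns s + i)) (\<lambda>i. f (ns s + i))"
      using bd s(1) by blast
    have rng: "ns s + j \<in> {1..N}" if "j < ns (s + 1) - ns s" for j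
      using strict_ns_mono[OF ns(3), of 1 s] strict_ns_mono[OF ns(3), of "s + 1" "k + 1"] s ns that by auto
    have "B u (e (ns s + j)) = 0" "B u (f (ns s + j)) = 0" if "j < ns (s + 1) - ns s" for j
      using rng[OF that] u by (auto simp: U_def)
    from block_orth[OF bl this, of "i - ns s"] show ?thesis using s by simp
  qed
  have "good U"
    unfolding good_def
  proof (intro conjI ballI impI)
    show "linsub U" using V unfolding U_def linsub_def by (auto simp: B_lin)
    show "U \<subseteq> V" by (auto simp: U_def)
    show "T u \<in> U" if u: "u \<in> U" for u
    proof -
      have uV: "u \<in> V" using u U_def by blast
      have "B (T u) (e i) = 0 \<and> B (T u) (f i) = 0" if i: "i \<in> {1..N}" for i
        using rel[OF uV eV(1)[OF i]] rel[OF uV eV(2)[OF i]] TeV[OF u i] u i by (simp add: U_def)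
      then show ?thesis using TV[OF uV] by (simp add: U_def)
    qed
    show "u = 0" if u: "u \<in> U" "\<forall>v\<in>U. B u v = 0" for u
    proof (rule nd)
      show "u \<in> V" using u U_def by blast
      fix v assume v: "v \<in> V"
      have "B u (pr v) = 0" using u unfolding pr_def U_def by (simp add: B_sum B_lin)
      moreover have "B u (v - pr v) = 0" using u(2) dU[OF v] by blast
      ultimately show "B u v = 0" by (simp add: B_diff)
    qed
  qed
  have U0: "U = {0}"
  proof (rule ccontr)
    assume "U \<noteq> {0}"
    then obtain \<tau>' \<kappa> r e' f' where bk: "blk_in U \<tau>' \<kappa> r e' f'" using exists_block[OF \<open>good U\<close>] by blast
    define e2 where "e2 i = (if i \<le> N then e i else e' (i - N - 1))" for i
    define f2 where "f2 i = (if i \<le> N then f i else f' (i - N - 1))" for i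
    define lam2 where "lam2 i = (if i \<le> N then lam i else \<kappa>)" for i
    define ns2 where "ns2 = ns(k + 2 := N + r + 1)"
    define \<tau>2 where "\<tau>2 = \<tau>(k + 1 := \<tau>')"
    have ns: "ns 1 = 1" "ns (k + 1) = N + 1" "\<forall>s\<in>{1..k}. ns s < ns (s + 1)" using bd by blast+
    have r: "r \<ge> 1" using bk by (auto simp: blk_in_def block_def)
    have nsN: "ns (s + 1) \<le> N + 1" if "s \<in> {1..k}" for s
      using strict_ns_mono[OF ns(3), of "s + 1" "k + 1"] that ns(2) by auto
    have e'U: "e' i \<in> U" "f' i \<in> U" "nilp \<kappa> (e' i)" "nilp (1 - \<kappa>) (f' i)" if "i < r" for i
      using bk that by (auto simp: blk_in_def)
    have old: "block (\<tau>2 s) (lam2 (ns2 s)) (ns2 (s + 1) - ns2 s) (\<lambda>i. e2 (ns2 s + i)) (\<lambda>i. f2 (ns2 s + i))"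
      if s: "s \<in> {1..k}" for s
    proof -
      have bl: "block (\<tau> s) (lam (ns s)) (ns (s + 1) - ns s) (\<lambda>i. e (ns s + i)) (\<lambda>i. f (ns s + i))"
        using bd s by blast
      have lt: "ns s < ns (s + 1)" "ns (s + 1) \<le> N + 1" using ns(3) s nsN by blast+
      have ns2: "ns2 s = ns s" "ns2 (s + 1) = ns (s + 1)" "\<tau>2 s = \<tau> s" using s by (auto simp: ns2_def \<tau>2_def)
      have "e2 (ns s + i) = e (ns s + i) \<and> f2 (ns s + i) = f (ns s + i)" if "i < ns (s + 1) - ns s" for i
        using that lt by (auto simp: e2_def f2_def)
      moreover have "lam2 (ns s) = lam (ns s)" using lt by (simp add: lam2_def)
      ultimately show ?thesis unfolding ns2 by (metis (no_types, lifting) block_cong[OF bl])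
    qed
    have new: "block \<tau>' \<kappa> r (\<lambda>i. e2 (N + 1 + i)) (\<lambda>i. f2 (N + 1 + i))"
      using bk by (simp add: blk_in_def e2_def f2_def)
    have "block_system (N + r) (k + 1) ns2 lam2 \<tau>2 e2 f2"
      unfolding block_system_def
    proof (intro conjI)
      show "ns2 1 = 1" using ns by (simp add: ns2_def)
      show "ns2 (k + 1 + 1) = N + r + 1" by (simp add: ns2_def)
      show "\<forall>s\<in>{1..k + 1}. ns2 s < ns2 (s + 1)"
      proof
        fix s assume "s \<in> {1..k + 1}"
        then consider "s \<in> {1..k}" | "s = k + 1" by force
        then show "ns2 s < ns2 (s + 1)" using ns r by cases (auto simp: ns2_def)
      qed
      show "\<forall>s\<in>{1..k + 1}. \<forall>i. ns2 s \<le> i \<and> i < ns2 (s + 1) \<longrightarrow> lam2 i = lam2 (ns2 s)"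
      proof (intro ballI allI impI)
        fix s i assume "s \<in> {1..k + 1}" and i: "ns2 s \<le> i \<and> i < ns2 (s + 1)"
        then consider "s \<in> {1..k}" | "s = k + 1" by force
        then show "lam2 i = lam2 (ns2 s)"
        proof cases
          case 1
          then have "ns2 s = ns s" "ns2 (s + 1) = ns (s + 1)" by (auto simp: ns2_def)
          moreover have "lam i = lam (ns s)" using bd 1 i calculation by metis
          ultimately show ?thesis using nsN[OF 1] i by (auto simp: lam2_def)
        next
          case 2
          then show ?thesis using i ns by (auto simp: lam2_def ns2_def)
        qed
      qed
      show "\<forall>s\<in>{1..k + 1}. block (\<tau>2 s) (lam2 (ns2 s)) (ns2 (s + 1) - ns2 s) (\<lambda>i. e2 (ns2 s + i)) (\<lambda>i. f2 (ns2 s + i))"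
      proof
        fix s assume "s \<in> {1..k + 1}"
        then consider "s \<in> {1..k}" | "s = k + 1" by force
        then show "block (\<tau>2 s) (lam2 (ns2 s)) (ns2 (s + 1) - ns2 s) (\<lambda>i. e2 (ns2 s + i)) (\<lambda>i. f2 (ns2 s + i))"
        proof cases
          case 2
          have "ns2 (k + 1) = N + 1" "ns2 (k + 1 + 1) - (N + 1) = r" "lam2 (N + 1) = \<kappa>" "\<tau>2 (k + 1) = \<tau>'"
            using ns by (auto simp: ns2_def lam2_def \<tau>2_def)
          then show ?thesis using new unfolding 2 by (simp only:)
        qed (rule old)
      qed
      have inr: "i - N - 1 < r" if "i \<in> {1..N + r}" "\<not> i \<le> N" for i using that by auto
      show "\<forall>i\<in>{1..N + r}. e2 i \<in> V \<and> f2 i \<in> V \<and> nilp (lam2 i) (e2 i) \<and> nilp (1 - lam2 i) (f2 i)"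
      proof
        fix i assume i: "i \<in> {1..N + r}"
        show "e2 i \<in> V \<and> f2 i \<in> V \<and> nilp (lam2 i) (e2 i) \<and> nilp (1 - lam2 i) (f2 i)"
        proof (cases "i \<le> N")
          case True
          then show ?thesis using bd i by (simp add: e2_def f2_def lam2_def)
        next
          case False
          then show ?thesis using e'U[OF inr[OF i False]] by (simp add: e2_def f2_def lam2_def U_def)
        qed
      qed
      have cross: "B (e' i) (e j) = 0" "B (e' i) (f j) = 0" "B (f' i) (e j) = 0" "B (f' i) (f j) = 0"
        "B (e j) (e' i) = 0" "B (f j) (e' i) = 0" "B (e j) (f' i) = 0" "B (f j) (f' i) = 0"
        if "i < r" "j \<in> {1..N}" for i j
        using e'U[OF that(1)] that(2) B_skew[of "e j"] B_skew[of "f j"] by (auto simp: U_def)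
      show "\<forall>i\<in>{1..N + r}. \<forall>j\<in>{1..N + r}. B (e2 i) (f2 j) = (if i = j then 1 else 0) \<and> B (e2 i) (e2 j) = 0 \<and> B (f2 i) (f2 j) = 0"
      proof (intro ballI)
        fix i j assume ij: "i \<in> {1..N + r}" "j \<in> {1..N + r}"
        have d: "dual_family r e' f'" using bk by (simp add: blk_in_def)
        show "B (e2 i) (f2 j) = (if i = j then 1 else 0) \<and> B (e2 i) (e2 j) = 0 \<and> B (f2 i) (f2 j) = 0"
        proof (cases "i \<le> N"; cases "j \<le> N")
          assume "i \<le> N" "j \<le> N"
          then show ?thesis using ef ij by (auto simp: e2_def f2_def)
        next
          assume h: "i \<le> N" "\<not> j \<le> N"
          then have "i \<in> {1..N}" using ij by auto
          then show ?thesis using cross[OF inr[OF ij(2) h(2)]] h by (auto simp: e2_def f2_def)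
        next
          assume h: "\<not> i \<le> N" "j \<le> N"
          then have "j \<in> {1..N}" using ij by auto
          then show ?thesis using cross[OF inr[OF ij(1) h(1)]] h by (auto simp: e2_def f2_def)
        next
          assume h: "\<not> i \<le> N" "\<not> j \<le> N"
          have "i - N - 1 = j - N - 1 \<longleftrightarrow> i = j" using h by auto
          then show ?thesis using d inr[OF ij(1) h(1)] inr[OF ij(2) h(2)] h
            by (simp add: dual_family_def e2_def f2_def)
        qed
      qed
    qed
    then have "P (N + r)" unfolding P_def by blast
    then have "N + r \<le> N" unfolding N_def by (rule Greatest_le_nat[of P _ "card S"]) (rule Pb)
    then show False using r by simp
  qed
  have "v = pr v" if "v \<in> V" for v using dU[OF that] U0 by auto
  then show ?thesis using b unfolding pr_def by blast
qed

end

section \<open>Matrices as functions on an index set\<close>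

definition mm :: "nat set \<Rightarrow> (nat \<Rightarrow> nat \<Rightarrow> complex) \<Rightarrow> (nat \<Rightarrow> nat \<Rightarrow> complex) \<Rightarrow> nat \<Rightarrow> nat \<Rightarrow> complex" where
  "mm I A B i j = (\<Sum>k\<in>I. A i k * B k j)"

definition tr :: "(nat \<Rightarrow> nat \<Rightarrow> complex) \<Rightarrow> nat \<Rightarrow> nat \<Rightarrow> complex" where
  "tr A i j = A j i"

lemma mm_assoc: "mm I (mm I A B) D = mm I A (mm I B D)"
proof (intro ext)
  fix i j
  show "mm I (mm I A B) D i j = mm I A (mm I B D) i j"
    unfolding mm_def by (simp add: sum_distrib_left sum_distrib_right mult.assoc) (rule sum.swap)
qed

lemma tr_mm: "tr (mm I A B) = mm I (tr B) (tr A)"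
  by (intro ext) (simp add: mm_def tr_def mult.commute)

lemma mm_cong: "(\<And>k. k \<in> I \<Longrightarrow> A i k = A' i k) \<Longrightarrow> (\<And>k. k \<in> I \<Longrightarrow> B k j = B' k j) \<Longrightarrow> mm I A B i j = mm I A' B' i j"
  unfolding mm_def by (rule sum.cong) auto

lemma mm_inv_left:
  assumes "inv_pair I P J" "finite I" "i \<in> I"
  shows "mm I P (mm I J A) i j = A i j" "mm I J (mm I P A) i j = A i j"
proof -
  have "mm I (mm I P J) A i j = (\<Sum>k\<in>I. if i = k then A k j else 0)"
    unfolding mm_def[of I "mm I P J"] using assms by (intro sum.cong) (auto simp: mm_def inv_pair_def)
  then show "mm I P (mm I J A) i j = A i j" using assms by (simp add: mm_assoc)
  have "mm I (mm I J P) A i j = (\<Sum>k\<in>I. if i = k then A k j else 0)"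
    unfolding mm_def[of I "mm I J P"] using assms by (intro sum.cong) (auto simp: mm_def inv_pair_def)
  then show "mm I J (mm I P A) i j = A i j" using assms by (simp add: mm_assoc)
qed

lemma mm_inv_right:
  assumes "inv_pair I P J" "finite I" "j \<in> I"
  shows "mm I A (mm I P J) i j = A i j" "mm I A (mm I J P) i j = A i j"
proof -
  have "mm I A (mm I P J) i j = (\<Sum>k\<in>I. if k = j then A i k else 0)"
    unfolding mm_def[of I A] using assms by (intro sum.cong) (auto simp: mm_def inv_pair_def)
  then show "mm I A (mm I P J) i j = A i j" using assms by simp
  have "mm I A (mm I J P) i j = (\<Sum>k\<in>I. if k = j then A i k else 0)"
    unfolding mm_def[of I A] using assms by (intro sum.cong) (auto simp: mm_def inv_pair_def)
  then show "mm I A (mm I J P) i j = A i j" using assms by simp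
qed

subsection \<open>Forms as fibrewise linear functions on the tangent bundle\<close>

text \<open>The variable \<open>0\<close> is \<open>\<theta>\<close>, the variables \<open>1, \<dots>, 2n\<close> are the \<open>x\<^sub>i\<close>, and \<open>2n + i\<close> stands for \<open>dx\<^sub>i\<close>.
  A 1-form becomes a series linear in the last group, and the Lie derivative along a vector field
  becomes the derivation given by its tangent lift.\<close>

locale tangent =
  fixes n :: nat
begin

definition K :: nat where "K = 4 * n + 1"
definition X :: "nat set" where "X = {1..2 * n}"

lemma X_facts [simp]:
  "finite X" "0 \<notin> X" "i \<in> X \<Longrightarrow> (i = 0) = False" "i \<in> X \<Longrightarrow> 2 * n + i \<notin> X"
  "0 < K" "i \<in> X \<Longrightarrow> i < K" "i \<in> X \<Longrightarrow> 2 * n + i < K" "X \<subseteq> {..<K}"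
  "i \<in> X \<Longrightarrow> j \<in> X \<Longrightarrow> 2 * n + i \<noteq> j" "i \<in> X \<Longrightarrow> j \<in> X \<Longrightarrow> j \<noteq> 2 * n + i"
  "0 \<notin> (+) (2 * n) ` X" "j \<in> X \<Longrightarrow> j \<notin> (+) (2 * n) ` X"
  by (auto simp: X_def K_def)

lemma sum_K: "(\<Sum>j<K. f j) = f 0 + (\<Sum>j\<in>X. f j) + (\<Sum>j\<in>X. f (2 * n + j))"
proof -
  have "{..<K} = insert 0 (X \<union> (\<lambda>j. 2 * n + j) ` X)"
  proof (intro equalityI subsetI)
    fix j assume "j \<in> {..<K}"
    then have "j = 0 \<or> j \<in> X \<or> (j - 2 * n \<in> X \<and> j = 2 * n + (j - 2 * n))" by (auto simp: X_def K_def)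
    then show "j \<in> insert 0 (X \<union> (\<lambda>j. 2 * n + j) ` X)" by blast
  qed auto
  moreover have "sum f (X \<union> (\<lambda>j. 2 * n + j) ` X) = sum f X + sum f ((\<lambda>j. 2 * n + j) ` X)"
    by (rule sum.union_disjoint) auto
  moreover have "sum f ((\<lambda>j. 2 * n + j) ` X) = (\<Sum>j\<in>X. f (2 * n + j))"
    by (subst sum.reindex) (auto simp: inj_on_def)
  moreover have "0 \<notin> X \<union> (\<lambda>j. 2 * n + j) ` X" by (auto simp: X_def)
  ultimately show ?thesis by (simp add: add.assoc)
qed

text \<open>The differential of a function on the base, with \<open>var (2 * n + p)\<close> in the
  role of dx_p. It has no component along \<theta>, as the forms treated here involve only the base
  variables.\<close>

definition dd :: "ser \<Rightarrow> ser" where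
  "dd F = (\<Sum>p\<in>X. var (2 * n + p) * pd p F)"

lemma dd_add [simp]: "dd (F + G) = dd F + dd G"
  by (simp add: dd_def algebra_simps sum.distrib)
lemma dd_diff [simp]: "dd (F - G) = dd F - dd G"
  by (simp add: dd_def algebra_simps sum_subtractf)
lemma dd_uminus [simp]: "dd (- F) = - dd F"
  by (simp add: dd_def sum_negf)
lemma dd_C [simp]: "dd (C c) = 0"
  by (simp add: dd_def)
lemma dd_zero [simp]: "dd 0 = 0"
  by (simp add: dd_def)
lemma dd_mult [simp]: "dd (F * G) = dd F * G + F * dd G"
  by (simp add: dd_def algebra_simps sum.distrib sum_distrib_left)
lemma dd_sum [simp]: "dd (sum f A) = (\<Sum>i\<in>A. dd (f i))"
  by (induction A rule: infinite_finite_induct) auto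
lemma dd_var: "p \<in> X \<Longrightarrow> dd (var p) = var (2 * n + p)"
  by (simp add: dd_def pd_var if_distrib cong: if_cong)

lemma om_dd: "om d F \<Longrightarrow> om d (dd F)"
proof (cases d)
  case (Suc e)
  assume F: "om d F"
  have "om (1 + e) (var (2 * n + p) * pd p F)" for p
    using F Suc by (intro om_mult om_pd_Suc) auto
  then show ?thesis unfolding dd_def Suc by (intro om_sum) simp
qed simp

lemma om1_dd: "om 1 (dd F)"
  unfolding dd_def using om_var by (intro om_sum om_mult_right) auto

lemma on_dd: "on X F \<Longrightarrow> on {..<K} (dd F)"
  unfolding dd_def by (intro on_sum on_mult on_pd on_var) (auto intro: on_mono[of X])

lemma on_XK: "on X F \<Longrightarrow> on {..<K} F"
  by (erule on_mono) simp

lemma pd_X: "on X F \<Longrightarrow> i \<notin> X \<Longrightarrow> pd i F = 0"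
  by (rule on_pd_zero)

definition lift :: "(nat \<Rightarrow> ser) \<Rightarrow> nat \<Rightarrow> ser" where
  "lift V i = (if i \<in> X then V i else if i \<in> (\<lambda>j. 2 * n + j) ` X then dd (V (i - 2 * n)) else 0)"

definition LL :: "(nat \<Rightarrow> ser) \<Rightarrow> ser \<Rightarrow> ser" where
  "LL V = vf K (lift V)"

definition fld :: "(nat \<Rightarrow> ser) \<Rightarrow> bool" where
  "fld V \<longleftrightarrow> (\<forall>p\<in>X. on X (V p) \<and> om 1 (V p))"

lemma lift_simps [simp]:
  "lift V 0 = 0" "p \<in> X \<Longrightarrow> lift V p = V p" "p \<in> X \<Longrightarrow> lift V (2 * n + p) = dd (V p)"
  by (auto simp: lift_def)

lemma small_lift: "fld V \<Longrightarrow> small K (lift V)"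
  using om1_dd by (auto simp: small_def lift_def fld_def)

lemma LL_deriv: "fld V \<Longrightarrow> deriv_op (LL V)"
  unfolding LL_def by (intro deriv_op_vf small_lift)

lemma LL_filtered: "fld V \<Longrightarrow> filtered (LL V)"
  using LL_deriv deriv_op_filtered by blast

lemma LL_simps [simp]: "LL V (F + G) = LL V F + LL V G" "LL V (F - G) = LL V F - LL V G"
  "LL V (F * G) = LL V F * G + F * LL V G" "LL V (C c) = 0" "LL V (sum f A) = (\<Sum>i\<in>A. LL V (f i))"
  "LL V 0 = 0" "LL V (- F) = - LL V F"
  by (simp_all add: LL_def)

lemma LL_X: "on X F \<Longrightarrow> LL V F = (\<Sum>p\<in>X. V p * pd p F)"
  unfolding LL_def vf_def sum_K by (simp add: pd_X)

lemma LL_var: "LL V (var 0) = 0" "p \<in> X \<Longrightarrow> LL V (var p) = V p" "p \<in> X \<Longrightarrow> LL V (var (2 * n + p)) = dd (V p)"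
  unfolding LL_def by (subst vf_var; auto)+

lemma on_LL: "fld V \<Longrightarrow> on X F \<Longrightarrow> on X (LL V F)"
  unfolding LL_X by (intro on_sum on_mult on_pd) (auto simp: fld_def)

lemma LL_dd:
  assumes V: "fld V" and F: "on X F"
  shows "LL V (dd F) = dd (LL V F)"
proof -
  have "LL V (dd F) = (\<Sum>p\<in>X. dd (V p) * pd p F) + (\<Sum>p\<in>X. var (2 * n + p) * (\<Sum>q\<in>X. V q * pd q (pd p F)))"
    unfolding dd_def[of F] LL_simps using LL_X[OF on_pd[OF F], of V]
    by (simp add: LL_var sum.distrib)
  also have "(\<Sum>p\<in>X. var (2 * n + p) * (\<Sum>q\<in>X. V q * pd q (pd p F))) = (\<Sum>q\<in>X. V q * dd (pd q F))"
    unfolding dd_def by (simp add: sum_distrib_left, subst sum.swap) (simp add: mult.left_commute pd_commute)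
  finally show ?thesis by (simp add: LL_X[OF F] sum.distrib)
qed

definition fm :: "(nat \<Rightarrow> ser) \<Rightarrow> ser" where
  "fm g = (\<Sum>p\<in>X. g p * var (2 * n + p))"

text \<open>Coefficients of the Lie derivative of a 1-form. The index set is a parameter because
  \<theta> is included before its elimination and absent afterwards.\<close>

definition lie :: "nat set \<Rightarrow> (nat \<Rightarrow> ser) \<Rightarrow> (nat \<Rightarrow> ser) \<Rightarrow> nat \<Rightarrow> ser" where
  "lie I V g q = (\<Sum>r\<in>I. V r * pd r (g q) + g r * pd q (V r))"

lemma LL_fm:
  assumes V: "fld V" and g: "\<And>p. p \<in> X \<Longrightarrow> on X (g p)"
  shows "LL V (fm g) = fm (lie X V g)"
proof -
  have "LL V (fm g) = (\<Sum>p\<in>X. (\<Sum>r\<in>X. V r * pd r (g p)) * var (2 * n + p) + g p * dd (V p))"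
    unfolding fm_def by (simp add: LL_var LL_X[OF g])
  also have "\<dots> = (\<Sum>p\<in>X. (\<Sum>r\<in>X. V r * pd r (g p)) * var (2 * n + p)) + (\<Sum>p\<in>X. \<Sum>q\<in>X. g p * (var (2 * n + q) * pd q (V p)))"
    by (simp add: sum.distrib dd_def sum_distrib_left)
  also have "(\<Sum>p\<in>X. \<Sum>q\<in>X. g p * (var (2 * n + q) * pd q (V p))) = (\<Sum>q\<in>X. (\<Sum>p\<in>X. g p * pd q (V p)) * var (2 * n + q))"
    by (subst sum.swap) (simp add: sum_distrib_left sum_distrib_right mult_ac)
  finally show ?thesis by (simp add: fm_def lie_def sum.distrib distrib_right)
qed

definition Om :: "(nat \<Rightarrow> ser) \<Rightarrow> nat \<Rightarrow> nat \<Rightarrow> ser" where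
  "Om g p q = pd p (g q) - pd q (g p)"

lemma Om_skew: "Om g p q = - Om g q p"
  by (simp add: Om_def)

text \<open>The exterior derivative commutes with the Lie derivative; the right-hand side is the Lie
  derivative of the 2-form \<open>Om g\<close> in coordinates. Only symmetry of second derivatives
  enters.\<close>

lemma d_lie:
  "pd p (lie I V g q) - pd q (lie I V g p)
    = (\<Sum>r\<in>I. V r * pd r (Om g p q) + pd p (V r) * Om g r q + pd q (V r) * Om g p r)"
  unfolding lie_def Om_def pd_sum sum_subtractf[symmetric]
proof (rule sum.cong)
  fix r
  have "pd p (pd r (g q)) = pd r (pd p (g q))" "pd q (pd r (g p)) = pd r (pd q (g p))"
    "pd p (pd q (V r)) = pd q (pd p (V r))" by (rule pd_commute)+
  then show "pd p (V r * pd r (g q) + g r * pd q (V r)) - pd q (V r * pd r (g p) + g r * pd p (V r)) =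
      V r * pd r (pd p (g q) - pd q (g p)) + pd p (V r) * (pd r (g q) - pd q (g r)) + pd q (V r) * (pd p (g r) - pd r (g p))"
    by (simp add: algebra_simps)
qed simp

text \<open>The change of coordinates induced on the tangent bundle. Because dx_i is replaced by the
  differential of \<open>y i\<close>, pulling back a form is ordinary substitution and inherits its
  algebra.\<close>

definition tc :: "(nat \<Rightarrow> ser) \<Rightarrow> nat \<Rightarrow> ser" where
  "tc y i = (if i = 0 then var 0 else if i \<in> X then y i else dd (y (i - 2 * n)))"

definition xcoords :: "(nat \<Rightarrow> ser) \<Rightarrow> bool" where
  "xcoords y \<longleftrightarrow> (\<forall>i\<in>X. on X (y i) \<and> om 1 (y i)) \<and> (\<exists>P. inv_pair X P (jac y))"

lemma tc_simps [simp]: "tc y 0 = var 0" "i \<in> X \<Longrightarrow> tc y i = y i" "i \<in> X \<Longrightarrow> tc y (2 * n + i) = dd (y i)"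
  by (auto simp: tc_def)

lemma K_cases:
  assumes "i < K"
  obtains "i = 0" | "i \<in> X" | j where "j \<in> X" "i = 2 * n + j"
proof -
  have "i = 0 \<or> i \<in> X \<or> (i - 2 * n \<in> X \<and> i = 2 * n + (i - 2 * n))" using assms by (auto simp: X_def K_def)
  then show ?thesis using that by blast
qed

lemma coef_mult_unitv: "coef (F * G) (unitv q) = coef F 0 * coef G (unitv q) + coef F (unitv q) * coef G 0"
proof -
  have "{..unitv q} = {0, unitv q}"
  proof (intro equalityI subsetI)
    fix b assume "b \<in> {..unitv q}"
    then have b: "b \<le> unitv q" by simp
    have "b i = 0" if "i \<noteq> q" for i using le_funD[OF b, of i] that by (simp add: unitv_def)
    moreover have "b q = 0 \<or> b q = 1" using le_funD[OF b, of q] by (simp add: unitv_def) linarith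
    ultimately have "b = (\<lambda>_. 0) \<or> b = unitv q" unfolding unitv_def fun_eq_iff by metis
    then show "b \<in> {0, unitv q}" by (simp add: zero_fun_def)
  qed (auto simp: le_fun_def)
  moreover have "unitv q - unitv q = 0" "unitv q - 0 = unitv q" by (auto simp: fun_eq_iff fun_diff_def)
  ultimately show ?thesis by (simp add: coef_mult)
qed

lemma coef_dd_unitv:
  "q \<in> X \<Longrightarrow> coef (dd F) (unitv (2 * n + q)) = coef F (unitv q)"
  "j \<notin> (\<lambda>q. 2 * n + q) ` X \<Longrightarrow> coef (dd F) (unitv j) = 0"
proof -
  have e: "coef (dd F) (unitv j) = (\<Sum>p\<in>X. if j = 2 * n + p then coef (pd p F) 0 else 0)" for j
    unfolding dd_def coef_sum coef_mult_unitv by (intro sum.cong) (auto simp: coef_var)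
  show "coef (dd F) (unitv (2 * n + q)) = coef F (unitv q)" if "q \<in> X"
    unfolding e using that by (simp add: coef_pd)
  show "coef (dd F) (unitv j) = 0" if "j \<notin> (\<lambda>q. 2 * n + q) ` X"
    unfolding e using that by (intro sum.neutral) auto
qed

text \<open>The Jacobian at the origin is block diagonal, with blocks 1, \<open>jac y\<close> and
  \<open>jac y\<close>.\<close>

lemma tc_coords:
  assumes y: "xcoords y"
  shows "coords K (tc y)"
proof -
  have on: "on X (y i)" "om 1 (y i)" if "i \<in> X" for i using y that by (auto simp: xcoords_def)
  obtain P where P: "inv_pair X P (jac y)" using y by (auto simp: xcoords_def)
  define P' where "P' i j = (if i = 0 \<or> j = 0 then (if i = j then 1 else 0)
      else if i \<in> X \<and> j \<in> X then P i j else if i \<notin> X \<and> j \<notin> X then P (i - 2 * n) (j - 2 * n) else 0)" for i j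
  have P'0: "P' 0 j = (if j = 0 then 1 else 0)" "P' j 0 = (if j = 0 then 1 else 0)" for j by (auto simp: P'_def)
  have P's: "P' i j = P i j" "P' i (2 * n + j) = 0" "P' (2 * n + i) j = 0" "P' (2 * n + i) (2 * n + j) = P i j"
    if "i \<in> X" "j \<in> X" for i j using that by (auto simp: P'_def)
  have j0: "jac (tc y) 0 j = (if j = 0 then 1 else 0)" for j
    by (simp add: jac_def coef_var)
  have js: "jac (tc y) i 0 = 0" "jac (tc y) (2 * n + i) 0 = 0" "jac (tc y) i j = jac y i j" "jac (tc y) i (2 * n + j) = 0"
    "jac (tc y) (2 * n + i) j = 0" "jac (tc y) (2 * n + i) (2 * n + j) = jac y i j"
    if "i \<in> X" "j \<in> X" for i j
  proof -
    have "coef (y i) (unitv l) = 0" if "l \<notin> X" for l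
      using on(1)[OF \<open>i \<in> X\<close>] that unfolding on_def by auto
    then show "jac (tc y) i 0 = 0" "jac (tc y) i (2 * n + j) = 0" using that by (auto simp: jac_def)
    show "jac (tc y) (2 * n + i) 0 = 0" "jac (tc y) (2 * n + i) j = 0"
      using that coef_dd_unitv(2)[of 0 "y i"] coef_dd_unitv(2)[of j "y i"] by (auto simp: jac_def)
    show "jac (tc y) i j = jac y i j" "jac (tc y) (2 * n + i) (2 * n + j) = jac y i j"
      using that coef_dd_unitv(1) by (auto simp: jac_def)
  qed
  have "inv_pair {..<K} P' (jac (tc y))"
  proof (rule left_inverse_inv_pair)
    fix i l assume "i \<in> {..<K}" "l \<in> {..<K}"
    then have il: "i < K" "l < K" by auto
    have PJ: "(\<Sum>j\<in>X. P i j * jac y j l) = (if i = l then 1 else 0)" if "i \<in> X" "l \<in> X" for i l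
      using P that by (auto simp: inv_pair_def)
    show "(\<Sum>j<K. P' i j * jac (tc y) j l) = (if i = l then 1 else 0)"
      using il(1)
    proof (cases rule: K_cases)
      case 1
      then show ?thesis by (auto simp: sum_K P'0 j0)
    next
      case i: 2
      from il(2) show ?thesis
        by (cases rule: K_cases) (use i PJ in \<open>auto simp: sum_K P'0 P's js j0\<close>)
    next
      case i: (3 i')
      from il(2) show ?thesis
        by (cases rule: K_cases) (use i PJ in \<open>auto simp: sum_K P'0 P's js j0\<close>)
    qed
  qed simp
  moreover have "on {..<K} (tc y i) \<and> om 1 (tc y i)" if "i < K" for i
    using that by (cases rule: K_cases) (auto simp: on on_XK on_dd om1_dd simp del: One_nat_def)
  ultimately show ?thesis unfolding coords_def small_def by blast
qed

lemma tc_small: "xcoords y \<Longrightarrow> small K (tc y)"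
  using tc_coords by (simp add: coords_def)

lemma cmp_tc_on: "xcoords y \<Longrightarrow> on X F \<Longrightarrow> on X (cmp K F (tc y))"
  by (rule on_cmp[of X]) (auto simp: xcoords_def)

text \<open>The Euler fields of \<open>\<theta>\<close> and of the fibre coordinates detect series in the base variables.\<close>

definition eul :: "bool \<Rightarrow> nat \<Rightarrow> ser" where
  "eul t i = (if i = 0 then (if t then var 0 else 0) else if i \<in> X then 0 else (if t then 0 else var i))"

definition ew :: "bool \<Rightarrow> nat \<Rightarrow> complex" where
  "ew t i = (if i = 0 then (if t then 1 else 0) else if i \<in> X then 0 else (if t then 0 else 1))"

lemma eul_deriv: "deriv_op (vf K (eul t))"
  using om_var by (intro deriv_op_vf) (auto simp: small_def eul_def simp del: One_nat_def)

lemma eul_X: "on X F \<Longrightarrow> vf K (eul t) F = 0"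
  unfolding vf_def sum_K by (simp add: pd_X) (auto simp: eul_def)

lemma eul_values [simp]: "i \<in> X \<Longrightarrow> eul t (2 * n + i) = (if t then 0 else var (2 * n + i))"
  by (simp add: eul_def)

lemma eul_fibre: "p \<in> X \<Longrightarrow> vf K (eul t) (var (2 * n + p)) = (if t then 0 else var (2 * n + p))"
  by (subst vf_var) (auto simp: eul_def)

lemma eigen_geig: "D F = C c * F \<Longrightarrow> F \<in> geig D c"
proof -
  assume "D F = C c * F"
  then have "(sh D c ^^ 1) F = 0" by (simp add: sh_def)
  then have "om d ((sh D c ^^ 1) F)" for d by (simp only: om_zero)
  then show ?thesis unfolding geig_def by blast
qed

lemma eul_dd: "on X F \<Longrightarrow> vf K (eul t) (dd F) = (if t then 0 else dd F)"
  unfolding dd_def by (auto simp: eul_fibre eul_X on_pd)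

lemma eul_tc: assumes y: "xcoords y" and i: "i < K" shows "tc y i \<in> geig (vf K (eul t)) (ew t i)"
  using i
proof (cases rule: K_cases)
  case 1
  have "vf K (eul t) (var 0) = C (ew t 0) * var 0" by (subst vf_var) (auto simp: eul_def ew_def)
  then show ?thesis using 1 by (simp add: eigen_geig)
next
  case 2
  then have "on X (y i)" using y by (auto simp: xcoords_def)
  then show ?thesis using 2 by (auto intro!: eigen_geig simp: ew_def eul_X)
next
  case (3 j)
  then have "on X (y j)" using y by (auto simp: xcoords_def)
  then show ?thesis using 3 by (auto intro!: eigen_geig simp: ew_def eul_dd)
qed

lemma wt_ew: "wt K (ew t) b = of_nat (if t then b 0 else (\<Sum>j\<in>X. b (2 * n + j)))"
proof -
  have "ew t (2 * n + j) = (if t then 0 else 1)" if "j \<in> X" for j using that by (auto simp: ew_def)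
  moreover have "ew t j = 0" if "j \<in> X" for j using that by (auto simp: ew_def)
  moreover have "ew t 0 = (if t then 1 else 0)" by (simp add: ew_def)
  ultimately show ?thesis unfolding wt_def sum_K by (simp cong: sum.cong)
qed

lemma eul_weights:
  assumes y: "xcoords y" and F: "on {..<K} F" and e: "vf K (eul t) (cmp K F (tc y)) = C (of_nat c) * cmp K F (tc y)"
    and b: "coef F b \<noteq> 0"
  shows "(if t then b 0 else (\<Sum>j\<in>X. b (2 * n + j))) = c"
proof -
  have "wtd K (ew t) (of_nat c) F"
    by (rule geig_cmp_weights[OF eul_deriv tc_coords[OF y] eul_tc[OF y] F eigen_geig[where D = "vf K (eul t)", OF e]])
  then have "wt K (ew t) b = of_nat c" using b by (simp add: wtd_def)
  then show ?thesis unfolding wt_ew of_nat_eq_iff .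
qed

text \<open>A preimage exists as a series in all \<open>K\<close> variables. Having weight zero for
  both Euler fields, it contains neither \<theta> nor fibre variables.\<close>

lemma X_surj:
  assumes y: "xcoords y" and H: "on X H"
  obtains G where "on X G" "cmp K G (tc y) = H"
proof -
  obtain G where G: "on {..<K} G" "cmp K G (tc y) = H"
    using cmp_surj[OF tc_coords[OF y] on_XK[OF H]] by blast
  have "on X G" unfolding on_def
  proof (intro allI impI subsetI)
    fix b i assume b: "coef G b \<noteq> 0" and i: "i \<in> supp b"
    have w: "(if t then b 0 else (\<Sum>j\<in>X. b (2 * n + j))) = 0" for t
      by (rule eul_weights[OF y G(1) _ b]) (simp add: G(2) eul_X[OF H])
    have "i < K" using G(1) b i unfolding on_def by blast
    then show "i \<in> X"
      by (cases rule: K_cases) (use w[of True] w[of False] i in \<open>auto simp: supp_def\<close>)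
  qed
  then show ?thesis using that G by blast
qed

lemma dd_cmp:
  assumes y: "xcoords y" and F: "on X F"
  shows "dd (cmp K F (tc y)) = cmp K (dd F) (tc y)"
proof -
  note s = tc_small[OF y]
  have "pd p (cmp K F (tc y)) = (\<Sum>i\<in>X. cmp K (pd i F) (tc y) * pd p (y i))" for p
    unfolding chain_rule[OF s] sum_K by (simp add: pd_X[OF F])
  then have "dd (cmp K F (tc y)) = (\<Sum>p\<in>X. \<Sum>i\<in>X. var (2 * n + p) * (cmp K (pd i F) (tc y) * pd p (y i)))"
    by (simp add: dd_def sum_distrib_left)
  also have "\<dots> = (\<Sum>i\<in>X. dd (y i) * cmp K (pd i F) (tc y))"
    by (subst sum.swap) (simp add: dd_def sum_distrib_left sum_distrib_right mult_ac)
  also have "\<dots> = cmp K (dd F) (tc y)"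
    unfolding dd_def[of F] using s by simp
  finally show ?thesis .
qed

text \<open>The pullback has fibre weight one and \<theta>-weight zero, so it is linear in the fibre
  variables. Euler's identity for degree one shows that it is the form whose coefficients are its
  fibre derivatives.\<close>

lemma form_surj:
  assumes y: "xcoords y" and g: "\<And>p. p \<in> X \<Longrightarrow> on X (g p) \<and> om 1 (g p)"
  obtains h F where "\<And>i. i \<in> X \<Longrightarrow> on X (h i) \<and> om 1 (h i)" "on {..<K} F" "F = fm h" "cmp K F (tc y) = fm g"
proof -
  have onfm: "on {..<K} (fm g)" unfolding fm_def using g on_XK by (intro on_sum on_mult on_var) auto
  obtain F where F: "on {..<K} F" "cmp K F (tc y) = fm g"
    using cmp_surj[OF tc_coords[OF y] onfm] by blast
  have eu: "vf K (eul t) (fm g) = C (of_nat (if t then 0 else 1)) * fm g" for t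
    unfolding fm_def using g by (auto simp: eul_X eul_fibre)
  have w: "(if t then b 0 else (\<Sum>j\<in>X. b (2 * n + j))) = (if t then 0 else 1)" if "coef F b \<noteq> 0" for t b
    using eul_weights[OF y F(1) _ that, of t "if t then 0 else 1"] eu[of t] F(2) by simp
  define h where "h i = pd (2 * n + i) F" for i
  have "F = fm h"
  proof (rule ser_eqI)
    fix b :: "nat \<Rightarrow> nat"
    have "coef (fm h) b = (\<Sum>p\<in>X. of_nat (b (2 * n + p)) * coef F b)"
      unfolding fm_def h_def coef_sum by (intro sum.cong) (simp_all add: coef_var_pd mult.commute[of _ "var _"])
    also have "\<dots> = of_nat (\<Sum>p\<in>X. b (2 * n + p)) * coef F b" by (simp add: sum_distrib_right)
    also have "\<dots> = coef F b" using w[of b False] by (cases "coef F b = 0") auto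
    finally show "coef F b = coef (fm h) b" by simp
  qed
  moreover have "on X (h i)" if i: "i \<in> X" for i
    unfolding on_def
  proof (intro allI impI subsetI)
    fix b l assume "coef (h i) b \<noteq> 0" and l: "l \<in> supp b"
    then have b: "coef F (b + unitv (2 * n + i)) \<noteq> 0" by (auto simp: h_def coef_pd)
    have "supp (b + unitv (2 * n + i)) \<subseteq> {..<K}" using F(1) b unfolding on_def by blast
    then have "l < K" using l by auto
    then show "l \<in> X"
    proof (cases rule: K_cases)
      case 1
      then show ?thesis using w[OF b, of True] l by (auto simp: supp_def)
    next
      case (3 j)
      have "(\<Sum>j\<in>X. b (2 * n + j)) + (\<Sum>j\<in>X. unitv (2 * n + i) (2 * n + j)) = 1"
        using w[OF b, of False] by (simp add: sum.distrib)
      moreover have "(\<Sum>j\<in>X. unitv (2 * n + i) (2 * n + j)) = 1"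
        using i by (simp add: unitv_def if_distrib cong: if_cong)
      ultimately have "(\<Sum>j\<in>X. b (2 * n + j)) = 0" by linarith
      then show ?thesis using 3 l by (auto simp: supp_def)
    qed
  qed
  moreover have "om 1 (h i)" for i
  proof -
    obtain \<Psi> where \<Psi>: "coords K \<Psi>" "\<And>i. i < K \<Longrightarrow> cmp K (tc y i) \<Psi> = var i"
      using coords_inverse[OF tc_coords[OF y]] by blast
    have "cmp K (fm g) \<Psi> = cmp K F (\<lambda>i. cmp K (tc y i) \<Psi>)"
      unfolding F(2)[symmetric] using \<Psi>(1) tc_small[OF y] by (intro cmp_assoc) (auto simp: coords_def)
    also have "\<dots> = cmp K F var" by (rule cmp_cong[of "{..<K}"]) (use F(1) \<Psi>(2) in auto)
    also have "\<dots> = F" by (rule cmp_ident) fact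
    finally have e: "cmp K (fm g) \<Psi> = F" .
    have "om (1 + 1) (fm g)" unfolding fm_def using g om_var by (intro om_sum om_mult) auto
    then have "om 2 F" unfolding e[symmetric] by (intro om_cmp) (simp add: numeral_2_eq_2)
    then show ?thesis unfolding h_def using om_pd_Suc[of 1 F] by (simp add: numeral_2_eq_2)
  qed
  ultimately show ?thesis using that[of h F] F by blast
qed

subsection \<open>The Liouville field\<close>

text \<open>Separating the constant part of the 2-form, which is invertible, from the rest
  \<open>O'\<close>, which vanishes at the origin, turns the equation for \<open>Z\<close> into a
  fixed point equation that gains one order.\<close>

lemma Om_solve:
  assumes g: "\<And>p. p \<in> X \<Longrightarrow> on X (g p) \<and> om 1 (g p)"
    and P: "inv_pair X P (\<lambda>p q. coef (Om g p q) 0)"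
  obtains Z where "fld Z" "\<And>q. q \<in> X \<Longrightarrow> (\<Sum>p\<in>X. Z p * Om g p q) = g q"
proof -
  define O0 where "O0 p q = coef (Om g p q) 0" for p q
  define O' where "O' p q = Om g p q - C (O0 p q)" for p q
  have O'om: "om 1 (O' p q)" for p q unfolding om1_iff O'_def O0_def by (simp add: coef_C)
  have O'on: "on X (O' p q)" if "p \<in> X" "q \<in> X" for p q
    unfolding O'_def Om_def using g that by (intro on_diff on_pd on_C) auto
  define T where "T Z p = (\<Sum>q\<in>X. C (P q p) * (g q - (\<Sum>r\<in>X. Z r * O' r q)))" for Z :: "nat \<Rightarrow> ser" and p
  define good where "good Z \<longleftrightarrow> (\<forall>p. on X (Z p) \<and> om 1 (Z p))" for Z :: "nat \<Rightarrow> ser"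
  obtain Z where Z: "good Z" "T Z = Z"
  proof (rule contraction_fixpoint[of good "\<lambda>_. 0" T])
    show "good (\<lambda>_. 0)" by (simp add: good_def)
    show "good (T h)" if "good h" for h
      using that g O'on O'om unfolding good_def T_def
      by (auto intro!: on_sum on_mult on_diff om_sum om_mult_left om_diff simp del: One_nat_def)
    show "good h" if h: "\<And>d. \<exists>u. good u \<and> (\<forall>i. om d (h i - u i))" for h
      unfolding good_def
    proof (intro allI conjI)
      fix i
      obtain u where "good u" "\<forall>i. om 1 (h i - u i)" using h by blast
      then show "om 1 (h i)" using om_add[of 1 "h i - u i" "u i"] by (simp add: good_def)
      show "on X (h i)" by (rule on_limit) (use h good_def in blast)
    qed
    show "om (Suc d) (T h i - T u i)" if "good h" "good u" "\<And>i. om d (h i - u i)" for h u d i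
    proof -
      have "T h i - T u i = (\<Sum>q\<in>X. C (P q i) * (- (\<Sum>r\<in>X. (h r - u r) * O' r q)))"
        unfolding T_def sum_subtractf[symmetric]
        by (rule sum.cong) (simp_all add: left_diff_distrib sum_subtractf right_diff_distrib)
      moreover have "om (Suc d) ((h r - u r) * O' r q)" for r q using om_mult[OF that(3) O'om] by simp
      then have "om (Suc d) (\<Sum>q\<in>X. C (P q i) * (- (\<Sum>r\<in>X. (h r - u r) * O' r q)))"
        by (rule_tac om_sum, rule_tac om_mult_left, rule_tac om_uminus, rule_tac om_sum)
      ultimately show ?thesis by simp
    qed
  qed
  have "(\<Sum>p\<in>X. Z p * Om g p q) = g q" if q: "q \<in> X" for q
  proof -
    have "(\<Sum>p\<in>X. Z p * C (O0 p q)) = (\<Sum>p\<in>X. C (tr O0 q p) * (\<Sum>r\<in>X. C (tr P p r) * (g r - (\<Sum>s\<in>X. Z s * O' s r))))"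
      using Z(2) by (intro sum.cong) (auto simp: tr_def T_def mult.commute fun_eq_iff)
    also have "\<dots> = g q - (\<Sum>s\<in>X. Z s * O' s q)"
    proof (rule inv_pair_solve[OF _ _ q])
      show "inv_pair X (tr P) (tr O0)" using P by (auto simp: inv_pair_def tr_def O0_def mult.commute)
    qed simp
    finally have "(\<Sum>p\<in>X. Z p * C (O0 p q)) + (\<Sum>s\<in>X. Z s * O' s q) = g q" by simp
    then show ?thesis by (simp add: O'_def algebra_simps sum_subtractf sum.distrib)
  qed
  then show ?thesis using that[of Z] Z(1) by (auto simp: good_def fld_def)
qed

text \<open>The same separation shows that a solution of order \<open>d\<close> has order
  \<open>d + 1\<close>, hence every order.\<close>

lemma Om_inj:
  assumes P: "inv_pair X P (\<lambda>p q. coef (Om g p q) 0)"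
    and U: "\<And>q. q \<in> X \<Longrightarrow> (\<Sum>p\<in>X. U p * Om g p q) = 0" and p: "p \<in> X"
  shows "U p = 0"
proof -
  define O0 where "O0 p q = coef (Om g p q) 0" for p q
  define O' where "O' p q = Om g p q - C (O0 p q)" for p q
  have O'om: "om 1 (O' p q)" for p q unfolding om1_iff O'_def O0_def by (simp add: coef_C)
  have P': "inv_pair X (tr O0) (tr P)" using P by (auto simp: inv_pair_def tr_def O0_def mult.commute)
  have "\<forall>p\<in>X. om d (U p)" for d
  proof (induction d)
    case (Suc d)
    have e: "(\<Sum>r\<in>X. C (tr O0 q r) * U r) = - (\<Sum>r\<in>X. U r * O' r q)" if "q \<in> X" for q
      using U[OF that] by (simp add: O'_def tr_def algebra_simps sum_subtractf)
    have o: "om (d + 1) (\<Sum>r\<in>X. C (tr O0 q r) * U r)" if "q \<in> X" for q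
      unfolding e[OF that] using Suc O'om by (intro om_uminus om_sum om_mult) auto
    show ?case
    proof
      fix p assume p: "p \<in> X"
      have "(\<Sum>q\<in>X. C (tr P p q) * (\<Sum>r\<in>X. C (tr O0 q r) * U r)) = U p"
        using inv_pair_solve[OF P' _ p, of U] by simp
      moreover have "om (Suc d) (\<Sum>q\<in>X. C (tr P p q) * (\<Sum>r\<in>X. C (tr O0 q r) * U r))"
        by (rule om_sum, rule om_mult_left) (use o in simp)
      ultimately show "om (Suc d) (U p)" by simp
    qed
  qed simp
  then show ?thesis using om_all_zero p by blast
qed

text \<open>Cartan's formula: the Lie derivative is the contraction of d\<gamma> with Z, which is
  \<gamma>, plus the differential of \<gamma>(Z) = d\<gamma>(Z, Z) = 0.\<close>

lemma Z_lie:
  assumes Z: "\<And>q. q \<in> X \<Longrightarrow> (\<Sum>p\<in>X. Z p * Om g p q) = g q" and q: "q \<in> X"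
  shows "lie X Z g q = g q"
proof -
  have "(\<Sum>p\<in>X. Z p * g p) = (\<Sum>p\<in>X. \<Sum>r\<in>X. Z p * (Z r * Om g r p))"
    using Z by (simp add: sum_distrib_left flip: Z)
  also have "\<dots> = - (\<Sum>p\<in>X. \<Sum>r\<in>X. Z p * (Z r * Om g p r))"
    by (subst Om_skew) (simp add: sum_negf)
  also have "(\<Sum>p\<in>X. \<Sum>r\<in>X. Z p * (Z r * Om g p r)) = (\<Sum>p\<in>X. \<Sum>r\<in>X. Z p * (Z r * Om g r p))"
    by (subst sum.swap) (simp add: mult.left_commute)
  also have "\<dots> = (\<Sum>p\<in>X. Z p * g p)"
    using Z by (simp add: sum_distrib_left flip: Z)
  finally have "C 2 * (\<Sum>p\<in>X. Z p * g p) = 0"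
    by (simp add: C_of_nat[of 2, simplified])
  then have "C (1/2) * (C 2 * (\<Sum>p\<in>X. Z p * g p)) = 0" by simp
  then have 0: "(\<Sum>p\<in>X. Z p * g p) = 0" by (simp flip: mult.assoc C_simps(6))
  have "lie X Z g q = (\<Sum>p\<in>X. Z p * Om g p q) + (\<Sum>p\<in>X. Z p * pd q (g p) + g p * pd q (Z p))"
    unfolding lie_def Om_def sum.distrib[symmetric] by (rule sum.cong) (simp_all add: algebra_simps)
  also have "(\<Sum>p\<in>X. Z p * pd q (g p) + g p * pd q (Z p)) = pd q (\<Sum>p\<in>X. Z p * g p)"
    by (simp add: algebra_simps)
  also have "\<dots> = 0" unfolding 0 by simp
  finally show ?thesis using Z[OF q] by simp
qed

text \<open>Contracting d\<gamma> with [V, Z] gives the Lie derivative of \<gamma> along V minus the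
  contraction of Z with that of d\<gamma>. Both vanish, and d\<gamma> is nondegenerate.\<close>

lemma Z_commute:
  assumes Z: "\<And>q. q \<in> X \<Longrightarrow> (\<Sum>p\<in>X. Z p * Om g p q) = g q" and fZ: "fld Z"
    and P: "inv_pair X P (\<lambda>p q. coef (Om g p q) 0)"
    and V: "fld V" and L: "\<And>q. q \<in> X \<Longrightarrow> lie X V g q = 0" and g: "\<And>p. p \<in> X \<Longrightarrow> on X (g p)" and p: "p \<in> X"
  shows "LL V (Z p) = LL Z (V p)"
proof -
  have oZ: "on X (Z p)" "on X (V p)" if "p \<in> X" for p using fZ V that by (auto simp: fld_def)
  have onO: "on X (Om g p q)" if "p \<in> X" "q \<in> X" for p q
    unfolding Om_def using g that by (intro on_diff on_pd) auto
  have "LL V (Z p) - LL Z (V p) = 0"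
  proof (rule Om_inj[OF P _ p, of "\<lambda>p. LL V (Z p) - LL Z (V p)"])
    fix q assume q: "q \<in> X"
    have dO: "LL V (Om g p q) = - (\<Sum>r\<in>X. pd p (V r) * Om g r q + pd q (V r) * Om g p r)" if "p \<in> X" for p
    proof -
      have "0 = pd p (lie X V g q) - pd q (lie X V g p)" using L q that by simp
      also have "\<dots> = LL V (Om g p q) + (\<Sum>r\<in>X. pd p (V r) * Om g r q + pd q (V r) * Om g p r)"
        unfolding d_lie LL_X[OF onO[OF that q]] by (simp add: sum.distrib add.assoc)
      finally show ?thesis by (simp add: eq_neg_iff_add_eq_0)
    qed
    have "(\<Sum>p\<in>X. LL V (Z p) * Om g p q) = LL V (\<Sum>p\<in>X. Z p * Om g p q) - (\<Sum>p\<in>X. Z p * LL V (Om g p q))"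
      by (simp add: sum.distrib)
    also have "(\<Sum>p\<in>X. Z p * LL V (Om g p q))
        = - ((\<Sum>p\<in>X. \<Sum>r\<in>X. Z p * (pd p (V r) * Om g r q)) + (\<Sum>p\<in>X. \<Sum>r\<in>X. Z p * (pd q (V r) * Om g p r)))"
      by (simp add: dO sum_distrib_left sum_negf sum.distrib distrib_left right_diff_distrib sum_subtractf)
    also have "(\<Sum>p\<in>X. \<Sum>r\<in>X. Z p * (pd p (V r) * Om g r q)) = (\<Sum>r\<in>X. LL Z (V r) * Om g r q)"
      by (subst sum.swap) (simp add: LL_X[OF oZ(2)] sum_distrib_right mult.assoc)
    also have "(\<Sum>p\<in>X. \<Sum>r\<in>X. Z p * (pd q (V r) * Om g p r)) = (\<Sum>r\<in>X. pd q (V r) * (\<Sum>p\<in>X. Z p * Om g p r))"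
      by (subst sum.swap) (simp add: sum_distrib_left mult.left_commute)
    also have "\<dots> = (\<Sum>r\<in>X. g r * pd q (V r))" using Z by (simp add: mult.commute)
    also have "LL V (\<Sum>p\<in>X. Z p * Om g p q) = LL V (g q)" using Z[OF q] by simp
    also have "LL V (g q) = - (\<Sum>r\<in>X. g r * pd q (V r))"
      using L[OF q] unfolding lie_def LL_X[OF g[OF q]] by (simp add: sum.distrib eq_neg_iff_add_eq_0)
    finally show "(\<Sum>p\<in>X. (LL V (Z p) - LL Z (V p)) * Om g p q) = 0"
      by (simp add: left_diff_distrib sum_subtractf)
  qed
  then show ?thesis by simp
qed

lemma LL_commute:
  assumes V: "fld V" and W: "fld W" and c: "\<And>p. p \<in> X \<Longrightarrow> LL V (W p) = LL W (V p)"
  shows "LL V (LL W F) = LL W (LL V F)"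
proof -
  have "vf K (lift V) (lift W j) - vf K (lift W) (lift V j) = 0" if "j < K" for j
    using that
  proof (cases rule: K_cases)
    case 2
    then show ?thesis using c by (simp add: LL_def)
  next
    case (3 i)
    then show ?thesis using LL_dd[OF V, of "W i"] LL_dd[OF W, of "V i"] V W c[of i]
      by (simp add: LL_def fld_def)
  qed simp
  then have "vf K (\<lambda>j. vf K (lift V) (lift W j) - vf K (lift W) (lift V j)) F = 0"
    unfolding vf_def[of K "\<lambda>j. vf K (lift V) (lift W j) - vf K (lift W) (lift V j)"] by (intro sum.neutral) simp
  then show ?thesis unfolding LL_def vf_bracket[symmetric] by simp
qed

end

section \<open>Joint generalized eigenfunctions of two commuting fields\<close>

lemma fin_decomp:
  assumes T: "linop T" and U: "linsub U" "\<And>u. u \<in> U \<Longrightarrow> T u \<in> U"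
    and fin: "finite S" and span: "\<And>v. v \<in> U \<Longrightarrow> \<exists>c. v = (\<Sum>s\<in>S. C (c s) * s)" and v: "v \<in> U"
  shows "\<exists>K u. finite K \<and> v = (\<Sum>\<kappa>\<in>K. papp T (u \<kappa>) v) \<and> (\<forall>\<kappa>\<in>K. \<exists>e. (sh T \<kappa> ^^ e) (papp T (u \<kappa>) v) = 0)"
proof -
  have "\<exists>c. (T ^^ i) v - (\<Sum>s\<in>S. C (c s) * s) \<in> {0}" for i
  proof -
    have "(T ^^ i) v \<in> U" by (induction i) (use U v in auto)
    then show ?thesis using span by force
  qed
  then obtain p where "p \<noteq> 0" "papp T p v \<in> {0}" using annihilator[OF T linsub_0 fin] by blast
  then show ?thesis using gen_eigen_decomp[OF T, of p v] by simp
qed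

lemma vector_space_ser: "vector_space (\<lambda>c F. C c * F)"
  by unfold_locales (simp_all add: algebra_simps)

lemma papp_commute:
  assumes T1: "linop T1" and U: "linsub U" "\<And>u. u \<in> U \<Longrightarrow> T2 u \<in> U"
    and comm: "\<And>u. u \<in> U \<Longrightarrow> T1 (T2 u) = T2 (T1 u)" and T1U: "\<And>u. u \<in> U \<Longrightarrow> T1 u \<in> U" and v: "v \<in> U"
    and T2: "linop T2"
  shows "(sh T1 \<kappa> ^^ e) (papp T2 u v) = papp T2 u ((sh T1 \<kappa> ^^ e) v)"
proof -
  have powU: "(T2 ^^ i) w \<in> U" if "w \<in> U" for i w by (induction i) (use that U in auto)
  have pow: "T1 ((T2 ^^ i) w) = (T2 ^^ i) (T1 w)" if "w \<in> U" for i w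
    by (induction i) (use that comm powU in auto)
  have 1: "sh T1 \<kappa> (papp T2 u w) = papp T2 u (sh T1 \<kappa> w)" if w: "w \<in> U" for w
  proof -
    have "T1 (papp T2 u w) = papp T2 u (T1 w)"
      unfolding papp_def using T1 by (simp add: linop_sum) (simp add: linop_def pow[OF w])
    moreover have "papp T2 u (C \<kappa> * w) = C \<kappa> * papp T2 u w" using linop_papp[OF T2] by (simp add: linop_def)
    ultimately show ?thesis by (simp add: sh_def linop_diff[OF linop_papp[OF T2]])
  qed
  have "(sh T1 \<kappa> ^^ e) v \<in> U" for e using sh_pow_in[OF U(1) T1U v] .
  then show ?thesis by (induction e) (simp_all add: 1)
qed

context tangent
begin

definition Lin :: "ser set" where
  "Lin = {F. \<exists>c. F = (\<Sum>p\<in>X. C (c p) * var p)}"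

definition lin1 :: "ser \<Rightarrow> ser" where
  "lin1 F = (\<Sum>p\<in>X. C (coef F (unitv p)) * var p)"

lemma lin1_Lin [simp]: "lin1 F \<in> Lin"
  unfolding Lin_def lin1_def mem_Collect_eq by (rule exI[of _ "\<lambda>p. coef F (unitv p)"]) (rule refl)

lemma coef_lin: "q \<in> X \<Longrightarrow> coef (\<Sum>p\<in>X. C (c p) * var p) (unitv q) = c q"
  by (simp add: coef_var if_distrib cong: if_cong)

lemma lin1_id: "F \<in> Lin \<Longrightarrow> lin1 F = F"
  unfolding Lin_def lin1_def by (auto simp: coef_lin simp del: coef_sum intro!: sum.cong)

lemma Lin_eqI: "F \<in> Lin \<Longrightarrow> G \<in> Lin \<Longrightarrow> (\<And>q. q \<in> X \<Longrightarrow> coef F (unitv q) = coef G (unitv q)) \<Longrightarrow> F = G"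
proof -
  assume a: "F \<in> Lin" "G \<in> Lin" "\<And>q. q \<in> X \<Longrightarrow> coef F (unitv q) = coef G (unitv q)"
  have "lin1 F = lin1 G" unfolding lin1_def using a(3) by (intro sum.cong) auto
  then show ?thesis using a by (simp add: lin1_id)
qed

lemma linop_lin1: "linop lin1"
  unfolding linop_def
proof (intro conjI allI)
  show "lin1 (F + G) = lin1 F + lin1 G" for F G
    unfolding lin1_def sum.distrib[symmetric] by (rule sum.cong) (simp_all add: distrib_right)
  show "lin1 (C c * F) = C c * lin1 F" for c F
    unfolding lin1_def sum_distrib_left by (rule sum.cong) (simp_all add: mult.assoc)
qed

lemma linsub_Lin: "linsub Lin"
  unfolding linsub_def
proof (intro conjI ballI allI)
  show "0 \<in> Lin" using lin1_Lin[of 0] linop_zero[OF linop_lin1] by simp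
  fix F assume F: "F \<in> Lin"
  have "lin1 (C c * F) = C c * F" for c using linop_lin1 lin1_id[OF F] by (simp add: linop_def)
  then show "C c * F \<in> Lin" for c by (metis lin1_Lin)
  fix G assume G: "G \<in> Lin"
  have "lin1 (F + G) = F + G" using linop_lin1 lin1_id[OF F] lin1_id[OF G] by (simp add: linop_def)
  then show "F + G \<in> Lin" by (metis lin1_Lin)
qed

lemma Lin_on: "F \<in> Lin \<Longrightarrow> on X F"
  unfolding Lin_def by (auto intro!: on_sum on_mult)

lemma Lin_om: "F \<in> Lin \<Longrightarrow> om 1 F"
  unfolding Lin_def using om_var by (auto intro!: om_sum om_mult_left simp del: One_nat_def)

lemma var_Lin: "p \<in> X \<Longrightarrow> var p \<in> Lin"
proof -
  assume "p \<in> X"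
  then have "var p = (\<Sum>q\<in>X. C (if q = p then 1 else 0) * var q)"
    by (simp add: if_distrib[of C] if_distrib[of "\<lambda>x. x * _"] cong: if_cong)
  then show ?thesis unfolding Lin_def mem_Collect_eq by (rule exI[of _ "\<lambda>q. if q = p then 1 else 0"])
qed

lemma lin1_om2: "on X F \<Longrightarrow> om 1 F \<Longrightarrow> om 2 (F - lin1 F)"
  unfolding lin1_def by (rule om2_linear) auto

lemma lin1_zero: "om 2 F \<Longrightarrow> lin1 F = 0"
  unfolding lin1_def om2_iff by simp

lemma Lin_om2: "F \<in> Lin \<Longrightarrow> om 2 F \<Longrightarrow> F = 0"
  using lin1_zero lin1_id by metis

lemma Lin_span: "v \<in> Lin \<Longrightarrow> \<exists>c. v = (\<Sum>s\<in>var ` X. C (c s) * s)"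
proof -
  have inj: "inj_on var X" by (rule inj_onI) (metis coef_var unitv_inj zero_neq_one)
  assume "v \<in> Lin"
  then obtain c where c: "v = (\<Sum>p\<in>X. C (c p) * var p)" unfolding Lin_def by blast
  have "v = (\<Sum>s\<in>var ` X. C (c (the_inv_into X var s)) * s)"
    unfolding c by (subst sum.reindex[OF inj]) (auto intro!: sum.cong simp: the_inv_into_f_f[OF inj])
  then show ?thesis by (rule exI[of _ "\<lambda>s. c (the_inv_into X var s)"])
qed

text \<open>The action of the field on the cotangent space at the origin, realized on linear
  functions by discarding higher terms.\<close>

definition TT :: "(nat \<Rightarrow> ser) \<Rightarrow> ser \<Rightarrow> ser" where
  "TT V F = lin1 (LL V F)"

lemma TT_Lin [simp]: "TT V F \<in> Lin" by (simp add: TT_def)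

lemma LL_linop: "linop (LL V)"
  by (simp add: linop_def)

lemma TT_linop: "linop (TT V)"
  using linop_lin1 by (simp add: linop_def TT_def)

lemma TT_LL:
  assumes V: "fld V" and F: "F \<in> Lin"
  shows "om 2 (LL V F - TT V F)"
  unfolding TT_def by (rule lin1_om2[OF on_LL[OF V Lin_on[OF F]] filtered_om[OF LL_filtered[OF V] Lin_om[OF F]]])

lemma sh_compare:
  assumes V: "fld V" and F: "F \<in> Lin"
  shows "(sh (TT V) \<kappa> ^^ p) F \<in> Lin \<and> om 2 ((sh (LL V) \<kappa> ^^ p) F - (sh (TT V) \<kappa> ^^ p) F)"
proof (induction p)
  case (Suc p)
  let ?A = "(sh (LL V) \<kappa> ^^ p) F" and ?B = "(sh (TT V) \<kappa> ^^ p) F"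
  have B: "?B \<in> Lin" using Suc by blast
  have "sh (TT V) \<kappa> ?B \<in> Lin" using linsub_Lin B by (simp add: sh_def linsub_diff linsub_scale)
  moreover have "om 2 (sh (LL V) \<kappa> (?A - ?B) + (LL V ?B - TT V ?B))"
    using filtered_sh_pow[OF LL_filtered[OF V], of 2 "?A - ?B" 1 \<kappa>] Suc TT_LL[OF V B] by (intro om_add) auto
  then have "om 2 (sh (LL V) \<kappa> ?A - sh (TT V) \<kappa> ?B)" by (simp add: sh_def algebra_simps)
  ultimately show ?case by simp
qed (simp add: F)

lemma TT_commute:
  assumes V: "fld V" and W: "fld W" and c: "\<And>F. LL V (LL W F) = LL W (LL V F)" and F: "F \<in> Lin"
  shows "TT V (TT W F) = TT W (TT V F)"
proof -
  have 1: "om 2 (LL V (LL W F) - TT V (TT W F))" if V: "fld V" and W: "fld W" for V W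
  proof -
    have "om 2 (LL V (LL W F - TT W F) + (LL V (TT W F) - TT V (TT W F)))"
      using filtered_om[OF LL_filtered[OF V] TT_LL[OF W F]] TT_LL[OF V, of "TT W F"] by (intro om_add) auto
    then show ?thesis by simp
  qed
  have "om 2 ((LL W (LL V F) - TT W (TT V F)) - (LL V (LL W F) - TT V (TT W F)))"
    by (rule om_diff[OF 1[OF W V] 1[OF V W]])
  then have "om 2 (TT V (TT W F) - TT W (TT V F))" by (simp add: c)
  then have "TT V (TT W F) - TT W (TT V F) = 0" using linsub_diff[OF linsub_Lin] by (intro Lin_om2) auto
  then show ?thesis by simp
qed

text \<open>Each variable is decomposed for \<open>TT V\<close> and each component again for
  \<open>TT W\<close>. The second components are polynomials in \<open>TT W\<close>, which commutes
  with \<open>TT V\<close>, so they remain generalized eigenvectors of the first operator. Joint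
  eigenvectors therefore span, and a maximal independent set of them has as many members as there
  are variables.\<close>

lemma joint_basis:
  assumes V: "fld V" and W: "fld W" and c: "\<And>F. LL V (LL W F) = LL W (LL V F)"
  shows "\<exists>v l m. (\<forall>i\<in>X. v i \<in> Lin \<and> (\<exists>e. (sh (TT V) (l i) ^^ e) (v i) = 0) \<and> (\<exists>e. (sh (TT W) (m i) ^^ e) (v i) = 0))
    \<and> (\<exists>P. inv_pair X P (jac v))"
proof -
  interpret vs: vector_space "\<lambda>c F. C c * F" by (rule vector_space_ser)
  define J where "J = {v \<in> Lin. (\<exists>\<kappa> e. (sh (TT V) \<kappa> ^^ e) v = 0) \<and> (\<exists>\<kappa> e. (sh (TT W) \<kappa> ^^ e) v = 0)}"
  have fX: "finite (var ` X)" by simp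
  have inj: "inj_on var X" by (rule inj_onI) (metis coef_var unitv_inj zero_neq_one)
  have varJ: "var p \<in> vs.span J" if p: "p \<in> X" for p
  proof -
    obtain K1 u where u: "finite K1" "var p = (\<Sum>\<kappa>\<in>K1. papp (TT V) (u \<kappa>) (var p))"
      "\<forall>\<kappa>\<in>K1. \<exists>e. (sh (TT V) \<kappa> ^^ e) (papp (TT V) (u \<kappa>) (var p)) = 0"
      using fin_decomp[OF TT_linop[of V] linsub_Lin _ fX Lin_span var_Lin[OF p]] by auto
    have "papp (TT V) (u \<kappa>) (var p) \<in> vs.span J" if k: "\<kappa> \<in> K1" for \<kappa>
    proof -
      define w where "w = papp (TT V) (u \<kappa>) (var p)"
      have wL: "w \<in> Lin" unfolding w_def using papp_in[OF linsub_Lin _ var_Lin[OF p]] by simp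
      obtain e where e: "(sh (TT V) \<kappa> ^^ e) w = 0" using u(3) k by (auto simp: w_def)
      obtain K2 u2 where u2: "finite K2" "w = (\<Sum>\<kappa>\<in>K2. papp (TT W) (u2 \<kappa>) w)"
        "\<forall>\<kappa>\<in>K2. \<exists>e. (sh (TT W) \<kappa> ^^ e) (papp (TT W) (u2 \<kappa>) w) = 0"
        using fin_decomp[OF TT_linop[of W] linsub_Lin _ fX Lin_span wL] by auto
      have "papp (TT W) (u2 \<kappa>') w \<in> J" if k': "\<kappa>' \<in> K2" for \<kappa>'
      proof -
        have "(sh (TT V) \<kappa> ^^ e) (papp (TT W) (u2 \<kappa>') w) = papp (TT W) (u2 \<kappa>') ((sh (TT V) \<kappa> ^^ e) w)"
          by (rule papp_commute[OF TT_linop linsub_Lin]) (auto simp: TT_commute[OF V W c] TT_linop wL)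
        then have "(sh (TT V) \<kappa> ^^ e) (papp (TT W) (u2 \<kappa>') w) = 0"
          using e linop_zero[OF linop_papp[OF TT_linop]] by simp
        moreover have "papp (TT W) (u2 \<kappa>') w \<in> Lin" using papp_in[OF linsub_Lin _ wL] by simp
        ultimately show ?thesis using u2(3) k' unfolding J_def by blast
      qed
      then have "(\<Sum>\<kappa>\<in>K2. papp (TT W) (u2 \<kappa>) w) \<in> vs.span J" by (intro vs.span_sum vs.span_base)
      then show ?thesis using u2(2) by (simp add: w_def)
    qed
    then have "(\<Sum>\<kappa>\<in>K1. papp (TT V) (u \<kappa>) (var p)) \<in> vs.span J" by (intro vs.span_sum)
    then show ?thesis using u(2) by simp
  qed
  obtain B where B: "B \<subseteq> J" "vs.independent B" "J \<subseteq> vs.span B"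
    using vs.maximal_independent_subset[of J] by blast
  have varB: "var p \<in> vs.span B" if "p \<in> X" for p
    using varJ[OF that] B(3) vs.span_mono[OF B(3)] by (metis subsetD vs.span_span)
  have "B \<subseteq> vs.span (var ` X)"
  proof
    fix b assume "b \<in> B"
    then have "b \<in> Lin" using B(1) J_def by blast
    then obtain d where "b = (\<Sum>p\<in>X. C (d p) * var p)" unfolding Lin_def by blast
    then show "b \<in> vs.span (var ` X)" by (simp only:) (rule vs.span_sum, rule vs.span_scale, rule vs.span_base, simp)
  qed
  then have finB: "finite B" "card B \<le> card (var ` X)" using vs.independent_span_bound[OF fX B(2)] by auto
  have "vs.independent (var ` X)"
  proof
    assume "vs.dependent (var ` X)"
    then obtain u where u: "\<exists>v\<in>var ` X. u v \<noteq> 0" "(\<Sum>v\<in>var ` X. C (u v) * v) = 0"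
      using vs.dependent_finite[OF fX] by blast
    then have "(\<Sum>p\<in>X. C (u (var p)) * var p) = 0" by (simp add: sum.reindex[OF inj])
    then have "u (var p) = 0" if "p \<in> X" for p using coef_lin[OF that, of "\<lambda>p. u (var p)"] by simp
    then show False using u(1) by blast
  qed
  moreover have "var ` X \<subseteq> vs.span B" using varB by blast
  ultimately have "card (var ` X) \<le> card B" using vs.independent_span_bound[OF finB(1)] by blast
  then have "card B = card X" using finB(2) card_image[OF inj] by simp
  then obtain v where v: "bij_betw v X B" using finite_same_card_bij[of X B] finB by auto
  have "\<exists>u. var p = (\<Sum>i\<in>X. C (u i) * v i)" if p: "p \<in> X" for p
  proof -
    have "var p \<in> range (\<lambda>u. \<Sum>b\<in>B. C (u b) * b)" using varB[OF p] vs.span_finite[OF finB(1)] by simp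
    then obtain u where "var p = (\<Sum>b\<in>B. C (u b) * b)" by (rule rangeE)
    also have "\<dots> = (\<Sum>i\<in>X. C (u (v i)) * v i)" by (rule sum.reindex_bij_betw[OF v, symmetric])
    finally show ?thesis by (rule exI[of _ "\<lambda>i. u (v i)"])
  qed
  then obtain P where P: "\<And>p. p \<in> X \<Longrightarrow> var p = (\<Sum>i\<in>X. C (P p i) * v i)" by metis
  have "inv_pair X P (jac v)"
  proof (rule left_inverse_inv_pair)
    fix p q assume pq: "p \<in> X" "q \<in> X"
    have "(\<Sum>i\<in>X. P p i * jac v i q) = coef (\<Sum>i\<in>X. C (P p i) * v i) (unitv q)" by (simp add: jac_def)
    then show "(\<Sum>i\<in>X. P p i * jac v i q) = (if p = q then 1 else 0)"
      unfolding P[OF pq(1), symmetric] by (simp add: coef_var)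
  qed simp
  moreover have "v i \<in> J" if "i \<in> X" for i using v B(1) that bij_betwE by blast
  then have "\<forall>i\<in>X. \<exists>l m. v i \<in> Lin \<and> (\<exists>e. (sh (TT V) l ^^ e) (v i) = 0) \<and> (\<exists>e. (sh (TT W) m ^^ e) (v i) = 0)"
    unfolding J_def by blast
  then obtain l m where "\<And>i. i \<in> X \<Longrightarrow> v i \<in> Lin \<and> (\<exists>e. (sh (TT V) (l i) ^^ e) (v i) = 0) \<and> (\<exists>e. (sh (TT W) (m i) ^^ e) (v i) = 0)"
    by metis
  ultimately show ?thesis by blast
qed

text \<open>The linear function is lifted for \<open>V\<close> first and the result for
  \<open>W\<close>. The second lift is a limit of polynomials in \<open>LL W\<close> applied to the
  first one; these stay in the generalized eigenspace of \<open>V\<close>, which is closed.\<close>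

lemma joint_lift:
  assumes V: "fld V" and W: "fld W" and c: "\<And>F. LL V (LL W F) = LL W (LL V F)" and v: "v \<in> Lin"
    and e: "(sh (TT V) \<kappa> ^^ e) v = 0" and e': "(sh (TT W) \<mu> ^^ e') v = 0"
  shows "\<exists>y. on X y \<and> om 2 (y - v) \<and> y \<in> geig (LL V) \<kappa> \<and> y \<in> geig (LL W) \<mu>"
proof -
  note fV = LL_filtered[OF V] and fW = LL_filtered[OF W]
  have onV: "on X (papp (LL V) u F)" if "on X F" for u F
    using papp_in[OF linsub_on, of X "LL V" F u] on_LL[OF V] that by simp
  have onW: "on X (papp (LL W) u F)" if "on X F" for u F
    using papp_in[OF linsub_on, of X "LL W" F u] on_LL[OF W] that by simp
  have 1: "om 2 ((sh (LL V) \<kappa> ^^ e) v)" using sh_compare[OF V v, of e \<kappa>] by (simp add: e)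
  have 2: "om 2 ((sh (LL W) \<mu> ^^ e') v)" using sh_compare[OF W v, of e' \<mu>] by (simp add: e')
  obtain y1 where y1: "om 2 (y1 - v)" "y1 \<in> geig (LL V) \<kappa>" "\<And>d. \<exists>u. om d (y1 - papp (LL V) u v)"
    using geig_lift[OF fV _ on_LL[OF V] Lin_on[OF v] 1] by auto
  have on1: "on X y1" by (rule on_limit) (use y1(3) onV Lin_on[OF v] in blast)
  have "om 2 ((sh (LL W) \<mu> ^^ e') (y1 - v) + (sh (LL W) \<mu> ^^ e') v)"
    using filtered_sh_pow[OF fW y1(1)] 2 by (intro om_add)
  then have 3: "om 2 ((sh (LL W) \<mu> ^^ e') y1)" by (simp add: sh_pow_lin[OF LL_linop])
  obtain y where y: "om 2 (y - y1)" "y \<in> geig (LL W) \<mu>" "\<And>d. \<exists>u. om d (y - papp (LL W) u y1)"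
    using geig_lift[OF fW _ on_LL[OF W] on1 3] by auto
  have "on X y" by (rule on_limit) (use y(3) onW on1 in blast)
  moreover have "om 2 (y - v)" using om_add[OF y(1) y1(1)] by simp
  moreover have "y \<in> geig (LL V) \<kappa>"
  proof (rule geig_closed[OF fV])
    fix d
    obtain u where u: "om d (y - papp (LL W) u y1)" using y(3) by blast
    have "papp (LL W) u y1 \<in> geig (LL V) \<kappa>"
    proof (rule papp_in[of "geig (LL V) \<kappa>" "LL W"])
      show "LL W F \<in> geig (LL V) \<kappa>" if "F \<in> geig (LL V) \<kappa>" for F
        using geig_commute[of "LL V" "LL W" F \<kappa>] fV fW c that by simp
    qed (use linsub_geig[OF fV] y1(2) in simp_all)
    then show "\<exists>G\<in>geig (LL V) \<kappa>. om d (y - G)" using u by blast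
  qed
  ultimately show ?thesis using y(2) by blast
qed

lemma joint_coords:
  assumes V: "fld V" and W: "fld W" and c: "\<And>F. LL V (LL W F) = LL W (LL V F)"
  shows "\<exists>y v l m. xcoords y \<and> (\<forall>i\<in>X. y i \<in> geig (LL V) (l i) \<and> y i \<in> geig (LL W) (m i) \<and>
     v i \<in> Lin \<and> om 2 (y i - v i) \<and> (\<exists>e. (sh (TT V) (l i) ^^ e) (v i) = 0))"
proof -
  obtain v l m where v: "\<And>i. i \<in> X \<Longrightarrow> v i \<in> Lin \<and> (\<exists>e. (sh (TT V) (l i) ^^ e) (v i) = 0) \<and> (\<exists>e. (sh (TT W) (m i) ^^ e) (v i) = 0)"
    and P: "\<exists>P. inv_pair X P (jac v)" using joint_basis[OF V W c] by blast
  have "\<forall>i\<in>X. \<exists>y. on X y \<and> om 2 (y - v i) \<and> y \<in> geig (LL V) (l i) \<and> y \<in> geig (LL W) (m i)"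
    using joint_lift[OF V W c] v by meson
  then obtain y where y: "\<And>i. i \<in> X \<Longrightarrow> on X (y i) \<and> om 2 (y i - v i) \<and> y i \<in> geig (LL V) (l i) \<and> y i \<in> geig (LL W) (m i)"
    by metis
  have "jac y i j = jac v i j" if "i \<in> X" for i j
    using y[OF that] by (auto simp: jac_def om2_iff)
  then have "\<exists>P. inv_pair X P (jac y)" using P inv_pair_cong[of X] by metis
  moreover have "om 1 (y i)" if "i \<in> X" for i
    using om_add[of 1 "y i - v i" "v i"] y[OF that] v[OF that] Lin_om[of "v i"] om_mono[of 2 "y i - v i" 1] by simp
  ultimately have "xcoords y" using y by (simp add: xcoords_def)
  then show ?thesis using y v by blast
qed

subsection \<open>Weighted Darboux coordinates\<close>

lemma wt_add: "wt k \<mu> (a + b) = wt k \<mu> a + wt k \<mu> b"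
  by (simp add: wt_def algebra_simps sum.distrib)

lemma wt_unitv: "i < k \<Longrightarrow> wt k \<mu> (unitv i) = \<mu> i"
proof -
  assume "i < k"
  moreover have "wt k \<mu> (unitv i) = (\<Sum>j<k. if j = i then \<mu> j else 0)"
    unfolding wt_def unitv_def by (rule sum.cong) auto
  ultimately show ?thesis by simp
qed

lemma wtd_zero [simp]: "wtd k \<mu> \<chi> 0" by (simp add: wtd_def)
lemma wtd_add: "wtd k \<mu> \<chi> F \<Longrightarrow> wtd k \<mu> \<chi> G \<Longrightarrow> wtd k \<mu> \<chi> (F + G)"
  unfolding wtd_def by (metis add_0 coef_simps(2))
lemma wtd_uminus: "wtd k \<mu> \<chi> F \<Longrightarrow> wtd k \<mu> \<chi> (- F)" by (simp add: wtd_def)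
lemma wtd_diff: "wtd k \<mu> \<chi> F \<Longrightarrow> wtd k \<mu> \<chi> G \<Longrightarrow> wtd k \<mu> \<chi> (F - G)"
  using wtd_add[of k \<mu> \<chi> F "- G"] wtd_uminus by simp
lemma wtd_C_mult: "(c \<noteq> 0 \<Longrightarrow> wtd k \<mu> \<chi> F) \<Longrightarrow> wtd k \<mu> \<chi> (C c * F)" by (auto simp: wtd_def)
lemma wtd_sum: "(\<And>i. i \<in> A \<Longrightarrow> wtd k \<mu> \<chi> (f i)) \<Longrightarrow> wtd k \<mu> \<chi> (sum f A)"
  by (induction A rule: infinite_finite_induct) (auto intro: wtd_add)
lemma wtd_mult:
  assumes "wtd k \<mu> \<chi> F" "wtd k \<mu> \<psi> G" shows "wtd k \<mu> (\<chi> + \<psi>) (F * G)"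
  unfolding wtd_def
proof (intro allI impI)
  fix a assume "coef (F * G) a \<noteq> 0"
  then obtain b where "b \<le> a" "coef F b \<noteq> 0" "coef G (a - b) \<noteq> 0"
    unfolding coef_mult by (metis (no_types, lifting) atMost_iff mult_zero_left mult_zero_right sum.neutral)
  then show "wt k \<mu> a = \<chi> + \<psi>" using assms wt_add[of k \<mu> b "a - b"] by (simp add: wtd_def minus_plus_exp)
qed
lemma wtd_pd: "i < k \<Longrightarrow> wtd k \<mu> \<chi> F \<Longrightarrow> wtd k \<mu> (\<chi> - \<mu> i) (pd i F)"
  unfolding wtd_def coef_pd using wt_add[of k \<mu> _ "unitv i"] wt_unitv[of i k \<mu>]
  by (metis add_diff_cancel_right' mult_zero_right)
lemma wtd_var: "i < k \<Longrightarrow> wtd k \<mu> (\<mu> i) (var i)"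
  by (auto simp: wtd_def coef_var wt_unitv)
lemma wtd_limit: assumes "\<And>d. \<exists>G. wtd k \<mu> \<chi> G \<and> om d (F - G)" shows "wtd k \<mu> \<chi> F"
  unfolding wtd_def
proof (intro allI impI)
  fix a assume a: "coef F a \<noteq> 0"
  obtain G where "wtd k \<mu> \<chi> G" "om (Suc (deg a)) (F - G)" using assms by blast
  moreover have "finite (supp a)" using a coef_inf by blast
  ultimately show "wt k \<mu> a = \<chi>" using a unfolding wtd_def om_def by auto
qed

text \<open>Weights on the tangent bundle: the differential preserves weights, so dx_i gets the
  weight of x_i, and \<theta> gets weight zero.\<close>

definition tw :: "(nat \<Rightarrow> complex) \<Rightarrow> nat \<Rightarrow> complex" where
  "tw l i = (if i = 0 then 0 else if i \<in> X then l i else l (i - 2 * n))"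

lemma tw_simps [simp]: "tw l 0 = 0" "i \<in> X \<Longrightarrow> tw l i = l i" "i \<in> X \<Longrightarrow> tw l (2 * n + i) = l i"
  by (auto simp: tw_def)

text \<open>A matrix respecting a grading has an inverse respecting it. Deleting the entries of
  \<open>P\<close> in the wrong positions leaves a left inverse of \<open>M\<close>, which must then
  be \<open>P\<close> itself.\<close>

lemma weighted_inverse:
  assumes IP: "inv_pair X P M" and M: "\<And>i j. i \<in> X \<Longrightarrow> j \<in> X \<Longrightarrow> M i j \<noteq> 0 \<Longrightarrow> L i = (L' j :: complex)"
    and ij: "i \<in> X" "j \<in> X" "P i j \<noteq> 0"
  shows "L' i = L j"
proof -
  define P' where "P' i j = (if L' i = L j then P i j else 0)" for i j
  have P'M: "mm X P' M a b = (if a = b then 1 else 0)" if ab: "a \<in> X" "b \<in> X" for a b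
  proof (cases "L' a = L' b")
    case True
    have "mm X P' M a b = mm X P M a b"
      unfolding mm_def
    proof (rule sum.cong)
      fix k assume k: "k \<in> X"
      show "P' a k * M k b = P a k * M k b"
        using M[OF k ab(2)] True by (cases "M k b = 0") (auto simp: P'_def)
    qed simp
    then show ?thesis using IP ab by (simp add: inv_pair_def mm_def)
  next
    case False
    have "P' a k * M k b = 0" if k: "k \<in> X" for k
      using M[OF k ab(2)] False by (cases "M k b = 0") (auto simp: P'_def)
    then have "mm X P' M a b = 0" unfolding mm_def by (intro sum.neutral) simp
    then show ?thesis using False by auto
  qed
  have "P' i j = mm X P' (mm X M P) i j" by (rule mm_inv_right(2)[OF IP, symmetric]) (use ij in auto)
  also have "\<dots> = mm X (mm X P' M) P i j" by (simp add: mm_assoc)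
  also have "\<dots> = (\<Sum>k\<in>X. if i = k then P k j else 0)"
    unfolding mm_def[of X "mm X P' M"] using P'M ij by (intro sum.cong) auto
  also have "\<dots> = P i j" using ij by simp
  finally have "P' i j = P i j" .
  then show ?thesis using ij(3) by (auto simp: P'_def split: if_splits)
qed

text \<open>Seek new coordinates w = x + u. With \<open>A\<close> the linear part of the
  coefficients, \<open>b\<close> the rest and \<open>q u\<close> the coefficients of the form
  quadratic in \<open>u\<close>, the equation for \<open>u\<close> becomes (A - A^T) u = b - q(u).
  It is contracting because \<open>u\<close> has order 2, and every term respects the weights, so
  the solution does too. The boolean \<open>t\<close> indexes the two gradings to be respected at
  once.\<close>

lemma darboux:
  fixes h :: "nat \<Rightarrow> ser" and L :: "bool \<Rightarrow> nat \<Rightarrow> complex" and c :: "bool \<Rightarrow> complex"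
  defines "A \<equiv> \<lambda>i j. coef (h i) (unitv j)"
  assumes h: "\<And>i. i \<in> X \<Longrightarrow> on X (h i) \<and> om 1 (h i)"
    and wth: "\<And>i t. i \<in> X \<Longrightarrow> wtd K (tw (L t)) (c t - L t i) (h i)"
    and IP: "inv_pair X P (\<lambda>i j. A i j - A j i)"
  obtains w R where "\<And>i. i \<in> X \<Longrightarrow> on X (w i) \<and> om 2 (w i - var i) \<and> (\<forall>t. wtd K (tw (L t)) (L t i) (w i))"
    "on X R" "om 3 R" "\<And>t. wtd K (tw (L t)) (c t) R"
    "fm h = (\<Sum>i\<in>X. \<Sum>j\<in>X. C (A i j) * (w j * dd (w i))) + dd R"
proof -
  have wA: "L t i + L t j = c t" if "i \<in> X" "j \<in> X" "A i j \<noteq> 0" for i j t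
  proof -
    have "wt K (tw (L t)) (unitv j) = c t - L t i" using wth[OF that(1), of t] that(3) by (simp add: wtd_def A_def)
    then show ?thesis using that by (simp add: wt_unitv algebra_simps)
  qed
  have wP: "L t i + L t j = c t" if "i \<in> X" "j \<in> X" "P i j \<noteq> 0" for i j t
  proof -
    have "c t - L t i = L t j"
    proof (rule weighted_inverse[OF IP _ that])
      fix i j assume "i \<in> X" "j \<in> X" "A i j - A j i \<noteq> 0"
      then show "L t i = c t - L t j" using wA[of i j t] wA[of j i t] by (cases "A i j = 0") (auto simp: algebra_simps)
    qed
    then show ?thesis by (simp add: algebra_simps)
  qed
  define b where "b i = h i - (\<Sum>j\<in>X. C (A i j) * var j)" for i
  have b2: "om 2 (b i)" if "i \<in> X" for i
    unfolding b_def A_def using h[OF that] by (intro om2_linear) auto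
  have bon: "on X (b i)" if "i \<in> X" for i
    unfolding b_def using h[OF that] by (intro on_diff on_sum on_mult) auto
  have bwt: "wtd K (tw (L t)) (c t - L t i) (b i)" if "i \<in> X" for i t
    unfolding b_def
  proof (intro wtd_diff wtd_sum wtd_C_mult)
    fix j assume j: "j \<in> X" "A i j \<noteq> 0"
    then have "c t - L t i = tw (L t) j" using wA[OF that, of j t] by (simp add: algebra_simps)
    then show "wtd K (tw (L t)) (c t - L t i) (var j)" using j wtd_var[of j K "tw (L t)"] by simp
  qed (use wth that in auto)
  define q where "q u i = (\<Sum>k\<in>X. \<Sum>l\<in>X. C (A k l) * (u l * pd i (u k)))" for u :: "nat \<Rightarrow> ser" and i
  define T where "T u j = (if j \<in> X then \<Sum>i\<in>X. C (P j i) * (b i - q u i) else 0)" for u j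
  define good where "good u \<longleftrightarrow> (\<forall>i. on X (u i) \<and> om 2 (u i) \<and> (i \<in> X \<longrightarrow> (\<forall>t. wtd K (tw (L t)) (L t i) (u i))))"
    for u :: "nat \<Rightarrow> ser"
  obtain u where g: "good u" and fp: "T u = u"
  proof (rule contraction_fixpoint[of good "\<lambda>_. 0" T])
    show "good (\<lambda>_. 0)" by (simp add: good_def)
    show "good (T u)" if u: "good u" for u
    proof -
      have u': "on X (u i)" "om 2 (u i)" for i using u by (auto simp: good_def)
      have uw: "wtd K (tw (L t)) (L t i) (u i)" if "i \<in> X" for i t using u that by (auto simp: good_def)
      have "on X (q u i)" for i
        unfolding q_def using u' by (intro on_sum on_mult on_pd) auto
      moreover have "om 2 (q u i)" for i
        unfolding q_def by (rule om_sum, rule om_sum, rule om_mult_left, rule om_mult_right, rule u'(2))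
      moreover have qw: "wtd K (tw (L t)) (c t - L t i) (q u i)" if i: "i \<in> X" for i t
        unfolding q_def
      proof (intro wtd_sum wtd_C_mult)
        fix k l assume kl: "k \<in> X" "l \<in> X" "A k l \<noteq> 0"
        have "wtd K (tw (L t)) (L t l + (L t k - tw (L t) i)) (u l * pd i (u k))"
          using kl i by (intro wtd_mult wtd_pd uw) auto
        moreover have "L t l + (L t k - tw (L t) i) = c t - L t i" using wA[OF kl] i by (simp add: algebra_simps flip: wA[OF kl])
        ultimately show "wtd K (tw (L t)) (c t - L t i) (u l * pd i (u k))" by simp
      qed
      moreover have "wtd K (tw (L t)) (L t j) (T u j)" if j: "j \<in> X" for j t
        unfolding T_def using j
      proof (simp, intro wtd_sum wtd_C_mult)
        fix i assume i: "i \<in> X" "P j i \<noteq> 0"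
        then have "L t j = c t - L t i" using wP[OF j i, of t] by (simp add: algebra_simps)
        then show "wtd K (tw (L t)) (L t j) (b i - q u i)" using bwt[OF i(1)] qw[OF i(1)] by (simp add: wtd_diff)
      qed
      ultimately show ?thesis unfolding good_def using bon b2
        by (auto simp: T_def intro!: on_sum on_mult on_diff om_sum om_mult_left om_diff)
    qed
    show "good u" if lim: "\<And>d. \<exists>v. good v \<and> (\<forall>i. om d (u i - v i))" for u
      unfolding good_def
    proof (intro allI conjI impI)
      fix i t
      obtain v where "good v" "\<forall>i. om 2 (u i - v i)" using lim by blast
      then show "om 2 (u i)" using om_add[of 2 "u i - v i" "v i"] by (simp add: good_def)
      show "on X (u i)" by (rule on_limit) (use lim good_def in blast)
      show "wtd K (tw (L t)) (L t i) (u i)" if "i \<in> X" by (rule wtd_limit) (use lim good_def that in blast)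
    qed
    show "om (Suc d) (T u j - T v j)" if gd: "good u" "good v" "\<And>i. om d (u i - v i)" for u v d j
    proof (cases "j \<in> X")
      case True
      have qd: "om (Suc d) (q u i - q v i)" for i
      proof -
        have "om (Suc d) (u l * pd i (u k) - v l * pd i (v k))" for k l
        proof -
          have "om 1 (pd i (u k))" using om_pd_Suc[of 1 "u k"] gd(1) by (simp add: good_def numeral_2_eq_2)
          then have "om (d + 1) ((u l - v l) * pd i (u k))" by (intro om_mult gd)
          moreover have "om (2 + (d - 1)) (v l * pd i (u k - v k))"
            using gd(2) by (intro om_mult om_pd gd(3)) (simp add: good_def)
          then have "om (Suc d) (v l * pd i (u k - v k))" by (rule om_mono) simp
          ultimately have "om (Suc d) ((u l - v l) * pd i (u k) + v l * pd i (u k - v k))" by (intro om_add) auto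
          then show ?thesis by (simp add: algebra_simps)
        qed
        then have "om (Suc d) (\<Sum>k\<in>X. \<Sum>l\<in>X. C (A k l) * (u l * pd i (u k) - v l * pd i (v k)))"
          by (rule_tac om_sum, rule_tac om_sum, rule_tac om_mult_left)
        then show ?thesis by (simp add: q_def sum_subtractf right_diff_distrib)
      qed
      have "T u j - T v j = (\<Sum>i\<in>X. C (P j i) * (- (q u i - q v i)))"
        using True by (simp add: T_def sum_subtractf right_diff_distrib sum_negf)
      moreover have "om (Suc d) (\<Sum>i\<in>X. C (P j i) * (- (q u i - q v i)))"
        using qd by (rule_tac om_sum, rule_tac om_mult_left, rule_tac om_uminus)
      ultimately show ?thesis by simp
    qed (simp add: T_def)
  qed
  have u': "on X (u i)" "om 2 (u i)" for i using g by (auto simp: good_def)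
  have uw: "wtd K (tw (L t)) (L t i) (u i)" if "i \<in> X" for i t using g that by (auto simp: good_def)
  have eq: "(\<Sum>j\<in>X. C (A i j - A j i) * u j) = b i - q u i" if i: "i \<in> X" for i
  proof -
    have "u j = (\<Sum>i\<in>X. C (P j i) * (b i - q u i))" if "j \<in> X" for j
      using fun_cong[OF fp, of j] that by (simp add: T_def)
    then have "(\<Sum>j\<in>X. C (A i j - A j i) * u j) = (\<Sum>j\<in>X. C (A i j - A j i) * (\<Sum>l\<in>X. C (P j l) * (b l - q u l)))"
      by (simp cong: sum.cong del: C_simps)
    also have "\<dots> = b i - q u i" by (rule inv_pair_solve[OF IP _ i]) simp
    finally show ?thesis .
  qed
  define w where "w i = var i + u i" for i
  \<comment> \<open>This exact correction cancels the terms in which \<open>var j\<close> multiplies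
    the differential of \<open>u i\<close>. A derivative of \<open>u\<close> occurring linearly
    would lose an order and destroy the contraction.\<close>
  define R where "R = - (\<Sum>i\<in>X. \<Sum>j\<in>X. C (A i j) * (var j * u i))"
  have 1: "on X (w i) \<and> om 2 (w i - var i) \<and> (\<forall>t. wtd K (tw (L t)) (L t i) (w i))" if "i \<in> X" for i
    using that u' uw wtd_var[of i K "tw (L t)" for t] unfolding w_def by (auto intro!: on_add wtd_add)
  have 2: "on X R" unfolding R_def using u' by (intro on_uminus on_sum on_mult) auto
  have "om (1 + 2) (var j * u i)" for i j by (intro om_mult om_var u')
  then have 3: "om 3 R" unfolding R_def by (rule_tac om_uminus, rule_tac om_sum, rule_tac om_sum, rule_tac om_mult_left) (simp add: numeral_3_eq_3)
  have 4: "wtd K (tw (L t)) (c t) R" for t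
    unfolding R_def
  proof (intro wtd_uminus wtd_sum wtd_C_mult)
    fix i j assume ij: "i \<in> X" "j \<in> X" "A i j \<noteq> 0"
    have "wtd K (tw (L t)) (tw (L t) j + L t i) (var j * u i)" using ij by (intro wtd_mult wtd_var uw) auto
    then show "wtd K (tw (L t)) (c t) (var j * u i)" using wA[OF ij, of t] ij by (simp add: add.commute)
  qed
  have termw: "C a * (w j * dd (w i)) - dd (C a * (var j * u i))
      = C a * (var j * var (2 * n + i)) + C a * (u j * var (2 * n + i)) - C a * (u i * var (2 * n + j)) + C a * (u j * dd (u i))"
    if "i \<in> X" "j \<in> X" for i j a
    using that by (simp add: w_def dd_var algebra_simps)
  have "(\<Sum>i\<in>X. \<Sum>j\<in>X. C (A i j) * (w j * dd (w i))) + dd R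
      = (\<Sum>i\<in>X. \<Sum>j\<in>X. C (A i j) * (w j * dd (w i)) - dd (C (A i j) * (var j * u i)))"
    unfolding R_def by (simp only: dd_uminus dd_sum sum_subtractf) simp
  also have "\<dots> = (\<Sum>i\<in>X. \<Sum>j\<in>X. C (A i j) * (var j * var (2 * n + i)) + C (A i j) * (u j * var (2 * n + i))
      - C (A i j) * (u i * var (2 * n + j)) + C (A i j) * (u j * dd (u i)))"
    by (intro sum.cong refl) (rule termw)
  also have "\<dots> = (\<Sum>i\<in>X. \<Sum>j\<in>X. C (A i j) * (var j * var (2 * n + i))) + (\<Sum>i\<in>X. \<Sum>j\<in>X. C (A i j) * (u j * var (2 * n + i)))
      - (\<Sum>i\<in>X. \<Sum>j\<in>X. C (A i j) * (u i * var (2 * n + j))) + (\<Sum>i\<in>X. \<Sum>j\<in>X. C (A i j) * (u j * dd (u i)))"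
    by (simp only: sum.distrib sum_subtractf)
  also have "(\<Sum>i\<in>X. \<Sum>j\<in>X. C (A i j) * (u i * var (2 * n + j))) = (\<Sum>i\<in>X. \<Sum>j\<in>X. C (A j i) * (u j * var (2 * n + i)))"
    by (rule sum.swap)
  also have "(\<Sum>i\<in>X. \<Sum>j\<in>X. C (A i j) * (u j * dd (u i))) = (\<Sum>p\<in>X. q u p * var (2 * n + p))"
  proof -
    have "(\<Sum>p\<in>X. q u p * var (2 * n + p)) = (\<Sum>p\<in>X. \<Sum>i\<in>X. \<Sum>j\<in>X. C (A i j) * (u j * pd p (u i)) * var (2 * n + p))"
      by (simp add: q_def sum_distrib_right)
    also have "\<dots> = (\<Sum>i\<in>X. \<Sum>p\<in>X. \<Sum>j\<in>X. C (A i j) * (u j * pd p (u i)) * var (2 * n + p))" by (rule sum.swap)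
    also have "\<dots> = (\<Sum>i\<in>X. \<Sum>j\<in>X. \<Sum>p\<in>X. C (A i j) * (u j * pd p (u i)) * var (2 * n + p))"
      by (rule sum.cong[OF refl], rule sum.swap)
    finally show ?thesis by (simp add: dd_def sum_distrib_left mult_ac)
  qed
  also have "(\<Sum>i\<in>X. \<Sum>j\<in>X. C (A i j) * (var j * var (2 * n + i))) + (\<Sum>i\<in>X. \<Sum>j\<in>X. C (A i j) * (u j * var (2 * n + i)))
      - (\<Sum>i\<in>X. \<Sum>j\<in>X. C (A j i) * (u j * var (2 * n + i))) + (\<Sum>p\<in>X. q u p * var (2 * n + p))
      = (\<Sum>i\<in>X. ((\<Sum>j\<in>X. C (A i j) * var j) + (\<Sum>j\<in>X. C (A i j - A j i) * u j) + q u i) * var (2 * n + i))"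
    by (simp add: sum.distrib sum_distrib_right distrib_right left_diff_distrib sum_subtractf mult.assoc)
  also have "\<dots> = (\<Sum>i\<in>X. h i * var (2 * n + i))"
  proof (rule sum.cong)
    fix i assume i: "i \<in> X"
    have "(\<Sum>j\<in>X. C (A i j) * var j) + (\<Sum>j\<in>X. C (A i j - A j i) * u j) + q u i = h i"
      unfolding eq[OF i] by (simp add: b_def)
    then show "((\<Sum>j\<in>X. C (A i j) * var j) + (\<Sum>j\<in>X. C (A i j - A j i) * u j) + q u i) * var (2 * n + i) = h i * var (2 * n + i)"
      by simp
  qed simp
  finally have 5: "fm h = (\<Sum>i\<in>X. \<Sum>j\<in>X. C (A i j) * (w j * dd (w i))) + dd R" by (simp add: fm_def)
  show ?thesis by (rule that[OF 1 2 3 4 5])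
qed

end

subsection \<open>The linear part of the form\<close>

lemma linsub_nil:
  assumes T: "linop T"
  shows "linsub {v. \<exists>e. (sh T \<kappa> ^^ e) v = 0}"
  unfolding linsub_def
proof (intro conjI ballI allI)
  show "0 \<in> {v. \<exists>e. (sh T \<kappa> ^^ e) v = 0}" by (auto intro: exI[of _ 0])
  fix F assume "F \<in> {v. \<exists>e. (sh T \<kappa> ^^ e) v = 0}"
  then obtain e where e: "(sh T \<kappa> ^^ e) F \<in> {0}" by auto
  then have "(sh T \<kappa> ^^ e) (C c * F) = 0" for c by (simp add: sh_pow_lin(3)[OF T])
  then show "C c * F \<in> {v. \<exists>e. (sh T \<kappa> ^^ e) v = 0}" for c by blast
  fix G assume "G \<in> {v. \<exists>e. (sh T \<kappa> ^^ e) v = 0}"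
  then obtain e' where e': "(sh T \<kappa> ^^ e') G \<in> {0}" by auto
  have "(sh T \<kappa> ^^ max e e') F \<in> {0}" "(sh T \<kappa> ^^ max e e') G \<in> {0}"
    using e e' sh_pow_mono[OF linsub_0, of T] linop_zero[OF T] by auto
  then have "(sh T \<kappa> ^^ max e e') (F + G) = 0" using sh_pow_lin(1)[OF T] by simp
  then show "F + G \<in> {v. \<exists>e. (sh T \<kappa> ^^ e) v = 0}" by blast
qed

context tangent
begin

text \<open>For \<open>q = p + 1\<close> the sums are empty, which leaves 0 for
  \<open>\<tau> = 0\<close> and the negative of the square of \<open>var p\<close> for
  \<open>\<tau> = 1\<close>.\<close>

definition Qblk :: "nat \<Rightarrow> nat \<Rightarrow> nat \<Rightarrow> ser" where
  "Qblk \<tau> p q =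
    (if \<tau> = 0 then \<Sum>j\<in>{p..<q - 1}. var (j + 1) * var (n + j)
     else if \<tau> = 1 then C 2 * (\<Sum>j\<in>{p..<q - 1}. var j * var (n + j + 1)) + C ((-1) ^ (q - p)) * var (q - 1) ^ 2
     else C 2 * (\<Sum>j\<in>{p..<q - 1}. var j * var (n + j + 1)))"

definition Qtot :: "nat \<Rightarrow> (nat \<Rightarrow> nat) \<Rightarrow> (nat \<Rightarrow> nat) \<Rightarrow> ser" where
  "Qtot k ns \<tau> = (\<Sum>s\<in>{1..k}. Qblk (\<tau> s) (ns s) (ns (s + 1)))"

lemma Qblk_on:
  assumes "1 \<le> p" "p < q"
  shows "on ({p..<q} \<union> (+) n ` {p..<q}) (Qblk \<tau> p q)"
proof -
  have v: "var j * var (n + j + 1) = var j * var (n + (j + 1))" for j by (simp add: add.assoc)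
  show ?thesis
    unfolding Qblk_def v using assms
    by (auto intro!: on_sum on_mult on_add on_var on_power)
qed

lemma Qblk_pd:
  assumes p: "1 \<le> p" and q: "q \<le> n + 1" and j: "p \<le> j" "j < q"
  shows "pd (n + j) (Qblk \<tau> p q) = (if \<tau> = 0 then (if j + 1 < q then var (j + 1) else 0) else (if p < j then C 2 * var (j - 1) else 0))"
    and "pd j (Qblk \<tau> p q) = (if \<tau> = 0 then (if p < j then var (n + j - 1) else 0)
      else (if j + 1 < q then C 2 * var (n + j + 1) else if \<tau> = 1 then C (2 * (-1) ^ (q - p)) * var (q - 1) else 0))"
proof -
  have a1: "(\<Sum>i\<in>{p..<q - 1}. pd (n + j) (var (i + 1) * var (n + i))) = (if j + 1 < q then var (j + 1) else 0)"
  proof -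
    have "(\<Sum>i\<in>{p..<q - 1}. pd (n + j) (var (i + 1) * var (n + i))) = (\<Sum>i\<in>{p..<q - 1}. if i = j then var (j + 1) else 0)"
      using j p q by (intro sum.cong) (auto simp: pd_var)
    also have "\<dots> = (if j \<in> {p..<q - 1} then var (j + 1) else 0)" by simp
    finally show ?thesis using j by auto
  qed
  have a2: "(\<Sum>i\<in>{p..<q - 1}. pd j (var (i + 1) * var (n + i))) = (if p < j then var (n + j - 1) else 0)"
  proof -
    have "(\<Sum>i\<in>{p..<q - 1}. pd j (var (i + 1) * var (n + i))) = (\<Sum>i\<in>{p..<q - 1}. if i = j - 1 then (if p < j then var (n + j - 1) else 0) else 0)"
      using j p q by (intro sum.cong) (auto simp: pd_var)
    also have "\<dots> = (if j - 1 \<in> {p..<q - 1} then (if p < j then var (n + j - 1) else 0) else 0)" by simp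
    finally show ?thesis using j p by auto
  qed
  have b1: "(\<Sum>i\<in>{p..<q - 1}. pd (n + j) (var i * var (n + i + 1))) = (if p < j then var (j - 1) else 0)"
  proof -
    have "(\<Sum>i\<in>{p..<q - 1}. pd (n + j) (var i * var (n + i + 1))) = (\<Sum>i\<in>{p..<q - 1}. if i = j - 1 then (if p < j then var (j - 1) else 0) else 0)"
      using j p q by (intro sum.cong) (auto simp: pd_var)
    also have "\<dots> = (if j - 1 \<in> {p..<q - 1} then (if p < j then var (j - 1) else 0) else 0)" by simp
    finally show ?thesis using j p by auto
  qed
  have b2: "(\<Sum>i\<in>{p..<q - 1}. pd j (var i * var (n + i + 1))) = (if j + 1 < q then var (n + j + 1) else 0)"
  proof -
    have "(\<Sum>i\<in>{p..<q - 1}. pd j (var i * var (n + i + 1))) = (\<Sum>i\<in>{p..<q - 1}. if i = j then var (n + j + 1) else 0)"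
      using j p q by (intro sum.cong) (auto simp: pd_var)
    also have "\<dots> = (if j \<in> {p..<q - 1} then var (n + j + 1) else 0)" by simp
    finally show ?thesis using j by auto
  qed
  have sq: "pd i (var (q - 1) ^ 2) = (if i = q - 1 then C 2 * var (q - 1) else 0)" for i
    by (simp add: pd_power pd_var C_of_nat[of 2, simplified])
  define A where "A = (\<Sum>j\<in>{p..<q - 1}. var (j + 1) * var (n + j))"
  define B where "B = (\<Sum>j\<in>{p..<q - 1}. var j * var (n + j + 1))"
  define S where "S = var (q - 1) ^ 2"
  have Q: "Qblk \<tau> p q = (if \<tau> = 0 then A else if \<tau> = 1 then C 2 * B + C ((-1) ^ (q - p)) * S else C 2 * B)"
    by (simp add: Qblk_def A_def B_def S_def)
  have A1: "pd (n + j) A = (if j + 1 < q then var (j + 1) else 0)" unfolding A_def pd_sum by (rule a1)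
  have A2: "pd j A = (if p < j then var (n + j - 1) else 0)" unfolding A_def pd_sum by (rule a2)
  have B1: "pd (n + j) B = (if p < j then var (j - 1) else 0)" unfolding B_def pd_sum by (rule b1)
  have B2: "pd j B = (if j + 1 < q then var (n + j + 1) else 0)" unfolding B_def pd_sum by (rule b2)
  have S: "pd i S = (if i = q - 1 then C 2 * var (q - 1) else 0)" for i unfolding S_def by (rule sq)
  have "n + j \<noteq> q - 1" using j p q by auto
  then show "pd (n + j) (Qblk \<tau> p q) = (if \<tau> = 0 then (if j + 1 < q then var (j + 1) else 0) else (if p < j then C 2 * var (j - 1) else 0))"
    unfolding Q using A1 B1 S by simp
  have "j = q - 1 \<longleftrightarrow> \<not> j + 1 < q" using j by auto
  then show "pd j (Qblk \<tau> p q) = (if \<tau> = 0 then (if p < j then var (n + j - 1) else 0)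
      else (if j + 1 < q then C 2 * var (n + j + 1) else if \<tau> = 1 then C (2 * (-1) ^ (q - p)) * var (q - 1) else 0))"
    unfolding Q using A2 B2 S by (simp add: mult_ac)
qed

lemma Qtot_pd:
  assumes ns: "ns 1 = 1" "ns (k + 1) = n + 1" "\<forall>s\<in>{1..k}. ns s < (ns (s + 1) :: nat)"
    and s: "s \<in> {1..k}" and j: "ns s \<le> j" "j < ns (s + 1)"
  shows "pd j (Qtot k ns \<tau>) = pd j (Qblk (\<tau> s) (ns s) (ns (s + 1)))"
    and "pd (n + j) (Qtot k ns \<tau>) = pd (n + j) (Qblk (\<tau> s) (ns s) (ns (s + 1)))"
proof -
  have mono: "ns a \<le> ns b" if "1 \<le> a" "a \<le> b" "b \<le> k + 1" for a b
    using that(2,3)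
  proof (induction b rule: dec_induct)
    case (step b)
    then have "ns b < ns (b + 1)" using ns(3) that(1) by auto
    then show ?case using step by simp
  qed simp
  have rng: "1 \<le> ns t \<and> ns (t + 1) \<le> n + 1" if "t \<in> {1..k}" for t
    using mono[of 1 t] mono[of "t + 1" "k + 1"] that ns by auto
  have out: "j \<notin> {ns t..<ns (t + 1)}" if t: "t \<in> {1..k}" "t \<noteq> s" for t
  proof (cases "t < s")
    case True
    then have "ns (t + 1) \<le> ns s" using t s by (intro mono) auto
    then show ?thesis using j by auto
  next
    case False
    then have "ns (s + 1) \<le> ns t" using t s by (intro mono) auto
    then show ?thesis using j by auto
  qed
  have jn: "1 \<le> j" "j \<le> n" using rng[OF s] j by auto
  have "pd j (Qblk (\<tau> t) (ns t) (ns (t + 1))) = 0 \<and> pd (n + j) (Qblk (\<tau> t) (ns t) (ns (t + 1))) = 0"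
    if t: "t \<in> {1..k}" "t \<noteq> s" for t
  proof -
    have on: "on ({ns t..<ns (t + 1)} \<union> (+) n ` {ns t..<ns (t + 1)}) (Qblk (\<tau> t) (ns t) (ns (t + 1)))"
      using rng[OF t(1)] ns(3) t by (intro Qblk_on) auto
    have "j \<notin> {ns t..<ns (t + 1)} \<union> (+) n ` {ns t..<ns (t + 1)}"
      "n + j \<notin> {ns t..<ns (t + 1)} \<union> (+) n ` {ns t..<ns (t + 1)}"
      using out[OF t] rng[OF t(1)] jn by auto
    then show ?thesis using on_pd_zero[OF on] by blast
  qed
  then show "pd j (Qtot k ns \<tau>) = pd j (Qblk (\<tau> s) (ns s) (ns (s + 1)))"
    "pd (n + j) (Qtot k ns \<tau>) = pd (n + j) (Qblk (\<tau> s) (ns s) (ns (s + 1)))"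
    unfolding Qtot_def pd_sum using s
    by (subst sum.remove[of _ s]; simp add: sum.neutral)+
qed

text \<open>In the coordinates \<open>x\<^sub>1, \<dots>, x\<^sub>2\<^sub>n\<close>, \<open>Lam\<close> is the coefficient matrix of \<open>\<Sum>\<gamma>\<^sub>s\<close> and \<open>nf\<close> that of
  \<open>\<Sum>\<gamma>\<^sub>s + dQ\<close>; \<open>ll\<close> extends the eigenvalues by \<open>\<lambda>\<^sub>n\<^sub>+\<^sub>i = 1 - \<lambda>\<^sub>i\<close>.\<close>

definition ll :: "(nat \<Rightarrow> complex) \<Rightarrow> nat \<Rightarrow> complex" where
  "ll lam i = (if i \<le> n then lam i else 1 - lam (i - n))"

definition Lam :: "(nat \<Rightarrow> complex) \<Rightarrow> nat \<Rightarrow> nat \<Rightarrow> complex" where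
  "Lam lam i l = (if i \<le> n \<and> l = n + i then lam i - 1 else if l \<le> n \<and> i = n + l then lam l else 0)"

definition nf :: "nat \<Rightarrow> (nat \<Rightarrow> nat) \<Rightarrow> (nat \<Rightarrow> complex) \<Rightarrow> (nat \<Rightarrow> nat) \<Rightarrow> nat \<Rightarrow> nat \<Rightarrow> complex" where
  "nf k ns lam \<tau> i l = Lam lam i l + coef (pd i (Qtot k ns \<tau>)) (unitv l)"

definition kind_ok :: "nat \<Rightarrow> complex \<Rightarrow> nat \<Rightarrow> bool" where
  "kind_ok \<tau> \<kappa> r \<longleftrightarrow> (\<tau> = 0 \<and> (\<kappa> \<noteq> 1/2 \<or> r = 1)) \<or> (\<tau> = 1 \<and> \<kappa> = 1/2) \<or> (\<tau> = 2 \<and> \<kappa> = 1/2 \<and> odd r \<and> r \<ge> 3)"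

lemma sum_X: "(\<Sum>i\<in>X. f i) = (\<Sum>j\<in>{1..n}. f j) + (\<Sum>j\<in>{1..n}. f (n + j))"
proof -
  have "X = {1..n} \<union> (+) n ` {1..n}"
  proof (intro equalityI subsetI)
    fix j assume "j \<in> X"
    then have "j \<in> {1..n} \<or> (j - n \<in> {1..n} \<and> j = n + (j - n))" by (auto simp: X_def)
    then show "j \<in> {1..n} \<union> (+) n ` {1..n}" by blast
  qed (auto simp: X_def)
  moreover have "sum f ({1..n} \<union> (+) n ` {1..n}) = sum f {1..n} + sum f ((+) n ` {1..n})"
    by (rule sum.union_disjoint) auto
  moreover have "sum f ((+) n ` {1..n}) = (\<Sum>j\<in>{1..n}. f (n + j))"
    by (subst sum.reindex) auto
  ultimately show ?thesis by (simp only:)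
qed

lemma Lam_sum:
  assumes "j \<in> {1..n}"
  shows "(\<Sum>l\<in>X. C (Lam lam j l) * (\<phi> l :: ser)) = C (lam j - 1) * \<phi> (n + j)"
    and "(\<Sum>l\<in>X. C (Lam lam (n + j) l) * (\<phi> l :: ser)) = C (lam j) * \<phi> j"
proof -
  have "(\<Sum>l\<in>X. C (Lam lam j l) * \<phi> l) = (\<Sum>l\<in>X. if l = n + j then C (lam j - 1) * \<phi> (n + j) else 0)"
    using assms by (intro sum.cong) (auto simp: Lam_def)
  moreover have "n + j \<in> X" using assms by (auto simp: X_def)
  ultimately show "(\<Sum>l\<in>X. C (Lam lam j l) * \<phi> l) = C (lam j - 1) * \<phi> (n + j)" by simp
  have "(\<Sum>l\<in>X. C (Lam lam (n + j) l) * \<phi> l) = (\<Sum>l\<in>X. if l = j then C (lam j) * \<phi> j else 0)"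
    using assms by (intro sum.cong) (auto simp: Lam_def)
  moreover have "j \<in> X" using assms by (auto simp: X_def)
  ultimately show "(\<Sum>l\<in>X. C (Lam lam (n + j) l) * \<phi> l) = C (lam j) * \<phi> j" by simp
qed

text \<open>The negative transpose of \<open>b\<close> is another inverse of \<open>N\<close>, and
  inverses are unique.\<close>

lemma inv_pair_skew:
  assumes b: "inv_pair X b N" and N: "\<And>p q. N p q = - N q p" and pq: "p \<in> X" "q \<in> X"
  shows "b q p = - b p q"
proof -
  define tb where "tb i j = - b j i" for i j
  have tb: "inv_pair X tb N"
    unfolding inv_pair_def
  proof (intro ballI conjI)
    fix i l assume il: "i \<in> X" "l \<in> X"
    have "(\<Sum>j\<in>X. tb i j * N j l) = (\<Sum>j\<in>X. N l j * b j i)"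
      by (rule sum.cong) (auto simp: tb_def N[of _ l] mult.commute)
    then show "(\<Sum>j\<in>X. tb i j * N j l) = (if i = l then 1 else 0)" using b il by (auto simp: inv_pair_def)
    have "(\<Sum>j\<in>X. N i j * tb j l) = (\<Sum>j\<in>X. b l j * N j i)"
      by (rule sum.cong) (auto simp: tb_def N[of i] mult.commute)
    then show "(\<Sum>j\<in>X. N i j * tb j l) = (if i = l then 1 else 0)" using b il by (auto simp: inv_pair_def)
  qed
  have "b q p = mm X b (mm X N tb) q p" by (rule mm_inv_right(2)[OF tb, symmetric]) (use pq in auto)
  also have "\<dots> = tb q p" by (rule mm_inv_left(1)[OF b]) (use pq in auto)
  finally show ?thesis by (simp add: tb_def)
qed

text \<open>The hypothesis \<open>TG\<close> says that \<open>TT Z\<close> acts on coefficient rows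
  through the matrix \<open>b G\<close>. For the Poisson pairing with matrix \<open>b\<close>, the
  similitude relation of \<open>symp\<close> is then the identity G - G^T = b^(-1). In the block
  basis \<phi> that results, the action of \<open>TT Z\<close> is that of the Liouville field of the
  normal form, and the action together with the pairing determines \<open>G\<close>.\<close>

lemma linear_normal_form:
  assumes Z: "fld Z" and b: "inv_pair X b (\<lambda>p q. G p q - G q p)"
    and TG: "\<And>u r. u \<in> Lin \<Longrightarrow> r \<in> X \<Longrightarrow>
      coef (TT Z u) (unitv r) = (\<Sum>q\<in>X. (\<Sum>p\<in>X. coef u (unitv p) * b p q) * G q r)"
  shows "\<exists>k ns lam \<tau> \<phi>. ns 1 = 1 \<and> ns (k + 1) = n + 1 \<and> (\<forall>s\<in>{1..k}. ns s < ns (s + 1)) \<and>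
     (\<forall>s\<in>{1..k}. \<forall>i. ns s \<le> i \<and> i < ns (s + 1) \<longrightarrow> lam i = lam (ns s)) \<and>
     (\<forall>s\<in>{1..k}. kind_ok (\<tau> s) (lam (ns s)) (ns (s + 1) - ns s)) \<and>
     (\<forall>i\<in>X. \<phi> i \<in> Lin \<and> (\<exists>e. (sh (TT Z) (ll lam i) ^^ e) (\<phi> i) = 0)) \<and>
     (\<exists>P. inv_pair X P (jac \<phi>)) \<and>
     (\<forall>p\<in>X. \<forall>q\<in>X. G p q = (\<Sum>i\<in>X. \<Sum>l\<in>X. nf k ns lam \<tau> i l * jac \<phi> i p * jac \<phi> l q))"
proof -
  let ?T = "TT Z"
  define c where "c u p = coef u (unitv p)" for u p
  define N where "N p q = G p q - G q p" for p q
  have IN: "inv_pair X b N" using b by (simp add: N_def[abs_def])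
  have bsk: "b q p = - b p q" if "p \<in> X" "q \<in> X" for p q
    by (rule inv_pair_skew[OF IN _ that]) (simp add: N_def)
  define U where "U u q = (\<Sum>p\<in>X. c u p * b p q)" for u q
  define B where "B u v = (\<Sum>q\<in>X. U u q * c v q)" for u v
  have B2: "B u v = - (\<Sum>p\<in>X. c u p * U v p)" for u v
  proof -
    have "B u v = (\<Sum>q\<in>X. \<Sum>p\<in>X. c u p * (b p q * c v q))"
      by (simp add: B_def U_def sum_distrib_right mult.assoc)
    also have "\<dots> = (\<Sum>p\<in>X. \<Sum>q\<in>X. c u p * (b p q * c v q))" by (rule sum.swap)
    also have "\<dots> = (\<Sum>p\<in>X. \<Sum>q\<in>X. - (c u p * (c v q * b q p)))"
    proof (intro sum.cong refl)
      fix p q assume "p \<in> X" "q \<in> X"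
      then have "b q p = - b p q" by (rule bsk)
      then show "c u p * (b p q * c v q) = - (c u p * (c v q * b q p))" by simp
    qed
    finally show ?thesis by (simp add: U_def sum_distrib_left sum_negf)
  qed
  have UN: "(\<Sum>q\<in>X. U u q * N q r) = c u r" if r: "r \<in> X" for u r
  proof -
    have "(\<Sum>q\<in>X. U u q * N q r) = mm X (\<lambda>_. c u) (mm X b N) 0 r"
      unfolding mm_assoc[symmetric] by (simp add: mm_def U_def)
    also have "\<dots> = c u r" by (rule mm_inv_right(1)[OF IN]) (use r in auto)
    finally show ?thesis .
  qed
  have Uvar: "B u (var q) = U u q" if "q \<in> X" for u q
    using that by (simp add: B_def c_def coef_var if_distrib cong: if_cong)
  have cT: "c (?T u) r = (\<Sum>q\<in>X. U u q * G q r)" if "u \<in> Lin" "r \<in> X" for u r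
    using TG[OF that] by (simp add: c_def U_def)
  have sy: "symp ?T B Lin (var ` X)"
  proof
    show "linop ?T" by (rule TT_linop)
    show "B (F + F') H = B F H + B F' H" for F F' H
      by (simp add: B_def U_def c_def distrib_right sum.distrib)
    show "B (C a * F) H = a * B F H" for a F H
      by (simp add: B_def U_def c_def sum_distrib_left sum_distrib_right mult.assoc)
    show "B F H = - B H F" for F H unfolding B2[of F H] by (simp add: B_def mult.commute)
    show "linsub Lin" by (rule linsub_Lin)
    show "?T v \<in> Lin" for v by simp
    show "finite (var ` X)" by simp
    show "\<exists>c. v = (\<Sum>s\<in>var ` X. C (c s) * s)" if "v \<in> Lin" for v using that by (rule Lin_span)
    fix u v assume u: "u \<in> Lin" and v: "v \<in> Lin"
    have "B (?T u) v = - (\<Sum>r\<in>X. \<Sum>q\<in>X. U u q * (U v r * G q r))"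
      unfolding B2[of "?T u"] using u by (simp add: cT sum_distrib_left sum_distrib_right mult_ac)
    also have "(\<Sum>r\<in>X. \<Sum>q\<in>X. U u q * (U v r * G q r)) = (\<Sum>q\<in>X. \<Sum>r\<in>X. U u q * (U v r * G q r))"
      by (rule sum.swap)
    finally have 1: "B (?T u) v = - (\<Sum>q\<in>X. \<Sum>r\<in>X. U u q * (U v r * G q r))" .
    have 2: "B u (?T v) = (\<Sum>q\<in>X. \<Sum>r\<in>X. U u q * (U v r * G r q))"
      unfolding B_def[of u] using v by (simp add: cT sum_distrib_left)
    have "B (?T u) v + B u (?T v) = - (\<Sum>q\<in>X. \<Sum>r\<in>X. U u q * N q r * U v r)"
      unfolding 1 2 N_def by (simp add: algebra_simps sum_subtractf)
    also have "(\<Sum>q\<in>X. \<Sum>r\<in>X. U u q * N q r * U v r) = (\<Sum>r\<in>X. (\<Sum>q\<in>X. U u q * N q r) * U v r)"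
      by (subst sum.swap) (simp add: sum_distrib_right)
    also have "\<dots> = (\<Sum>r\<in>X. c u r * U v r)" by (rule sum.cong) (simp_all add: UN)
    finally show "B (?T u) v + B u (?T v) = B u v" unfolding B2[of u v] .
  qed
  interpret S: symp ?T B Lin "var ` X" by (rule sy)
  have nd: "u = 0" if u: "u \<in> Lin" and z: "\<And>v. v \<in> Lin \<Longrightarrow> B u v = 0" for u
  proof (rule Lin_eqI[OF u])
    show "0 \<in> Lin" using linsub_Lin by (rule linsub_zero)
    fix r assume r: "r \<in> X"
    have "U u q = 0" if "q \<in> X" for q using z[OF var_Lin[OF that]] Uvar[OF that] by simp
    then show "coef u (unitv r) = coef 0 (unitv r)" using UN[OF r, of u] by (simp add: c_def)
  qed
  obtain N' k ns lam \<tau> e f where bs: "S.block_system N' k ns lam \<tau> e f"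
    and ex: "\<forall>v\<in>Lin. v = (\<Sum>i\<in>{1..N'}. C (B v (f i)) * e i - C (B v (e i)) * f i)"
    using S.normal_form[OF nd] by blast
  note bd = bs[unfolded S.block_system_def]
  have efL: "e i \<in> Lin" "f i \<in> Lin" if "i \<in> {1..N'}" for i using bd that by blast+
  have dual: "B (e i) (f j) = (if i = j then 1 else 0)" "B (e i) (e j) = 0" "B (f i) (f j) = 0"
    if "i \<in> {1..N'}" "j \<in> {1..N'}" for i j using bd that by blast+
  have dual2: "B (f i) (e j) = (if i = j then -1 else 0)" if "i \<in> {1..N'}" "j \<in> {1..N'}" for i j
    using dual(1)[OF that(2,1)] S.B_skew[of "f i"] by auto
  \<comment> \<open>A dimension count: more than \<open>n\<close> dual pairs would be linearly
    dependent, and with fewer some nonzero linear function would be orthogonal to all of them,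
    contrary to the expansion \<open>ex\<close>.\<close>
  have "N' = n"
  proof (rule ccontr)
    assume "N' \<noteq> n"
    then consider "n < N'" | "N' < n" by linarith
    then show False
    proof cases
      case 1
      define \<psi> where "\<psi> i = (if i \<le> N' then e i else f (i - N'))" for i
      have "card X < card {1..2 * N'}" using 1 by (simp add: X_def)
      then obtain r where r: "\<exists>i\<in>{1..2 * N'}. r i \<noteq> 0" "\<forall>s\<in>X. (\<Sum>i\<in>{1..2 * N'}. r i * c (\<psi> i) s) = 0"
        using homogeneous_system[of X "{1..2 * N'}" "\<lambda>i. c (\<psi> i)"] by auto
      have z: "B (\<Sum>i\<in>{1..2 * N'}. C (r i) * \<psi> i) v = 0" for v
      proof -
        have "c (\<Sum>i\<in>{1..2 * N'}. C (r i) * \<psi> i) s = 0" if "s \<in> X" for s using r(2) that by (simp add: c_def)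
        then show ?thesis unfolding B2 by simp
      qed
      have spl: "(\<Sum>i\<in>{1..2 * N'}. h i) = (\<Sum>i\<in>{1..N'}. h i) + (\<Sum>i\<in>{1..N'}. h (N' + i))" for h :: "nat \<Rightarrow> complex"
      proof -
        have "{1..2 * N'} = {1..N'} \<union> (+) N' ` {1..N'}"
        proof (intro equalityI subsetI)
          fix j assume "j \<in> {1..2 * N'}"
          then have "j \<in> {1..N'} \<or> (j - N' \<in> {1..N'} \<and> j = N' + (j - N'))" by auto
          then show "j \<in> {1..N'} \<union> (+) N' ` {1..N'}" by blast
        qed auto
        moreover have "sum h ({1..N'} \<union> (+) N' ` {1..N'}) = sum h {1..N'} + sum h ((+) N' ` {1..N'})"
          by (rule sum.union_disjoint) auto
        moreover have "sum h ((+) N' ` {1..N'}) = (\<Sum>i\<in>{1..N'}. h (N' + i))" by (subst sum.reindex) auto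
        ultimately show ?thesis by (simp only:)
      qed
      have "r j = 0 \<and> r (N' + j) = 0" if j: "j \<in> {1..N'}" for j
      proof -
        have "0 = (\<Sum>i\<in>{1..N'}. r i * B (e i) (f j)) + (\<Sum>i\<in>{1..N'}. r (N' + i) * B (f i) (f j))"
          using z[of "f j"] unfolding S.B_sum S.B_scale spl by (simp add: \<psi>_def)
        also have "\<dots> = (\<Sum>i\<in>{1..N'}. if i = j then r i else 0) + 0"
          using j by (intro arg_cong2[of _ _ _ _ "(+)"] sum.cong sum.neutral ballI) (auto simp: dual)
        finally have 1: "r j = 0" using j by simp
        have "0 = (\<Sum>i\<in>{1..N'}. r i * B (e i) (e j)) + (\<Sum>i\<in>{1..N'}. r (N' + i) * B (f i) (e j))"
          using z[of "e j"] unfolding S.B_sum S.B_scale spl by (simp add: \<psi>_def)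
        also have "\<dots> = 0 + (\<Sum>i\<in>{1..N'}. if i = j then - r (N' + i) else 0)"
          using j by (intro arg_cong2[of _ _ _ _ "(+)"] sum.cong sum.neutral ballI) (auto simp: dual dual2)
        finally show ?thesis using 1 j by simp
      qed
      note rz = this
      have "r i = 0" if i: "i \<in> {1..2 * N'}" for i
      proof (cases "i \<le> N'")
        case True
        then have "i \<in> {1..N'}" using i by simp
        then show ?thesis using rz by blast
      next
        case False
        then have "i - N' \<in> {1..N'}" "N' + (i - N') = i" using i by auto
        then show ?thesis using rz[of "i - N'"] by simp
      qed
      then show False using r(1) by blast
    next
      case 2
      define d where "d p i = (if i \<le> N' then B (var p) (f i) else - B (var p) (e (i - N')))" for p i
      have "card {1..2 * N'} < card X" using 2 by (simp add: X_def)
      then obtain r where r: "\<exists>p\<in>X. r p \<noteq> 0" "\<forall>s\<in>{1..2 * N'}. (\<Sum>p\<in>X. r p * d p s) = 0"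
        using homogeneous_system[of "{1..2 * N'}" X d] by auto
      define v where "v = (\<Sum>p\<in>X. C (r p) * var p)"
      have vL: "v \<in> Lin" unfolding v_def using linsub_Lin var_Lin by (intro linsub_sum linsub_scale) auto
      have "B v (f i) = 0 \<and> B v (e i) = 0" if i: "i \<in> {1..N'}" for i
      proof -
        have "(\<Sum>p\<in>X. r p * d p i) = 0" "(\<Sum>p\<in>X. r p * d p (N' + i)) = 0" using r(2) i by auto
        then show ?thesis using i by (simp add: v_def S.B_sum S.B_scale d_def sum_negf)
      qed
      then have "(\<Sum>i\<in>{1..N'}. C (B v (f i)) * e i - C (B v (e i)) * f i) = 0" by (intro sum.neutral) simp
      then have "v = 0" using ex vL by metis
      then have "r p = 0" if "p \<in> X" for p using coef_lin[OF that, of r] by (simp add: v_def)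
      then show False using r(1) by blast
    qed
  qed
  note bd = bd[unfolded this] and ex = ex[unfolded this] and efL = efL[unfolded this]
    and dual = dual[unfolded this] and dual2 = dual2[unfolded this]
  have ns: "ns 1 = 1" "ns (k + 1) = n + 1" "\<forall>s\<in>{1..k}. ns s < ns (s + 1)"
    and lamb: "\<forall>s\<in>{1..k}. \<forall>i. ns s \<le> i \<and> i < ns (s + 1) \<longrightarrow> lam i = lam (ns s)"
    and blk: "\<And>s. s \<in> {1..k} \<Longrightarrow> S.block (\<tau> s) (lam (ns s)) (ns (s + 1) - ns s) (\<lambda>i. e (ns s + i)) (\<lambda>i. f (ns s + i))"
    using bd by blast+
  have nil: "S.nilp (lam i) (e i)" "S.nilp (1 - lam i) (f i)" if "i \<in> {1..n}" for i
    using bd that by blast+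
  define \<phi> where "\<phi> i = (if i \<le> n then e i else f (i - n))" for i
  have Xc: "i \<in> {1..n} \<or> (i - n \<in> {1..n} \<and> i = n + (i - n))" if "i \<in> X" for i using that by (auto simp: X_def)
  have phi: "\<phi> j = e j" "\<phi> (n + j) = f j" if "j \<in> {1..n}" for j using that by (auto simp: \<phi>_def)
  have phiL: "\<phi> i \<in> Lin" if "i \<in> X" for i
  proof (cases "i \<in> {1..n}")
    case True
    then show ?thesis using efL phi(1)[OF True] by simp
  next
    case False
    then have i: "i - n \<in> {1..n}" "i = n + (i - n)" using Xc[OF that] by auto
    show ?thesis using efL i(1) phi(2)[OF i(1)] by (subst i(2)) simp
  qed
  have phin: "\<exists>e. (sh ?T (ll lam i) ^^ e) (\<phi> i) = 0" if "i \<in> X" for i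
  proof (cases "i \<in> {1..n}")
    case True
    then show ?thesis using nil(1)[OF True] by (simp add: phi ll_def S.nilp_def)
  next
    case False
    then have i: "i - n \<in> {1..n}" "i = n + (i - n)" using Xc[OF that] by auto
    then have "\<phi> i = f (i - n)" "ll lam i = 1 - lam (i - n)" using False that by (auto simp: \<phi>_def ll_def X_def)
    then show ?thesis using nil(2)[OF i(1)] by (simp add: S.nilp_def)
  qed
  have invphi: "\<exists>P. inv_pair X P (jac \<phi>)"
  proof -
    define P where "P p i = (if i \<le> n then B (var p) (f i) else - B (var p) (e (i - n)))" for p i
    have "inv_pair X P (jac \<phi>)"
    proof (rule left_inverse_inv_pair)
      fix p q assume pq: "p \<in> X" "q \<in> X"
      have "var p = (\<Sum>i\<in>X. C (P p i) * \<phi> i)"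
      proof -
        have "(\<Sum>i\<in>X. C (P p i) * \<phi> i) = (\<Sum>i\<in>{1..n}. C (B (var p) (f i)) * e i) + (\<Sum>i\<in>{1..n}. C (- B (var p) (e i)) * f i)"
          unfolding sum_X by (intro arg_cong2[of _ _ _ _ "(+)"] sum.cong refl) (auto simp: P_def \<phi>_def)
        also have "\<dots> = (\<Sum>i\<in>{1..n}. C (B (var p) (f i)) * e i - C (B (var p) (e i)) * f i)"
          by (simp add: sum_subtractf sum_negf)
        also have "\<dots> = var p" using ex var_Lin[OF pq(1)] by (simp flip: One_nat_def)
        finally show ?thesis by simp
      qed
      then have "coef (var p) (unitv q) = (\<Sum>i\<in>X. P p i * jac \<phi> i q)"
        by (simp add: coef_sum jac_def)
      then show "(\<Sum>i\<in>X. P p i * jac \<phi> i q) = (if p = q then 1 else 0)" by (auto simp: coef_var split: if_splits)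
    qed simp
    then show ?thesis by blast
  qed
  define sub where "sub F = (\<Sum>l\<in>X. C (coef F (unitv l)) * \<phi> l)" for F
  have sub_simps: "sub 0 = 0" "sub (C a * F) = C a * sub F" for a F
    by (simp_all add: sub_def sum_distrib_left mult.assoc)
  have sub_var: "sub (var l) = \<phi> l" if "l \<in> X" for l
  proof -
    have "sub (var l) = (\<Sum>i\<in>X. if i = l then \<phi> l else 0)" unfolding sub_def by (rule sum.cong) (auto simp: coef_var)
    then show ?thesis using that by simp
  qed
  let ?Q = "Qtot k ns \<tau>"
  \<comment> \<open>In Darboux coordinates the Liouville field has component \<lambda>_j x_j +
    dQ/dx_(n+j) along x_j and (1 - \<lambda>_j) x_(n+j) - dQ/dx_j along x_(n+j). Here \<phi> is
    substituted for the variables.\<close>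
  have TQ: "?T (e j) = C (lam j) * e j + sub (pd (n + j) ?Q)" "?T (f j) = C (1 - lam j) * f j - sub (pd j ?Q)"
    if j: "j \<in> {1..n}" for j
  proof -
    obtain s where s: "s \<in> {1..k}" "ns s \<le> j" "j < ns (s + 1)" using block_index[OF ns j] by blast
    define p where "p = ns s"
    define q where "q = ns (s + 1)"
    define i where "i = j - p"
    have pq: "1 \<le> p" "q \<le> n + 1" "p \<le> j" "j < q" "i < q - p" "p + i = j"
      using strict_ns_mono[OF ns(3), of 1 s] strict_ns_mono[OF ns(3), of "s + 1" "k + 1"] s ns
      by (auto simp: p_def q_def i_def)
    have lj: "lam j = lam p" unfolding p_def using lamb s by blast
    have bl: "S.block (\<tau> s) (lam p) (q - p) (\<lambda>i. e (p + i)) (\<lambda>i. f (p + i))"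
      using blk[OF s(1)] by (simp add: p_def q_def)
    have Q1: "pd (n + j) ?Q = (if \<tau> s = 0 then (if j + 1 < q then var (j + 1) else 0) else (if p < j then C 2 * var (j - 1) else 0))"
      unfolding Qtot_pd(2)[OF ns s] p_def[symmetric] q_def[symmetric] by (rule Qblk_pd(1)[OF pq(1-4)])
    have Q2: "pd j ?Q = (if \<tau> s = 0 then (if p < j then var (n + j - 1) else 0)
      else (if j + 1 < q then C 2 * var (n + j + 1) else if \<tau> s = 1 then C (2 * (-1) ^ (q - p)) * var (q - 1) else 0))"
      unfolding Qtot_pd(1)[OF ns s] p_def[symmetric] q_def[symmetric] by (rule Qblk_pd(2)[OF pq(1-4)])
    have v1: "sub (var (j + 1)) = e (j + 1)" "sub (var (n + j + 1)) = f (j + 1)" if "j + 1 < q"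
    proof -
      have "j + 1 \<in> {1..n}" using that pq by auto
      then show "sub (var (j + 1)) = e (j + 1)" "sub (var (n + j + 1)) = f (j + 1)"
        using sub_var[of "j + 1"] sub_var[of "n + (j + 1)"] phi[of "j + 1"] by (auto simp: X_def add.assoc)
    qed
    have v2: "sub (var (j - 1)) = e (j - 1)" "sub (var (n + j - 1)) = f (j - 1)" if "p < j"
    proof -
      have j1: "j - 1 \<in> {1..n}" "n + j - 1 = n + (j - 1)" using that pq by auto
      show "sub (var (j - 1)) = e (j - 1)" "sub (var (n + j - 1)) = f (j - 1)"
        unfolding j1(2) using sub_var[of "j - 1"] sub_var[of "n + (j - 1)"] phi[OF j1(1)] j1(1) by (auto simp: X_def)
    qed
    have v3: "sub (var (q - 1)) = e (q - 1)"
    proof -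
      have "q - 1 \<in> {1..n}" using pq by auto
      then show ?thesis using sub_var[of "q - 1"] phi[of "q - 1"] by (auto simp: X_def)
    qed
    have id: "p + (i + 1) = j + 1" "i > 0 \<Longrightarrow> p + (i - 1) = j - 1" "i + 1 < q - p \<longleftrightarrow> j + 1 < q" "i > 0 \<longleftrightarrow> p < j"
      "p + (q - p - 1) = q - 1" using pq by auto
    have "\<tau> s = 0 \<or> \<tau> s = 1 \<or> \<tau> s = 2" using bl unfolding S.block_def by (elim disjE conjE; simp only: simp_thms)
    then have "?T (e j) = C (lam j) * e j + sub (pd (n + j) ?Q) \<and> ?T (f j) = C (1 - lam j) * f j - sub (pd j ?Q)"
    proof (elim disjE)
      assume 1: "\<tau> s = 0"
      from 1 have "?T (e (p + i)) = C (lam p) * e (p + i) + (if i + 1 < q - p then e (p + (i + 1)) else 0)"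
        "?T (f (p + i)) = C (1 - lam p) * f (p + i) - (if i > 0 then f (p + (i - 1)) else 0)"
        using bl pq(5) unfolding S.block_def by auto
      then show ?thesis using 1 unfolding Q1 Q2 lj by (simp add: id pq(6) v1 v2 sub_simps del: C_simps One_nat_def)
    next
      assume 2: "\<tau> s = 1"
      from 2 have "?T (e (p + i)) = C (lam p) * e (p + i) + (if i > 0 then C 2 * e (p + (i - 1)) else 0)"
        "?T (f (p + i)) = C (1 - lam p) * f (p + i) - (if i + 1 < q - p then C 2 * f (p + (i + 1)) else C (2 * (-1) ^ (q - p)) * e (p + (q - p - 1)))"
        using bl pq(5) unfolding S.block_def by auto
      then show ?thesis using 2 unfolding Q1 Q2 lj id(5) by (simp add: id pq(6) v1 v2 v3 sub_simps del: C_simps One_nat_def)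
    next
      assume 3: "\<tau> s = 2"
      from 3 have "?T (e (p + i)) = C (lam p) * e (p + i) + (if i > 0 then C 2 * e (p + (i - 1)) else 0)"
        "?T (f (p + i)) = C (1 - lam p) * f (p + i) - (if i + 1 < q - p then C 2 * f (p + (i + 1)) else 0)"
        using bl pq(5) unfolding S.block_def by auto
      then show ?thesis using 3 unfolding Q1 Q2 lj by (simp add: id pq(6) v1 v2 sub_simps del: C_simps One_nat_def)
    qed
    then show "?T (e j) = C (lam j) * e j + sub (pd (n + j) ?Q)" "?T (f j) = C (1 - lam j) * f j - sub (pd j ?Q)" by blast+
  qed
  let ?nf = "nf k ns lam \<tau>"
  have nfs: "(\<Sum>l\<in>X. C (?nf i l) * \<phi> l) = (\<Sum>l\<in>X. C (Lam lam i l) * \<phi> l) + sub (pd i ?Q)" for i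
    by (simp add: nf_def sub_def distrib_right sum.distrib)
  have Te: "c (?T (e j)) r = (\<Sum>l\<in>X. ?nf (n + j) l * jac \<phi> l r)"
    and Tf: "c (?T (f j)) r = - (\<Sum>l\<in>X. ?nf j l * jac \<phi> l r)" if j: "j \<in> {1..n}" for j r
  proof -
    have "?T (e j) = (\<Sum>l\<in>X. C (?nf (n + j) l) * \<phi> l)" unfolding nfs TQ(1)[OF j] Lam_sum(2)[OF j] phi[OF j] ..
    then show "c (?T (e j)) r = (\<Sum>l\<in>X. ?nf (n + j) l * jac \<phi> l r)" by (simp add: c_def jac_def)
    have "?T (f j) = - (\<Sum>l\<in>X. C (?nf j l) * \<phi> l)"
      unfolding nfs TQ(2)[OF j] Lam_sum(1)[OF j] phi[OF j] by (simp add: algebra_simps)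
    then show "c (?T (f j)) r = - (\<Sum>l\<in>X. ?nf j l * jac \<phi> l r)" by (simp add: c_def jac_def)
  qed
  have "G q r = (\<Sum>i\<in>X. \<Sum>l\<in>X. ?nf i l * jac \<phi> i q * jac \<phi> l r)" if qr: "q \<in> X" "r \<in> X" for q r
  proof -
    \<comment> \<open>The completeness relation of the basis, read off from the expansion of
      \<open>var s\<close>. Contracted with \<open>G\<close> it expresses \<open>G\<close> through
      the action of \<open>TT Z\<close>.\<close>
    have delta: "(\<Sum>j\<in>{1..n}. U (e j) s * c (f j) q - U (f j) s * c (e j) q) = (if s = q then 1 else 0)" if s: "s \<in> X" for s
    proof -
      have "c (var s) q = (\<Sum>j\<in>{1..n}. B (var s) (f j) * c (e j) q - B (var s) (e j) * c (f j) q)"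
        using arg_cong[OF ex[rule_format, OF var_Lin[OF s]], of "\<lambda>F. coef F (unitv q)"] by (simp add: c_def)
      also have "\<dots> = (\<Sum>j\<in>{1..n}. U (e j) s * c (f j) q - U (f j) s * c (e j) q)"
        using S.B_skew[of "var s"] Uvar[OF s] by (intro sum.cong) auto
      finally show ?thesis by (auto simp: c_def coef_var split: if_splits)
    qed
    have "(\<Sum>j\<in>{1..n}. c (?T (e j)) r * c (f j) q - c (?T (f j)) r * c (e j) q)
        = (\<Sum>j\<in>{1..n}. \<Sum>s\<in>X. (U (e j) s * c (f j) q - U (f j) s * c (e j) q) * G s r)"
      using efL qr by (intro sum.cong) (simp_all add: cT sum_distrib_left right_diff_distrib sum_subtractf mult_ac)
    also have "\<dots> = (\<Sum>s\<in>X. (\<Sum>j\<in>{1..n}. U (e j) s * c (f j) q - U (f j) s * c (e j) q) * G s r)"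
      by (subst sum.swap) (simp only: sum_distrib_right)
    also have "\<dots> = (\<Sum>s\<in>X. if s = q then G s r else 0)" by (rule sum.cong) (simp_all add: delta[simplified])
    also have "\<dots> = G q r" using qr by simp
    finally have "G q r = (\<Sum>j\<in>{1..n}. c (?T (e j)) r * c (f j) q - c (?T (f j)) r * c (e j) q)" by simp
    also have "\<dots> = (\<Sum>j\<in>{1..n}. (\<Sum>l\<in>X. ?nf j l * jac \<phi> l r) * jac \<phi> j q) + (\<Sum>j\<in>{1..n}. (\<Sum>l\<in>X. ?nf (n + j) l * jac \<phi> l r) * jac \<phi> (n + j) q)"
      unfolding sum.distrib[symmetric] by (rule sum.cong) (simp_all add: Te Tf phi jac_def c_def[of "e _"] c_def[of "f _"])
    also have "\<dots> = (\<Sum>i\<in>X. (\<Sum>l\<in>X. ?nf i l * jac \<phi> l r) * jac \<phi> i q)" by (rule sum_X[symmetric])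
    finally show ?thesis by (simp add: sum_distrib_left mult_ac)
  qed
  moreover have "kind_ok (\<tau> s) (lam (ns s)) (ns (s + 1) - ns s)" if "s \<in> {1..k}" for s
    using blk[OF that] unfolding S.block_def kind_ok_def by (elim disjE conjE; simp only: simp_thms)
  ultimately show ?thesis using ns lamb phiL phin invphi
    by (intro exI[of _ k] exI[of _ ns] exI[of _ lam] exI[of _ \<tau>] exI[of _ \<phi>]) (intro conjI ballI; assumption | blast)
qed

end

subsection \<open>Simultaneous normal form of the form and the field\<close>

lemma inv_pair_tr: "inv_pair I P J \<Longrightarrow> inv_pair I (tr J) (tr P) \<and> inv_pair I (tr P) (tr J)"
  unfolding inv_pair_def tr_def by (auto simp: mult.commute)

lemma inv_pair_mm_iff:
  "inv_pair I P J \<longleftrightarrow> (\<forall>i\<in>I. \<forall>l\<in>I. mm I P J i l = (if i = l then 1 else 0) \<and> mm I J P i l = (if i = l then 1 else 0))"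
  by (simp add: inv_pair_def mm_def)

lemma inv_pair_mm:
  assumes I: "finite I" and A: "inv_pair I A A'" and B: "inv_pair I B B'"
  shows "inv_pair I (mm I A B) (mm I B' A')"
  unfolding inv_pair_mm_iff
proof (intro ballI conjI)
  fix i l assume il: "i \<in> I" "l \<in> I"
  have "mm I (mm I A B) (mm I B' A') i l = mm I A (mm I B (mm I B' A')) i l" by (simp only: mm_assoc)
  also have "\<dots> = mm I A A' i l" by (rule mm_cong) (simp_all add: mm_inv_left(1)[OF B I])
  finally show "mm I (mm I A B) (mm I B' A') i l = (if i = l then 1 else 0)"
    using A il by (simp add: inv_pair_mm_iff)
  have "mm I (mm I B' A') (mm I A B) i l = mm I B' (mm I A' (mm I A B)) i l" by (simp only: mm_assoc)
  also have "\<dots> = mm I B' B i l" by (rule mm_cong) (simp_all add: mm_inv_left(2)[OF A I])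
  finally show "mm I (mm I B' A') (mm I A B) i l = (if i = l then 1 else 0)"
    using B il by (simp add: inv_pair_mm_iff)
qed

lemma congruence_inverse:
  assumes I: "finite I" and P: "inv_pair I P J"
    and G: "\<And>p q. p \<in> I \<Longrightarrow> q \<in> I \<Longrightarrow> G p q = mm I (tr J) (mm I A J) p q" and ij: "i \<in> I" "j \<in> I"
  shows "A i j = mm I (tr P) (mm I G P) i j"
proof -
  have "mm I (tr P) (mm I G P) i j = mm I (tr P) (mm I (mm I (tr J) (mm I A J)) P) i j"
    by (intro mm_cong refl) (simp add: G)
  also have "\<dots> = mm I (tr P) (mm I (tr J) (mm I A (mm I J P))) i j" by (simp only: mm_assoc)
  also have "\<dots> = mm I A (mm I J P) i j" using inv_pair_tr[OF P] I ij by (simp add: mm_inv_left)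
  also have "\<dots> = A i j" by (rule mm_inv_right(2)[OF P I ij(2)])
  finally show ?thesis by simp
qed

lemma tr_tr [simp]: "tr (tr A) = A"
  by (simp add: tr_def fun_eq_iff)

lemma coef_mult_0: "coef (F * G) 0 = coef F 0 * coef G 0"
proof -
  have "{..0 :: nat \<Rightarrow> nat} = {0}" by (auto simp: le_fun_def)
  then show ?thesis by (simp add: coef_mult)
qed

lemma coef_pd_0: "coef (pd q F) 0 = coef F (unitv q)"
  by (simp add: coef_pd)

lemma coef_cmp_0: assumes "small k \<Phi>" shows "coef (cmp k F \<Phi>) 0 = coef F 0"
proof -
  have "om 1 (F - C (coef F 0))" by (simp add: om1_iff coef_C del: One_nat_def)
  from om_cmp[OF this, of k \<Phi>] show ?thesis using assms by (simp add: om1_iff coef_C del: One_nat_def)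
qed

lemma jac_cmp:
  assumes "small k \<Phi>"
  shows "coef (cmp k F \<Phi>) (unitv q) = (\<Sum>i<k. coef F (unitv i) * jac \<Phi> i q)"
proof -
  have "coef (cmp k F \<Phi>) (unitv q) = coef (pd q (cmp k F \<Phi>)) 0" by (simp only: coef_pd_0)
  also have "\<dots> = (\<Sum>i<k. coef F (unitv i) * jac \<Phi> i q)"
    unfolding chain_rule[OF assms] by (simp add: coef_mult_0 coef_cmp_0[OF assms] coef_pd_0 jac_def)
  finally show ?thesis .
qed

context tangent
begin

lemma jac_cmp_tc:
  assumes "small K (tc y)" "on X F"
  shows "coef (cmp K F (tc y)) (unitv q) = (\<Sum>i\<in>X. coef F (unitv i) * jac y i q)"
proof -
  have "coef F (unitv i) = 0" if "i \<notin> X" for i using assms(2) that by (auto simp: on_def)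
  then have "(\<Sum>i<K. coef F (unitv i) * jac (tc y) i q) = (\<Sum>i\<in>X. coef F (unitv i) * jac y i q)"
    unfolding sum_K by (simp add: jac_def)
  then show ?thesis using jac_cmp[OF assms(1), of F q] by simp
qed

text \<open>Comparing linear terms in the equation that defines \<open>Z\<close> shows that the
  matrix of its linear part is \<open>b G\<close>. This is the description of \<open>TT Z\<close>
  from which \<open>linear_normal_form\<close> starts.\<close>

lemma liouville_field:
  assumes g: "\<And>p. p \<in> X \<Longrightarrow> on X (g p) \<and> om 1 (g p)"
  defines "G \<equiv> \<lambda>p q. coef (g p) (unitv q)"
  assumes b: "inv_pair X b (\<lambda>p q. G p q - G q p)"
  obtains Z where "fld Z" "\<And>q. q \<in> X \<Longrightarrow> lie X Z g q = g q"
    "\<And>u r. u \<in> Lin \<Longrightarrow> r \<in> X \<Longrightarrow>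
      coef (TT Z u) (unitv r) = (\<Sum>q\<in>X. (\<Sum>p\<in>X. coef u (unitv p) * b p q) * G q r)"
    "\<And>V p. fld V \<Longrightarrow> (\<And>q. q \<in> X \<Longrightarrow> lie X V g q = 0) \<Longrightarrow> p \<in> X \<Longrightarrow> LL V (Z p) = LL Z (V p)"
proof -
  have Om0: "coef (Om g p q) 0 = - (G p q - G q p)" for p q
    by (simp add: Om_def coef_pd_0 G_def)
  have P: "inv_pair X (\<lambda>p q. - b p q) (\<lambda>p q. coef (Om g p q) 0)"
    using b unfolding Om0 inv_pair_def by (simp only: minus_mult_minus)
  obtain Z where Z: "fld Z" "\<And>q. q \<in> X \<Longrightarrow> (\<Sum>p\<in>X. Z p * Om g p q) = g q"
    using Om_solve[OF g P] by blast
  define z where "z p r = coef (Z p) (unitv r)" for p r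
  have zG: "mm X (\<lambda>p q. G p q - G q p) z q r = G q r" if q: "q \<in> X" for q r
  proof -
    have "G q r = coef (\<Sum>p\<in>X. Z p * Om g p q) (unitv r)" using Z(2)[OF q] by (simp add: G_def)
    also have "\<dots> = (\<Sum>p\<in>X. z p r * - (G p q - G q p))"
      unfolding coef_sum coef_mult_unitv Om0 using Z(1)
      by (intro sum.cong refl) (auto simp: fld_def om1_iff z_def simp del: One_nat_def)
    also have "\<dots> = mm X (\<lambda>p q. G p q - G q p) z q r" unfolding mm_def by (rule sum.cong) (simp_all add: algebra_simps)
    finally show ?thesis by simp
  qed
  have z: "z p r = mm X b G p r" if "p \<in> X" for p r
  proof -
    have "z p r = mm X b (mm X (\<lambda>p q. G p q - G q p) z) p r"
      by (rule mm_inv_left(1)[OF b _ that, symmetric]) simp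
    also have "\<dots> = mm X b G p r" by (rule mm_cong) (simp_all add: zG)
    finally show ?thesis .
  qed
  have TG: "coef (TT Z u) (unitv r) = (\<Sum>q\<in>X. (\<Sum>p\<in>X. coef u (unitv p) * b p q) * G q r)"
    if u: "u \<in> Lin" and r: "r \<in> X" for u r
  proof -
    have "u = (\<Sum>p\<in>X. C (coef u (unitv p)) * var p)" using lin1_id[OF u] by (simp add: lin1_def)
    then have "LL Z u = LL Z (\<Sum>p\<in>X. C (coef u (unitv p)) * var p)" by simp
    also have "\<dots> = (\<Sum>p\<in>X. C (coef u (unitv p)) * Z p)" by (simp add: LL_var)
    finally have "coef (TT Z u) (unitv r) = (\<Sum>p\<in>X. coef u (unitv p) * z p r)"
      unfolding TT_def lin1_def coef_lin[OF r] by (simp add: z_def)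
    also have "\<dots> = mm X (\<lambda>_ p. coef u (unitv p)) (mm X b G) 0 r"
      unfolding mm_def[of X "\<lambda>_ p. coef u (unitv p)"] by (rule sum.cong) (simp_all add: z)
    also have "\<dots> = mm X (mm X (\<lambda>_ p. coef u (unitv p)) b) G 0 r" by (simp only: mm_assoc)
    finally show ?thesis by (simp add: mm_def)
  qed
  show thesis
  proof (rule that[OF Z(1) _ TG])
    show "lie X Z g q = g q" if "q \<in> X" for q by (rule Z_lie[OF Z(2) that])
    show "LL V (Z p) = LL Z (V p)" if "fld V" "\<And>q. q \<in> X \<Longrightarrow> lie X V g q = 0" "p \<in> X" for V p
      using Z_commute[OF Z(2) Z(1) P that(1) that(2) _ that(3)] g by blast
  qed
qed

text \<open>Expanding \<open>u\<close> in the eigenbasis \<open>v\<close> and grouping by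
  eigenvalue, uniqueness of the decomposition leaves only the group of \<kappa>; the coefficients of
  the other vectors vanish.\<close>

lemma frame_weights:
  assumes Z: "fld Z" and J: "inv_pair X P (jac v)" and v: "\<And>i. i \<in> X \<Longrightarrow> v i \<in> Lin \<and> (\<exists>e. (sh (TT Z) (l i) ^^ e) (v i) = 0)"
    and u: "u \<in> Lin" "\<exists>e. (sh (TT Z) \<kappa> ^^ e) u = 0"
    and i: "i \<in> X" "(\<Sum>s\<in>X. coef u (unitv s) * P s i) \<noteq> 0"
  shows "l i = \<kappa>"
proof -
  let ?T = "TT Z"
  define a where "a i = (\<Sum>s\<in>X. coef u (unitv s) * P s i)" for i
  have T: "linop ?T" by (rule TT_linop)
  have nil: "linsub {v. \<exists>e. (sh ?T \<chi> ^^ e) v = 0}" for \<chi> by (rule linsub_nil[OF T])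
  have ua: "u = (\<Sum>i\<in>X. C (a i) * v i)"
  proof (rule Lin_eqI[OF u(1)])
    show "(\<Sum>i\<in>X. C (a i) * v i) \<in> Lin" using v linsub_Lin by (intro linsub_sum linsub_scale) auto
    fix q assume q: "q \<in> X"
    have "coef (\<Sum>i\<in>X. C (a i) * v i) (unitv q) = mm X (mm X (\<lambda>_ s. coef u (unitv s)) P) (jac v) 0 q"
      by (simp add: mm_def a_def jac_def)
    also have "\<dots> = mm X (\<lambda>_ s. coef u (unitv s)) (mm X P (jac v)) 0 q" by (simp only: mm_assoc)
    also have "\<dots> = coef u (unitv q)" by (rule mm_inv_right(1)[OF J _ q]) simp
    finally show "coef u (unitv q) = coef (\<Sum>i\<in>X. C (a i) * v i) (unitv q)" by simp
  qed
  define w where "w \<chi> = (\<Sum>i\<in>{i \<in> X. l i = \<chi>}. C (a i) * v i)" for \<chi>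
  have wn: "\<exists>e. (sh ?T \<chi> ^^ e) (w \<chi>) = 0" for \<chi>
  proof -
    have "w \<chi> \<in> {v. \<exists>e. (sh ?T \<chi> ^^ e) v = 0}" unfolding w_def
      using v by (intro linsub_sum[OF nil] linsub_scale[OF nil]) auto
    then show ?thesis by simp
  qed
  have "u - w \<kappa> \<in> {v. \<exists>e. (sh ?T \<kappa> ^^ e) v = 0}" using u(2) wn by (intro linsub_diff[OF nil]) auto
  then obtain e where e: "(sh ?T \<kappa> ^^ e) (u - w \<kappa>) \<in> {0}" by blast
  have split: "(\<Sum>i\<in>X. C (a i) * v i) = (\<Sum>\<chi>\<in>l ` X. w \<chi>)"
    unfolding w_def by (rule sum.image_gen) simp
  have sp2: "(\<Sum>\<chi>\<in>l ` X. w \<chi>) = w \<kappa> + (\<Sum>\<chi>\<in>l ` X - {\<kappa>}. w \<chi>)"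
  proof (cases "\<kappa> \<in> l ` X")
    case True
    then show ?thesis by (intro sum.remove) auto
  next
    case False
    then have "{i \<in> X. l i = \<kappa>} = {}" by auto
    then have "w \<kappa> = 0" unfolding w_def by (simp only: sum.empty)
    then show ?thesis using False by simp
  qed
  have "u - w \<kappa> \<in> {0}"
  proof (rule gen_eigen_unique[OF T linsub_0 _ _ _ _ e])
    show "F \<in> {0} \<Longrightarrow> ?T F \<in> {0}" for F using linop_zero[OF T] by simp
    show "finite (l ` X - {\<kappa>})" "\<kappa> \<notin> l ` X - {\<kappa>}" by auto
    show "\<exists>p. (sh ?T \<chi> ^^ p) (w \<chi>) \<in> {0}" for \<chi> using wn by blast
    show "u - w \<kappa> - (\<Sum>\<chi>\<in>l ` X - {\<kappa>}. w \<chi>) \<in> {0}" using ua split sp2 by simp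
  qed
  then have uw: "u = w \<kappa>" by simp
  have "w \<kappa> = (\<Sum>i\<in>X. C (if l i = \<kappa> then a i else 0) * v i)"
    unfolding w_def by (rule sum.mono_neutral_cong_left) auto
  then have cu: "coef u (unitv s) = (\<Sum>i\<in>X. (if l i = \<kappa> then a i else 0) * jac v i s)" for s
    using uw by (simp add: jac_def)
  have "a i = mm X (mm X (\<lambda>_ i. if l i = \<kappa> then a i else 0) (jac v)) P 0 i"
    unfolding a_def[of i] cu by (simp add: mm_def)
  also have "\<dots> = mm X (\<lambda>_ i. if l i = \<kappa> then a i else 0) (mm X (jac v) P) 0 i" by (simp only: mm_assoc)
  also have "\<dots> = (if l i = \<kappa> then a i else 0)" by (rule mm_inv_right(2)[OF J _ i(1)]) simp
  finally have "a i = (if l i = \<kappa> then a i else 0)" .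
  then have "l i \<noteq> \<kappa> \<Longrightarrow> a i = 0" by (simp only: if_False)
  then show ?thesis using i(2) unfolding a_def by blast
qed

lemma geig_dd:
  assumes V: "fld V" and F: "on X F" "F \<in> geig (LL V) \<chi>"
  shows "dd F \<in> geig (LL V) \<chi>"
proof -
  have "on X ((sh (LL V) \<chi> ^^ p) F) \<and> (sh (LL V) \<chi> ^^ p) (dd F) = dd ((sh (LL V) \<chi> ^^ p) F)" for p
  proof (induction p)
    case (Suc p)
    define H where "H = (sh (LL V) \<chi> ^^ p) F"
    have H: "on X H" "(sh (LL V) \<chi> ^^ p) (dd F) = dd H" using Suc.IH by (simp_all add: H_def)
    have "on X (LL V H - C \<chi> * H)" using H(1) on_LL[OF V H(1)] by (intro on_diff on_mult on_C)
    moreover have "LL V (dd H) - C \<chi> * dd H = dd (LL V H - C \<chi> * H)" using LL_dd[OF V H(1)] by simp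
    moreover have "(sh (LL V) \<chi> ^^ Suc p) F = LL V H - C \<chi> * H" "(sh (LL V) \<chi> ^^ Suc p) (dd F) = LL V (dd H) - C \<chi> * dd H"
      using H(2) by (simp_all add: sh_def H_def)
    ultimately show ?case by (simp only: simp_thms)
  next
    case 0
    show ?case using F(1) by (simp only: funpow_0 simp_thms)
  qed
  then have p: "(sh (LL V) \<chi> ^^ p) (dd F) = dd ((sh (LL V) \<chi> ^^ p) F)" for p by blast
  show ?thesis unfolding geig_def mem_Collect_eq p
  proof
    fix d
    obtain p where "om d ((sh (LL V) \<chi> ^^ p) F)" using F(2) unfolding geig_def by blast
    then show "\<exists>p. om d (dd ((sh (LL V) \<chi> ^^ p) F))" by (blast intro: om_dd)
  qed
qed

lemma geig_tc:
  assumes V: "fld V" and y: "\<And>i. i \<in> X \<Longrightarrow> on X (y i) \<and> y i \<in> geig (LL V) (l i)" and i: "i < K"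
  shows "tc y i \<in> geig (LL V) (tw l i)"
  using i
proof (cases rule: K_cases)
  case 1
  have "LL V (var 0) = C 0 * var 0" by (simp add: LL_var)
  then show ?thesis using 1 eigen_geig by simp
qed (use y geig_dd[OF V] in auto)

lemma pd_fibre_fm:
  assumes "\<And>i. i \<in> X \<Longrightarrow> on X (h i)" "i \<in> X"
  shows "pd (2 * n + i) (fm h) = h i"
proof -
  have "pd (2 * n + i) (fm h) = (\<Sum>p\<in>X. if p = i then h i else 0)"
    unfolding fm_def pd_sum using assms by (intro sum.cong) (auto simp: pd_var pd_X)
  then show ?thesis using assms(2) by simp
qed

lemma form_weights:
  assumes V: "fld V" and y: "xcoords y" and yl: "\<And>i. i \<in> X \<Longrightarrow> y i \<in> geig (LL V) (l i)"
    and h: "\<And>i. i \<in> X \<Longrightarrow> on X (h i)" and F: "on {..<K} (fm h)" "cmp K (fm h) (tc y) \<in> geig (LL V) \<chi>" and i: "i \<in> X"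
  shows "wtd K (tw l) (\<chi> - l i) (h i)"
proof -
  have "wtd K (tw l) \<chi> (fm h)"
  proof (rule geig_cmp_weights[OF LL_deriv[OF V] tc_coords[OF y] _ F])
    show "tc y i \<in> geig (LL V) (tw l i)" if "i < K" for i
      by (rule geig_tc[OF V _ that]) (use y yl in \<open>auto simp: xcoords_def\<close>)
  qed
  then have "wtd K (tw l) (\<chi> - tw l (2 * n + i)) (pd (2 * n + i) (fm h))" using i by (intro wtd_pd) auto
  then show ?thesis using i pd_fibre_fm[of h i, OF h] by simp
qed

lemma fm_cong: "(\<And>p. p \<in> X \<Longrightarrow> g p = h p) \<Longrightarrow> fm g = fm h"
  unfolding fm_def by (rule sum.cong) auto

lemma pd_fibre_dd: "on X F \<Longrightarrow> p \<in> X \<Longrightarrow> pd (2 * n + p) (dd F) = pd p F"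
  using pd_fibre_fm[of "\<lambda>p. pd p F" p] on_pd[of X F] by (simp add: fm_def dd_def mult.commute)

text \<open>Under a change of coordinates the coefficient matrix of the quadratic part transforms by
  congruence with the Jacobian; this comes from the fibre derivative of the pullback at first
  order.\<close>

lemma form_linear_part:
  assumes y: "xcoords y" and h: "\<And>i. i \<in> X \<Longrightarrow> on X (h i) \<and> om 1 (h i)" and g: "\<And>i. i \<in> X \<Longrightarrow> on X (g i)"
    and eq: "cmp K (fm h) (tc y) = fm g" and p: "p \<in> X" and q: "q \<in> X"
  shows "coef (g p) (unitv q) = mm X (tr (jac y)) (mm X (\<lambda>i j. coef (h i) (unitv j)) (jac y)) p q"
proof -
  have s: "small K (tc y)" by (rule tc_small[OF y])
  have yi: "on X (y i)" if "i \<in> X" for i using y that by (simp add: xcoords_def)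
  have ho: "on X (cmp K (h i) (tc y))" if "i \<in> X" for i using cmp_tc_on[OF y] h that by blast
  have "fm g = (\<Sum>i\<in>X. cmp K (h i) (tc y) * dd (y i))"
    unfolding eq[symmetric] fm_def[of h] using s by simp
  then have "g p = pd (2 * n + p) (\<Sum>i\<in>X. cmp K (h i) (tc y) * dd (y i))"
    using pd_fibre_fm[of g p] g p by simp
  also have "\<dots> = (\<Sum>i\<in>X. cmp K (h i) (tc y) * pd p (y i))"
    unfolding pd_sum using p ho yi by (intro sum.cong) (simp_all add: pd_fibre_dd pd_X)
  finally have "coef (g p) (unitv q) = (\<Sum>i\<in>X. coef (cmp K (h i) (tc y)) (unitv q) * jac y i p)"
    using h by (simp add: coef_mult_unitv coef_cmp_0[OF s] om1_iff coef_pd_0 jac_def del: One_nat_def)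
  also have "\<dots> = (\<Sum>i\<in>X. tr (jac y) p i * mm X (\<lambda>i j. coef (h i) (unitv j)) (jac y) i q)"
    using h by (intro sum.cong) (simp_all add: jac_cmp_tc[OF s] tr_def mm_def)
  finally show ?thesis by (simp add: mm_def)
qed

text \<open>Joint eigencoordinates \<open>y\<close> give the form its weights, and the weighted
  Darboux argument turns them into \<open>w\<close>. The block basis \<phi>, chosen for
  \<open>Z\<close> alone, enters only through the matrix \<open>c\<close> from the joint eigenbasis
  to \<phi>, which by \<open>frame_weights\<close> mixes equal eigenvalues of \<open>Z\<close> only.
  The condition m_i + m_j = 0 on the entries of \<open>A\<close> expresses that \<open>V\<close>
  annihilates the form.\<close>

lemma adapted_coordinates:
  assumes Z: "fld Z" and V: "fld V" and cm: "\<And>F. LL Z (LL V F) = LL V (LL Z F)"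
    and g: "\<And>p. p \<in> X \<Longrightarrow> on X (g p) \<and> om 1 (g p)"
  defines "G \<equiv> \<lambda>p q. coef (g p) (unitv q)"
  assumes b: "inv_pair X b (\<lambda>p q. G p q - G q p)"
    and gZ: "\<And>q. q \<in> X \<Longrightarrow> lie X Z g q = g q" and gV: "\<And>q. q \<in> X \<Longrightarrow> lie X V g q = 0"
    and \<phi>: "\<And>i. i \<in> X \<Longrightarrow> \<phi> i \<in> Lin \<and> (\<exists>e. (sh (TT Z) (\<kappa> i) ^^ e) (\<phi> i) = 0)" and P\<phi>: "inv_pair X P\<phi> (jac \<phi>)"
    and B: "\<And>p q. p \<in> X \<Longrightarrow> q \<in> X \<Longrightarrow> G p q = mm X (tr (jac \<phi>)) (mm X B (jac \<phi>)) p q"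
  shows "\<exists>w l m c ci A H. xcoords w \<and> (\<forall>i\<in>X. w i \<in> geig (LL Z) (l i) \<and> w i \<in> geig (LL V) (m i)) \<and>
    inv_pair X c ci \<and> (\<forall>i\<in>X. \<forall>j\<in>X. c j i \<noteq> 0 \<longrightarrow> l i = \<kappa> j) \<and> (\<forall>i\<in>X. \<forall>j\<in>X. ci i j \<noteq> 0 \<longrightarrow> l i = \<kappa> j) \<and>
    (\<forall>i\<in>X. \<forall>j\<in>X. A i j \<noteq> 0 \<longrightarrow> m i + m j = 0) \<and>
    (\<forall>i\<in>X. \<forall>j\<in>X. A i j = mm X (tr c) (mm X B c) i j) \<and>
    on X H \<and> om 3 H \<and> H \<in> geig (LL Z) 1 \<and> H \<in> geig (LL V) 0 \<and>
    fm g = (\<Sum>i\<in>X. \<Sum>j\<in>X. C (A i j) * (w j * dd (w i))) + dd H"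
proof -
  obtain y v l m where y: "xcoords y" and yv: "\<And>i. i \<in> X \<Longrightarrow> y i \<in> geig (LL Z) (l i)" "\<And>i. i \<in> X \<Longrightarrow> y i \<in> geig (LL V) (m i)"
    and v: "\<And>i. i \<in> X \<Longrightarrow> v i \<in> Lin" "\<And>i. i \<in> X \<Longrightarrow> om 2 (y i - v i)" "\<And>i. i \<in> X \<Longrightarrow> \<exists>e. (sh (TT Z) (l i) ^^ e) (v i) = 0"
    using joint_coords[OF Z V cm] by blast
  have yX: "on X (y i)" "om 1 (y i)" if "i \<in> X" for i using y that unfolding xcoords_def by auto
  have s: "small K (tc y)" by (rule tc_small[OF y])
  obtain P where PJ: "inv_pair X P (jac y)" using y unfolding xcoords_def by blast
  have "jac v i j = jac y i j" if "i \<in> X" for i j using v(2)[OF that] by (simp add: om2_iff jac_def)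
  then have Pv: "inv_pair X P (jac v)" using PJ inv_pair_cong[of X P P "jac v" "jac y"] by simp
  define c where "c = mm X (jac \<phi>) P"
  define ci where "ci = mm X (jac y) P\<phi>"
  have c: "inv_pair X c ci" unfolding c_def ci_def
    by (rule inv_pair_mm[OF _ inv_pair_sym[OF P\<phi>] PJ]) simp
  have cw: "l i = \<kappa> j" if "i \<in> X" "j \<in> X" "c j i \<noteq> 0" for i j
    by (rule frame_weights[OF Z Pv _ _ _ that(1)])
      (use v \<phi>[OF that(2)] that(3) in \<open>auto simp: c_def mm_def jac_def\<close>)
  have ciw: "l i = \<kappa> j" if "i \<in> X" "j \<in> X" "ci i j \<noteq> 0" for i j
    using weighted_inverse[OF inv_pair_sym[OF c], of \<kappa> l i j] cw that by (metis (no_types))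
  obtain h F where h: "\<And>i. i \<in> X \<Longrightarrow> on X (h i) \<and> om 1 (h i)" and F: "on {..<K} F" "F = fm h" "cmp K F (tc y) = fm g"
    using form_surj[where g = g, OF y g] by blast
  have hF: "on {..<K} (fm h)" "cmp K (fm h) (tc y) = fm g" using F by auto
  define A where "A i j = coef (h i) (unitv j)" for i j
  have GA: "G p q = mm X (tr (jac y)) (mm X A (jac y)) p q" if "p \<in> X" "q \<in> X" for p q
    unfolding G_def A_def[abs_def] by (rule form_linear_part[OF y h _ hF(2) that]) (use g in auto)
  have gon: "\<And>p. p \<in> X \<Longrightarrow> on X (g p)" using g by blast
  have "fm (lie X Z g) = fm g" "fm (lie X V g) = fm (\<lambda>_. 0)"
    by (rule fm_cong, simp add: gZ gV)+
  moreover have fm0: "fm (\<lambda>_. 0) = 0" by (simp add: fm_def)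
  ultimately have "LL Z (fm g) = C 1 * fm g" "LL V (fm g) = C 0 * fm g"
    using LL_fm[where g = g, OF Z gon] LL_fm[where g = g, OF V gon] fm0 by simp_all
  then have fg: "fm g \<in> geig (LL Z) 1" "fm g \<in> geig (LL V) 0" by (auto intro: eigen_geig)
  have hw: "wtd K (tw l) (1 - l i) (h i)" "wtd K (tw m) (0 - m i) (h i)" if i: "i \<in> X" for i
    using form_weights[OF Z y yv(1) _ hF(1) _ i, of 1] form_weights[OF V y yv(2) _ hF(1) _ i, of 0] h fg hF(2) by auto
  have Aw: "m i + m j = 0" if "i \<in> X" "j \<in> X" "A i j \<noteq> 0" for i j
  proof -
    have "wt K (tw m) (unitv j) = 0 - m i" using hw(2)[OF that(1)] that(3) unfolding wtd_def A_def by blast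
    then show ?thesis using that(2) by (simp add: wt_unitv)
  qed
  have AG: "A i j = mm X (tr P) (mm X G P) i j" if "i \<in> X" "j \<in> X" for i j
    by (rule congruence_inverse[OF _ PJ GA that]) auto
  have Ac: "A i j = mm X (tr c) (mm X B c) i j" if "i \<in> X" "j \<in> X" for i j
  proof -
    have "A i j = mm X (tr P) (mm X (mm X (tr (jac \<phi>)) (mm X B (jac \<phi>))) P) i j"
      unfolding AG[OF that] by (intro mm_cong refl) (simp add: B)
    then show ?thesis unfolding c_def tr_mm by (simp only: mm_assoc)
  qed
  have skew: "A i j - A j i = mm X (tr P) (mm X (\<lambda>p q. G p q - G q p) P) i j" if "i \<in> X" "j \<in> X" for i j
  proof -
    have "A j i = tr (mm X (tr P) (mm X G P)) i j" unfolding AG[OF that(2,1)] by (simp add: tr_def)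
    also have "\<dots> = mm X (tr P) (mm X (tr G) P) i j" unfolding tr_mm tr_tr by (simp only: mm_assoc)
    finally show ?thesis unfolding AG[OF that]
      by (simp add: mm_def tr_def[of G] left_diff_distrib right_diff_distrib sum_subtractf)
  qed
  have "inv_pair X (mm X (mm X (jac y) b) (tr (jac y))) (mm X (tr P) (mm X (\<lambda>p q. G p q - G q p) P))"
    by (intro inv_pair_mm b) (use inv_pair_sym[OF PJ] inv_pair_tr[OF PJ] in auto)
  then have AI: "inv_pair X (mm X (mm X (jac y) b) (tr (jac y))) (\<lambda>i j. coef (h i) (unitv j) - coef (h j) (unitv i))"
    by (subst inv_pair_cong[OF refl]) (use skew in \<open>auto simp: A_def\<close>)
  \<comment> \<open>\<open>True\<close> stands for the grading by \<open>Z\<close>, where the form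
    has weight 1, and \<open>False\<close> for the grading by \<open>V\<close>, where it has weight
    0.\<close>
  define L where "L t = (if t then l else m)" for t
  define e where "e t = (if t then 1 else 0 :: complex)" for t
  have hL: "wtd K (tw (L t)) (e t - L t i) (h i)" if "i \<in> X" for i t using hw[OF that] by (cases t) (simp_all add: L_def e_def)
  obtain w0 R where w0: "\<And>i. i \<in> X \<Longrightarrow> on X (w0 i) \<and> om 2 (w0 i - var i) \<and> (\<forall>t. wtd K (tw (L t)) (L t i) (w0 i))"
    and R: "on X R" "om 3 R" "\<And>t. wtd K (tw (L t)) (e t) R"
    and fmh: "fm h = (\<Sum>i\<in>X. \<Sum>j\<in>X. C (coef (h i) (unitv j)) * (w0 j * dd (w0 i))) + dd R"
    by (rule darboux[where h = h and L = L and c = e, OF h hL AI]) auto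
  define w where "w i = cmp K (w0 i) (tc y)" for i
  define H where "H = cmp K R (tc y)"
  have won: "on X (w i)" if "i \<in> X" for i unfolding w_def using w0[OF that] by (intro cmp_tc_on[OF y]) auto
  have wy: "om 2 (w i - y i)" if i: "i \<in> X" for i
    using om_cmp[of 2 "w0 i - var i" K "tc y"] w0[OF i] s i by (simp add: w_def)
  have wom: "om 1 (w i)" if i: "i \<in> X" for i
    using om_add[of 1 "w i - y i" "y i"] om_mono[OF wy[OF i], of 1] yX[OF i] by simp
  have "jac w i j = jac y i j" if "i \<in> X" for i j using wy[OF that] by (simp add: om2_iff jac_def)
  then have "inv_pair X P (jac w)" using PJ inv_pair_cong[of X P P "jac w" "jac y"] by simp
  then have xw: "xcoords w" using won wom unfolding xcoords_def by blast
  have ge: "cmp K F (tc y) \<in> geig (LL Z) \<chi>" if "on X F" "wtd K (tw l) \<chi> F" for F \<chi>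
    by (rule geig_cmp[OF LL_deriv[OF Z] s geig_tc[OF Z] on_XK[OF that(1)] that(2)]) (use yX yv in auto)
  have ge': "cmp K F (tc y) \<in> geig (LL V) \<chi>" if "on X F" "wtd K (tw m) \<chi> F" for F \<chi>
    by (rule geig_cmp[OF LL_deriv[OF V] s geig_tc[OF V] on_XK[OF that(1)] that(2)]) (use yX yv in auto)
  have ww: "w i \<in> geig (LL Z) (l i)" "w i \<in> geig (LL V) (m i)" if "i \<in> X" for i
  proof -
    have "wtd K (tw (L True)) (L True i) (w0 i)" "wtd K (tw (L False)) (L False i) (w0 i)" using w0[OF that] by blast+
    then show "w i \<in> geig (LL Z) (l i)" "w i \<in> geig (LL V) (m i)"
      unfolding w_def using w0[OF that] by (auto simp: L_def intro: ge ge')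
  qed
  have HH: "H \<in> geig (LL Z) 1" "H \<in> geig (LL V) 0"
    unfolding H_def using R(1) R(3)[of True] R(3)[of False] by (auto simp: L_def e_def intro: ge ge')
  have Hon: "on X H" "om 3 H" unfolding H_def using cmp_tc_on[OF y R(1)] om_cmp[OF R(2)] by auto
  have cdd: "cmp K (dd (w0 i)) (tc y) = dd (w i)" if "i \<in> X" for i
    unfolding w_def using w0[OF that] by (intro dd_cmp[OF y, symmetric]) auto
  have "fm g = (\<Sum>i\<in>X. \<Sum>j\<in>X. C (A i j) * (w j * cmp K (dd (w0 i)) (tc y))) + dd H"
    unfolding hF(2)[symmetric] fmh using s R(1) by (simp add: A_def w_def H_def dd_cmp[OF y])
  also have "\<dots> = (\<Sum>i\<in>X. \<Sum>j\<in>X. C (A i j) * (w j * dd (w i))) + dd H"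
    by (simp add: cdd)
  finally have fin: "fm g = (\<Sum>i\<in>X. \<Sum>j\<in>X. C (A i j) * (w j * dd (w i))) + dd H" .
  show ?thesis
    apply (rule exI[of _ w], rule exI[of _ l], rule exI[of _ m], rule exI[of _ c], rule exI[of _ ci], rule exI[of _ A], rule exI[of _ H])
    using xw ww c cw ciw Aw Ac Hon HH fin by (intro conjI ballI impI; assumption | blast)
qed

end

section \<open>The final coordinates and the semisimple part of the field\<close>

lemma om_cmp_cancel:
  assumes c: "coords k \<Phi>" and F: "on {..<k} F" and o: "om d (cmp k F \<Phi>)"
  shows "om d F"
proof -
  obtain \<Psi> where \<Psi>: "coords k \<Psi>" "\<forall>i<k. cmp k (\<Phi> i) \<Psi> = var i" using coords_inverse[OF c] by blast
  have "cmp k (cmp k F \<Phi>) \<Psi> = cmp k F (\<lambda>i. cmp k (\<Phi> i) \<Psi>)"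
    using c \<Psi>(1) unfolding coords_def by (intro cmp_assoc) auto
  also have "\<dots> = cmp k F var" by (rule cmp_cong[OF F]) (use \<Psi>(2) in auto)
  also have "\<dots> = F" by (rule cmp_ident[OF F])
  finally show ?thesis using om_cmp[OF o, of k \<Psi>] by simp
qed

primrec mpow :: "nat set \<Rightarrow> (nat \<Rightarrow> nat \<Rightarrow> complex) \<Rightarrow> nat \<Rightarrow> nat \<Rightarrow> nat \<Rightarrow> complex" where
  "mpow I A 0 = (\<lambda>i j. if i = j then 1 else 0)"
| "mpow I A (Suc p) = mm I (mpow I A p) A"

definition dg :: "(nat \<Rightarrow> complex) \<Rightarrow> nat \<Rightarrow> nat \<Rightarrow> complex" where
  "dg m i j = (if i = j then m i else 0)"

lemma mm_dg:
  "finite I \<Longrightarrow> i \<in> I \<Longrightarrow> mm I (dg m) A i j = m i * A i j"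
  "finite I \<Longrightarrow> j \<in> I \<Longrightarrow> mm I A (dg m) i j = A i j * m j"
  by (simp_all add: mm_def dg_def if_distrib if_distribR cong: if_cong)

lemma tr_dg: "tr (dg m) = dg m"
  by (auto simp: tr_def dg_def fun_eq_iff)

context tangent
begin

text \<open>The diagonal linear field with eigenvalues \<open>m\<close> multiplies every monomial by
  its weight.\<close>

lemma euler_weight:
  assumes F: "on X F" "wtd K (tw m) \<chi> F"
  shows "(\<Sum>i\<in>X. C (m i) * (var i * pd i F)) = C \<chi> * F"
proof (rule ser_eqI)
  fix a
  have "(\<Sum>i\<in>X. m i * (of_nat (a i) * coef F a)) = \<chi> * coef F a"
  proof (cases "coef F a = 0")
    case False
    then have "supp a \<subseteq> X" and w: "wt K (tw m) a = \<chi>" using F unfolding on_def wtd_def by auto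
    then have "a (2 * n + j) = 0" if "j \<in> X" for j using that by (auto simp: supp_def)
    then have "wt K (tw m) a = (\<Sum>i\<in>X. of_nat (a i) * m i)" unfolding wt_def sum_K by simp
    then show ?thesis unfolding w[symmetric] by (simp add: sum_distrib_left sum_distrib_right mult_ac)
  qed simp
  then show "coef (\<Sum>i\<in>X. C (m i) * (var i * pd i F)) a = coef (C \<chi> * F) a"
    by (simp add: coef_var_pd)
qed

lemma X_surj_family:
  assumes y: "xcoords y" and H: "\<And>i. i \<in> X \<Longrightarrow> on X (H i)"
  shows "\<exists>G. \<forall>i\<in>X. on X (G i) \<and> cmp K (G i) (tc y) = H i"
proof -
  have "\<exists>F. i \<in> X \<longrightarrow> on X F \<and> cmp K F (tc y) = H i" for i
  proof (cases "i \<in> X")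
    case True
    obtain F where "on X F" "cmp K F (tc y) = H i" by (rule X_surj[OF y H[OF True]])
    then show ?thesis by blast
  qed simp
  then have "\<forall>i. \<exists>F. i \<in> X \<longrightarrow> on X F \<and> cmp K F (tc y) = H i" by blast
  from choice[OF this] show ?thesis by blast
qed

lemma om_tc_cancel: "xcoords y \<Longrightarrow> on X F \<Longrightarrow> om d (cmp K F (tc y)) \<Longrightarrow> om d F"
  by (rule om_cmp_cancel[OF tc_coords on_XK])

text \<open>Up to order 2, the power \<open>p\<close> of \<open>LL V - m i\<close> applied to
  \<open>w i\<close> is row \<open>i\<close> of the matrix power of \<open>Nt\<close> applied to
  \<open>w\<close>: since \<open>Nt\<close> connects only indices with equal \<open>m\<close>, the
  same shift serves every coordinate that occurs. The left side eventually has order 2, hence the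
  rows vanish.\<close>

lemma nilpotent_part:
  assumes V: "fld V" and w: "xcoords w" "\<And>i. i \<in> X \<Longrightarrow> w i \<in> geig (LL V) (m i)"
    and Nt: "\<And>i. i \<in> X \<Longrightarrow> om 2 (LL V (w i) - (\<Sum>j\<in>X. C (dg m i j + Nt i j) * w j))"
    and Nw: "\<And>i j. i \<in> X \<Longrightarrow> j \<in> X \<Longrightarrow> Nt i j \<noteq> 0 \<Longrightarrow> m i = m j"
  shows "\<exists>p. \<forall>i\<in>X. \<forall>j\<in>X. mpow X Nt p i j = 0"
proof -
  let ?D = "\<lambda>i. sh (LL V) (m i)"
  have fil: "filtered (LL V)" by (rule LL_filtered[OF V])
  have lin: "linop (LL V)" by (rule LL_linop)
  have mw: "m i = m j" if "i \<in> X" "j \<in> X" "mpow X Nt p i j \<noteq> 0" for p i j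
    using that
  proof (induction p arbitrary: j)
    case 0
    then show ?case by (auto split: if_splits)
  next
    case (Suc p)
    have "(\<Sum>k\<in>X. mpow X Nt p i k * Nt k j) \<noteq> 0" using Suc.prems(3) by (simp add: mm_def)
    then obtain k where k: "k \<in> X" "mpow X Nt p i k * Nt k j \<noteq> 0" by (rule sum.not_neutral_contains_not_neutral)
    then have "m i = m k" "m k = m j" using Suc.IH[of k] Suc.prems Nw[of k j] by auto
    then show ?case by simp
  qed
  have step: "om 2 (?D i (w i) - (\<Sum>j\<in>X. C (Nt i j) * w j))" if i: "i \<in> X" for i
  proof -
    have "(\<Sum>j\<in>X. C (dg m i j + Nt i j) * w j) = (\<Sum>j\<in>X. if j = i then C (m i) * w i else 0) + (\<Sum>j\<in>X. C (Nt i j) * w j)"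
      unfolding sum.distrib[symmetric] by (rule sum.cong) (auto simp: dg_def distrib_right)
    also have "(\<Sum>j\<in>X. if j = i then C (m i) * w i else 0) = C (m i) * w i" using i by simp
    finally show ?thesis using Nt[OF i] by (simp add: sh_def diff_diff_eq)
  qed
  have it: "om 2 ((?D i ^^ p) (w i) - (\<Sum>j\<in>X. C (mpow X Nt p i j) * w j))" if i: "i \<in> X" for i p
  proof (induction p)
    case 0
    have "(\<Sum>j\<in>X. C (mpow X Nt 0 i j) * w j) = (\<Sum>j\<in>X. if j = i then w i else 0)" by (rule sum.cong) auto
    then show ?case using i by simp
  next
    case (Suc p)
    define M where "M = mpow X Nt p i"
    define E where "E = (?D i ^^ p) (w i) - (\<Sum>j\<in>X. C (M j) * w j)"
    have "om 2 E" using Suc.IH by (simp only: E_def M_def)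
    then have 1: "om 2 (?D i E)" using filtered_sh_pow[OF fil, of 2 E 1 "m i"] by simp
    have e: "(?D i ^^ p) (w i) = E + (\<Sum>j\<in>X. C (M j) * w j)" by (simp add: E_def)
    have sc: "?D i (C a * F) = C a * ?D i F" for a F using linop_sh[OF lin, of "m i"] unfolding linop_def by blast
    have "(?D i ^^ Suc p) (w i) = ?D i E + (\<Sum>j\<in>X. C (M j) * ?D i (w j))"
      using linop_sh[OF lin, of "m i"] by (simp add: e linop_sum sc linop_def[THEN iffD1, THEN conjunct1, rule_format])
    moreover have "(\<Sum>j\<in>X. C (mpow X Nt (Suc p) i j) * w j) = (\<Sum>j\<in>X. C (M j) * (\<Sum>k\<in>X. C (Nt j k) * w k))"
    proof -
      have "(\<Sum>j\<in>X. C (M j) * (\<Sum>k\<in>X. C (Nt j k) * w k)) = (\<Sum>j\<in>X. \<Sum>k\<in>X. C (M j) * (C (Nt j k) * w k))"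
        by (simp add: sum_distrib_left)
      also have "\<dots> = (\<Sum>k\<in>X. \<Sum>j\<in>X. C (M j) * (C (Nt j k) * w k))" by (rule sum.swap)
      finally show ?thesis by (simp add: mm_def M_def C_sum sum_distrib_right mult.assoc)
    qed
    ultimately have eq: "(?D i ^^ Suc p) (w i) - (\<Sum>j\<in>X. C (mpow X Nt (Suc p) i j) * w j)
        = ?D i E + (\<Sum>j\<in>X. C (M j) * (?D i (w j) - (\<Sum>k\<in>X. C (Nt j k) * w k)))"
      by (simp only: right_diff_distrib sum_subtractf add_diff_eq)
    have "om 2 (C (M j) * (?D i (w j) - (\<Sum>k\<in>X. C (Nt j k) * w k)))" if j: "j \<in> X" for j
    proof (cases "M j = 0")
      case False
      then have "m i = m j" using mw[OF i j] by (simp add: M_def)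
      then show ?thesis using step[OF j] by (intro om_mult_left) simp
    qed simp
    then show ?case unfolding eq by (intro om_add[OF 1] om_sum)
  qed
  have "\<forall>i. \<exists>p. i \<in> X \<longrightarrow> om 2 ((?D i ^^ p) (w i))" using w(2) unfolding geig_def by blast
  then obtain q where q: "\<forall>i. i \<in> X \<longrightarrow> om 2 ((?D i ^^ q i) (w i))" using choice[of "\<lambda>i p. i \<in> X \<longrightarrow> om 2 ((?D i ^^ p) (w i))"] by blast
  define p where "p = (\<Sum>i\<in>X. q i)"
  obtain P where P: "inv_pair X P (jac w)" using w(1) unfolding xcoords_def by blast
  have "mpow X Nt p i j = 0" if ij: "i \<in> X" "j \<in> X" for i j
  proof -
    have "q i \<le> p" unfolding p_def using ij by (intro member_le_sum) auto
    then have "om 2 ((?D i ^^ p) (w i))" using q ij filtered_sh_mono[OF fil] by blast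
    from om_diff[OF this it[OF ij(1), of p]] have "om 2 (\<Sum>j\<in>X. C (mpow X Nt p i j) * w j)" by simp
    then have z: "(\<Sum>j\<in>X. mpow X Nt p i j * jac w j s) = 0" for s by (simp add: om2_iff jac_def)
    have "mpow X Nt p i j = mm X (mpow X Nt p) (mm X (jac w) P) i j"
      by (rule mm_inv_right(2)[OF P _ ij(2), symmetric]) simp
    also have "\<dots> = mm X (mm X (mpow X Nt p) (jac w)) P i j" by (simp only: mm_assoc)
    also have "\<dots> = 0" using z unfolding mm_def[of X "mm X (mpow X Nt p) (jac w)"] by (simp add: mm_def)
    finally show ?thesis .
  qed
  then show ?thesis by blast
qed

lemma small_tc: "(\<And>i. i \<in> X \<Longrightarrow> om 1 (y i)) \<Longrightarrow> small K (tc y)"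
  unfolding small_def
proof (intro allI impI)
  fix i assume y: "\<And>i. i \<in> X \<Longrightarrow> om 1 (y i)" and "i < K"
  from this(2) show "om 1 (tc y i)" by (cases rule: K_cases) (simp_all add: y om1_dd del: One_nat_def)
qed

text \<open>The coordinates \<Psi> arise from \<open>w\<close> by the linear change
  \<open>c\<close>. Weights for \<open>Z\<close> persist, and give those of \<open>R\<close>. For
  the field \<open>V\<close>, weights are available only in \<open>w\<close>; so \<open>R\<close>
  and \<open>Y\<close> are written as series \<open>Rw\<close> and \<open>Yw\<close> in
  \<open>w\<close>, where homogeneity is known, and carried over.\<close>

lemma normal_coordinates:
  assumes Z: "fld Z" and V: "fld V" and w: "xcoords w"
    and wg: "\<And>i. i \<in> X \<Longrightarrow> w i \<in> geig (LL Z) (l i)" "\<And>i. i \<in> X \<Longrightarrow> w i \<in> geig (LL V) (m i)"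
    and c: "inv_pair X c ci" and cw: "\<And>i j. i \<in> X \<Longrightarrow> j \<in> X \<Longrightarrow> c j i \<noteq> 0 \<Longrightarrow> l i = \<kappa> j"
    and A: "\<And>i j. i \<in> X \<Longrightarrow> j \<in> X \<Longrightarrow> A i j = mm X (tr c) (mm X B c) i j"
    and H: "on X H" "om 3 H" "H \<in> geig (LL Z) 1" "H \<in> geig (LL V) 0"
    and g: "fm g = (\<Sum>i\<in>X. \<Sum>j\<in>X. C (A i j) * (w j * dd (w i))) + dd H"
  defines "S \<equiv> mm X c (mm X (dg m) ci)"
  defines "Sf \<equiv> \<lambda>j. \<Sum>k\<in>X. C (S j k) * var k"
  shows "\<exists>\<Psi> R Y Nt. xcoords \<Psi> \<and> on X R \<and> om 3 R \<and> wtd K (tw \<kappa>) 1 R \<and>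
    fm g = (\<Sum>i\<in>X. \<Sum>j\<in>X. C (B i j) * (\<Psi> j * dd (\<Psi> i))) + dd (cmp K R (tc \<Psi>)) \<and>
    (\<forall>i\<in>X. on X (Y i) \<and> om 1 (Y i) \<and> cmp K (Y i) (tc \<Psi>) = LL V (\<Psi> i)) \<and>
    (\<forall>i\<in>X. \<forall>j\<in>X. coef (Y i) (unitv j) = mm X c (mm X (\<lambda>i j. dg m i j + Nt i j) ci) i j) \<and>
    (\<forall>i\<in>X. \<forall>j\<in>X. Nt i j \<noteq> 0 \<longrightarrow> m i = m j) \<and> (\<exists>p. \<forall>i\<in>X. \<forall>j\<in>X. mpow X Nt p i j = 0) \<and>
    LL Sf R = 0 \<and> (\<forall>j\<in>X. LL Sf (Y j) = (\<Sum>k\<in>X. C (S j k) * Y k))"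
proof -
  have wX: "on X (w i)" "om 1 (w i)" if "i \<in> X" for i using w that unfolding xcoords_def by auto
  obtain P where P: "inv_pair X P (jac w)" using w unfolding xcoords_def by blast
  define \<Psi> where "\<Psi> j = (\<Sum>i\<in>X. C (c j i) * w i)" for j
  have Pon: "on X (\<Psi> j)" "om 1 (\<Psi> j)" for j unfolding \<Psi>_def
    by (rule on_sum, rule on_mult, simp, rule wX, assumption) (rule om_sum, rule om_mult_left, rule wX, assumption)
  have jP: "jac \<Psi> = mm X c (jac w)" by (simp add: fun_eq_iff \<Psi>_def jac_def mm_def)
  have "inv_pair X (mm X P ci) (jac \<Psi>)" unfolding jP by (rule inv_pair_mm[OF _ P inv_pair_sym[OF c]]) simp
  then have x\<Psi>: "xcoords \<Psi>" using Pon unfolding xcoords_def by blast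
  have s\<Psi>: "small K (tc \<Psi>)" by (rule tc_small[OF x\<Psi>])
  have sw: "small K (tc w)" by (rule tc_small[OF w])
  have w\<Psi>: "w i = (\<Sum>j\<in>X. C (ci i j) * \<Psi> j)" if "i \<in> X" for i
    using inv_pair_solve[OF c _ that, of w] by (simp add: \<Psi>_def)
  have gP: "\<Psi> j \<in> geig (LL Z) (\<kappa> j)" if j: "j \<in> X" for j
    unfolding \<Psi>_def
  proof (rule linsub_sum[OF linsub_geig[OF LL_filtered[OF Z]]])
    fix i assume i: "i \<in> X"
    show "C (c j i) * w i \<in> geig (LL Z) (\<kappa> j)"
    proof (cases "c j i = 0")
      case True
      then show ?thesis using linsub_zero[OF linsub_geig[OF LL_filtered[OF Z]]] by simp
    next
      case False
      then show ?thesis using cw[OF i j] wg(1)[OF i] by (intro linsub_scale[OF linsub_geig[OF LL_filtered[OF Z]]]) simp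
    qed
  qed
  obtain R where R: "on X R" "cmp K R (tc \<Psi>) = H" by (rule X_surj[OF x\<Psi> H(1)])
  have R3: "om 3 R" using om_tc_cancel[OF x\<Psi> R(1)] H(2) R(2) by simp
  have RW: "wtd K (tw \<kappa>) 1 R"
    by (rule geig_cmp_weights[OF LL_deriv[OF Z] tc_coords[OF x\<Psi>] geig_tc[OF Z] on_XK[OF R(1)]])
      (use Pon gP H R in auto)
  have LP: "on X (LL V (\<Psi> i))" for i by (rule on_LL[OF V Pon(1)])
  obtain Y where Y: "\<forall>i\<in>X. on X (Y i) \<and> cmp K (Y i) (tc \<Psi>) = LL V (\<Psi> i)"
    using X_surj_family[of \<Psi> "\<lambda>i. LL V (\<Psi> i)", OF x\<Psi> LP] by blast
  have omL: "om 1 (LL V F)" if "om 1 F" for F using filtered_om[OF LL_filtered[OF V] that] .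
  have Y1: "om 1 (Y i)" if "i \<in> X" for i
    using om_tc_cancel[OF x\<Psi>, of "Y i" 1] Y that omL[OF Pon(2)[of i]] by simp
  obtain Rw where Rw: "on X Rw" "cmp K Rw (tc w) = H" by (rule X_surj[OF w H(1)])
  have Lw: "on X (LL V (w i))" if "i \<in> X" for i using on_LL[OF V wX(1)[OF that]] .
  obtain Yw where Yw: "\<forall>i\<in>X. on X (Yw i) \<and> cmp K (Yw i) (tc w) = LL V (w i)"
    using X_surj_family[of w "\<lambda>i. LL V (w i)", OF w Lw] by blast
  have gw: "wtd K (tw m) \<chi> F" if "on X F" "cmp K F (tc w) \<in> geig (LL V) \<chi>" for F \<chi>
    by (rule geig_cmp_weights[OF LL_deriv[OF V] tc_coords[OF w] geig_tc[OF V] on_XK[OF that(1)] that(2)])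
      (use wX wg in auto)
  have Rww: "wtd K (tw m) 0 Rw" using gw[OF Rw(1)] Rw(2) H(4) by simp
  have Yww: "wtd K (tw m) (m i) (Yw i)" if i: "i \<in> X" for i
  proof -
    have "LL V (w i) \<in> geig (LL V) (m i)"
      by (rule geig_commute[OF LL_filtered[OF V] LL_filtered[OF V] refl wg(2)[OF i]])
    then show ?thesis using gw[of "Yw i" "m i"] Yw i by simp
  qed
  \<comment> \<open>The linear functions that express \<open>w\<close> in terms of \<Psi>. They are
    eigenfunctions of the field with matrix \<open>S\<close>, so weight-homogeneous series in them
    are as well.\<close>
  define ell where "ell i = (\<Sum>j\<in>X. C (ci i j) * var j)" for i
  have eon: "on X (ell i)" "om 1 (ell i)" for i unfolding ell_def
    by (rule on_sum, rule on_mult, simp, rule on_var, assumption) (rule om_sum, rule om_mult_left, rule om_var)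
  have se: "small K (tc ell)" by (rule small_tc[OF eon(2)])
  have ecomp: "cmp K (cmp K F (tc ell)) (tc \<Psi>) = cmp K F (tc w)" if F: "on X F" for F
  proof -
    have "cmp K (tc ell i) (tc \<Psi>) = tc w i" if i: "i \<in> X" for i
      using i s\<Psi> w\<Psi>[OF i] by (simp add: ell_def)
    then have "cmp K F (\<lambda>i. cmp K (tc ell i) (tc \<Psi>)) = cmp K F (tc w)" by (intro cmp_cong[OF F]) auto
    then show ?thesis unfolding cmp_assoc[OF se s\<Psi>] .
  qed
  have eX: "on X (cmp K F (tc ell))" if "on X F" for F
    by (rule on_cmp[OF that]) (use eon in auto)
  have uniq: "F = G" if "on X F" "on X G" "cmp K F (tc \<Psi>) = cmp K G (tc \<Psi>)" for F G
    by (rule cmp_inj[OF tc_coords[OF x\<Psi>] on_XK on_XK]) (use that in auto)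
  have Re: "R = cmp K Rw (tc ell)"
    by (rule uniq[OF R(1) eX[OF Rw(1)]]) (simp add: ecomp Rw R)
  have Ye: "Y j = (\<Sum>i\<in>X. C (c j i) * cmp K (Yw i) (tc ell))" if j: "j \<in> X" for j
  proof (rule uniq)
    show "on X (Y j)" using Y j by blast
    show "on X (\<Sum>i\<in>X. C (c j i) * cmp K (Yw i) (tc ell))"
      using Yw eX by (intro on_sum on_mult on_C) auto
    have "cmp K (Y j) (tc \<Psi>) = LL V (\<Psi> j)" using Y j by blast
    also have "\<dots> = (\<Sum>i\<in>X. C (c j i) * LL V (w i))" by (simp add: \<Psi>_def)
    also have "\<dots> = cmp K (\<Sum>i\<in>X. C (c j i) * cmp K (Yw i) (tc ell)) (tc \<Psi>)"
      using s\<Psi> Yw by (simp add: ecomp)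
    finally show "cmp K (Y j) (tc \<Psi>) = cmp K (\<Sum>i\<in>X. C (c j i) * cmp K (Yw i) (tc ell)) (tc \<Psi>)" .
  qed
  have Sfe: "LL Sf (ell i) = C (m i) * ell i" if i: "i \<in> X" for i
  proof -
    have ciS: "mm X ci S i k = m i * ci i k" for k
    proof -
      have "mm X ci S i k = mm X (dg m) ci i k" unfolding S_def by (rule mm_inv_left(2)[OF c _ i]) simp
      then show ?thesis using i by (simp add: mm_dg)
    qed
    have "LL Sf (ell i) = (\<Sum>j\<in>X. C (ci i j) * (\<Sum>k\<in>X. C (S j k) * var k))"
      by (simp add: ell_def LL_var Sf_def)
    also have "\<dots> = (\<Sum>k\<in>X. \<Sum>j\<in>X. C (ci i j) * (C (S j k) * var k))"
      unfolding sum_distrib_left by (rule sum.swap)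
    also have "\<dots> = (\<Sum>k\<in>X. C (mm X ci S i k) * var k)"
      by (simp add: mm_def C_sum sum_distrib_right mult.assoc)
    also have "\<dots> = C (m i) * ell i" unfolding ciS by (simp add: ell_def sum_distrib_left mult.assoc)
    finally show ?thesis .
  qed
  have Sfc: "LL Sf (cmp K F (tc ell)) = C \<chi> * cmp K F (tc ell)" if F: "on X F" "wtd K (tw m) \<chi> F" for F \<chi>
  proof -
    have "LL Sf (cmp K F (tc ell)) = (\<Sum>i<K. cmp K (pd i F) (tc ell) * LL Sf (tc ell i))"
      unfolding LL_def by (rule vf_chain[OF se])
    also have "\<dots> = (\<Sum>i\<in>X. cmp K (pd i F) (tc ell) * (C (m i) * ell i))"
      unfolding sum_K using F(1) by (simp add: pd_X Sfe)
    also have "\<dots> = cmp K (\<Sum>i\<in>X. C (m i) * (var i * pd i F)) (tc ell)"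
      using se by (simp add: mult_ac)
    finally show ?thesis unfolding euler_weight[OF F] using se by simp
  qed
  have SR: "LL Sf R = 0" unfolding Re using Sfc[OF Rw(1) Rww] by simp
  have Sc: "mm X S c j i = c j i * m i" if "j \<in> X" "i \<in> X" for i j
  proof -
    have "mm X S c j i = mm X c (mm X (dg m) (mm X ci c)) j i" unfolding S_def by (simp only: mm_assoc)
    also have "\<dots> = mm X (mm X c (dg m)) (mm X ci c) j i" by (simp only: mm_assoc)
    also have "\<dots> = mm X c (dg m) j i" by (rule mm_inv_right(2)[OF c _ that(2)]) simp
    finally show ?thesis using that by (simp add: mm_dg)
  qed
  have SY: "LL Sf (Y j) = (\<Sum>k\<in>X. C (S j k) * Y k)" if j: "j \<in> X" for j
  proof -
    let ?y = "\<lambda>i. cmp K (Yw i) (tc ell)"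
    have "LL Sf (Y j) = (\<Sum>i\<in>X. C (c j i) * (C (m i) * ?y i))"
    proof -
      have "LL Sf (?y i) = C (m i) * ?y i" if "i \<in> X" for i using Sfc[of "Yw i" "m i"] Yw Yww that by blast
      then show ?thesis unfolding Ye[OF j] by simp
    qed
    also have "\<dots> = (\<Sum>i\<in>X. C (mm X S c j i) * ?y i)" by (simp add: Sc[OF j] mult.assoc)
    also have "\<dots> = (\<Sum>i\<in>X. \<Sum>k\<in>X. C (S j k) * (C (c k i) * ?y i))"
      by (simp add: mm_def C_sum sum_distrib_right mult.assoc)
    also have "\<dots> = (\<Sum>k\<in>X. \<Sum>i\<in>X. C (S j k) * (C (c k i) * ?y i))" by (rule sum.swap)
    also have "\<dots> = (\<Sum>k\<in>X. C (S j k) * Y k)" by (simp add: Ye sum_distrib_left)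
    finally show ?thesis .
  qed
  define Lin' where "Lin' i j = coef (Yw i) (unitv j)" for i j
  define Nt where "Nt i j = Lin' i j - dg m i j" for i j
  have Nw: "m i = m j" if "i \<in> X" "j \<in> X" "Nt i j \<noteq> 0" for i j
  proof (cases "i = j")
    case False
    then have "coef (Yw i) (unitv j) \<noteq> 0" using that(3) by (simp add: Nt_def Lin'_def dg_def)
    then have "wt K (tw m) (unitv j) = m i" using Yww[OF that(1)] unfolding wtd_def by blast
    then show ?thesis using that(2) by (simp add: wt_unitv)
  qed simp
  have Yw1: "om 1 (Yw i)" if "i \<in> X" for i
    using om_tc_cancel[OF w, of "Yw i" 1] Yw that omL[OF wX(2)[OF that]] by simp
  have Nstep: "om 2 (LL V (w i) - (\<Sum>j\<in>X. C (dg m i j + Nt i j) * w j))" if i: "i \<in> X" for i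
  proof -
    have "om 2 (Yw i - (\<Sum>j\<in>X. C (coef (Yw i) (unitv j)) * var j))"
      using Yw i Yw1[OF i] by (intro om2_linear) auto
    from om_cmp[OF this, of K "tc w"] have "om 2 (LL V (w i) - (\<Sum>j\<in>X. C (Lin' i j) * w j))"
      using sw Yw i by (simp add: Lin'_def)
    moreover have "dg m i j + Nt i j = Lin' i j" for j by (simp add: Nt_def)
    ultimately show ?thesis by simp
  qed
  have nil: "\<exists>p. \<forall>i\<in>X. \<forall>j\<in>X. mpow X Nt p i j = 0"
    by (rule nilpotent_part[OF V w wg(2) Nstep Nw])
  have jY: "coef (Y i) (unitv j) = mm X c (mm X (\<lambda>i j. dg m i j + Nt i j) ci) i j" if ij: "i \<in> X" "j \<in> X" for i j
  proof -
    have je: "jac ell a j = ci a j" for a using ij(2) by (simp only: jac_def ell_def coef_lin)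
    have "coef (Y i) (unitv j) = (\<Sum>a\<in>X. c i a * coef (cmp K (Yw a) (tc ell)) (unitv j))"
      unfolding Ye[OF ij(1)] by simp
    also have "\<dots> = (\<Sum>a\<in>X. c i a * (\<Sum>b\<in>X. Lin' a b * ci b j))"
      using Yw by (simp add: jac_cmp_tc[OF se] je Lin'_def)
    finally show ?thesis by (simp add: mm_def Nt_def)
  qed
  have "(\<Sum>i\<in>X. \<Sum>j\<in>X. C (A i j) * (w j * dd (w i))) = (\<Sum>a\<in>X. \<Sum>b\<in>X. C (B a b) * (\<Psi> b * dd (\<Psi> a)))"
  proof -
    have "(\<Sum>a\<in>X. \<Sum>b\<in>X. C (B a b) * (\<Psi> b * dd (\<Psi> a)))
        = (\<Sum>a\<in>X. \<Sum>b\<in>X. \<Sum>i\<in>X. \<Sum>j\<in>X. C (c a i * B a b * c b j) * (w j * dd (w i)))"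
    proof (intro sum.cong refl)
      fix a b
      have "C (B a b) * (\<Psi> b * dd (\<Psi> a)) = C (B a b) * (\<Sum>i\<in>X. \<Sum>j\<in>X. (C (c b j) * w j) * (C (c a i) * dd (w i)))"
        unfolding \<Psi>_def by (simp add: sum_product, subst sum.swap, rule refl)
      then show "C (B a b) * (\<Psi> b * dd (\<Psi> a)) = (\<Sum>i\<in>X. \<Sum>j\<in>X. C (c a i * B a b * c b j) * (w j * dd (w i)))"
        by (simp add: sum_distrib_left mult_ac)
    qed
    also have "\<dots> = (\<Sum>a\<in>X. \<Sum>i\<in>X. \<Sum>b\<in>X. \<Sum>j\<in>X. C (c a i * B a b * c b j) * (w j * dd (w i)))"
      by (intro sum.cong refl sum.swap)
    also have "\<dots> = (\<Sum>i\<in>X. \<Sum>a\<in>X. \<Sum>j\<in>X. \<Sum>b\<in>X. C (c a i * B a b * c b j) * (w j * dd (w i)))"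
      by (subst sum.swap) (intro sum.cong refl sum.swap)
    also have "\<dots> = (\<Sum>i\<in>X. \<Sum>j\<in>X. \<Sum>a\<in>X. \<Sum>b\<in>X. C (c a i * B a b * c b j) * (w j * dd (w i)))"
      by (intro sum.cong refl sum.swap)
    also have "\<dots> = (\<Sum>i\<in>X. \<Sum>j\<in>X. C (A i j) * (w j * dd (w i)))"
      by (intro sum.cong refl) (simp add: A mm_def tr_def C_sum sum_distrib_left sum_distrib_right mult_ac)
    finally show ?thesis by simp
  qed
  then have g': "fm g = (\<Sum>i\<in>X. \<Sum>j\<in>X. C (B i j) * (\<Psi> j * dd (\<Psi> i))) + dd (cmp K R (tc \<Psi>))"
    using g R(2) by simp
  show ?thesis
    apply (rule exI[of _ \<Psi>], rule exI[of _ R], rule exI[of _ Y], rule exI[of _ Nt])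
    using x\<Psi> R(1) R3 RW g' Y Y1 jY Nw nil SR SY by (intro conjI ballI impI; assumption | blast)
qed

section \<open>Invariance of Q under the semisimple part\<close>

lemma Qtot_on:
  assumes ns: "ns 1 = 1" "ns (k + 1) = n + 1" "\<forall>s\<in>{1..k}. ns s < (ns (s + 1) :: nat)"
  shows "on X (Qtot k ns \<tau>)"
  unfolding Qtot_def
proof (rule on_sum)
  fix s assume s: "s \<in> {1..k}"
  have "1 \<le> ns s" "ns (s + 1) \<le> n + 1" "ns s < ns (s + 1)"
    using strict_ns_mono[OF ns(3), of 1 s] strict_ns_mono[OF ns(3), of "s + 1" "k + 1"] s ns by auto
  then show "on X (Qblk (\<tau> s) (ns s) (ns (s + 1)))"
    by (intro on_mono[OF Qblk_on]) (auto simp: X_def)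
qed

lemma Qtot_pd_Lin:
  assumes ns: "ns 1 = 1" "ns (k + 1) = n + 1" "\<forall>s\<in>{1..k}. ns s < (ns (s + 1) :: nat)" and p: "p \<in> X"
  shows "pd p (Qtot k ns \<tau>) \<in> Lin"
proof -
  define j where "j = (if p \<le> n then p else p - n)"
  have j: "j \<in> {1..n}" and pj: "p = j \<or> p = n + j" using p by (auto simp: j_def X_def)
  obtain s where s: "s \<in> {1..k}" "ns s \<le> j" "j < ns (s + 1)" using block_index[OF ns j] by blast
  have b: "1 \<le> ns s" "ns (s + 1) \<le> n + 1"
    using strict_ns_mono[OF ns(3), of 1 s] strict_ns_mono[OF ns(3), of "s + 1" "k + 1"] s ns by auto
  have v: "var i \<in> Lin" if "1 \<le> i" "i \<le> 2 * n" for i using that by (intro var_Lin) (simp add: X_def)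
  have L: "0 \<in> Lin" "F \<in> Lin \<Longrightarrow> C a * F \<in> Lin" for F a
    using linsub_zero[OF linsub_Lin] linsub_scale[OF linsub_Lin] by auto
  have "pd j (Qtot k ns \<tau>) \<in> Lin" "pd (n + j) (Qtot k ns \<tau>) \<in> Lin"
    unfolding Qtot_pd[OF ns s] Qblk_pd[OF b s(2,3)] using s(2,3) b j
    by (auto intro!: L v simp del: One_nat_def C_simps)
  then show ?thesis using pj by blast
qed

lemma Qtot_hessian_sym: "coef (pd i (Qtot k ns \<tau>)) (unitv l) = coef (pd l (Qtot k ns \<tau>)) (unitv i)"
  by (metis coef_pd_0 pd_commute)

text \<open>As matrices, \<open>Lam\<close> is its own antisymmetrization, the standard symplectic
  matrix up to sign, times the diagonal matrix of the eigenvalues \<open>ll lam\<close>.\<close>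

lemma Lam_skew: "i \<in> X \<Longrightarrow> j \<in> X \<Longrightarrow> Lam lam i j = (Lam lam i j - Lam lam j i) * ll lam j"
  by (auto simp: Lam_def ll_def X_def)

text \<open>Condition \<open>Aw\<close> says that diag(m) preserves the bilinear form
  \<open>A\<close>, so after conjugation S^T B + B S = 0 for B = \<open>nf\<close>. Antisymmetrizing
  removes the symmetric Hessian of Q and shows that \<open>S\<close> is infinitesimally symplectic.
  Once the part \<open>Lam\<close> is removed from the equation, what remains is invariance of the
  Hessian.\<close>

lemma Q_invariant:
  assumes ns: "ns 1 = 1" "ns (k + 1) = n + 1" "\<forall>s\<in>{1..k}. ns s < (ns (s + 1) :: nat)"
    and c: "inv_pair X c ci" and cw: "\<And>i j. i \<in> X \<Longrightarrow> j \<in> X \<Longrightarrow> c j i \<noteq> 0 \<Longrightarrow> l i = ll lam j"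
    and ciw: "\<And>i j. i \<in> X \<Longrightarrow> j \<in> X \<Longrightarrow> ci i j \<noteq> 0 \<Longrightarrow> l i = ll lam j"
    and Aw: "\<And>i j. i \<in> X \<Longrightarrow> j \<in> X \<Longrightarrow> A i j \<noteq> 0 \<Longrightarrow> m i + m j = 0"
    and A: "\<And>i j. i \<in> X \<Longrightarrow> j \<in> X \<Longrightarrow> A i j = mm X (tr c) (mm X (nf k ns lam \<tau>) c) i j"
  defines "S \<equiv> mm X c (mm X (dg m) ci)"
  shows "LL (\<lambda>j. \<Sum>k\<in>X. C (S j k) * var k) (Qtot k ns \<tau>) = 0"
proof -
  let ?B = "nf k ns lam \<tau>" and ?Q = "Qtot k ns \<tau>"
  define q where "q i l = coef (pd i ?Q) (unitv l)" for i l
  have qs: "q i l = q l i" for i l unfolding q_def by (rule Qtot_hessian_sym)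
  have B: "?B i j = mm X (tr ci) (mm X A ci) i j" if "i \<in> X" "j \<in> X" for i j
    by (rule congruence_inverse[OF _ inv_pair_sym[OF c] A that]) auto
  have tc: "inv_pair X (tr c) (tr ci)" using inv_pair_tr[OF c] by blast
  have SB: "mm X (tr S) ?B i j = mm X (tr ci) (mm X (dg m) (mm X A ci)) i j" if ij: "i \<in> X" "j \<in> X" for i j
  proof -
    have "mm X (tr S) ?B i j = mm X (tr S) (mm X (tr ci) (mm X A ci)) i j"
      by (intro mm_cong refl) (simp add: B ij)
    also have "\<dots> = mm X (tr ci) (mm X (dg m) (mm X (tr c) (mm X (tr ci) (mm X A ci)))) i j"
      unfolding S_def tr_mm tr_dg by (simp only: mm_assoc)
    also have "\<dots> = mm X (tr ci) (mm X (dg m) (mm X A ci)) i j"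
      by (rule mm_cong[OF refl], rule mm_cong[OF refl]) (simp add: mm_inv_left(1)[OF tc])
    finally show ?thesis .
  qed
  have BS: "mm X ?B S i j = mm X (tr ci) (mm X A (mm X (dg m) ci)) i j" if ij: "i \<in> X" "j \<in> X" for i j
  proof -
    have "mm X ?B S i j = mm X (mm X (tr ci) (mm X A ci)) S i j"
      by (intro mm_cong refl) (simp add: B ij)
    also have "\<dots> = mm X (tr ci) (mm X A (mm X ci (mm X c (mm X (dg m) ci)))) i j"
      unfolding S_def by (simp only: mm_assoc)
    also have "\<dots> = mm X (tr ci) (mm X A (mm X (dg m) ci)) i j"
      by (rule mm_cong[OF refl], rule mm_cong[OF refl]) (simp add: mm_inv_left(2)[OF c])
    finally show ?thesis .
  qed
  have skew: "(\<Sum>a\<in>X. S a i * ?B a j) + (\<Sum>a\<in>X. ?B i a * S a j) = 0" if ij: "i \<in> X" "j \<in> X" for i j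
  proof -
    have "mm X (dg m) (mm X A ci) a j + mm X A (mm X (dg m) ci) a j = 0" if a: "a \<in> X" for a
    proof -
      have "mm X (dg m) (mm X A ci) a j + mm X A (mm X (dg m) ci) a j = (\<Sum>b\<in>X. (m a + m b) * A a b * ci b j)"
        using a by (simp add: mm_dg mm_def[of X A] sum_distrib_left sum.distrib[symmetric] algebra_simps)
      also have "\<dots> = 0" using Aw[OF a] by (intro sum.neutral) auto
      finally show ?thesis .
    qed
    then have "mm X (tr ci) (mm X (dg m) (mm X A ci)) i j + mm X (tr ci) (mm X A (mm X (dg m) ci)) i j = 0"
      unfolding mm_def[of X "tr ci"] sum.distrib[symmetric] distrib_left[symmetric] by simp
    then show ?thesis unfolding SB[OF ij, symmetric] BS[OF ij, symmetric] by (simp add: mm_def tr_def)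
  qed
  define Jm where "Jm i j = Lam lam i j - Lam lam j i" for i j
  have Jq: "?B i j - ?B j i = Jm i j" for i j by (simp add: nf_def Jm_def Qtot_hessian_sym[of i])
  have SJ: "(\<Sum>a\<in>X. S a i * Jm a j) + (\<Sum>a\<in>X. Jm i a * S a j) = 0" if ij: "i \<in> X" "j \<in> X" for i j
    unfolding Jq[symmetric] using skew[OF ij] skew[OF ij(2,1)]
    by (simp add: algebra_simps sum_subtractf) (simp add: add_eq_0_iff)
  have Sl: "ll lam j = ll lam k'" if jk: "j \<in> X" "k' \<in> X" "S j k' \<noteq> 0" for j k'
  proof -
    have "(\<Sum>i\<in>X. c j i * mm X (dg m) ci i k') \<noteq> 0" using jk(3) by (simp add: S_def mm_def[of X c])
    then obtain i where i: "i \<in> X" "c j i * mm X (dg m) ci i k' \<noteq> 0" by (rule sum.not_neutral_contains_not_neutral)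
    then have "c j i \<noteq> 0" "ci i k' \<noteq> 0" by (auto simp: mm_dg)
    then show ?thesis using cw[OF i(1) jk(1)] ciw[OF i(1) jk(2)] by simp
  qed
  \<comment> \<open>By \<open>Sl\<close> the matrix \<open>S\<close> commutes with the diagonal of
    \<open>ll lam\<close>, and \<open>Lam\<close> is \<open>Jm\<close> times that diagonal; so the
    left side is the expression in \<open>SJ\<close> multiplied by \<open>ll lam j\<close>.\<close>
  have SL: "(\<Sum>a\<in>X. S a i * Lam lam a j) + (\<Sum>a\<in>X. Lam lam i a * S a j) = 0" if ij: "i \<in> X" "j \<in> X" for i j
  proof -
    have "(\<Sum>a\<in>X. S a i * Lam lam a j) = (\<Sum>a\<in>X. S a i * Jm a j * ll lam j)"
      using Lam_skew[OF _ ij(2)] by (intro sum.cong refl) (simp add: Jm_def mult.assoc)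
    moreover have "(\<Sum>a\<in>X. Lam lam i a * S a j) = (\<Sum>a\<in>X. Jm i a * S a j * ll lam j)"
    proof (rule sum.cong[OF refl])
      fix a assume a: "a \<in> X"
      have "S a j = 0 \<or> ll lam a = ll lam j" using Sl[OF a ij(2)] by blast
      moreover have "Lam lam i a = Jm i a * ll lam a" using Lam_skew[OF ij(1) a, of lam] by (simp add: Jm_def)
      ultimately show "Lam lam i a * S a j = Jm i a * S a j * ll lam j" by auto
    qed
    ultimately show ?thesis using SJ[OF ij] by (simp flip: sum_distrib_right distrib_right)
  qed
  have Sq: "(\<Sum>a\<in>X. S a i * q a j) + (\<Sum>a\<in>X. S a j * q a i) = 0" if ij: "i \<in> X" "j \<in> X" for i j
  proof -
    have "?B a b = Lam lam a b + q a b" for a b by (simp add: nf_def q_def)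
    then have "(\<Sum>a\<in>X. S a i * ?B a j) + (\<Sum>a\<in>X. ?B i a * S a j) =
        ((\<Sum>a\<in>X. S a i * Lam lam a j) + (\<Sum>a\<in>X. Lam lam i a * S a j)) + ((\<Sum>a\<in>X. S a i * q a j) + (\<Sum>a\<in>X. S a j * q a i))"
      by (simp add: distrib_left distrib_right sum.distrib qs[of i] mult.commute[of "q _ _"])
    then show ?thesis unfolding skew[OF ij] SL[OF ij] by simp
  qed
  define T where "T = LL (\<lambda>j. \<Sum>k\<in>X. C (S j k) * var k) ?Q"
  have pdQ: "pd p ?Q = (\<Sum>l\<in>X. C (q p l) * var l)" if "p \<in> X" for p
    using lin1_id[OF Qtot_pd_Lin[OF ns that, of \<tau>]] unfolding q_def lin1_def by simp
  have "T = (\<Sum>p\<in>X. (\<Sum>k\<in>X. C (S p k) * var k) * pd p ?Q)"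
    unfolding T_def by (rule LL_X[OF Qtot_on[OF ns]])
  also have "\<dots> = (\<Sum>p\<in>X. \<Sum>i\<in>X. \<Sum>j\<in>X. C (S p i * q p j) * (var i * var j))"
    by (intro sum.cong refl) (simp add: pdQ sum_product mult_ac)
  also have "\<dots> = (\<Sum>i\<in>X. \<Sum>p\<in>X. \<Sum>j\<in>X. C (S p i * q p j) * (var i * var j))" by (rule sum.swap)
  also have "\<dots> = (\<Sum>i\<in>X. \<Sum>j\<in>X. \<Sum>p\<in>X. C (S p i * q p j) * (var i * var j))"
    by (intro sum.cong refl sum.swap)
  also have "\<dots> = (\<Sum>i\<in>X. \<Sum>j\<in>X. C (\<Sum>p\<in>X. S p i * q p j) * (var i * var j))"
    by (simp add: C_sum sum_distrib_right)
  finally have T1: "T = (\<Sum>i\<in>X. \<Sum>j\<in>X. C (\<Sum>p\<in>X. S p i * q p j) * (var i * var j))" .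
  also have "\<dots> = (\<Sum>j\<in>X. \<Sum>i\<in>X. C (\<Sum>p\<in>X. S p i * q p j) * (var i * var j))" by (rule sum.swap)
  finally have T2: "T = (\<Sum>i\<in>X. \<Sum>j\<in>X. C (\<Sum>p\<in>X. S p j * q p i) * (var i * var j))" by (simp add: mult_ac)
  \<comment> \<open>The matrix found for \<open>T\<close> need not be symmetric; adding the
    expression with the two variables exchanged symmetrizes it, and \<open>Sq\<close>
    applies.\<close>
  have "T + T = (\<Sum>i\<in>X. \<Sum>j\<in>X. C ((\<Sum>p\<in>X. S p i * q p j) + (\<Sum>p\<in>X. S p j * q p i)) * (var i * var j))"
    by (subst (1) T1, subst T2) (simp only: C_simps distrib_right sum.distrib)
  also have "\<dots> = 0" by (intro sum.neutral ballI) (simp only: Sq C_simps mult_zero_left)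
  finally have "coef T a + coef T a = 0" for a by (metis coef_simps(1,2))
  then have "T = 0" by (intro ser_eqI) (simp add: mult_2[symmetric])
  then show ?thesis by (simp add: T_def)
qed

lemma tangent_normal_form:
  assumes g: "\<And>p. p \<in> X \<Longrightarrow> on X (g p) \<and> om 1 (g p)"
    and b: "inv_pair X b (\<lambda>p q. coef (g p) (unitv q) - coef (g q) (unitv p))"
    and V: "fld V" and gV: "\<And>q. q \<in> X \<Longrightarrow> lie X V g q = 0"
  shows "\<exists>k ns lam \<tau> \<Psi> R Y c ci m Nt. ns 1 = 1 \<and> ns (k + 1) = n + 1 \<and> (\<forall>s\<in>{1..k}. ns s < (ns (s + 1) :: nat)) \<and>
     (\<forall>s\<in>{1..k}. \<forall>i. ns s \<le> i \<and> i < ns (s + 1) \<longrightarrow> lam i = lam (ns s)) \<and>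
     (\<forall>s\<in>{1..k}. kind_ok (\<tau> s) (lam (ns s)) (ns (s + 1) - ns s)) \<and>
     xcoords \<Psi> \<and> on X R \<and> om 3 R \<and> wtd K (tw (ll lam)) 1 R \<and>
     fm g = (\<Sum>i\<in>X. \<Sum>j\<in>X. C (nf k ns lam \<tau> i j) * (\<Psi> j * dd (\<Psi> i))) + dd (cmp K R (tc \<Psi>)) \<and>
     (\<forall>i\<in>X. on X (Y i) \<and> om 1 (Y i) \<and> cmp K (Y i) (tc \<Psi>) = LL V (\<Psi> i)) \<and>
     inv_pair X c ci \<and>
     (\<forall>i\<in>X. \<forall>j\<in>X. coef (Y i) (unitv j) = mm X c (mm X (\<lambda>i j. dg m i j + Nt i j) ci) i j) \<and>
     (\<forall>i\<in>X. \<forall>j\<in>X. Nt i j \<noteq> 0 \<longrightarrow> m i = m j) \<and> (\<exists>p. \<forall>i\<in>X. \<forall>j\<in>X. mpow X Nt p i j = 0) \<and>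
     LL (\<lambda>j. \<Sum>k\<in>X. C (mm X c (mm X (dg m) ci) j k) * var k) R = 0 \<and>
     LL (\<lambda>j. \<Sum>k\<in>X. C (mm X c (mm X (dg m) ci) j k) * var k) (Qtot k ns \<tau>) = 0 \<and>
     (\<forall>j\<in>X. LL (\<lambda>j. \<Sum>k\<in>X. C (mm X c (mm X (dg m) ci) j k) * var k) (Y j) =
        (\<Sum>k\<in>X. C (mm X c (mm X (dg m) ci) j k) * Y k))"
proof -
  let ?G = "\<lambda>p q. coef (g p) (unitv q)"
  obtain Z where Z: "fld Z" and gZ: "\<And>q. q \<in> X \<Longrightarrow> lie X Z g q = g q"
    and TG: "\<And>u r. u \<in> Lin \<Longrightarrow> r \<in> X \<Longrightarrow>
      coef (TT Z u) (unitv r) = (\<Sum>q\<in>X. (\<Sum>p\<in>X. coef u (unitv p) * b p q) * ?G q r)"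
    and ZV: "\<And>V p. fld V \<Longrightarrow> (\<And>q. q \<in> X \<Longrightarrow> lie X V g q = 0) \<Longrightarrow> p \<in> X \<Longrightarrow> LL V (Z p) = LL Z (V p)"
    by (rule liouville_field[where g = g, OF g b]) blast+
  have cm: "LL Z (LL V F) = LL V (LL Z F)" for F
    by (rule LL_commute[OF V Z, symmetric]) (rule ZV[OF V gV])
  obtain k ns lam \<tau> \<phi> P\<phi> where ns: "ns 1 = 1" "ns (k + 1) = n + 1" "\<forall>s\<in>{1..k}. ns s < (ns (s + 1) :: nat)"
    and lam: "\<forall>s\<in>{1..k}. \<forall>i. ns s \<le> i \<and> i < ns (s + 1) \<longrightarrow> lam i = lam (ns s)"
    and kind: "\<forall>s\<in>{1..k}. kind_ok (\<tau> s) (lam (ns s)) (ns (s + 1) - ns s)"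
    and \<phi>: "\<forall>i\<in>X. \<phi> i \<in> Lin \<and> (\<exists>e. (sh (TT Z) (ll lam i) ^^ e) (\<phi> i) = 0)"
    and P\<phi>: "inv_pair X P\<phi> (jac \<phi>)"
    and G: "\<forall>p\<in>X. \<forall>q\<in>X. ?G p q = (\<Sum>i\<in>X. \<Sum>l\<in>X. nf k ns lam \<tau> i l * jac \<phi> i p * jac \<phi> l q)"
    apply (rule exE[OF linear_normal_form[where G = ?G, OF Z b TG]])
      apply assumption+
    apply (elim exE conjE)
    apply (rule that; assumption)
    done
  have B: "?G p q = mm X (tr (jac \<phi>)) (mm X (nf k ns lam \<tau>) (jac \<phi>)) p q" if "p \<in> X" "q \<in> X" for p q
    using G that by (simp add: mm_def tr_def sum_distrib_left mult_ac)
  obtain w l m c ci A H where w: "xcoords w" and wg: "\<forall>i\<in>X. w i \<in> geig (LL Z) (l i) \<and> w i \<in> geig (LL V) (m i)"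
    and c: "inv_pair X c ci" and cw: "\<forall>i\<in>X. \<forall>j\<in>X. c j i \<noteq> 0 \<longrightarrow> l i = ll lam j" and ciw: "\<forall>i\<in>X. \<forall>j\<in>X. ci i j \<noteq> 0 \<longrightarrow> l i = ll lam j"
    and Aw: "\<forall>i\<in>X. \<forall>j\<in>X. A i j \<noteq> 0 \<longrightarrow> m i + m j = 0"
    and A: "\<forall>i\<in>X. \<forall>j\<in>X. A i j = mm X (tr c) (mm X (nf k ns lam \<tau>) c) i j"
    and H: "on X H" "om 3 H" "H \<in> geig (LL Z) 1" "H \<in> geig (LL V) 0"
    and fg: "fm g = (\<Sum>i\<in>X. \<Sum>j\<in>X. C (A i j) * (w j * dd (w i))) + dd H"
    apply (rule exE[OF adapted_coordinates[where g = g, OF Z V cm g b gZ gV \<phi>[rule_format] P\<phi> B]])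
          apply assumption+
    apply (elim exE conjE)
    apply (rule that; assumption)
    done
  have Q: "LL (\<lambda>j. \<Sum>k\<in>X. C (mm X c (mm X (dg m) ci) j k) * var k) (Qtot k ns \<tau>) = 0"
    by (rule Q_invariant[OF ns c cw[rule_format] ciw[rule_format] Aw[rule_format] A[rule_format]])
  have wgZ: "w i \<in> geig (LL Z) (l i)" and wgV: "w i \<in> geig (LL V) (m i)" if "i \<in> X" for i using wg that by blast+
  note nc = normal_coordinates[OF Z V w wgZ wgV c cw[rule_format] A[rule_format] H fg]
  show ?thesis
    apply (rule exI[of _ k], rule exI[of _ ns], rule exI[of _ lam], rule exI[of _ \<tau>])
    apply (rule exE[OF nc], assumption+)
    apply (elim exE conjE)
    subgoal premises pr for \<Psi> R Y Nt
      apply (rule exI[of _ \<Psi>], rule exI[of _ R], rule exI[of _ Y], rule exI[of _ c], rule exI[of _ ci], rule exI[of _ m], rule exI[of _ Nt])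
      apply (insert ns lam kind c Q pr)
      apply (intro conjI)
      apply assumption+
      apply (rule exI, assumption)
      apply assumption+
      done
    done
qed

end

subsection \<open>Translation to coefficient functions\<close>

lemma mps_mul_coef: "mps_mul (coef F) (coef G) = coef (F * G)"
  by (simp add: fun_eq_iff mps_mul_atMost coef_mult)

lemma supp_lessThan: "supp a \<subseteq> {..<k} \<longleftrightarrow> (\<forall>i\<ge>k. a i = 0)"
  unfolding supp_def by (auto simp: subset_iff) (metis leI neq0_conv)

lemma mps_bridge:
  "mps_zero = coef 0" "zexp = 0" "mps_const c = coef (C c)" "mps_var i = coef (var i)"
  "mps_add (coef F) (coef G) = coef (F + G)" "mps_scale c (coef F) = coef (C c * F)"
  "mps_mul (coef F) (coef G) = coef (F * G)" "mps_sum A (\<lambda>i. coef (f i)) = coef (sum f A)"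
  "mps_pd i (coef F) = coef (pd i F)"
  by (auto simp: fun_eq_iff mps_zero_def zexp_def mps_const_def coef_C mps_var_def coef_var mps_add_def
      mps_scale_def mps_mul_coef mps_sum_def mps_pd_alt coef_pd)

lemma mps_pow_coef: "mps_pow (coef F) p = coef (F ^ p)"
  by (induction p) (simp_all add: mps_bridge mult.commute)

lemma mps_sum_cong: "(\<And>i. i \<in> A \<Longrightarrow> f i = coef (h i)) \<Longrightarrow> mps_sum A f = coef (sum h A)"
  by (auto simp: mps_sum_def fun_eq_iff)

lemma mps_wf_coef: "mps_wf k (coef F) \<longleftrightarrow> on {..<k} F"
  unfolding mps_wf_def on_def supp_lessThan by auto

lemma mps_wf_ser: assumes "mps_wf k F" shows "\<exists>G. F = coef G \<and> on {..<k} G"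
proof -
  have "F a = 0" if "infinite (supp a)" for a
  proof -
    have "\<not> supp a \<subseteq> {..<k}" using that finite_subset by blast
    then obtain i where "i \<ge> k" "a i \<noteq> 0" unfolding supp_lessThan by auto
    then show ?thesis using assms unfolding mps_wf_def by auto
  qed
  then have F: "F = coef (Ser F)" by (simp add: Ser_inverse)
  then show ?thesis using assms mps_wf_coef[of k "Ser F"] by auto
qed

lemma indep0_coef: "on I F \<Longrightarrow> 0 \<notin> I \<Longrightarrow> indep0 (coef F)"
  unfolding indep0_def on_def supp_def by blast

lemma mps_monprod_coef:
  assumes "\<And>i. i < j \<Longrightarrow> Phi i = coef (\<Phi> i)"
  shows "mps_monprod Phi b j = coef (powv j \<Phi> b)"
  using assms by (induction j) (simp_all add: powv_def mps_bridge mps_pow_coef)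

lemma mps_deg_eq: "supp a \<subseteq> {..<k} \<Longrightarrow> mps_deg k a = deg a"
  unfolding mps_deg_def by (rule deg_eq_sum[symmetric]) auto

text \<open>For exponents in the first \<open>k\<close> variables the two notions of degree agree.
  At all others both sides vanish, because the substituted series do not contain those
  variables.\<close>

lemma mps_comp_coef:
  assumes \<Phi>: "\<And>i. i < k \<Longrightarrow> Phi i = coef (\<Phi> i) \<and> on {..<k} (\<Phi> i)"
  shows "mps_comp k (coef F) Phi = coef (cmp k F \<Phi>)"
proof
  fix a
  have mp: "mps_monprod Phi b k a = coef (powv k \<Phi> b) a" for b
    using mps_monprod_coef[of k Phi \<Phi> b] \<Phi> by simp
  note sp = supp_lessThan[of _ k, symmetric]
  show "mps_comp k (coef F) Phi a = coef (cmp k F \<Phi>) a"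
  proof (cases "supp a \<subseteq> {..<k}")
    case True
    have "{b. (\<forall>i\<ge>k. b i = 0) \<and> mps_deg k b \<le> mps_deg k a} = exps k (deg a)"
      using True by (auto simp: sp mps_deg_eq)
    then show ?thesis by (simp add: mps_comp_def coef_cmp mp)
  next
    case False
    have "coef (powv k \<Phi> b) a = 0" if "supp b \<subseteq> {..<k}" for b
      using on_powv[of b "{..<k}" \<Phi> k] \<Phi> that False unfolding on_def by (meson lessThan_iff subsetD)
    then show ?thesis by (auto simp: mps_comp_def coef_cmp mp sp intro!: sum.neutral)
  qed
qed

lemma vf_apply_coef:
  assumes "\<And>i. i < k \<Longrightarrow> V i = coef (W i)"
  shows "vf_apply k V (coef h) = coef (vf k W h)"
  unfolding vf_apply_def vf_def by (rule mps_sum_cong) (simp add: assms mps_bridge)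

lemma lie_form_coef:
  assumes "\<And>i. i < k \<Longrightarrow> V i = coef (W i)" "\<And>i. i < k \<Longrightarrow> al i = coef (be i)" "j < k"
  shows "lie_form k V al j = coef (tangent.lie {..<k} W be j)"
  unfolding lie_form_def tangent.lie_def by (rule mps_sum_cong) (simp add: assms mps_bridge)

text \<open>Only the variables that occur in \<open>F\<close> matter for the substitution. This
  replaces the tangent bundle with its \<open>K\<close> variables by the original space with 2n +
  1.\<close>

lemma cmp_change:
  assumes F: "on I F" and I: "I \<subseteq> {..<k}" "I \<subseteq> {..<l}" and eq: "\<And>i. i \<in> I \<Longrightarrow> \<Phi> i = \<Psi> i"
  shows "cmp k F \<Phi> = cmp l F \<Psi>"
proof (rule ser_eqI)
  fix a
  have pw: "powv k \<Phi> b = powv l \<Psi> b" if "supp b \<subseteq> I" for b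
  proof -
    have fin: "finite (supp b)" using that I(1) by (meson finite_lessThan finite_subset)
    have "powv r \<Theta> b = (\<Prod>i\<in>supp b. \<Theta> i ^ b i)" if "supp b \<subseteq> {..<r}" for r \<Theta>
      unfolding powv_def using that by (intro prod.mono_neutral_right) (auto simp: supp_def)
    from this[of k \<Phi>] this[of l \<Psi>] show ?thesis using that I eq by (auto intro!: prod.cong)
  qed
  have z: "(\<Sum>b\<in>exps r (deg a). coef F b * coef (powv r \<Theta> b) a)
      = (\<Sum>b\<in>{b. supp b \<subseteq> I \<and> deg b \<le> deg a}. coef F b * coef (powv r \<Theta> b) a)" if "I \<subseteq> {..<r}" for r \<Theta>
    using that F by (intro sum.mono_neutral_right finite_exps) (auto simp: on_def)
  show "coef (cmp k F \<Phi>) a = coef (cmp l F \<Psi>) a"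
    unfolding coef_cmp z[OF I(1)] z[OF I(2)] by (rule sum.cong) (auto simp: pw)
qed

section \<open>Ingredients for the elimination of \<theta>\<close>

lemma pd_zero_on: "on I F \<Longrightarrow> pd i F = 0 \<Longrightarrow> on (I - {i}) F"
  unfolding on_def
proof (intro allI impI)
  fix a assume I: "\<forall>a. coef F a \<noteq> 0 \<longrightarrow> supp a \<subseteq> I" and z: "pd i F = 0" and a: "coef F a \<noteq> 0"
  have "of_nat (a i) * coef F a = 0" using coef_var_pd[of i F a] z by simp
  then have "i \<notin> supp a" using a by (simp add: supp_def)
  then show "supp a \<subseteq> I - {i}" using I a by blast
qed

lemma var_power: "var i ^ p = xmon (\<lambda>j. if j = i then p else 0)"
proof (induction p)
  case 0
  have "(\<lambda>j. if j = i then 0 else 0) = (0 :: nat \<Rightarrow> nat)" by auto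
  then show ?case by simp
next
  case (Suc p)
  have "(\<lambda>j. if j = i then p else 0) + unitv i = (\<lambda>j. if j = i then Suc p else 0)" by (auto simp: unitv_def)
  moreover have "finite (supp (\<lambda>j. if j = i then p else 0))"
    by (rule finite_subset[of _ "{i}"]) (auto simp: supp_def)
  ultimately show ?case using Suc xmon_plus_var by (metis power_Suc2)
qed

text \<open>The coefficients of positive \<open>\<theta>\<close>-degree of the hypothesis form a recursion for \<open>F\<close> along the
  \<open>x\<^sub>1\<close>-degree.\<close>

lemma weierstrass_zero:
  assumes m: "m > (2 :: nat)" and G: "on I G" "0 \<notin> I"
    and eq: "pd 0 ((C (of_nat m) * var 0 ^ (m - 1) - var 1) * F) = G"
  shows "F = 0"
proof -
  define e where "e = (\<lambda>j :: nat. if j = 0 then m - 1 else 0 :: nat)"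
  have fe: "finite (supp e)" by (rule finite_subset[of _ "{0}"]) (auto simp: supp_def e_def)
  define H where "H = (C (of_nat m) * var 0 ^ (m - 1) - var 1) * F"
  have H: "H = C (of_nat m) * (xmon e * F) - var 1 * F"
    by (simp add: H_def var_power e_def left_diff_distrib mult.assoc del: C_simps One_nat_def)
  \<comment> \<open>The \<theta>-derivative of \<open>H\<close> does not contain \<theta>, so
    \<open>H\<close> has degree at most 1 in \<theta>.\<close>
  have H0: "coef H a = 0" if "a 0 \<ge> 2" for a
  proof -
    define c where "c = a - unitv 0"
    have a: "a = c + unitv 0" "c 0 \<ge> 1" using that by (auto simp: c_def unitv_def fun_eq_iff)
    have "0 \<in> supp c" using a(2) by (simp add: supp_def)
    then have "coef G c = 0" using G unfolding on_def by blast
    then have "of_nat (c 0 + 1) * coef H a = 0"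
      using arg_cong[OF eq, of "\<lambda>F. coef F c"] by (simp only: coef_pd a(1) H_def)
    moreover have "of_nat (c 0 + 1) \<noteq> (0 :: complex)" by (simp only: of_nat_eq_0_iff)
    ultimately show ?thesis by (simp only: mult_eq_0_iff simp_thms)
  qed
  \<comment> \<open>The exponent \<open>e + b\<close> has \<theta>-degree at least m - 1, which is
    at least 2; here m > 2 is essential.\<close>
  have rec: "of_nat m * coef F b = coef (var 1 * F) (e + b)" if "finite (supp b)" for b
  proof -
    have "(e + b) 0 \<ge> 2" using m by (simp add: e_def)
    from H0[of "e + b", OF this] show ?thesis using fe by (simp add: H del: C_simps One_nat_def)
  qed
  have "coef F b = 0" if "finite (supp b)" "b 1 = d" for b d
    using that
  proof (induction d arbitrary: b)
    case 0
    have "\<not> unitv 1 \<le> e + b" using 0 by (auto simp: le_fun_def unitv_def e_def)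
    then have "coef (var 1 * F) (e + b) = 0" unfolding var_def using coef_xmon_mult[of "unitv 1" F "e + b"] by (simp del: One_nat_def)
    then show ?case using rec[OF 0(1)] m by simp
  next
    case (Suc d)
    define b' where "b' = e + b - unitv 1"
    have "supp b' \<subseteq> supp e \<union> supp b" unfolding b'_def using supp_minus[of "e + b"] by simp
    then have "finite (supp b')" using fe Suc.prems finite_subset by blast
    moreover have "b' 1 = d" using Suc.prems by (simp add: b'_def e_def unitv_def)
    ultimately have "coef F b' = 0" by (rule Suc.IH)
    then have "coef (var 1 * F) (e + b) = 0" unfolding var_def b'_def using coef_xmon_mult[of "unitv 1" F "e + b"] by (simp del: One_nat_def)
    then show ?case using rec[OF Suc.prems(1)] m by simp
  qed
  then show ?thesis by (intro ser_eqI) simp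
qed

context tangent
begin

section \<open>Matrices and determinants with the index 0 of \<theta>\<close>

lemma X_lessThan: "{..<2 * n + 1} = insert 0 X"
  by (auto simp: X_def)

lemma sum_insert0: "(\<Sum>i<2 * n + 1. f i) = f 0 + (\<Sum>i\<in>X. f i)"
  unfolding X_lessThan by simp

lemma det_inv_pair:
  assumes "det (mat (2 * n) (2 * n) (\<lambda>(i, j). A (i + 1) (j + 1))) \<noteq> 0"
  shows "\<exists>P. inv_pair X P A"
proof -
  let ?A = "mat (2 * n) (2 * n) (\<lambda>(i, j). A (i + 1) (j + 1))"
  have "?A \<in> carrier_mat (2 * n) (2 * n)" by simp
  from det_non_zero_imp_unit[OF this assms, of undefined]
  obtain B where B: "B \<in> carrier_mat (2 * n) (2 * n)" "B * ?A = 1\<^sub>m (2 * n)"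
    unfolding Units_def ring_mat_def by auto
  have "inv_pair X (\<lambda>i j. B $$ (i - 1, j - 1)) A"
  proof (rule left_inverse_inv_pair)
    fix i l assume il: "i \<in> X" "l \<in> X"
    then have r: "i - 1 < 2 * n" "l - 1 < 2 * n" "l - 1 + 1 = l" "(i - 1 = l - 1) = (i = l)" by (auto simp: X_def)
    have "(if i = l then 1 else 0) = (B * ?A) $$ (i - 1, l - 1)" unfolding B(2) using r by simp
    also have "\<dots> = (\<Sum>j\<in>{0..<2 * n}. B $$ (i - 1, j) * A (j + 1) l)"
      using B(1) r by (simp add: scalar_prod_def del: One_nat_def)
    also have "\<dots> = (\<Sum>j\<in>X. B $$ (i - 1, j - 1) * A j l)"
      by (rule sum.reindex_bij_witness[of _ "\<lambda>j. j - 1" "\<lambda>j. j + 1"]) (auto simp: X_def)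
    finally show "(\<Sum>j\<in>X. B $$ (i - 1, j - 1) * A j l) = (if i = l then 1 else 0)" by simp
  qed simp
  then show ?thesis by blast
qed

text \<open>Block matrices with a separate entry for \<theta>: it is 1 for changes of coordinates,
  which keep \<theta>, and 0 for linear parts of fields, whose \<theta>-component vanishes.\<close>

definition emb :: "complex \<Rightarrow> (nat \<Rightarrow> nat \<Rightarrow> complex) \<Rightarrow> complex mat" where
  "emb t A = mat (2 * n + 1) (2 * n + 1) (\<lambda>(i, j). if i = 0 \<and> j = 0 then t else if i \<in> X \<and> j \<in> X then A i j else 0)"

lemma emb_carrier [simp]: "emb t A \<in> carrier_mat (2 * n + 1) (2 * n + 1)"
  "dim_row (emb t A) = 2 * n + 1" "dim_col (emb t A) = 2 * n + 1"
  by (simp_all add: emb_def)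

lemma emb_index: "i < 2 * n + 1 \<Longrightarrow> j < 2 * n + 1 \<Longrightarrow>
    emb t A $$ (i, j) = (if i = 0 \<and> j = 0 then t else if i \<in> X \<and> j \<in> X then A i j else 0)"
  by (simp add: emb_def)

lemma emb_cong: "t = t' \<Longrightarrow> (\<And>i j. i \<in> X \<Longrightarrow> j \<in> X \<Longrightarrow> A i j = B i j) \<Longrightarrow> emb t A = emb t' B"
  unfolding emb_def by (rule cong_mat) auto

lemma emb_mult: "emb t A * emb t' B = emb (t * t') (mm X A B)"
proof (rule eq_matI)
  fix i j assume "i < dim_row (emb (t * t') (mm X A B))" "j < dim_col (emb (t * t') (mm X A B))"
  then have ij: "i < 2 * n + 1" "j < 2 * n + 1" by (simp_all del: One_nat_def)
  have "(emb t A * emb t' B) $$ (i, j) = (\<Sum>l<2 * n + 1. emb t A $$ (i, l) * emb t' B $$ (l, j))"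
    using ij by (simp add: scalar_prod_def atLeast0LessThan del: One_nat_def)
  also have "\<dots> = emb t A $$ (i, 0) * emb t' B $$ (0, j) + (\<Sum>l\<in>X. emb t A $$ (i, l) * emb t' B $$ (l, j))"
    by (rule sum_insert0)
  also have "(\<Sum>l\<in>X. emb t A $$ (i, l) * emb t' B $$ (l, j)) = (if i \<in> X \<and> j \<in> X then mm X A B i j else 0)"
  proof -
    have "(\<Sum>l\<in>X. emb t A $$ (i, l) * emb t' B $$ (l, j)) = (\<Sum>l\<in>X. if i \<in> X \<and> j \<in> X then A i l * B l j else 0)"
      using ij by (intro sum.cong refl) (auto simp: emb_index X_def)
    then show ?thesis by (cases "i \<in> X \<and> j \<in> X") (auto simp: mm_def)
  qed
  also have "emb t A $$ (i, 0) * emb t' B $$ (0, j) = (if i = 0 \<and> j = 0 then t * t' else 0)"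
    using ij by (simp add: emb_index)
  finally show "(emb t A * emb t' B) $$ (i, j) = emb (t * t') (mm X A B) $$ (i, j)"
    using ij by (simp add: emb_index del: One_nat_def)
qed simp_all

lemma emb_one: "(\<And>i j. i \<in> X \<Longrightarrow> j \<in> X \<Longrightarrow> A i j = (if i = j then 1 else 0)) \<Longrightarrow> emb 1 A = 1\<^sub>m (2 * n + 1)"
proof (rule eq_matI)
  fix i j assume A: "\<And>i j. i \<in> X \<Longrightarrow> j \<in> X \<Longrightarrow> A i j = (if i = j then 1 else 0)"
    and "i < dim_row (1\<^sub>m (2 * n + 1) :: complex mat)" "j < dim_col (1\<^sub>m (2 * n + 1) :: complex mat)"
  then have "i \<in> insert 0 X" "j \<in> insert 0 X" "i < 2 * n + 1" "j < 2 * n + 1" unfolding X_lessThan[symmetric] by auto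
  then show "emb 1 A $$ (i, j) = 1\<^sub>m (2 * n + 1) $$ (i, j)" using A by (auto simp: emb_index simp del: One_nat_def)
qed simp_all

lemma emb_inv:
  assumes "inv_pair X P J"
  shows "emb 1 P * emb 1 J = 1\<^sub>m (2 * n + 1)" "emb 1 J * emb 1 P = 1\<^sub>m (2 * n + 1)" "det (emb 1 J) \<noteq> 0"
proof -
  show *: "emb 1 P * emb 1 J = 1\<^sub>m (2 * n + 1)" "emb 1 J * emb 1 P = 1\<^sub>m (2 * n + 1)"
    unfolding emb_mult mult_1 by (rule emb_one, use assms in \<open>simp add: inv_pair_mm_iff\<close>)+
  have "det (emb 1 P) * det (emb 1 J) = 1"
    using det_mult[of "emb 1 P" "2 * n + 1" "emb 1 J"] unfolding * by (simp del: One_nat_def)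
  then show "det (emb 1 J) \<noteq> 0" by auto
qed

text \<open>Conjugation by \<open>c\<close> transports diag(m) + Nt. The two summands commute
  because \<open>Nt\<close> has entries only between indices with equal \<open>m\<close>.\<close>

lemma emb_jordan:
  assumes c: "inv_pair X c ci" and Nt: "\<And>i j. i \<in> X \<Longrightarrow> j \<in> X \<Longrightarrow> Nt i j \<noteq> 0 \<Longrightarrow> m i = m j"
    and nil: "\<forall>i\<in>X. \<forall>j\<in>X. mpow X Nt p i j = 0"
    and L: "\<And>i j. i \<in> X \<Longrightarrow> j \<in> X \<Longrightarrow> L i j = mm X c (mm X (\<lambda>i j. dg m i j + Nt i j) ci) i j"
  shows "jordan_decomp (2 * n + 1) (emb 0 L) (emb 0 (mm X c (mm X (dg m) ci))) (emb 0 (mm X c (mm X Nt ci)))"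
proof -
  let ?k = "2 * n + 1"
  let ?S = "emb 0 (mm X c (mm X (dg m) ci))" and ?N = "emb 0 (mm X c (mm X Nt ci))"
  have "emb 0 L = ?S + ?N"
  proof (rule eq_matI)
    fix i j assume "i < dim_row (?S + ?N)" "j < dim_col (?S + ?N)"
    then show "emb 0 L $$ (i, j) = (?S + ?N) $$ (i, j)"
      by (simp add: emb_index L mm_def distrib_left distrib_right sum.distrib del: One_nat_def)
  qed simp_all
  moreover have "diagonalizable_mat ?S"
    unfolding diagonalizable_mat_def similar_mat_def
  proof (intro exI conjI)
    show "similar_mat_wit ?S (emb 0 (dg m)) (emb 1 c) (emb 1 ci)"
      using emb_inv[OF c] by (intro similar_mat_witI[of _ _ ?k]) (simp_all add: emb_mult mm_assoc del: One_nat_def)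
    show "diagonal_mat (emb 0 (dg m))" by (auto simp: diagonal_mat_def emb_index dg_def simp del: One_nat_def)
  qed
  moreover have "nilpotent_mat ?k ?N"
  proof -
    \<comment> \<open>The zeroth power is the identity and has entry 1 at \<theta>, so it is the
      power \<open>Suc p\<close> that is shown to vanish.\<close>
    have pw: "?N ^\<^sub>m q = emb (if q = 0 then 1 else 0) (mm X c (mm X (mpow X Nt q) ci))" for q
    proof (induction q)
      case 0
      have "mm X c (mm X (mpow X Nt 0) ci) i j = (if i = j then 1 else 0)" if "i \<in> X" "j \<in> X" for i j
      proof -
        have "mm X c (mm X (mpow X Nt 0) ci) i j = mm X c ci i j"
          by (rule mm_cong) (simp_all add: mm_def if_distrib if_distribR cong: if_cong)
        then show ?thesis using c that by (simp add: inv_pair_mm_iff)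
      qed
      then show ?case using emb_one by (simp del: One_nat_def mpow.simps)
    next
      case (Suc q)
      have "?N ^\<^sub>m Suc q = emb 0 (mm X (mm X c (mm X (mpow X Nt q) ci)) (mm X c (mm X Nt ci)))"
        by (simp add: Suc emb_mult)
      also have "\<dots> = emb 0 (mm X c (mm X (mpow X Nt (Suc q)) ci))"
      proof (rule emb_cong[OF refl])
        fix i j
        have "mm X (mm X c (mm X (mpow X Nt q) ci)) (mm X c (mm X Nt ci)) i j
            = mm X c (mm X (mpow X Nt q) (mm X ci (mm X c (mm X Nt ci)))) i j" by (simp only: mm_assoc)
        also have "\<dots> = mm X c (mm X (mpow X Nt q) (mm X Nt ci)) i j"
          by (rule mm_cong[OF refl], rule mm_cong[OF refl]) (simp add: mm_inv_left(2)[OF c])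
        finally show "mm X (mm X c (mm X (mpow X Nt q) ci)) (mm X c (mm X Nt ci)) i j = mm X c (mm X (mpow X Nt (Suc q)) ci) i j"
          by (simp add: mm_assoc)
      qed
      finally show ?case by simp
    qed
    have "?N ^\<^sub>m Suc p = 0\<^sub>m ?k ?k"
    proof (rule eq_matI)
      have z: "mm X c (mm X (mpow X Nt (Suc p)) ci) i j = 0" for i j
        using nil by (simp add: mm_def)
      fix i j assume "i < dim_row (0\<^sub>m ?k ?k :: complex mat)" "j < dim_col (0\<^sub>m ?k ?k :: complex mat)"
      then show "(?N ^\<^sub>m Suc p) $$ (i, j) = 0\<^sub>m ?k ?k $$ (i, j)"
        unfolding pw by (simp add: emb_index z del: One_nat_def mpow.simps)
    qed (simp_all del: One_nat_def)
    then show ?thesis unfolding nilpotent_mat_def by blast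
  qed
  moreover have "?S * ?N = ?N * ?S"
  proof -
    have cc: "mm X (mm X c (mm X A ci)) (mm X c (mm X B ci)) i j = mm X c (mm X (mm X A B) ci) i j" for A B i j
    proof -
      have "mm X (mm X c (mm X A ci)) (mm X c (mm X B ci)) i j = mm X c (mm X A (mm X ci (mm X c (mm X B ci)))) i j"
        by (simp only: mm_assoc)
      also have "\<dots> = mm X c (mm X A (mm X B ci)) i j"
        by (rule mm_cong[OF refl], rule mm_cong[OF refl]) (simp add: mm_inv_left(2)[OF c])
      finally show ?thesis by (simp add: mm_assoc)
    qed
    have "mm X (dg m) Nt i j = mm X Nt (dg m) i j" if "i \<in> X" "j \<in> X" for i j
      using Nt[OF that] that by (auto simp: mm_dg)
    then have "mm X c (mm X (mm X (dg m) Nt) ci) i j = mm X c (mm X (mm X Nt (dg m)) ci) i j" for i j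
      by (intro mm_cong[OF refl mm_cong[OF _ refl]])
    then show ?thesis unfolding emb_mult cc by (intro emb_cong) (simp_all add: cc)
  qed
  ultimately show ?thesis unfolding jordan_decomp_def by (simp del: One_nat_def)
qed

text \<open>The 2-form d\<alpha> = d\<gamma> has no component along \<theta>, so the
  \<theta>-components of its Lie derivative reduce to the contraction of d\<gamma> with the
  \<theta>-derivative of the field; nondegeneracy makes the base components independent of \<theta>.
  The d\<theta>-coefficient of the original equation then says that the \<theta>-derivative of
  \<open>th 0 * U 0\<close> is \<open>U 1\<close>, to which \<open>weierstrass_zero\<close>
  applies.\<close>

lemma theta_reduction:
  assumes n: "n \<ge> 1" and M: "M > (2 :: nat)"
    and g: "\<And>q. q \<in> X \<Longrightarrow> on X (g q)"
    and U: "\<And>j. j < 2 * n + 1 \<Longrightarrow> on {..<2 * n + 1} (U j) \<and> om 1 (U j)"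
  defines "be \<equiv> \<lambda>j. pd j (var 0 ^ M - var 1 * var 0) + (if j \<in> X then g j else 0)"
  assumes L: "\<And>j. j < 2 * n + 1 \<Longrightarrow> lie {..<2 * n + 1} U be j = 0"
    and P: "inv_pair X P (\<lambda>p q. coef (Om g p q) 0)"
  shows "U 0 = 0 \<and> U 1 = 0 \<and> fld U \<and> (\<forall>q\<in>X. lie X U g q = 0)"
proof -
  have X1: "1 \<in> X" using n by (simp add: X_def)
  have Xk: "r < 2 * n + 1" if "r \<in> X" for r using that by (auto simp: X_def)
  define th where "th j = pd j (var 0 ^ M - var 1 * var 0)" for j
  have bX: "be j = th j + g j" if "j \<in> X" for j using that by (simp add: be_def th_def)
  have b0: "be 0 = th 0" by (simp add: be_def th_def)
  have thc: "pd p (th q) = pd q (th p)" for p q unfolding th_def by (rule pd_commute)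
  have Om0: "Om be 0 q = 0" if "q \<in> insert 0 X" for q
    using that thc[of 0 q] pd_X[OF g, of q 0] by (auto simp: Om_def bX b0)
  have OmX: "Om be r q = Om g r q" if "r \<in> X" "q \<in> X" for r q
    using that thc[of r q] by (simp add: Om_def bX)
  have pU: "pd 0 (U r) = 0" if r: "r \<in> X" for r
  proof (rule Om_inj[OF P _ r])
    fix q assume q: "q \<in> X"
    have "0 = pd 0 (lie {..<2 * n + 1} U be q) - pd q (lie {..<2 * n + 1} U be 0)"
      using L[OF Xk[OF q]] L[of 0] by simp
    also have "\<dots> = (\<Sum>r<2 * n + 1. U r * pd r (Om be 0 q) + pd 0 (U r) * Om be r q + pd q (U r) * Om be 0 r)"
      by (rule d_lie)
    also have "\<dots> = (\<Sum>r<2 * n + 1. pd 0 (U r) * Om be r q)"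
    proof (rule sum.cong[OF refl])
      fix r assume "r \<in> {..<2 * n + 1}"
      then have "Om be 0 r = 0" unfolding X_lessThan by (rule Om0)
      moreover have "Om be 0 q = 0" using q by (intro Om0) simp
      ultimately show "U r * pd r (Om be 0 q) + pd 0 (U r) * Om be r q + pd q (U r) * Om be 0 r = pd 0 (U r) * Om be r q"
        by simp
    qed
    also have "\<dots> = (\<Sum>r\<in>X. pd 0 (U r) * Om g r q)"
      unfolding sum_insert0 using Om0[of q] q by (simp add: OmX)
    finally show "(\<Sum>r\<in>X. pd 0 (U r) * Om g r q) = 0" by simp
  qed
  have UX: "on X (U r)" if "r \<in> X" for r
    using pd_zero_on[of "{..<2 * n + 1}" "U r" 0] U[OF Xk[OF that]] pU[OF that] by (simp add: X_lessThan del: One_nat_def)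
  have th0: "th 0 = C (of_nat M) * var 0 ^ (M - 1) - var 1"
    by (simp add: th_def pd_power pd_var C_of_nat)
  have pth: "pd r (th 0) = (if r = 1 then - 1 else 0)" if "r \<in> X" for r
    using that unfolding th0 by (simp add: pd_power pd_var)
  have "0 = lie {..<2 * n + 1} U be 0" using L[of 0] by simp
  also have "\<dots> = (U 0 * pd 0 (th 0) + th 0 * pd 0 (U 0)) + (\<Sum>r\<in>X. if r = 1 then - U 1 else 0)"
    unfolding lie_def sum_insert0 b0
    by (intro arg_cong2[of _ _ _ _ "(+)"] refl sum.cong) (auto simp: pth pU)
  also have "(\<Sum>r\<in>X. if r = 1 then - U 1 else 0) = - U 1" using X1 by (subst sum.delta) auto
  finally have "pd 0 (th 0 * U 0) = U 1" by (simp add: mult.commute add.commute)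
  then have U0: "U 0 = 0" using weierstrass_zero[OF M UX[OF X1] X_facts(2)] unfolding th0 by blast
  then have U1: "U 1 = 0" using \<open>pd 0 (th 0 * U 0) = U 1\<close> by simp
  have thX: "th r = (if r = 1 then - var 0 else 0)" if "r \<in> X" for r
    using that by (simp add: th_def pd_power pd_var)
  have "lie X U g q = 0" if q: "q \<in> X" for q
  proof -
    have "0 = lie {..<2 * n + 1} U be q" using L[OF Xk[OF q]] by simp
    also have "\<dots> = (\<Sum>r\<in>X. U r * pd r (be q) + be r * pd q (U r))"
      unfolding lie_def sum_insert0 using U0 by simp
    also have "\<dots> = lie X U g q"
      unfolding lie_def
    proof (rule sum.cong[OF refl])
      fix r assume r: "r \<in> X"
      have "pd r (th q) = 0" using r q by (simp add: thX pd_var)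
      moreover have "th r * pd q (U r) = 0" using U1 r by (simp add: thX)
      ultimately show "U r * pd r (be q) + be r * pd q (U r) = U r * pd r (g q) + g r * pd q (U r)"
        using r q by (simp add: bX distrib_right)
    qed
    finally show ?thesis by simp
  qed
  moreover have "fld U" using UX U Xk unfolding fld_def by blast
  ultimately show ?thesis using U0 U1 by blast
qed

lemma alpha_form_coef:
  assumes "\<And>i. i \<in> X \<Longrightarrow> g i = coef (gs i)"
  shows "alpha_form M n g j = coef (pd j (var 0 ^ M - var 1 * var 0) + (if j \<in> X then gs j else 0))"
proof -
  have "mps_add (mps_pow (mps_var 0) M) (mps_scale (-1) (mps_mul (mps_var 1) (mps_var 0))) = coef (var 0 ^ M - var 1 * var 0)"
    by (simp add: mps_bridge mps_pow_coef del: One_nat_def)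
  then show ?thesis unfolding alpha_form_def form_d_def
    using assms[of j] by (simp add: mps_bridge X_def del: One_nat_def pd_diff pd_mult)
qed

section \<open>The transformed form and the conditions of (P)\<close>

definition gm :: "nat \<Rightarrow> (nat \<Rightarrow> nat) \<Rightarrow> (nat \<Rightarrow> complex) \<Rightarrow> (nat \<Rightarrow> nat) \<Rightarrow> ser \<Rightarrow> nat \<Rightarrow> ser" where
  "gm k ns lam \<tau> R j = (if j \<in> X then (\<Sum>l\<in>X. C (nf k ns lam \<tau> j l) * var l) + pd j R else 0)"

lemma gm_on: "on X R \<Longrightarrow> on X (gm k ns lam \<tau> R j)"
  unfolding gm_def by (auto intro!: on_add on_sum on_mult on_pd)

lemma gm_pullback:
  assumes \<Psi>: "xcoords \<Psi>" and R: "on X R" and g: "\<And>i. i \<in> X \<Longrightarrow> on X (g i)"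
    and eq: "fm g = (\<Sum>i\<in>X. \<Sum>j\<in>X. C (nf k ns lam \<tau> i j) * (\<Psi> j * dd (\<Psi> i))) + dd (cmp K R (tc \<Psi>))"
    and j: "j \<in> X"
  shows "g j = (\<Sum>i\<in>X. cmp K (gm k ns lam \<tau> R i) (tc \<Psi>) * pd j (\<Psi> i))"
proof -
  have s: "small K (tc \<Psi>)" by (rule tc_small[OF \<Psi>])
  have P: "on X (\<Psi> i)" if "i \<in> X" for i using \<Psi> that by (simp add: xcoords_def)
  have Rc: "on X (cmp K R (tc \<Psi>))" by (rule cmp_tc_on[OF \<Psi> R])
  have "pd j (cmp K R (tc \<Psi>)) = (\<Sum>i\<in>X. cmp K (pd i R) (tc \<Psi>) * pd j (\<Psi> i))"
    unfolding chain_rule[OF s] sum_K using R by (simp add: pd_X)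
  moreover have "g j = pd (2 * n + j) ((\<Sum>i\<in>X. \<Sum>l\<in>X. C (nf k ns lam \<tau> i l) * (\<Psi> l * dd (\<Psi> i))) + dd (cmp K R (tc \<Psi>)))"
    using pd_fibre_fm[of g j, OF g j] eq by simp
  moreover have "\<dots> = (\<Sum>i\<in>X. \<Sum>l\<in>X. C (nf k ns lam \<tau> i l) * (\<Psi> l * pd j (\<Psi> i))) + pd j (cmp K R (tc \<Psi>))"
    using j P Rc by (simp add: pd_fibre_dd pd_X)
  moreover have "cmp K (gm k ns lam \<tau> R i) (tc \<Psi>) = (\<Sum>l\<in>X. C (nf k ns lam \<tau> i l) * \<Psi> l) + cmp K (pd i R) (tc \<Psi>)"
    if "i \<in> X" for i using that s by (simp add: gm_def)
  ultimately show ?thesis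
    by (simp add: distrib_right sum.distrib sum_distrib_right mult.assoc)
qed

text \<open>The differentials of Q and R are closed, so only \<open>Lam\<close> contributes to the
  2-form, through its antisymmetrization.\<close>

lemma gm_symplectic:
  assumes "i \<in> X" "j \<in> X"
  shows "pd i (gm k ns lam \<tau> R j) - pd j (gm k ns lam \<tau> R i) = C (if j = i + n then 1 else if i = j + n then -1 else 0)"
proof -
  have s: "pd a (\<Sum>l\<in>X. C (nf k ns lam \<tau> b l) * var l) = C (nf k ns lam \<tau> b a)" if "a \<in> X" for a b
  proof -
    have "pd a (\<Sum>l\<in>X. C (nf k ns lam \<tau> b l) * var l) = (\<Sum>l\<in>X. if l = a then C (nf k ns lam \<tau> b a) else 0)"
      unfolding pd_sum by (rule sum.cong) (auto simp: pd_var)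
    then show ?thesis using that by simp
  qed
  have "pd i (gm k ns lam \<tau> R j) - pd j (gm k ns lam \<tau> R i) = C (nf k ns lam \<tau> j i) - C (nf k ns lam \<tau> i j)"
    unfolding gm_def using assms by (simp only: assms if_True pd_add s pd_commute[of i j] add_diff_cancel_right)
  also have "\<dots> = C (nf k ns lam \<tau> j i - nf k ns lam \<tau> i j)" by simp
  also have "nf k ns lam \<tau> j i - nf k ns lam \<tau> i j = Lam lam j i - Lam lam i j"
    by (simp add: nf_def Qtot_hessian_sym[of i])
  also have "\<dots> = (if j = i + n then 1 else if i = j + n then -1 else 0)"
    using assms by (auto simp: Lam_def X_def)
  finally show ?thesis .
qed

definition gbl :: "nat \<Rightarrow> nat \<Rightarrow> complex \<Rightarrow> nat \<Rightarrow> ser" where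
  "gbl p q l j = (if p \<le> j \<and> j < q then C (l - 1) * var (n + j)
     else if n < j \<and> p \<le> j - n \<and> j - n < q then C l * var (j - n) else 0)"

lemma gamma_blk_coef: "gamma_blk n p q l j = coef (gbl p q l j)"
  by (simp add: gamma_blk_def gbl_def mps_bridge del: C_simps)

lemma block_unique:
  fixes ns :: "nat \<Rightarrow> nat"
  assumes ns: "\<forall>s\<in>{1..k}. ns s < (ns (s + 1) :: nat)" and st: "s \<in> {1..k}" "t \<in> {1..k}"
    and j: "ns s \<le> j" "j < ns (s + 1)" "ns t \<le> j" "j < ns (t + 1)"
  shows "s = t"
proof (rule ccontr)
  assume "s \<noteq> t"
  then consider "s < t" | "t < s" by linarith
  then show False
  proof cases
    case 1
    have "ns (s + 1) \<le> ns t" by (rule strict_ns_mono[OF ns]) (use 1 st in auto)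
    then show False using j by simp
  next
    case 2
    have "ns (t + 1) \<le> ns s" by (rule strict_ns_mono[OF ns]) (use 2 st in auto)
    then show False using j by simp
  qed
qed

lemma gbl_sum:
  fixes ns :: "nat \<Rightarrow> nat"
  assumes ns: "ns 1 = 1" "ns (k + 1) = n + 1" "\<forall>s\<in>{1..k}. ns s < (ns (s + 1) :: nat)"
    and lam: "\<forall>s\<in>{1..k}. \<forall>i. ns s \<le> i \<and> i < ns (s + 1) \<longrightarrow> lam i = (lam (ns s) :: complex)" and j: "j \<in> X"
  shows "(\<Sum>s\<in>{1..k}. gbl (ns s) (ns (s + 1)) (lam (ns s)) j) = (\<Sum>l\<in>X. C (Lam lam j l) * var l)"
proof -
  define i where "i = (if j \<le> n then j else j - n)"
  have i: "i \<in> {1..n}" "j = i \<or> j = n + i" using j by (auto simp: i_def X_def)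
  obtain s where s: "s \<in> {1..k}" "ns s \<le> i" "i < ns (s + 1)" using block_index[OF ns i(1)] by blast
  have li: "lam i = lam (ns s)" using lam s by blast
  have rng: "1 \<le> ns t \<and> ns (t + 1) \<le> n + 1" if "t \<in> {1..k}" for t
    using strict_ns_mono[OF ns(3), of 1 t] strict_ns_mono[OF ns(3), of "t + 1" "k + 1"] that ns by auto
  have one: "(\<Sum>t\<in>{1..k}. h t) = h s" if "\<And>t. t \<in> {1..k} \<Longrightarrow> t \<noteq> s \<Longrightarrow> h t = 0" for h :: "nat \<Rightarrow> ser"
    using that s(1) by (subst sum.remove[of _ s]) (auto intro!: sum.neutral)
  have out: "\<not> (ns t \<le> i \<and> i < ns (t + 1))" if "t \<in> {1..k}" "t \<noteq> s" for t
    using block_unique[OF ns(3) s(1) that(1) s(2,3)] that(2) by blast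
  show ?thesis
  proof (cases "j = i")
    case True
    have "(\<Sum>t\<in>{1..k}. gbl (ns t) (ns (t + 1)) (lam (ns t)) j) = gbl (ns s) (ns (s + 1)) (lam (ns s)) j"
      by (rule one) (use out i True in \<open>auto simp: gbl_def\<close>)
    also have "\<dots> = C (lam i - 1) * var (n + i)" using s True li by (simp add: gbl_def)
    finally show ?thesis using Lam_sum(1)[OF i(1), of lam var] True by simp
  next
    case False
    then have ji: "j = n + i" using i by simp
    have e: "gbl (ns t) (ns (t + 1)) (lam (ns t)) j = (if ns t \<le> i \<and> i < ns (t + 1) then C (lam (ns t)) * var i else 0)"
      if "t \<in> {1..k}" for t
      using rng[OF that] i ji by (auto simp: gbl_def)
    have "(\<Sum>t\<in>{1..k}. gbl (ns t) (ns (t + 1)) (lam (ns t)) j) = gbl (ns s) (ns (s + 1)) (lam (ns s)) j"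
    proof (rule one)
      fix t assume t: "t \<in> {1..k}" "t \<noteq> s"
      show "gbl (ns t) (ns (t + 1)) (lam (ns t)) j = 0" by (simp only: e[OF t(1)] if_not_P[OF out[OF t]])
    qed
    also have "\<dots> = C (lam i) * var i" unfolding e[OF s(1)] using s li by simp
    finally show ?thesis using Lam_sum(2)[OF i(1), of lam var] ji by simp
  qed
qed

lemma Qblk_ok:
  assumes "kind_ok t l (q - p)" "p < q"
  shows "Qs_ok n p q l (coef (Qblk t p q))"
proof -
  have 0: "mps_sum {p..<q - 1} (\<lambda>j. mps_mul (mps_var (j + 1)) (mps_var (n + j))) = coef (\<Sum>j\<in>{p..<q - 1}. var (j + 1) * var (n + j))"
    by (rule mps_sum_cong) (simp only: mps_bridge)
  have 1: "mps_sum {p..<q - 1} (\<lambda>j. mps_mul (mps_var j) (mps_var (n + j + 1))) = coef (\<Sum>j\<in>{p..<q - 1}. var j * var (n + j + 1))"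
    by (rule mps_sum_cong) (simp only: mps_bridge)
  consider "t = 0" "l \<noteq> 1/2" | "t = 0" "l = 1/2" "q - p = 1" | "t = 1" "l = 1/2" | "t = 2" "l = 1/2" "odd (q - p)" "q - p \<ge> 3"
    using assms(1) unfolding kind_ok_def by auto
  then show ?thesis
  proof cases
    case 1
    then have "coef (Qblk t p q) = coef (\<Sum>j\<in>{p..<q - 1}. var (j + 1) * var (n + j))" by (simp only: Qblk_def if_True simp_thms)
    then show ?thesis unfolding Qs_ok_def 0 using 1 by blast
  next
    case 2
    \<comment> \<open>An isolated block with eigenvalue 1/2 and \<open>\<tau> = 0\<close> has an
      empty sum and falls under the option Q_s = 0 of (P).\<close>
    then have "{p..<q - 1} = {}" by auto
    then have "coef (Qblk t p q) = mps_zero" using 2 by (simp add: Qblk_def mps_bridge)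
    then show ?thesis unfolding Qs_ok_def using 2 by blast
  next
    case 3
    have "coef (Qblk t p q) = mps_add (mps_scale 2 (coef (\<Sum>j\<in>{p..<q - 1}. var j * var (n + j + 1)))) (mps_scale ((-1) ^ (q - p)) (mps_pow (mps_var (q - 1)) 2))"
      using 3 by (simp add: Qblk_def mps_bridge mps_pow_coef del: C_simps)
    then show ?thesis unfolding Qs_ok_def 1 using 3 by blast
  next
    case 4
    have "coef (Qblk t p q) = mps_scale 2 (coef (\<Sum>j\<in>{p..<q - 1}. var j * var (n + j + 1)))"
      using 4 by (simp add: Qblk_def mps_bridge del: C_simps)
    then show ?thesis unfolding Qs_ok_def 1 using 4 by blast
  qed
qed

lemma wt_X: assumes "supp a \<subseteq> X" shows "wt K (tw l) a = (\<Sum>i\<in>X. of_nat (a i) * l i)"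
proof -
  have "a (2 * n + j) = 0" if "j \<in> X" for j using that assms by (auto simp: supp_def)
  then show ?thesis unfolding wt_def sum_K by simp
qed

lemma prim_nf_gm:
  assumes ns: "ns 1 = 1" "ns (k + 1) = n + 1" "\<forall>s\<in>{1..k}. ns s < (ns (s + 1) :: nat)"
    and lam: "\<forall>s\<in>{1..k}. \<forall>i. ns s \<le> i \<and> i < ns (s + 1) \<longrightarrow> lam i = lam (ns s)"
    and kind: "\<forall>s\<in>{1..k}. kind_ok (\<tau> s) (lam (ns s)) (ns (s + 1) - ns s)"
    and R: "on X R" "om 3 R" "wtd K (tw (ll lam)) 1 R"
  shows "prim_nf n (\<lambda>j. coef (gm k ns lam \<tau> R j)) (coef (Qtot k ns \<tau>)) (coef R)"
  unfolding prim_nf_def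
proof (intro conjI exI)
  let ?G = "gm k ns lam \<tau> R"
  have rng: "1 \<le> ns t \<and> ns (t + 1) \<le> n + 1 \<and> ns t \<le> n" if t: "t \<in> {1..k}" for t
  proof -
    have "ns 1 \<le> ns t" "ns (t + 1) \<le> ns (k + 1)" using t by (auto intro!: strict_ns_mono[OF ns(3)])
    moreover have "ns t < ns (t + 1)" using ns(3) t by blast
    ultimately show ?thesis using ns(1,2) by linarith
  qed
  have lll: "ll lam (ns s) = lam (ns s)" if "s \<in> {1..k}" for s using rng[OF that] by (simp add: ll_def)
  show "\<forall>i\<in>{1..2 * n}. \<forall>j\<in>{1..2 * n}. (\<lambda>a. mps_pd i (coef (?G j)) a - mps_pd j (coef (?G i)) a)
      = mps_const (if j = i + n then 1 else if i = j + n then - 1 else 0)"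
  proof (intro ballI)
    fix i j assume "i \<in> {1..2 * n}" "j \<in> {1..2 * n}"
    then have ij: "i \<in> X" "j \<in> X" by (simp_all add: X_def)
    show "(\<lambda>a. mps_pd i (coef (?G j)) a - mps_pd j (coef (?G i)) a) = mps_const (if j = i + n then 1 else if i = j + n then - 1 else 0)"
    proof -
      have "mps_const (if j = i + n then 1 else if i = j + n then - 1 else 0) = coef (pd i (?G j) - pd j (?G i))"
        by (simp only: mps_bridge gm_symplectic[OF ij])
      then show ?thesis by (simp only: mps_bridge coef_simps fun_eq_iff simp_thms)
    qed
  qed
  show "ns 1 = 1" "ns (k + 1) = n + 1" "\<forall>s\<in>{1..k}. ns s < ns (s + 1)" by (rule ns)+
  show "\<forall>i\<in>{1..n}. ll lam i + ll lam (n + i) = 1" by (auto simp: ll_def)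
  show "\<forall>s\<in>{1..k}. \<forall>i j. ns s \<le> i \<and> i < j \<and> j < ns (s + 1) \<longrightarrow> ll lam i = ll lam j"
  proof (intro ballI allI impI)
    fix s i j assume s: "s \<in> {1..k}" and ij: "ns s \<le> i \<and> i < j \<and> j < ns (s + 1)"
    have "ns s \<le> i \<and> i < ns (s + 1)" "ns s \<le> j \<and> j < ns (s + 1)" using ij by linarith+
    then have "lam i = lam (ns s)" "lam j = lam (ns s)" using lam s by blast+
    moreover have "i \<le> n" "j \<le> n" using rng[OF s] ij by auto
    ultimately show "ll lam i = ll lam j" by (simp add: ll_def)
  qed
  show "\<forall>s\<in>{1..k}. Qs_ok n (ns s) (ns (s + 1)) (ll lam (ns s)) (coef (Qblk (\<tau> s) (ns s) (ns (s + 1))))"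
  proof
    fix s assume s: "s \<in> {1..k}"
    have "Qs_ok n (ns s) (ns (s + 1)) (lam (ns s)) (coef (Qblk (\<tau> s) (ns s) (ns (s + 1))))"
      by (rule Qblk_ok) (use kind ns(3) s in blast)+
    then show "Qs_ok n (ns s) (ns (s + 1)) (ll lam (ns s)) (coef (Qblk (\<tau> s) (ns s) (ns (s + 1))))"
      by (simp only: lll[OF s])
  qed
  show "coef (Qtot k ns \<tau>) = mps_sum {1..k} (\<lambda>s. coef (Qblk (\<tau> s) (ns s) (ns (s + 1))))"
    by (simp only: mps_bridge Qtot_def)
  show "mps_wf (2 * n + 1) (coef R)"
    unfolding mps_wf_coef by (rule on_mono[OF R(1)]) (auto simp: X_lessThan simp del: One_nat_def)
  show "indep0 (coef R)" by (rule indep0_coef[OF R(1)]) simp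
  show "\<forall>a. coef R a \<noteq> 0 \<longrightarrow> (\<Sum>i\<in>{1..2 * n}. of_nat (a i) * ll lam i) = 1 \<and> 3 \<le> (\<Sum>i\<in>{1..2 * n}. a i)"
  proof (intro allI impI)
    fix a assume a: "coef R a \<noteq> 0"
    then have s: "supp a \<subseteq> X" using R(1) unfolding on_def by blast
    then have f: "finite (supp a)" by (rule finite_subset) simp
    have "wt K (tw (ll lam)) a = 1" using R(3) a unfolding wtd_def by blast
    then have 1: "(\<Sum>i\<in>X. of_nat (a i) * ll lam i) = 1" unfolding wt_X[OF s] .
    have "\<not> deg a < 3" using R(2) a f unfolding om_def by blast
    then have "3 \<le> (\<Sum>i\<in>X. a i)" using deg_eq_sum[OF _ s] by simp
    then show "(\<Sum>i\<in>{1..2 * n}. of_nat (a i) * ll lam i) = 1 \<and> 3 \<le> (\<Sum>i\<in>{1..2 * n}. a i)"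
      using 1 by (simp only: X_def simp_thms)
  qed
  show "\<forall>j\<in>{0..2 * n}. coef (?G j) = mps_add (mps_sum {1..k} (\<lambda>s. mps_add (gamma_blk n (ns s) (ns (s + 1)) (ll lam (ns s)) j)
      (mps_pd j (coef (Qblk (\<tau> s) (ns s) (ns (s + 1))))))) (mps_pd j (coef R))"
  proof
    fix j assume "j \<in> {0..2 * n}"
    then have "j < 2 * n + 1" by simp
    then have j: "j \<in> insert 0 X" unfolding X_lessThan[symmetric] by simp
    let ?b = "\<lambda>s. gbl (ns s) (ns (s + 1)) (lam (ns s)) j" and ?q = "\<lambda>s. Qblk (\<tau> s) (ns s) (ns (s + 1))"
    have "?G j = (\<Sum>s\<in>{1..k}. ?b s + pd j (?q s)) + pd j R"
    proof (cases "j = 0")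
      case True
      have "?b s = 0" if "s \<in> {1..k}" for s using rng[OF that] True by (auto simp: gbl_def)
      moreover have "(\<Sum>s\<in>{1..k}. pd j (?q s)) = 0"
        using pd_X[OF Qtot_on[OF ns], of 0] True by (simp add: Qtot_def del: One_nat_def)
      moreover have "pd j R = 0" using pd_X[OF R(1), of 0] True by simp
      ultimately show ?thesis using True by (simp add: gm_def sum.distrib del: One_nat_def)
    next
      case False
      then have jX: "j \<in> X" using j by simp
      have "(\<Sum>s\<in>{1..k}. pd j (?q s)) = pd j (Qtot k ns \<tau>)" by (simp add: Qtot_def del: One_nat_def)
      also have "\<dots> = (\<Sum>l\<in>X. C (coef (pd j (Qtot k ns \<tau>)) (unitv l)) * var l)"
        using lin1_id[OF Qtot_pd_Lin[OF ns jX, of \<tau>]] unfolding lin1_def by simp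
      finally show ?thesis unfolding sum.distrib gbl_sum[OF ns lam jX] using jX
        by (simp add: gm_def nf_def distrib_right sum.distrib)
    qed
    moreover have "mps_sum {1..k} (\<lambda>s. mps_add (gamma_blk n (ns s) (ns (s + 1)) (ll lam (ns s)) j) (mps_pd j (coef (?q s))))
        = coef (\<Sum>s\<in>{1..k}. ?b s + pd j (?q s))"
      by (rule mps_sum_cong) (simp only: lll gamma_blk_coef mps_bridge)
    ultimately show "coef (?G j) = mps_add (mps_sum {1..k} (\<lambda>s. mps_add (gamma_blk n (ns s) (ns (s + 1)) (ll lam (ns s)) j)
      (mps_pd j (coef (?q s))))) (mps_pd j (coef R))" by (simp only: mps_bridge)
  qed
qed

section \<open>Assembly of the theorem from series back to coefficient functions\<close>

lemma vf_LL:
  assumes "W 0 = 0" "on X F"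
  shows "vf (2 * n + 1) W F = LL W F"
  unfolding vf_def sum_insert0 LL_X[OF assms(2)] using assms(1) by simp

lemma LL_cong: "on X F \<Longrightarrow> (\<And>p. p \<in> X \<Longrightarrow> V p = W p) \<Longrightarrow> LL V F = LL W F"
  by (simp add: LL_X)

lemma wf_series_family:
  assumes "\<And>i. i \<in> A \<Longrightarrow> mps_wf k (g i) \<and> g i zexp = 0"
  shows "\<exists>gs. \<forall>i\<in>A. g i = coef (gs i) \<and> on {..<k} (gs i) \<and> om 1 (gs i)"
proof -
  have "\<exists>G. i \<in> A \<longrightarrow> g i = coef G \<and> on {..<k} G \<and> om 1 G" for i
  proof (cases "i \<in> A")
    case True
    obtain G where G: "g i = coef G" "on {..<k} G" using mps_wf_ser assms[OF True] by blast
    then have "om 1 G" using assms[OF True] by (simp add: om1_iff mps_bridge del: One_nat_def)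
    then show ?thesis using G by blast
  qed simp
  then have "\<forall>i. \<exists>G. i \<in> A \<longrightarrow> g i = coef G \<and> on {..<k} G \<and> om 1 G" by blast
  from choice[OF this] show ?thesis by blast
qed

lemma on_X_indep0: "on {..<2 * n + 1} F \<Longrightarrow> indep0 (coef F) \<Longrightarrow> on X F"
  unfolding on_def indep0_def X_lessThan
proof (intro allI impI)
  fix a assume 1: "\<forall>a. coef F a \<noteq> 0 \<longrightarrow> supp a \<subseteq> insert 0 X" "\<forall>a. a 0 \<noteq> 0 \<longrightarrow> coef F a = 0" and a: "coef F a \<noteq> 0"
  then have "supp a \<subseteq> insert 0 X" "a 0 = 0" by auto
  then show "supp a \<subseteq> X" by (auto simp: supp_def)
qed

lemma coef_unitv_0: assumes "on X F" shows "coef F (unitv 0) = 0"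
proof (rule ccontr)
  assume "coef F (unitv 0) \<noteq> 0"
  then have "supp (unitv 0) \<subseteq> X" using assms unfolding on_def by blast
  then show False by simp
qed

lemma normal_form_theorem:
  assumes M: "M > 2" and n1: "n \<ge> 1"
    and g_wf: "\<forall>i\<in>{1..2*n}. mps_wf (2*n+1) (g i) \<and> indep0 (g i) \<and> g i zexp = 0"
    and g_symp: "det (mat (2*n) (2*n) (\<lambda>(i, j).
                   mps_pd (i+1) (g (j+1)) zexp - mps_pd (j+1) (g (i+1)) zexp)) \<noteq> 0"
    and U_wf: "\<forall>j<2*n+1. mps_wf (2*n+1) (U j) \<and> U j zexp = 0"
    and U_lie: "\<forall>j<2*n+1. lie_form (2*n+1) U (alpha_form M n g) j = mps_zero"
  shows "\<exists>(Phi::nat \<Rightarrow> mps) (f::mps) (gam'::nat \<Rightarrow> mps) (Q::mps) (R::mps) (Y::nat \<Rightarrow> mps)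
            (S::complex mat) (N::complex mat).
      Phi 0 = mps_var 0 \<and>
      (\<forall>j<2*n+1. mps_wf (2*n+1) (Phi j) \<and> Phi j zexp = 0) \<and>
      det (jac0 (2*n+1) Phi) \<noteq> 0 \<and>
      mps_wf (2*n+1) f \<and> indep0 f \<and> f zexp = 0 \<and> (\<exists>i\<in>{1..2*n}. f (unitv i) \<noteq> 0) \<and>
      (\<forall>j<2*n+1. mps_wf (2*n+1) (gam' j)) \<and>
      prim_nf n gam' Q R \<and>
      (\<forall>j<2*n+1. alpha_form M n g j =
          mps_add (form_d (mps_comp (2*n+1)
                      (mps_add (mps_pow (mps_var 0) M) (mps_scale (-1) (mps_mul f (mps_var 0)))) Phi) j)
                  (mps_sum {1..2*n} (\<lambda>i. mps_mul (mps_comp (2*n+1) (gam' i) Phi) (mps_pd j (Phi i))))) \<and>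
      (\<forall>j<2*n+1. mps_wf (2*n+1) (Y j) \<and> mps_comp (2*n+1) (Y j) Phi = vf_apply (2*n+1) U (Phi j)) \<and>
      jordan_decomp (2*n+1) (lin_part (2*n+1) Y) S N \<and>
      (\<forall>j<2*n+1. vf_bracket (2*n+1) (lin_vf (2*n+1) S) Y j = mps_zero) \<and>
      U 0 = mps_zero \<and>
      vf_apply (2*n+1) U (mps_comp (2*n+1) f Phi) = mps_zero \<and>
      vf_apply (2*n+1) (lin_vf (2*n+1) S) Q = mps_zero \<and>
      vf_apply (2*n+1) (lin_vf (2*n+1) S) R = mps_zero"
proof -
  let ?k = "2 * n + 1"
  have X1: "1 \<in> X" using n1 by (simp add: X_def)
  have Xk: "r < ?k" if "r \<in> X" for r using that by (auto simp: X_def)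
  have kX: "j \<in> insert 0 X" if "j < ?k" for j using that unfolding X_lessThan[symmetric] by simp
  have onk: "on {..<?k} F" if "on X F" for F by (rule on_mono[OF that]) (auto simp: X_lessThan simp del: One_nat_def)
  obtain gs where gs0: "\<forall>i\<in>X. g i = coef (gs i) \<and> on {..<?k} (gs i) \<and> om 1 (gs i)"
    using wf_series_family[of X ?k g] g_wf unfolding X_def by blast
  have gs: "g i = coef (gs i)" "on X (gs i)" "om 1 (gs i)" if "i \<in> X" for i
    using gs0 that g_wf on_X_indep0[of "gs i"] by (auto simp: X_def simp del: One_nat_def)
  obtain Us where Us: "\<forall>i\<in>{..<?k}. U i = coef (Us i) \<and> on {..<?k} (Us i) \<and> om 1 (Us i)"
    using wf_series_family[of "{..<?k}" ?k U] U_wf by blast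
  have Uc: "U j = coef (Us j)" if "j < ?k" for j using Us that by blast
  define A where "A p q = coef (Om gs p q) 0" for p q
  have "mat (2 * n) (2 * n) (\<lambda>(i, j). mps_pd (i+1) (g (j+1)) zexp - mps_pd (j+1) (g (i+1)) zexp)
      = mat (2 * n) (2 * n) (\<lambda>(i, j). A (i + 1) (j + 1))"
  proof (rule cong_mat[OF refl refl])
    fix i j assume "i < 2 * n" "j < 2 * n"
    then have "i + 1 \<in> X" "j + 1 \<in> X" by (auto simp: X_def)
    then show "(\<lambda>(i, j). mps_pd (i+1) (g (j+1)) zexp - mps_pd (j+1) (g (i+1)) zexp) (i, j) = (\<lambda>(i, j). A (i + 1) (j + 1)) (i, j)"
      by (simp only: split_conv gs(1) mps_bridge A_def Om_def coef_simps)
  qed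
  then obtain P where P: "inv_pair X P A" using det_inv_pair[of A] g_symp by auto
  have Ab: "A p q = - (coef (gs p) (unitv q) - coef (gs q) (unitv p))" for p q by (simp add: A_def Om_def coef_pd_0)
  have b: "inv_pair X (\<lambda>p q. - P p q) (\<lambda>p q. coef (gs p) (unitv q) - coef (gs q) (unitv p))"
    using P unfolding inv_pair_def Ab by (simp only: mult_minus_left mult_minus_right)
  define be where "be j = pd j (var 0 ^ M - var 1 * var 0) + (if j \<in> X then gs j else 0)" for j
  have al: "alpha_form M n g j = coef (be j)" for j unfolding be_def by (rule alpha_form_coef) (rule gs(1))
  have L: "lie {..<?k} Us be j = 0" if j: "j < ?k" for j
  proof -
    have "coef (lie {..<?k} Us be j) = coef 0"
      using lie_form_coef[of ?k U Us "alpha_form M n g" be j] Uc al j U_lie by (simp add: mps_bridge del: One_nat_def)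
    then show ?thesis by (simp add: coef_inject)
  qed
  have tr: "Us 0 = 0 \<and> Us 1 = 0 \<and> fld Us \<and> (\<forall>q\<in>X. lie X Us gs q = 0)"
    by (rule theta_reduction[OF n1 M gs(2), where P = P]) (use Us L P in \<open>auto simp: be_def[abs_def] A_def[abs_def] simp del: One_nat_def pd_diff pd_mult\<close>)
  then have U0: "Us 0 = 0" and U1: "Us 1 = 0" and fU: "fld Us" and gU: "\<And>q. q \<in> X \<Longrightarrow> lie X Us gs q = 0" by blast+
  have gso: "on X (gs p) \<and> om 1 (gs p)" if "p \<in> X" for p using gs[OF that] by blast
  obtain k ns lam \<tau> \<Psi> R Y c ci mu Nt p where ns: "ns 1 = 1" "ns (k + 1) = n + 1" "\<forall>s\<in>{1..k}. ns s < (ns (s + 1) :: nat)"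
    and lam: "\<forall>s\<in>{1..k}. \<forall>i. ns s \<le> i \<and> i < ns (s + 1) \<longrightarrow> lam i = lam (ns s)"
    and kind: "\<forall>s\<in>{1..k}. kind_ok (\<tau> s) (lam (ns s)) (ns (s + 1) - ns s)"
    and x\<Psi>: "xcoords \<Psi>" and R: "on X R" "om 3 R" "wtd K (tw (ll lam)) 1 R"
    and fg: "fm gs = (\<Sum>i\<in>X. \<Sum>j\<in>X. C (nf k ns lam \<tau> i j) * (\<Psi> j * dd (\<Psi> i))) + dd (cmp K R (tc \<Psi>))"
    and Y: "\<forall>i\<in>X. on X (Y i) \<and> om 1 (Y i) \<and> cmp K (Y i) (tc \<Psi>) = LL Us (\<Psi> i)"
    and c: "inv_pair X c ci"
    and jY: "\<forall>i\<in>X. \<forall>j\<in>X. coef (Y i) (unitv j) = mm X c (mm X (\<lambda>i j. dg mu i j + Nt i j) ci) i j"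
    and Nt: "\<forall>i\<in>X. \<forall>j\<in>X. Nt i j \<noteq> 0 \<longrightarrow> mu i = mu j" and nil: "\<forall>i\<in>X. \<forall>j\<in>X. mpow X Nt p i j = 0"
    and SR: "LL (\<lambda>j. \<Sum>k\<in>X. C (mm X c (mm X (dg mu) ci) j k) * var k) R = 0"
    and SQ: "LL (\<lambda>j. \<Sum>k\<in>X. C (mm X c (mm X (dg mu) ci) j k) * var k) (Qtot k ns \<tau>) = 0"
    and SY: "\<forall>j\<in>X. LL (\<lambda>j. \<Sum>k\<in>X. C (mm X c (mm X (dg mu) ci) j k) * var k) (Y j) =
        (\<Sum>k\<in>X. C (mm X c (mm X (dg mu) ci) j k) * Y k)"
    apply (rule exE[OF tangent_normal_form[where g = gs, OF gso b fU gU]])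
      apply assumption+
    apply (elim exE conjE)
    apply (rule that; assumption)
    done
  define Sm where "Sm = mm X c (mm X (dg mu) ci)"
  define Sf where "Sf j = (\<Sum>k\<in>X. C (Sm j k) * var k)" for j
  have LR: "LL Sf R = 0" and LQ: "LL Sf (Qtot k ns \<tau>) = 0" and LY: "\<And>j. j \<in> X \<Longrightarrow> LL Sf (Y j) = (\<Sum>k\<in>X. C (Sm j k) * Y k)"
    using SR SQ SY unfolding Sf_def[abs_def] Sm_def by blast+
  have \<Psi>: "on X (\<Psi> i)" "om 1 (\<Psi> i)" if "i \<in> X" for i using x\<Psi> that unfolding xcoords_def by auto
  obtain J where J: "inv_pair X J (jac \<Psi>)" using x\<Psi> unfolding xcoords_def by blast
  \<comment> \<open>Index 0 is the one below 2n + 1 that lies outside \<open>X\<close>, so the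
    default value is the unchanged coordinate \<theta>.\<close>
  define Ph where "Ph j = (if j \<in> X then \<Psi> j else var 0)" for j
  have Pon: "on {..<?k} (Ph j)" "om 1 (Ph j)" for j
    using onk[OF \<Psi>(1)] \<Psi>(2) by (simp_all add: Ph_def on_var del: One_nat_def)
  have s: "small ?k Ph" using Pon(2) by (simp add: small_def del: One_nat_def)
  have comp: "mps_comp ?k (coef F) (\<lambda>j. coef (Ph j)) = coef (cmp ?k F Ph)" for F
    by (rule mps_comp_coef) (use Pon in blast)
  have cK: "cmp ?k F Ph = cmp K F (tc \<Psi>)" if "on X F" for F
    by (rule cmp_change[OF that]) (auto simp: X_lessThan Ph_def simp del: One_nat_def)
  \<comment> \<open>The function f is the old coordinate x_1 in the new ones. Hence f \<theta> pulls
    back to x_1 \<theta>, and X(f) is the component of X along x_1, already known to vanish.\<close>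
  obtain fs where fs: "on X fs" "cmp K fs (tc \<Psi>) = var 1" by (rule X_surj[OF x\<Psi> on_var[OF X1]])
  have f0: "coef fs 0 = 0"
    using coef_cmp_0[OF tc_small[OF x\<Psi>], of fs] fs(2) by (simp add: coef_var del: One_nat_def)
  have f1: "\<exists>i\<in>X. coef fs (unitv i) \<noteq> 0"
  \<comment> \<open>If the linear part of f vanished, the chain rule would make the differential of
    x_1 vanish at the origin.\<close>
  proof (rule ccontr)
    assume "\<not> ?thesis"
    then have "coef (var 1) (unitv 1) = 0"
      unfolding fs(2)[symmetric] jac_cmp_tc[OF tc_small[OF x\<Psi>] fs(1)] by (intro sum.neutral) simp
    then show False by (simp add: coef_var del: One_nat_def)
  qed
  let ?G = "gm k ns lam \<tau> R"
  have Gon: "on X (?G j)" for j by (rule gm_on[OF R(1)])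
  \<comment> \<open>The component along \<theta> is 0 because X(\<theta>) = 0.\<close>
  define Yf where "Yf j = (if j \<in> X then Y j else 0)" for j
  have Yon: "on X (Yf j)" for j using Y by (simp add: Yf_def)
  define sf where "sf j = (if j \<in> X then Sf j else 0)" for j
  have Sfon: "on X (Sf j)" for j unfolding Sf_def by (rule on_sum, rule on_mult, simp, rule on_var, assumption)
  let ?S = "emb 0 Sm"
  have lv: "lin_vf ?k ?S j = coef (sf j)" if j: "j < ?k" for j
  proof -
    have "lin_vf ?k ?S j = coef (\<Sum>i<?k. C (?S $$ (j, i)) * var i)"
      unfolding lin_vf_def by (rule mps_sum_cong) (simp only: mps_bridge)
    also have "(\<Sum>i<?k. C (?S $$ (j, i)) * var i) = sf j"
      unfolding sum_insert0 using kX[OF j] j Xk by (auto simp: emb_index sf_def Sf_def simp del: One_nat_def)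
    finally show ?thesis .
  qed
  have vfS: "vf_apply ?k (lin_vf ?k ?S) (coef F) = coef (LL Sf F)" if F: "on X F" for F
  proof -
    have "vf_apply ?k (lin_vf ?k ?S) (coef F) = coef (vf ?k sf F)" by (rule vf_apply_coef) (rule lv)
    also have "vf ?k sf F = LL sf F" by (rule vf_LL[OF _ F]) (simp add: sf_def)
    also have "\<dots> = LL Sf F" by (rule LL_cong[OF F]) (simp add: sf_def)
    finally show ?thesis .
  qed
  have vfU: "vf_apply ?k U (coef F) = coef (vf ?k Us F)" for F by (rule vf_apply_coef) (rule Uc)
  have lp: "lin_part ?k (\<lambda>j. coef (Yf j)) = emb 0 (\<lambda>i j. coef (Y i) (unitv j))"
    unfolding lin_part_def emb_def
  proof (rule cong_mat[OF refl refl])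
    fix i j assume ij: "i < ?k" "j < ?k"
    have "coef (Y i) (unitv 0) = 0" if "i \<in> X" using Y that coef_unitv_0 by blast
    then show "(\<lambda>(j, i). coef (Yf j) (unitv i)) (i, j) = (\<lambda>(i, j). if i = 0 \<and> j = 0 then 0 else if i \<in> X \<and> j \<in> X then coef (Y i) (unitv j) else 0) (i, j)"
      using kX[OF ij(1)] kX[OF ij(2)] by (auto simp: Yf_def)
  qed
  have jac: "jac0 ?k (\<lambda>j. coef (Ph j)) = emb 1 (jac \<Psi>)"
    unfolding jac0_def emb_def
  proof (rule cong_mat[OF refl refl])
    fix i j assume ij: "i < ?k" "j < ?k"
    have "coef (\<Psi> i) (unitv 0) = 0" if "i \<in> X" by (rule coef_unitv_0[OF \<Psi>(1)[OF that]])
    then show "(\<lambda>(j, i). coef (Ph j) (unitv i)) (i, j) = (\<lambda>(i, j). if i = 0 \<and> j = 0 then 1 else if i \<in> X \<and> j \<in> X then jac \<Psi> i j else 0) (i, j)"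
      using kX[OF ij(1)] kX[OF ij(2)] by (auto simp: Ph_def jac_def coef_var)
  qed
  have pull: "(if j \<in> X then gs j else 0) = (\<Sum>i\<in>X. cmp ?k (?G i) Ph * pd j (Ph i))" if j: "j < ?k" for j
  proof (cases "j \<in> X")
    case True
    have "(\<Sum>i\<in>X. cmp ?k (?G i) Ph * pd j (Ph i)) = (\<Sum>i\<in>X. cmp K (?G i) (tc \<Psi>) * pd j (\<Psi> i))"
      by (rule sum.cong) (simp_all only: cK[OF Gon] Ph_def if_True)
    then show ?thesis using gm_pullback[OF x\<Psi> R(1) gs(2) fg True] True by simp
  next
    case False
    have "pd j (Ph i) = 0" if "i \<in> X" for i using pd_X[OF \<Psi>(1)[OF that] False] that by (simp add: Ph_def)
    then show ?thesis using False by simp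
  qed
  have c1: "\<forall>j<?k. alpha_form M n g j =
          mps_add (form_d (mps_comp ?k
                      (mps_add (mps_pow (mps_var 0) M) (mps_scale (-1) (mps_mul (coef fs) (mps_var 0)))) (\<lambda>j. coef (Ph j))) j)
                  (mps_sum {1..2*n} (\<lambda>i. mps_mul (mps_comp ?k (coef (?G i)) (\<lambda>j. coef (Ph j))) (mps_pd j (coef (Ph i)))))"
  proof (intro allI impI)
    fix j assume j: "j < ?k"
    have "mps_add (mps_pow (mps_var 0) M) (mps_scale (-1) (mps_mul (coef fs) (mps_var 0))) = coef (var 0 ^ M - fs * var 0)"
      by (simp add: mps_bridge mps_pow_coef)
    moreover have "cmp ?k (var 0 ^ M - fs * var 0) Ph = var 0 ^ M - var 1 * var 0"
      using s cK[OF fs(1)] fs(2) by (simp add: Ph_def del: One_nat_def)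
    moreover have "mps_sum {1..2*n} (\<lambda>i. mps_mul (mps_comp ?k (coef (?G i)) (\<lambda>j. coef (Ph j))) (mps_pd j (coef (Ph i))))
        = coef (\<Sum>i\<in>X. cmp ?k (?G i) Ph * pd j (Ph i))"
      unfolding X_def by (rule mps_sum_cong) (simp only: comp mps_bridge)
    ultimately show "alpha_form M n g j =
          mps_add (form_d (mps_comp ?k
                      (mps_add (mps_pow (mps_var 0) M) (mps_scale (-1) (mps_mul (coef fs) (mps_var 0)))) (\<lambda>j. coef (Ph j))) j)
                  (mps_sum {1..2*n} (\<lambda>i. mps_mul (mps_comp ?k (coef (?G i)) (\<lambda>j. coef (Ph j))) (mps_pd j (coef (Ph i)))))"
      by (simp only: comp form_d_def mps_bridge al be_def pull[OF j])
  qed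
  have c2: "mps_comp ?k (coef (Yf j)) (\<lambda>j. coef (Ph j)) = vf_apply ?k U (coef (Ph j))" if j: "j < ?k" for j
  proof (cases "j \<in> X")
    case True
    have "cmp ?k (Yf j) Ph = LL Us (\<Psi> j)" using cK[of "Yf j"] Y True by (simp add: Yf_def del: One_nat_def)
    also have "\<dots> = vf ?k Us (\<Psi> j)" by (rule vf_LL[where W = Us, OF U0 \<Psi>(1)[OF True], symmetric])
    finally show ?thesis unfolding comp vfU using True by (simp add: Ph_def del: One_nat_def)
  next
    case False
    have "vf ?k Us (var 0) = Us 0" by (rule vf_var) simp
    then show ?thesis unfolding comp vfU using False U0 by (simp add: Ph_def Yf_def del: One_nat_def)
  qed
  have c3: "vf_bracket ?k (lin_vf ?k ?S) (\<lambda>j. coef (Yf j)) j = mps_zero" if j: "j < ?k" for j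
  proof -
    have 1: "vf_apply ?k (lin_vf ?k ?S) (coef (Yf j)) = coef (LL Sf (Yf j))" by (rule vfS[OF Yon])
    have 2: "vf_apply ?k (\<lambda>j. coef (Yf j)) (lin_vf ?k ?S j) = coef (vf ?k Yf (sf j))"
      unfolding lv[OF j] by (rule vf_apply_coef) (rule refl)
    have "LL Sf (Yf j) = vf ?k Yf (sf j)"
    proof (cases "j \<in> X")
      case True
      have "vf ?k Yf (sf j) = (\<Sum>i\<in>X. C (Sm j i) * Yf i)"
        using True Xk by (simp add: sf_def Sf_def vf_var del: One_nat_def)
      also have "\<dots> = (\<Sum>i\<in>X. C (Sm j i) * Y i)" by (rule sum.cong) (simp_all add: Yf_def)
      finally show ?thesis using LY[OF True] True by (simp add: Yf_def del: One_nat_def)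
    qed (simp add: Yf_def sf_def)
    then show ?thesis unfolding vf_bracket_def 1 2 by (simp add: mps_zero_def)
  qed
  have c4: "vf_apply ?k U (mps_comp ?k (coef fs) (\<lambda>j. coef (Ph j))) = mps_zero"
  proof -
    have "vf ?k Us (var 1) = Us 1" using vf_var[OF Xk[OF X1], of Us] .
    then have "vf ?k Us (var 1) = 0" using U1 by (rule trans)
    then show ?thesis unfolding comp vfU cK[OF fs(1)] fs(2) by (simp add: mps_bridge del: One_nat_def)
  qed
  have jd: "jordan_decomp ?k (lin_part ?k (\<lambda>j. coef (Yf j))) ?S (emb 0 (mm X c (mm X Nt ci)))"
    unfolding lp Sm_def by (rule emb_jordan[OF c _ nil]) (use Nt jY in auto)
  show ?thesis
  proof (rule exI[of _ "\<lambda>j. coef (Ph j)"], rule exI[of _ "coef fs"], rule exI[of _ "\<lambda>j. coef (?G j)"],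
      rule exI[of _ "coef (Qtot k ns \<tau>)"], rule exI[of _ "coef R"], rule exI[of _ "\<lambda>j. coef (Yf j)"],
      rule exI[of _ ?S], rule exI[of _ "emb 0 (mm X c (mm X Nt ci))"], intro conjI)
    show "coef (Ph 0) = mps_var 0" by (simp add: Ph_def mps_bridge)
    show "\<forall>j<?k. mps_wf ?k (coef (Ph j)) \<and> coef (Ph j) zexp = 0"
      using Pon unfolding mps_wf_coef mps_bridge om1_iff by blast
    show "det (jac0 ?k (\<lambda>j. coef (Ph j))) \<noteq> 0" unfolding jac by (rule emb_inv(3)[OF J])
    show "mps_wf ?k (coef fs)" unfolding mps_wf_coef by (rule onk[OF fs(1)])
    show "indep0 (coef fs)" by (rule indep0_coef[OF fs(1)]) simp
    show "coef fs zexp = 0" using f0 unfolding mps_bridge .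
    show "\<exists>i\<in>{1..2*n}. coef fs (unitv i) \<noteq> 0" using f1 unfolding X_def .
    show "\<forall>j<?k. mps_wf ?k (coef (?G j))" using onk[OF Gon] unfolding mps_wf_coef by blast
    show "prim_nf n (\<lambda>j. coef (?G j)) (coef (Qtot k ns \<tau>)) (coef R)" by (rule prim_nf_gm[OF ns lam kind R])
    show "\<forall>j<?k. mps_wf ?k (coef (Yf j)) \<and> mps_comp ?k (coef (Yf j)) (\<lambda>j. coef (Ph j)) = vf_apply ?k U (coef (Ph j))"
      using onk[OF Yon] c2 unfolding mps_wf_coef by blast
    show "\<forall>j<?k. vf_bracket ?k (lin_vf ?k ?S) (\<lambda>j. coef (Yf j)) j = mps_zero" using c3 by blast
    show "U 0 = mps_zero" using Uc[of 0] U0 by (simp add: mps_bridge)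
    show "vf_apply ?k (lin_vf ?k ?S) (coef (Qtot k ns \<tau>)) = mps_zero"
      unfolding vfS[OF Qtot_on[OF ns]] LQ mps_bridge ..
    show "vf_apply ?k (lin_vf ?k ?S) (coef R) = mps_zero" unfolding vfS[OF R(1)] LR mps_bridge ..
  qed (rule c1 jd c4)+
qed

end

theorem theorem5p8:
  fixes m n :: nat and g X :: "nat \<Rightarrow> mps"
  assumes m_gt: "m > 2"
    and n_pos: "n \<ge> 1"
    and g_wf: "\<forall>i\<in>{1..2*n}. mps_wf (2*n+1) (g i) \<and> indep0 (g i) \<and> g i zexp = 0"
    and g_symp: "det (mat (2*n) (2*n) (\<lambda>(i, j).
                   mps_pd (i+1) (g (j+1)) zexp - mps_pd (j+1) (g (i+1)) zexp)) \<noteq> 0"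
    and g_diffeo: "det (mat (2*n) (2*n) (\<lambda>(i, j). mps_pd (j+1) (g (i+1)) zexp)) \<noteq> 0"
    and X_wf: "\<forall>j<2*n+1. mps_wf (2*n+1) (X j) \<and> X j zexp = 0"
    and X_lie: "\<forall>j<2*n+1. lie_form (2*n+1) X (alpha_form m n g) j = mps_zero"
  shows "\<exists>(Phi::nat \<Rightarrow> mps) (f::mps) (gam'::nat \<Rightarrow> mps) (Q::mps) (R::mps) (Y::nat \<Rightarrow> mps)
            (S::complex mat) (N::complex mat).
      \<comment> \<open>new formal coordinates (theta, x'_1, ..., x'_2n) = (Phi 0, ..., Phi 2n), theta unchanged\<close>
      Phi 0 = mps_var 0 \<and>
      (\<forall>j<2*n+1. mps_wf (2*n+1) (Phi j) \<and> Phi j zexp = 0) \<and>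
      det (jac0 (2*n+1) Phi) \<noteq> 0 \<and>
      \<comment> \<open>f = f(x'), f(O) = 0, df(O) nonzero\<close>
      mps_wf (2*n+1) f \<and> indep0 f \<and> f zexp = 0 \<and> (\<exists>i\<in>{1..2*n}. f (unitv i) \<noteq> 0) \<and>
      \<comment> \<open>gamma' in primitive normal form in the coordinates x'\<close>
      (\<forall>j<2*n+1. mps_wf (2*n+1) (gam' j)) \<and>
      prim_nf n gam' Q R \<and>
      \<comment> \<open>alpha = d(theta^m - f(x') theta) + sum_i gamma'_i(x') dx'_i\<close>
      (\<forall>j<2*n+1. alpha_form m n g j =
          mps_add (form_d (mps_comp (2*n+1)
                      (mps_add (mps_pow (mps_var 0) m) (mps_scale (-1) (mps_mul f (mps_var 0)))) Phi) j)
                  (mps_sum {1..2*n} (\<lambda>i. mps_mul (mps_comp (2*n+1) (gam' i) Phi) (mps_pd j (Phi i))))) \<and>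
      \<comment> \<open>Y is X expressed in the coordinates (theta, x')\<close>
      (\<forall>j<2*n+1. mps_wf (2*n+1) (Y j) \<and> mps_comp (2*n+1) (Y j) Phi = vf_apply (2*n+1) X (Phi j)) \<and>
      \<comment> \<open>Poincare-Dulac normal form: S = semisimple part of the linear part of X\<close>
      jordan_decomp (2*n+1) (lin_part (2*n+1) Y) S N \<and>
      (\<forall>j<2*n+1. vf_bracket (2*n+1) (lin_vf (2*n+1) S) Y j = mps_zero) \<and>
      \<comment> \<open>X(theta) = X(f) = 0\<close>
      X 0 = mps_zero \<and>
      vf_apply (2*n+1) X (mps_comp (2*n+1) f Phi) = mps_zero \<and>
      \<comment> \<open>Q and R are first integrals of X^s\<close>
      vf_apply (2*n+1) (lin_vf (2*n+1) S) Q = mps_zero \<and>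
      vf_apply (2*n+1) (lin_vf (2*n+1) S) R = mps_zero"
  by (rule tangent.normal_form_theorem[OF m_gt n_pos g_wf g_symp X_wf X_lie])

end
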